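(* Let $M$ be the origami associated to the data $(G,H,g_r,g_u)$, let $N$ be the normalizer of $H$ in $G$ and let $c=g_rg_ug_r^{-1}g_u^{-1}$. Let $\chi_\alpha$ be an irreducible complex character of $\mathrm{Aut}(M)=N/H$. Then the multiplicity $\ell_\alpha$ of $\chi_\alpha$ in the character of the $N/H$-module $H_1^{(0)}(M,\mathbf{C})$ is given by $$\ell_\alpha=\dim\psi_\alpha-\sum_{C\ \text{cycle of}\ \rho}f_\alpha(C),$$ where $\psi_\alpha$ is the representation of $G$ induced by the representation of $N$ with character $\chi_\alpha$, $\rho$ is the permutation of $G/N$ given by the action of $c$, and $f_\alpha(C)$ is the dimension of the fixed space of $\psi_\alpha(c^{n_C})$ in any of the summands of the induced representation indexed by the cycle $C$, $n_C$ being the length of $C$.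
   Context: An origami is a ramified covering $\pi:M\to \mathbf{T}^2=\mathbf{R}^2/\mathbf{Z}^2$ from a compact connected surface, unramified outside $0$. Its squares are the connected components of $\pi^{-1}((0,1)^2)$. $\mathrm{Aut}(M)$ is the group of homeomorphisms $f$ of $M$ with $\pi\circ f=\pi$. $H_1^{(0)}(M,\mathbf{C})$ is the kernel of $\pi_*:H_1(M,\mathbf{C})\to H_1(\mathbf{T}^2,\mathbf{C})$. Data $(G,H,g_r,g_u)$: $G$ is a finite group generated by $g_r,g_u$, and $H$ is a subgroup of $G$ containing no normal subgroup of $G$ other than the trivial one. The associated origami $M$ has as squares the right cosets $Hg\in H\backslash G$, the square to the right of $Hg$ being $Hgg_r$ and the square above $Hg$ being $Hgg_u$. $\mathrm{Aut}(M)$ is canonically identified with $N/H$, the class of $n\in N$ acting on squares by $Hg\mapsto Hng$. Induced representation. Let $E_\alpha$ be the space of a representation of $N/H$ with character $\chi_\alpha$, viewed as a representation of $N$ through $N\to N/H$. Choose representatives $g_1=1,\dots,g_r$ of the classes $Ng$ of $G$ (here $r=\#G/\#N$). The space of the induced representation $\psi_\alpha$ of $G$ is $F_\alpha=\bigoplus_{i=1}^r g_i^{-1}.E_\alpha$. The permutation $\rho$ of $\{1,\dots,r\}$ is defined by $cg_i^{-1}\in g_{\rho(i)}^{-1}N$, so that $\psi_\alpha(c)(g_i^{-1}.E_\alpha)=g_{\rho(i)}^{-1}.E_\alpha$. For a cycle $C$ of $\rho$ (fixed points count as cycles of length $1$), of length $n_C$, each $g_i^{-1}.E_\alpha$ with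 $i\in C$ is invariant under $\psi_\alpha(c^{n_C})$, and $f_\alpha(C)$ is the dimension of the space of vectors of $g_i^{-1}.E_\alpha$ fixed by $\psi_\alpha(c^{n_C})$; it does not depend on the choice of $i\in C$. *)

theory Defs
  imports
    "HOL-Homology.Homology"
    "HOL-Algebra.Group_Action"
    "HOL-Algebra.Generated_Groups"
    "HOL-Combinatorics.Orbits"
    "Jordan_Normal_Form.VS_Connect"
begin

section \<open>Complex representations and their characters\<close>

abbreviation complex_field :: "complex ring" where
  "complex_field \<equiv> class_ring"

text \<open>A finite-dimensional complex representation of \<open>K\<close> on the vector space \<open>V\<close>; outside
  \<open>carrier K\<close> and \<open>carrier V\<close> the map \<open>\<phi>\<close> is unconstrained.\<close>

definition representation ::
    "('k, 'l) monoid_scheme \<Rightarrow> (complex, 'v) module \<Rightarrow> ('k \<Rightarrow> 'v \<Rightarrow> 'v) \<Rightarrow> bool" where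
  "representation K V \<phi> \<longleftrightarrow>
     group K \<and> vectorspace complex_field V \<and> vectorspace.fin_dim complex_field V \<and>
     (\<forall>k\<in>carrier K. linear_map complex_field V V (\<phi> k)) \<and>
     (\<forall>v\<in>carrier V. \<phi> \<one>\<^bsub>K\<^esub> v = v) \<and>
     (\<forall>k\<in>carrier K. \<forall>l\<in>carrier K. \<forall>v\<in>carrier V. \<phi> (k \<otimes>\<^bsub>K\<^esub> l) v = \<phi> k (\<phi> l v))"

definition irreducible_rep ::
    "('k, 'l) monoid_scheme \<Rightarrow> (complex, 'v) module \<Rightarrow> ('k \<Rightarrow> 'v \<Rightarrow> 'v) \<Rightarrow> bool" where
  "irreducible_rep K V \<phi> \<longleftrightarrow>
     representation K V \<phi> \<and> carrier V \<noteq> {\<zero>\<^bsub>V\<^esub>} \<and>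
     (\<forall>W. VectorSpace.subspace complex_field W V \<and> (\<forall>k\<in>carrier K. \<phi> k ` W \<subseteq> W)
        \<longrightarrow> W = {\<zero>\<^bsub>V\<^esub>} \<or> W = carrier V)"

text \<open>The coefficient of \<open>b\<close> in the expansion of \<open>v\<close> in a finite basis \<open>B\<close>.\<close>

definition basis_coeff :: "(complex, 'v) module \<Rightarrow> 'v set \<Rightarrow> 'v \<Rightarrow> 'v \<Rightarrow> complex" where
  "basis_coeff V B v b = (THE a. a \<in> extensional B \<and> module.lincomb V a B = v) b"

definition endo_trace :: "(complex, 'v) module \<Rightarrow> ('v \<Rightarrow> 'v) \<Rightarrow> complex" where
  "endo_trace V T =
     (let B = (SOME B. finite B \<and> vectorspace.basis complex_field V B)
      in \<Sum>b\<in>B. basis_coeff V B (T b) b)"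

definition rep_character ::
    "('k, 'l) monoid_scheme \<Rightarrow> (complex, 'v) module \<Rightarrow> ('k \<Rightarrow> 'v \<Rightarrow> 'v) \<Rightarrow> 'k \<Rightarrow> complex" where
  "rep_character K V \<phi> = (\<lambda>k\<in>carrier K. endo_trace V (\<phi> k))"

text \<open>All irreducible complex characters of \<open>K\<close>. Restricting the underlying type of the
  representation space to \<open>nat \<Rightarrow> complex\<close> loses nothing, since every finite-dimensional
  complex vector space is isomorphic to one whose vectors are of that type.\<close>

definition irreducible_characters :: "('k, 'l) monoid_scheme \<Rightarrow> ('k \<Rightarrow> complex) set" where
  "irreducible_characters K =
     {rep_character K V \<phi> | (V :: (complex, nat \<Rightarrow> complex) module) \<phi>. irreducible_rep K V \<phi>}"

text \<open>The coefficient of the irreducible character \<open>\<theta>\<close> in the decomposition of the character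
  \<open>\<xi>\<close> as a sum of irreducible characters.\<close>

definition character_multiplicity ::
    "('k, 'l) monoid_scheme \<Rightarrow> ('k \<Rightarrow> complex) \<Rightarrow> ('k \<Rightarrow> complex) \<Rightarrow> nat" where
  "character_multiplicity K \<xi> \<theta> =
     (THE l. \<exists>m :: ('k \<Rightarrow> complex) \<Rightarrow> nat.
        (\<forall>k\<in>carrier K. \<xi> k = (\<Sum>\<eta>\<in>irreducible_characters K. of_nat (m \<eta>) * \<eta> k)) \<and>
        m \<theta> = l)"

definition quotient_space :: "(complex, 'v) module \<Rightarrow> 'v set \<Rightarrow> (complex, 'v set) module" where
  "quotient_space V W =
     \<lparr>carrier = a_rcosets\<^bsub>V\<^esub> W, monoid.mult = undefined, one = undefined,
      zero = W, add = (\<lambda>S T. S <+>\<^bsub>V\<^esub> T),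
      smult = (\<lambda>z S. (\<Union>v\<in>S. W +>\<^bsub>V\<^esub> (z \<odot>\<^bsub>V\<^esub> v)))\<rparr>"


section \<open>Singular homology with complex coefficients\<close>

text \<open>The library's singular simplices, faces and simplex maps, with the coefficient ring of the
  integers replaced by the complex numbers.\<close>

type_synonym 'a complex_chain = "((nat \<Rightarrow> real) \<Rightarrow> 'a) \<Rightarrow>\<^sub>0 complex"

definition chain_scale :: "complex \<Rightarrow> ('b \<Rightarrow>\<^sub>0 complex) \<Rightarrow> ('b \<Rightarrow>\<^sub>0 complex)" where
  "chain_scale z c = Poly_Mapping.map ((*) z) c"

definition linear_extend ::
    "('b \<Rightarrow> ('d \<Rightarrow>\<^sub>0 complex)) \<Rightarrow> ('b \<Rightarrow>\<^sub>0 complex) \<Rightarrow> ('d \<Rightarrow>\<^sub>0 complex)" where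
  "linear_extend h c =
     (\<Sum>f\<in>Poly_Mapping.keys c. chain_scale (Poly_Mapping.lookup c f) (h f))"

definition chain_space :: "nat \<Rightarrow> 'a topology \<Rightarrow> (complex, 'a complex_chain) module" where
  "chain_space p X =
     \<lparr>carrier = {c. Poly_Mapping.keys c \<subseteq> singular_simplex_set p X},
      monoid.mult = undefined, one = undefined, zero = 0, add = (+), smult = chain_scale\<rparr>"

definition complex_boundary :: "nat \<Rightarrow> 'a complex_chain \<Rightarrow> 'a complex_chain" where
  "complex_boundary p c =
     (if p = 0 then 0
      else linear_extend
             (\<lambda>f. \<Sum>k\<le>p. Poly_Mapping.single (singular_face p k f) ((-1) ^ k)) c)"

definition complex_cycles :: "nat \<Rightarrow> 'a topology \<Rightarrow> 'a complex_chain set" where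
  "complex_cycles p X = {c \<in> carrier (chain_space p X). complex_boundary p c = 0}"

definition complex_boundaries :: "nat \<Rightarrow> 'a topology \<Rightarrow> 'a complex_chain set" where
  "complex_boundaries p X = complex_boundary (Suc p) ` carrier (chain_space (Suc p) X)"

definition complex_homology :: "nat \<Rightarrow> 'a topology \<Rightarrow> (complex, 'a complex_chain set) module" where
  "complex_homology p X =
     quotient_space ((chain_space p X)\<lparr>carrier := complex_cycles p X\<rparr>) (complex_boundaries p X)"

definition complex_chain_map ::
    "nat \<Rightarrow> ('a \<Rightarrow> 'b) \<Rightarrow> 'a complex_chain \<Rightarrow> 'b complex_chain" where
  "complex_chain_map p g = linear_extend (\<lambda>f. Poly_Mapping.single (simplex_map p g f) 1)"

text \<open>The map induced in degree \<open>p\<close> by a continuous map \<open>g\<close> into \<open>Y\<close>. The cosets in the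
  union all coincide when \<open>S\<close> is a homology class.\<close>

definition homology_map ::
    "nat \<Rightarrow> 'b topology \<Rightarrow> ('a \<Rightarrow> 'b) \<Rightarrow> 'a complex_chain set \<Rightarrow> 'b complex_chain set" where
  "homology_map p Y g S =
     (\<Union>c\<in>S. complex_boundaries p Y +>\<^bsub>chain_space p Y\<^esub> complex_chain_map p g c)"


section \<open>Origamis\<close>

definition quotient_top :: "'a topology \<Rightarrow> ('a \<Rightarrow> 'b) \<Rightarrow> 'b topology" where
  "quotient_top X q =
     topology (\<lambda>U. U \<subseteq> q ` topspace X \<and> openin X {x \<in> topspace X. q x \<in> U})"

lemma openin_quotient_top:
  "openin (quotient_top X q) U \<longleftrightarrow>
     U \<subseteq> q ` topspace X \<and> openin X {x \<in> topspace X. q x \<in> U}"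
proof -
  let ?P = "\<lambda>U. U \<subseteq> q ` topspace X \<and> openin X {x \<in> topspace X. q x \<in> U}"
  have "istopology ?P"
    unfolding istopology_def
  proof (intro conjI allI impI)
    fix S T assume "?P S" "?P T"
    moreover have "{x \<in> topspace X. q x \<in> S \<inter> T} =
        {x \<in> topspace X. q x \<in> S} \<inter> {x \<in> topspace X. q x \<in> T}" by blast
    ultimately show "S \<inter> T \<subseteq> q ` topspace X" "openin X {x \<in> topspace X. q x \<in> S \<inter> T}"
      by auto
  next
    fix \<K> assume *: "\<forall>K\<in>\<K>. ?P K"
    then show "\<Union>\<K> \<subseteq> q ` topspace X" by blast
    have "{x \<in> topspace X. q x \<in> \<Union>\<K>} = (\<Union>K\<in>\<K>. {x \<in> topspace X. q x \<in> K})" by blast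
    then show "openin X {x \<in> topspace X. q x \<in> \<Union>\<K>}" using * by auto
  qed
  then show ?thesis by (simp add: quotient_top_def)
qed

lemma topspace_quotient_top [simp]: "topspace (quotient_top X q) = q ` topspace X"
proof -
  have "{x \<in> topspace X. q x \<in> q ` topspace X} = topspace X" by blast
  then have "openin (quotient_top X q) (q ` topspace X)" by (simp add: openin_quotient_top)
  then show ?thesis
    using openin_subset openin_quotient_top[of X q "topspace (quotient_top X q)"] by blast
qed

lemma quotient_map_quotient_top: "quotient_map X (quotient_top X q) q"
  by (auto simp: quotient_map_def openin_quotient_top)

locale origami_data = group G for G (structure) +
  fixes H :: "'a set" and g_r g_u :: 'a
  assumes finite_G: "finite (carrier G)"
    and g_r_closed: "g_r \<in> carrier G"
    and g_u_closed: "g_u \<in> carrier G"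
    and generated: "generate G {g_r, g_u} = carrier G"
    and subgroup_H: "subgroup H G"
    and core_free: "\<And>K. K \<lhd> G \<Longrightarrow> K \<subseteq> H \<Longrightarrow> K = {\<one>}"

text \<open>\<open>(s, x, y)\<close> is the point with coordinates \<open>(x, y)\<close> of a closed unit square labelled by
  the right coset \<open>s\<close>. The right side of \<open>s\<close> is glued to the left side of \<open>s #> g_r\<close>, the top
  side of \<open>s\<close> to the bottom side of \<open>s #> g_u\<close>; a point of the origami is an equivalence class
  for the equivalence relation generated by these identifications.\<close>

definition square_gluing ::
    "('a, 'b) monoid_scheme \<Rightarrow> 'a set \<Rightarrow> 'a \<Rightarrow> 'a \<Rightarrow> ('a set \<times> real \<times> real) rel" where
  "square_gluing G H g_r g_u =
     {((s, 1, y), (s #>\<^bsub>G\<^esub> g_r, 0, y)) | s y. s \<in> rcosets\<^bsub>G\<^esub> H \<and> y \<in> {0..1}} \<union>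
     {((s, x, 1), (s #>\<^bsub>G\<^esub> g_u, x, 0)) | s x. s \<in> rcosets\<^bsub>G\<^esub> H \<and> x \<in> {0..1}}"

definition origami_point ::
    "('a, 'b) monoid_scheme \<Rightarrow> 'a set \<Rightarrow> 'a \<Rightarrow> 'a \<Rightarrow>
     'a set \<times> real \<times> real \<Rightarrow> ('a set \<times> real \<times> real) set" where
  "origami_point G H g_r g_u P =
     (square_gluing G H g_r g_u \<union> (square_gluing G H g_r g_u)\<inverse>)\<^sup>* `` {P}"

definition origami ::
    "('a, 'b) monoid_scheme \<Rightarrow> 'a set \<Rightarrow> 'a \<Rightarrow> 'a \<Rightarrow> ('a set \<times> real \<times> real) set topology" where
  "origami G H g_r g_u =
     quotient_top
       (prod_topology (discrete_topology (rcosets\<^bsub>G\<^esub> H)) (top_of_set ({0..1} \<times> {0..1})))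
       (origami_point G H g_r g_u)"

definition torus_point :: "real \<times> real \<Rightarrow> (real \<times> real) set" where
  "torus_point P = {P + (of_int m, of_int n) | m n. True}"

definition torus :: "(real \<times> real) set topology" where
  "torus = quotient_top euclidean torus_point"

text \<open>The covering of the torus: it sends the class of \<open>(s, x, y)\<close> to the class of \<open>(x, y)\<close>,
  glued points having coordinates congruent modulo the integer lattice.\<close>

definition covering :: "('a set \<times> real \<times> real) set \<Rightarrow> (real \<times> real) set" where
  "covering Q = (\<Union>P\<in>Q. torus_point (snd P))"

abbreviation normalizer_quotient :: "('a, 'b) monoid_scheme \<Rightarrow> 'a set \<Rightarrow> 'a set monoid" where
  "normalizer_quotient G H \<equiv> G\<lparr>carrier := normalizer G H\<rparr> Mod H"

text \<open>For \<open>\<nu> = Hn\<close> with \<open>n\<close> in the normalizer of \<open>H\<close>, the product set \<open>\<nu> <#> Hg\<close> is the coset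
  \<open>Hng\<close>; the corresponding automorphism maps the square \<open>Hg\<close> to the square \<open>Hng\<close> preserving
  the coordinates.\<close>

definition origami_automorphism ::
    "('a, 'b) monoid_scheme \<Rightarrow> 'a set \<Rightarrow>
     ('a set \<times> real \<times> real) set \<Rightarrow> ('a set \<times> real \<times> real) set" where
  "origami_automorphism G \<nu> Q = (\<lambda>(s, P). (\<nu> <#>\<^bsub>G\<^esub> s, P)) ` Q"

definition H1_zero ::
    "('a, 'b) monoid_scheme \<Rightarrow> 'a set \<Rightarrow> 'a \<Rightarrow> 'a \<Rightarrow>
     (complex, ('a set \<times> real \<times> real) set complex_chain set) module" where
  "H1_zero G H g_r g_u =
     (let V = complex_homology 1 (origami G H g_r g_u)
      in V\<lparr>carrier := {S \<in> carrier V.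
             homology_map 1 torus covering S = \<zero>\<^bsub>complex_homology 1 torus\<^esub>}\<rparr>)"

definition H1_action ::
    "('a, 'b) monoid_scheme \<Rightarrow> 'a set \<Rightarrow> 'a \<Rightarrow> 'a \<Rightarrow> 'a set \<Rightarrow>
     ('a set \<times> real \<times> real) set complex_chain set \<Rightarrow>
     ('a set \<times> real \<times> real) set complex_chain set" where
  "H1_action G H g_r g_u \<nu> =
     homology_map 1 (origami G H g_r g_u) (origami_automorphism G \<nu>)"


section \<open>The representation induced from the normalizer\<close>

text \<open>\<open>g 1 = \<one>, ..., g r\<close> are representatives of the classes \<open>Ng\<close>.\<close>

definition coset_representatives ::
    "('a, 'b) monoid_scheme \<Rightarrow> 'a set \<Rightarrow> nat \<Rightarrow> (nat \<Rightarrow> 'a) \<Rightarrow> bool" where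
  "coset_representatives G N r g \<longleftrightarrow>
     g \<in> {1..r} \<rightarrow> carrier G \<and> g 1 = \<one>\<^bsub>G\<^esub> \<and>
     bij_betw (\<lambda>i. N #>\<^bsub>G\<^esub> g i) {1..r} (rcosets\<^bsub>G\<^esub> N)"

text \<open>The direct sum of the copies \<open>g\<^sub>i\<inverse>.E\<close> of \<open>E\<close> for \<open>1 \<le> i \<le> r\<close>: the element with
  components \<open>g\<^sub>i\<inverse>.(v i)\<close> is represented by the family \<open>v\<close>.\<close>

definition induced_space :: "(complex, 'e) module \<Rightarrow> nat \<Rightarrow> (complex, nat \<Rightarrow> 'e) module" where
  "induced_space E r =
     \<lparr>carrier = {1..r} \<rightarrow>\<^sub>E carrier E, monoid.mult = undefined, one = undefined,
      zero = (\<lambda>i\<in>{1..r}. \<zero>\<^bsub>E\<^esub>),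
      add = (\<lambda>v w. \<lambda>i\<in>{1..r}. v i \<oplus>\<^bsub>E\<^esub> w i),
      smult = (\<lambda>z v. \<lambda>i\<in>{1..r}. z \<odot>\<^bsub>E\<^esub> v i)\<rparr>"

text \<open>Here \<open>\<phi>\<close> is a representation of \<open>N\<close> on \<open>E\<close>. If \<open>x g\<^sub>i\<inverse> = g\<^sub>j\<inverse> n\<close> with \<open>n\<close> in \<open>N\<close>, then
  \<open>x\<close> maps \<open>g\<^sub>i\<inverse>.e\<close> to \<open>g\<^sub>j\<inverse>.(\<phi> n e)\<close>, where \<open>n = g\<^sub>j x g\<^sub>i\<inverse>\<close>.\<close>

definition induced_action ::
    "('a, 'b) monoid_scheme \<Rightarrow> 'a set \<Rightarrow> nat \<Rightarrow> (nat \<Rightarrow> 'a) \<Rightarrow> (complex, 'e) module \<Rightarrow>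
     ('a \<Rightarrow> 'e \<Rightarrow> 'e) \<Rightarrow> 'a \<Rightarrow> (nat \<Rightarrow> 'e) \<Rightarrow> nat \<Rightarrow> 'e" where
  "induced_action G N r g E \<phi> x v =
     (\<lambda>j\<in>{1..r}.
        \<Oplus>\<^bsub>E\<^esub>i\<in>{i \<in> {1..r}. x \<otimes>\<^bsub>G\<^esub> inv\<^bsub>G\<^esub> (g i) \<in> inv\<^bsub>G\<^esub> (g j) <#\<^bsub>G\<^esub> N}.
          \<phi> (g j \<otimes>\<^bsub>G\<^esub> x \<otimes>\<^bsub>G\<^esub> inv\<^bsub>G\<^esub> (g i)) (v i))"

text \<open>The summand \<open>g\<^sub>i\<inverse>.E\<close>.\<close>

definition induced_summand :: "(complex, 'e) module \<Rightarrow> nat \<Rightarrow> nat \<Rightarrow> (nat \<Rightarrow> 'e) set" where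
  "induced_summand E r i =
     {v \<in> carrier (induced_space E r). \<forall>j\<in>{1..r}. j \<noteq> i \<longrightarrow> v j = \<zero>\<^bsub>E\<^esub>}"

definition coset_perm ::
    "('a, 'b) monoid_scheme \<Rightarrow> 'a set \<Rightarrow> nat \<Rightarrow> (nat \<Rightarrow> 'a) \<Rightarrow> 'a \<Rightarrow> nat \<Rightarrow> nat" where
  "coset_perm G N r g x i =
     (if i \<in> {1..r}
      then THE j. j \<in> {1..r} \<and> x \<otimes>\<^bsub>G\<^esub> inv\<^bsub>G\<^esub> (g i) \<in> inv\<^bsub>G\<^esub> (g j) <#\<^bsub>G\<^esub> N
      else i)"

definition cycles_on :: "nat \<Rightarrow> (nat \<Rightarrow> nat) \<Rightarrow> nat set set" where
  "cycles_on r \<rho> = Orbits.orbit \<rho> ` {1..r}"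

text \<open>The dimension of the space of vectors of \<open>g\<^sub>i\<inverse>.E\<close> fixed by \<open>\<psi>(x\<^sup>n)\<close>, where \<open>\<psi>\<close> is the
  induced representation.\<close>

definition fixed_dim ::
    "('a, 'b) monoid_scheme \<Rightarrow> 'a set \<Rightarrow> nat \<Rightarrow> (nat \<Rightarrow> 'a) \<Rightarrow> (complex, 'e) module \<Rightarrow>
     ('a \<Rightarrow> 'e \<Rightarrow> 'e) \<Rightarrow> 'a \<Rightarrow> nat \<Rightarrow> nat \<Rightarrow> nat" where
  "fixed_dim G N r g E \<phi> x n i =
     vectorspace.dim complex_field
       ((induced_space E r)\<lparr>carrier :=
          {v \<in> induced_summand E r i. induced_action G N r g E \<phi> (x [^]\<^bsub>G\<^esub> n) v = v}\<rparr>)"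

end

theory Submission
  imports
    Defs
    "Jordan_Normal_Form.Spectral_Radius"
    "HOL-Analysis.Further_Topology"
    "HOL-Analysis.Abstract_Topological_Spaces"
    "HOL-Analysis.Complex_Transcendental"
    "HOL-Algebra.Zassenhaus"
begin

text \<open>Two computations give the formula. The first is the character of \<open>H1_zero\<close>. The origami is a
  cell complex whose 2-cells are the squares, whose edges are the bottom and left sides of the squares
  and whose vertices are the points over \<open>0\<close>. Write \<open>sq k\<close> and \<open>vt k\<close> for the numbers of squares
  and vertices fixed by an automorphism \<open>k\<close>. Then \<open>k\<close> has trace \<open>sq k\<close>, \<open>2 * sq k\<close> and \<open>vt k\<close> on
  cellular chains of degree 2, 1 and 0. The image of the boundary map on edges has codimension 1 in
  the chains of degree 0, the kernel of the boundary map on squares is the line of constant chains,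
  since the surface is connected and closed, and the covering maps the cycles onto the trivial
  representation of dimension 2 given by the homology of the torus. Additivity of the trace in
  exact sequences leaves \<open>2 * sq k - (vt k - 1) - 2 - (sq k - 1) = sq k - vt k\<close> for the character
  of \<open>H1_zero\<close>; this is \<open>H1_zero_character\<close>.

  That singular homology in degree 1 is computed by these cells takes two steps.
  Every singular cycle is homologous to a combination of edges (\<open>cycle_cellular\<close>): a path is
  subdivided until each piece lies in the star of a point of the half-integral grid, and the star
  is contracted along straight segments. A combination of edges that bounds is a combination of
  boundaries of squares (\<open>cell_chain_boundary_imp_square_boundary\<close>): otherwise some linear
  functional vanishes on the boundaries of squares but not on this combination. Such a functional is
  a cellular cocycle. When its values are integers it is the winding of a map from the surface to
  the punctured plane, and windings vanish on singular boundaries; complex values are reduced to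
  rational ones by splitting them along a basis of the complex numbers over the rationals.

  The second computation is the inner product of \<open>sq - vt\<close> with the irreducible character. The
  multiplicity is this inner product by the orthogonality relations. The group \<open>N/H\<close> acts freely on
  the squares with \<open>r\<close> orbits, so \<open>sq\<close> contributes \<open>r * dim E\<close>, the dimension of the induced
  space. In general an orbit contributes the dimension of the subspace fixed by a stabilizer
  (\<open>orbit_fixed_sum\<close>). Turning around the upper right corner of the square \<open>s\<close> leads to the square
  \<open>s #> c\<close>, so vertices are orbits of \<open>c\<close> on squares, and orbits of \<open>N/H\<close> on vertices are cycles of
  \<open>c\<close> on \<open>N\<close>-cosets. The stabilizer of the vertex at \<open>H #> g i\<close> is cyclic, generated by the class of
  \<open>g i \<otimes> c [^] n \<otimes> inv (g i)\<close> with \<open>n\<close> the length of the cycle of \<open>i\<close>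
  (\<open>corner_stabilizer\<close>). This element is how \<open>c [^] n\<close> acts on the summand with index \<open>i\<close> of the
  induced representation, so \<open>vt\<close> contributes the sum of the dimensions of the fixed spaces.\<close>

section \<open>Frames, traces and dimensions of complex vector spaces\<close>

abbreviation fin_dim_space :: "(complex, 'v) module \<Rightarrow> bool" where
  "fin_dim_space V \<equiv> vectorspace complex_field V \<and> vectorspace.fin_dim complex_field V"

definition linear_functional :: "(complex, 'v) module \<Rightarrow> ('v \<Rightarrow> complex) \<Rightarrow> bool" where
  "linear_functional V c \<longleftrightarrow>
     (\<forall>v\<in>carrier V. \<forall>w\<in>carrier V. c (v \<oplus>\<^bsub>V\<^esub> w) = c v + c w) \<and>
     (\<forall>z. \<forall>v\<in>carrier V. c (z \<odot>\<^bsub>V\<^esub> v) = z * c v)"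

text \<open>Vectors \<open>e i\<close> and functionals \<open>c i\<close> that expand every vector.
  The vectors may be dependent, so a frame is weaker than a basis with its dual basis, but it
  computes traces all the same.\<close>

definition frame :: "(complex, 'v) module \<Rightarrow> 'i set \<Rightarrow> ('i \<Rightarrow> 'v) \<Rightarrow> ('i \<Rightarrow> 'v \<Rightarrow> complex) \<Rightarrow> bool" where
  "frame V I e c \<longleftrightarrow>
     finite I \<and> e \<in> I \<rightarrow> carrier V \<and> (\<forall>i\<in>I. linear_functional V (c i)) \<and>
     (\<forall>v\<in>carrier V. v = (\<Oplus>\<^bsub>V\<^esub>i\<in>I. c i v \<odot>\<^bsub>V\<^esub> e i))"

lemma frameD:
  assumes "frame V I e c"
  shows frame_finite: "finite I"
    and frame_carrier: "\<And>i. i \<in> I \<Longrightarrow> e i \<in> carrier V"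
    and frame_functional: "\<And>i. i \<in> I \<Longrightarrow> linear_functional V (c i)"
    and frame_expand: "\<And>v. v \<in> carrier V \<Longrightarrow> (\<Oplus>\<^bsub>V\<^esub>i\<in>I. c i v \<odot>\<^bsub>V\<^esub> e i) = v"
  using assms unfolding frame_def by fastforce+

lemma complex_vectorspace_facts:
  assumes "vectorspace complex_field V"
  shows vs_module: "Module.module complex_field V"
    and vs_abelian_group: "abelian_group V"
    and vs_abelian_monoid: "abelian_monoid V"
    and vs_zero: "\<zero>\<^bsub>V\<^esub> \<in> carrier V"
    and vs_add: "\<And>v w. v \<in> carrier V \<Longrightarrow> w \<in> carrier V \<Longrightarrow> v \<oplus>\<^bsub>V\<^esub> w \<in> carrier V"
    and vs_smult: "\<And>z v. v \<in> carrier V \<Longrightarrow> z \<odot>\<^bsub>V\<^esub> v \<in> carrier V"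
    and vs_smult_zero: "\<And>v. v \<in> carrier V \<Longrightarrow> 0 \<odot>\<^bsub>V\<^esub> v = \<zero>\<^bsub>V\<^esub>"
    and vs_smult_zero2: "\<And>z. z \<odot>\<^bsub>V\<^esub> \<zero>\<^bsub>V\<^esub> = \<zero>\<^bsub>V\<^esub>"
    and vs_smult_one: "\<And>v. v \<in> carrier V \<Longrightarrow> 1 \<odot>\<^bsub>V\<^esub> v = v"
    and vs_smult_assoc: "\<And>a b v. v \<in> carrier V \<Longrightarrow> a \<odot>\<^bsub>V\<^esub> (b \<odot>\<^bsub>V\<^esub> v) = (a * b) \<odot>\<^bsub>V\<^esub> v"
    and vs_smult_l_distr: "\<And>a b v. v \<in> carrier V \<Longrightarrow> (a + b) \<odot>\<^bsub>V\<^esub> v = a \<odot>\<^bsub>V\<^esub> v \<oplus>\<^bsub>V\<^esub> b \<odot>\<^bsub>V\<^esub> v"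
    and vs_smult_r_distr: "\<And>a v w. v \<in> carrier V \<Longrightarrow> w \<in> carrier V \<Longrightarrow>
          a \<odot>\<^bsub>V\<^esub> (v \<oplus>\<^bsub>V\<^esub> w) = a \<odot>\<^bsub>V\<^esub> v \<oplus>\<^bsub>V\<^esub> a \<odot>\<^bsub>V\<^esub> w"
    and vs_l_zero: "\<And>v. v \<in> carrier V \<Longrightarrow> \<zero>\<^bsub>V\<^esub> \<oplus>\<^bsub>V\<^esub> v = v"
    and vs_r_zero: "\<And>v. v \<in> carrier V \<Longrightarrow> v \<oplus>\<^bsub>V\<^esub> \<zero>\<^bsub>V\<^esub> = v"
    and vs_neg: "\<And>v. v \<in> carrier V \<Longrightarrow> v \<oplus>\<^bsub>V\<^esub> (-1) \<odot>\<^bsub>V\<^esub> v = \<zero>\<^bsub>V\<^esub>"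
    and vs_comm: "\<And>v w. v \<in> carrier V \<Longrightarrow> w \<in> carrier V \<Longrightarrow> v \<oplus>\<^bsub>V\<^esub> w = w \<oplus>\<^bsub>V\<^esub> v"
    and vs_assoc: "\<And>u v w. u \<in> carrier V \<Longrightarrow> v \<in> carrier V \<Longrightarrow> w \<in> carrier V \<Longrightarrow>
          u \<oplus>\<^bsub>V\<^esub> v \<oplus>\<^bsub>V\<^esub> w = u \<oplus>\<^bsub>V\<^esub> (v \<oplus>\<^bsub>V\<^esub> w)"
    and vs_finsum: "\<And>f I. f \<in> I \<rightarrow> carrier V \<Longrightarrow> finsum V f I \<in> carrier V"
proof -
  interpret vectorspace complex_field V by fact
  show "Module.module complex_field V" "abelian_group V" "abelian_monoid V" "\<zero>\<^bsub>V\<^esub> \<in> carrier V"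
    using module_axioms M.abelian_group_axioms M.abelian_monoid_axioms M.zero_closed by blast+
  show "\<And>v w. v \<in> carrier V \<Longrightarrow> w \<in> carrier V \<Longrightarrow> v \<oplus>\<^bsub>V\<^esub> w \<in> carrier V" by simp
  show sc: "\<And>z v. v \<in> carrier V \<Longrightarrow> z \<odot>\<^bsub>V\<^esub> v \<in> carrier V"
    using smult_closed by simp
  show "\<And>v. v \<in> carrier V \<Longrightarrow> 0 \<odot>\<^bsub>V\<^esub> v = \<zero>\<^bsub>V\<^esub>" using lmult_0 by simp
  show "\<And>z. z \<odot>\<^bsub>V\<^esub> \<zero>\<^bsub>V\<^esub> = \<zero>\<^bsub>V\<^esub>" using rmult_0 by simp
  show one: "\<And>v. v \<in> carrier V \<Longrightarrow> 1 \<odot>\<^bsub>V\<^esub> v = v" using smult_one by simp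
  show "\<And>a b v. v \<in> carrier V \<Longrightarrow> a \<odot>\<^bsub>V\<^esub> (b \<odot>\<^bsub>V\<^esub> v) = (a * b) \<odot>\<^bsub>V\<^esub> v"
    using smult_assoc1 by simp
  show ld: "\<And>a b v. v \<in> carrier V \<Longrightarrow> (a + b) \<odot>\<^bsub>V\<^esub> v = a \<odot>\<^bsub>V\<^esub> v \<oplus>\<^bsub>V\<^esub> b \<odot>\<^bsub>V\<^esub> v"
    using smult_l_distr by simp
  show "\<And>a v w. v \<in> carrier V \<Longrightarrow> w \<in> carrier V \<Longrightarrow>
          a \<odot>\<^bsub>V\<^esub> (v \<oplus>\<^bsub>V\<^esub> w) = a \<odot>\<^bsub>V\<^esub> v \<oplus>\<^bsub>V\<^esub> a \<odot>\<^bsub>V\<^esub> w"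
    using smult_r_distr by simp
  show "\<And>v. v \<in> carrier V \<Longrightarrow> \<zero>\<^bsub>V\<^esub> \<oplus>\<^bsub>V\<^esub> v = v" by simp
  show "\<And>v. v \<in> carrier V \<Longrightarrow> v \<oplus>\<^bsub>V\<^esub> \<zero>\<^bsub>V\<^esub> = v" by simp
  show "v \<oplus>\<^bsub>V\<^esub> (-1) \<odot>\<^bsub>V\<^esub> v = \<zero>\<^bsub>V\<^esub>" if "v \<in> carrier V" for v
    using ld[OF that, of 1 "-1"] one[OF that] lmult_0[OF that] by simp
  show "\<And>v w. v \<in> carrier V \<Longrightarrow> w \<in> carrier V \<Longrightarrow> v \<oplus>\<^bsub>V\<^esub> w = w \<oplus>\<^bsub>V\<^esub> v"
    by (rule M.a_comm)
  show "\<And>u v w. u \<in> carrier V \<Longrightarrow> v \<in> carrier V \<Longrightarrow> w \<in> carrier V \<Longrightarrow>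
          u \<oplus>\<^bsub>V\<^esub> v \<oplus>\<^bsub>V\<^esub> w = u \<oplus>\<^bsub>V\<^esub> (v \<oplus>\<^bsub>V\<^esub> w)"
    by (rule M.a_assoc)
  show "\<And>f I. f \<in> I \<rightarrow> carrier V \<Longrightarrow> finsum V f I \<in> carrier V" by (rule M.finsum_closed)
qed

lemma complex_linear_mapI:
  assumes "vectorspace complex_field V" "vectorspace complex_field W"
    and "\<And>v. v \<in> carrier V \<Longrightarrow> T v \<in> carrier W"
    and "\<And>v w. v \<in> carrier V \<Longrightarrow> w \<in> carrier V \<Longrightarrow> T (v \<oplus>\<^bsub>V\<^esub> w) = T v \<oplus>\<^bsub>W\<^esub> T w"
    and "\<And>z v. v \<in> carrier V \<Longrightarrow> T (z \<odot>\<^bsub>V\<^esub> v) = z \<odot>\<^bsub>W\<^esub> T v"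
  shows "linear_map complex_field V W T"
  unfolding linear_map_def mod_hom_def mod_hom_axioms_def module_hom_def
  using assms by (auto intro: vs_module)

lemma complex_linear_mapD:
  assumes "linear_map complex_field V W T"
  shows lm_dom: "vectorspace complex_field V"
    and lm_cod: "vectorspace complex_field W"
    and lm_closed: "\<And>v. v \<in> carrier V \<Longrightarrow> T v \<in> carrier W"
    and lm_add: "\<And>v w. v \<in> carrier V \<Longrightarrow> w \<in> carrier V \<Longrightarrow> T (v \<oplus>\<^bsub>V\<^esub> w) = T v \<oplus>\<^bsub>W\<^esub> T w"
    and lm_smult: "\<And>z v. v \<in> carrier V \<Longrightarrow> T (z \<odot>\<^bsub>V\<^esub> v) = z \<odot>\<^bsub>W\<^esub> T v"
    and lm_zero: "T \<zero>\<^bsub>V\<^esub> = \<zero>\<^bsub>W\<^esub>"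
proof -
  interpret linear_map complex_field V W T by fact
  show "vectorspace complex_field V" "vectorspace complex_field W" by unfold_locales
  show "\<And>v. v \<in> carrier V \<Longrightarrow> T v \<in> carrier W" by (rule T_im)
  show "\<And>v w. v \<in> carrier V \<Longrightarrow> w \<in> carrier V \<Longrightarrow> T (v \<oplus>\<^bsub>V\<^esub> w) = T v \<oplus>\<^bsub>W\<^esub> T w"
    by (rule T_add)
  show "\<And>z v. v \<in> carrier V \<Longrightarrow> T (z \<odot>\<^bsub>V\<^esub> v) = z \<odot>\<^bsub>W\<^esub> T v"
    using T_smult by simp
  show "T \<zero>\<^bsub>V\<^esub> = \<zero>\<^bsub>W\<^esub>" by simp
qed

lemma lm_finsum:
  assumes "linear_map complex_field V W T" "finite I" "g \<in> I \<rightarrow> carrier V"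
  shows "T (\<Oplus>\<^bsub>V\<^esub>i\<in>I. g i) = (\<Oplus>\<^bsub>W\<^esub>i\<in>I. T (g i))"
  using assms(2,3)
proof (induction I rule: finite_induct)
  case empty
  then show ?case
    using lm_zero[OF assms(1)]
    by (simp add: abelian_monoid.finsum_empty[OF vs_abelian_monoid[OF lm_dom[OF assms(1)]]]
        abelian_monoid.finsum_empty[OF vs_abelian_monoid[OF lm_cod[OF assms(1)]]])
next
  case (insert x F)
  have V: "abelian_monoid V" and W: "abelian_monoid W"
    using vs_abelian_monoid lm_dom[OF assms(1)] lm_cod[OF assms(1)] by auto
  have "T (finsum V g (insert x F)) = T (g x \<oplus>\<^bsub>V\<^esub> finsum V g F)"
    using insert V by (subst abelian_monoid.finsum_insert) auto
  also have "\<dots> = T (g x) \<oplus>\<^bsub>W\<^esub> T (finsum V g F)"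
    using insert lm_add[OF assms(1)] abelian_monoid.finsum_closed[OF V, of g F] by auto
  also have "\<dots> = (\<Oplus>\<^bsub>W\<^esub>i\<in>insert x F. T (g i))"
    using insert W lm_closed[OF assms(1)] by (subst abelian_monoid.finsum_insert[OF W]) auto
  finally show ?case .
qed

lemma functional_zero:
  assumes "vectorspace complex_field V" "linear_functional V c"
  shows "c \<zero>\<^bsub>V\<^esub> = 0"
  using assms vs_smult_zero[OF assms(1) vs_zero[OF assms(1)]] vs_zero[OF assms(1)]
  unfolding linear_functional_def by (metis mult_zero_left)

lemma functional_finsum:
  assumes V: "vectorspace complex_field V" and c: "linear_functional V c"
    and "finite I" "g \<in> I \<rightarrow> carrier V"
  shows "c (\<Oplus>\<^bsub>V\<^esub>i\<in>I. g i) = (\<Sum>i\<in>I. c (g i))"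
  using assms(3,4)
proof (induction I rule: finite_induct)
  case empty
  then show ?case
    using functional_zero[OF V c] by (simp add: abelian_monoid.finsum_empty vs_abelian_monoid[OF V])
next
  case (insert x F)
  note M = vs_abelian_monoid[OF V]
  have "c (finsum V g (insert x F)) = c (g x \<oplus>\<^bsub>V\<^esub> finsum V g F)"
    using insert M by (subst abelian_monoid.finsum_insert) auto
  also have "\<dots> = c (g x) + c (finsum V g F)"
    using insert c abelian_monoid.finsum_closed[OF M, of g F] unfolding linear_functional_def by auto
  finally show ?case using insert by auto
qed

lemma functional_compose:
  assumes "linear_map complex_field V W T" "linear_functional W c"
  shows "linear_functional V (\<lambda>v. c (T v))"
  using assms(2) lm_closed[OF assms(1)] lm_add[OF assms(1)] lm_smult[OF assms(1)]
  unfolding linear_functional_def by auto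

lemma functional_frame:
  assumes V: "vectorspace complex_field V" and f: "frame V I e c" and d: "linear_functional V d"
    and v: "v \<in> carrier V"
  shows "d v = (\<Sum>i\<in>I. c i v * d (e i))"
proof -
  have e: "e i \<in> carrier V" if "i \<in> I" for i using f that by (auto simp: frame_def)
  have "v = (\<Oplus>\<^bsub>V\<^esub>i\<in>I. c i v \<odot>\<^bsub>V\<^esub> e i)" using f v by (simp add: frame_def)
  then have "d v = d (\<Oplus>\<^bsub>V\<^esub>i\<in>I. c i v \<odot>\<^bsub>V\<^esub> e i)" by simp
  also have "\<dots> = (\<Sum>i\<in>I. d (c i v \<odot>\<^bsub>V\<^esub> e i))"
    using f e by (intro functional_finsum[OF V d]) (auto simp: frame_def intro!: vs_smult[OF V])
  also have "\<dots> = (\<Sum>i\<in>I. c i v * d (e i))"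
    using d e by (intro sum.cong) (auto simp: linear_functional_def)
  finally show ?thesis .
qed

lemma frame_linear_map:
  assumes T: "linear_map complex_field V W T" and f: "frame V I e c" and v: "v \<in> carrier V"
  shows "T v = (\<Oplus>\<^bsub>W\<^esub>i\<in>I. c i v \<odot>\<^bsub>W\<^esub> T (e i))"
proof -
  note V = lm_dom[OF T] and W = lm_cod[OF T]
  have e: "e i \<in> carrier V" if "i \<in> I" for i using f that by (auto simp: frame_def)
  have "v = (\<Oplus>\<^bsub>V\<^esub>i\<in>I. c i v \<odot>\<^bsub>V\<^esub> e i)" using f v by (simp add: frame_def)
  then have "T v = T (\<Oplus>\<^bsub>V\<^esub>i\<in>I. c i v \<odot>\<^bsub>V\<^esub> e i)" by simp
  also have "\<dots> = (\<Oplus>\<^bsub>W\<^esub>i\<in>I. T (c i v \<odot>\<^bsub>V\<^esub> e i))"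
    using f e by (intro lm_finsum[OF T]) (auto simp: frame_def intro!: vs_smult[OF V])
  also have "\<dots> = (\<Oplus>\<^bsub>W\<^esub>i\<in>I. c i v \<odot>\<^bsub>W\<^esub> T (e i))"
    using e lm_smult[OF T] lm_closed[OF T]
    by (intro abelian_monoid.finsum_cong'[OF vs_abelian_monoid[OF W]]) (auto intro!: vs_smult[OF W])
  finally show ?thesis .
qed

text \<open>The coefficients in a basis are given by a description operator; here they become the
  functionals of a frame, after which bases are only met through frames.\<close>

lemma basis_coeff_frame:
  assumes V: "vectorspace complex_field V" and B: "finite B" "vectorspace.basis complex_field V B"
  shows basis_frame: "frame V B (\<lambda>b. b) (\<lambda>b v. basis_coeff V B v b)"
    and basis_coeff_dual: "\<And>b b'. b \<in> B \<Longrightarrow> b' \<in> B \<Longrightarrow> basis_coeff V B b b' = (if b = b' then 1 else 0)"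
proof -
  interpret vectorspace complex_field V by fact
  have BV: "B \<subseteq> carrier V" using B(2) unfolding basis_def by auto
  have ex1: "\<exists>!a. a \<in> extensional B \<and> lincomb a B = v" if "v \<in> carrier V" for v
    using basis_criterion[OF B(1) BV] B(2) that by (auto simp: PiE_def)
  define k where "k v = (THE a. a \<in> extensional B \<and> lincomb a B = v)" for v
  have k: "k v \<in> extensional B" "lincomb (k v) B = v" if "v \<in> carrier V" for v
    using theI'[OF ex1[OF that]] unfolding k_def by auto
  have kI: "k v = restrict a B" if "a \<in> B \<rightarrow> UNIV" "lincomb a B = v" for v a
  proof -
    have "lincomb (restrict a B) B = lincomb a B"
      using BV by (intro lincomb_cong) auto
    moreover have "v \<in> carrier V" using that BV by (auto intro: lincomb_closed)
    ultimately show ?thesis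
      using ex1[of v] k[of v] that by (metis restrict_extensional)
  qed
  have coeff: "basis_coeff V B v b = k v b" for v b
    by (simp add: basis_coeff_def k_def)
  have add: "k (v \<oplus>\<^bsub>V\<^esub> w) b = k v b + k w b" if "v \<in> carrier V" "w \<in> carrier V" "b \<in> B" for v w b
  proof -
    have "lincomb (\<lambda>b. k v b \<oplus>\<^bsub>complex_field\<^esub> k w b) B = lincomb (k v) B \<oplus>\<^bsub>V\<^esub> lincomb (k w) B"
      by (rule lincomb_sum) (use B(1) BV in auto)
    then have "k (v \<oplus>\<^bsub>V\<^esub> w) = restrict (\<lambda>b. k v b + k w b) B"
      using k that by (intro kI) auto
    then show ?thesis using that by simp
  qed
  have sm: "k (z \<odot>\<^bsub>V\<^esub> v) b = z * k v b" if "v \<in> carrier V" "b \<in> B" for v z b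
  proof -
    have "lincomb (\<lambda>b. z \<otimes>\<^bsub>complex_field\<^esub> k v b) B = z \<odot>\<^bsub>V\<^esub> lincomb (k v) B"
      by (rule lincomb_smult) (use B(1) BV in auto)
    then have "k (z \<odot>\<^bsub>V\<^esub> v) = restrict (\<lambda>b. z * k v b) B"
      using k that by (intro kI) auto
    then show ?thesis using that by simp
  qed
  show "frame V B (\<lambda>b. b) (\<lambda>b v. basis_coeff V B v b)"
    unfolding frame_def linear_functional_def coeff
    using B(1) BV add sm k(2) by (auto simp: lincomb_def)
  show "basis_coeff V B b b' = (if b = b' then 1 else 0)" if "b \<in> B" "b' \<in> B" for b b'
  proof -
    have "lincomb (\<lambda>x. if x = b then 1 else 0) B = (\<Oplus>\<^bsub>V\<^esub>x\<in>B. if b = x then x else \<zero>\<^bsub>V\<^esub>)"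
      unfolding lincomb_def using BV lmult_0
      by (intro M.finsum_cong') (auto simp: vs_smult_one[OF V] vs_smult_zero[OF V] V vs_zero)
    also have "\<dots> = b" using that BV B(1) by (subst M.finsum_singleton) auto
    finally show ?thesis unfolding coeff using kI[of "\<lambda>x. if x = b then 1 else 0" b] that by auto
  qed
qed

lemma dual_frame_exists:
  assumes "fin_dim_space V"
  obtains B c where "frame V B (\<lambda>b. b) c" "\<And>b b'. b \<in> B \<Longrightarrow> b' \<in> B \<Longrightarrow> c b b' = (if b' = b then 1 else 0)"
proof -
  obtain B where "finite B" "vectorspace.basis complex_field V B"
    using assms vectorspace.finite_basis_exists by blast
  then show ?thesis
    using that basis_frame basis_coeff_dual assms by (smt (verit, best))
qed

lemma frame_imp_fin_dim:
  assumes V: "vectorspace complex_field V" and f: "frame V I e c"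
  shows "vectorspace.fin_dim complex_field V"
proof -
  interpret vectorspace complex_field V by fact
  have e: "e ` I \<subseteq> carrier V" and I: "finite I" using f by (auto simp: frame_def)
  have s: "submodule complex_field (span (e ` I)) V" using e by (rule span_is_submodule)
  have "v \<in> span (e ` I)" if "v \<in> carrier V" for v
  proof -
    have m: "c i v \<odot>\<^bsub>V\<^esub> e i \<in> span (e ` I)" if "i \<in> I" for i
    proof -
      have "e i \<in> span (e ` I)" using that e in_own_span by blast
      then show ?thesis using s by (auto simp: submodule_def)
    qed
    have "(\<Oplus>\<^bsub>V\<^esub>i\<in>J. c i v \<odot>\<^bsub>V\<^esub> e i) \<in> span (e ` I)" if "finite J" "J \<subseteq> I" for J
      using that
    proof (induction J rule: finite_induct)
      case empty
      show ?case using span_zero by simp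
    next
      case (insert x F)
      have "(\<Oplus>\<^bsub>V\<^esub>i\<in>insert x F. c i v \<odot>\<^bsub>V\<^esub> e i) =
          c x v \<odot>\<^bsub>V\<^esub> e x \<oplus>\<^bsub>V\<^esub> (\<Oplus>\<^bsub>V\<^esub>i\<in>F. c i v \<odot>\<^bsub>V\<^esub> e i)"
        using insert e by (intro M.finsum_insert) (auto intro!: vs_smult[OF V])
      then show ?case using insert m[of x] s by (auto simp: submodule_def)
    qed
    then show ?thesis using frame_expand[OF f that] I by fastforce
  qed
  moreover have "span (e ` I) \<subseteq> carrier V" using e by auto
  ultimately show ?thesis unfolding fin_dim_def using I e by (intro exI[of _ "e ` I"]) auto
qed

text \<open>Expanding \<open>T (e i)\<close> in the second frame and \<open>e' j\<close> in the
  first one turns both sides into the same double sum. In particular the trace does not depend on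
  the basis chosen in its definition.\<close>

lemma frame_trace_eq:
  assumes T: "linear_map complex_field V V T" and f: "frame V I e c" and g: "frame V J e' c'"
  shows "(\<Sum>i\<in>I. c i (T (e i))) = (\<Sum>j\<in>J. c' j (T (e' j)))"
proof -
  note V = lm_dom[OF T]
  have e: "e i \<in> carrier V" "linear_functional V (c i)" if "i \<in> I" for i
    using f that by (auto simp: frame_def)
  have e': "e' j \<in> carrier V" "linear_functional V (c' j)" if "j \<in> J" for j
    using g that by (auto simp: frame_def)
  have "(\<Sum>i\<in>I. c i (T (e i))) = (\<Sum>i\<in>I. \<Sum>j\<in>J. c' j (e i) * c i (T (e' j)))"
    using e by (intro sum.cong refl functional_frame[OF V g]) (auto intro: functional_compose[OF T])
  also have "\<dots> = (\<Sum>j\<in>J. \<Sum>i\<in>I. c i (T (e' j)) * c' j (e i))"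
    by (subst sum.swap) (simp add: mult.commute)
  also have "\<dots> = (\<Sum>j\<in>J. c' j (T (e' j)))"
    using e' lm_closed[OF T] by (intro sum.cong refl functional_frame[OF V f, symmetric]) auto
  finally show ?thesis .
qed

lemma endo_trace_frame:
  assumes T: "linear_map complex_field V V T" and f: "frame V I e c"
  shows "endo_trace V T = (\<Sum>i\<in>I. c i (T (e i)))"
proof -
  note V = lm_dom[OF T]
  define B where "B = (SOME B. finite B \<and> vectorspace.basis complex_field V B)"
  have "\<exists>B. finite B \<and> vectorspace.basis complex_field V B"
    using vectorspace.finite_basis_exists[OF V frame_imp_fin_dim[OF V f]] .
  then have "finite B \<and> vectorspace.basis complex_field V B" unfolding B_def by (rule someI_ex)
  then have "frame V B (\<lambda>b. b) (\<lambda>b v. basis_coeff V B v b)" by (intro basis_frame[OF V]) auto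
  from frame_trace_eq[OF T this f] show ?thesis
    by (simp add: endo_trace_def B_def Let_def)
qed

lemma endo_trace_cong:
  assumes T: "linear_map complex_field V V T" and "fin_dim_space V" "\<And>v. v \<in> carrier V \<Longrightarrow> T v = T' v"
  shows "endo_trace V T = endo_trace V T'"
proof -
  obtain B c where f: "frame V B (\<lambda>b. b) c" using dual_frame_exists[OF assms(2)] by metis
  have T': "linear_map complex_field V V T'"
    using T assms(3) lm_closed[OF T] lm_add[OF T] lm_smult[OF T] assms(2)
    by (intro complex_linear_mapI) (auto simp: vs_add vs_smult)
  show ?thesis
    unfolding endo_trace_frame[OF T f] endo_trace_frame[OF T' f]
    using frame_carrier[OF f] assms(3) by (intro sum.cong) simp_all
qed

text \<open>The trace of the identity, computed in this frame and in a basis.\<close>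

lemma dim_eq_frame:
  assumes V: "vectorspace complex_field V" and f: "frame V I e c"
    and d: "\<And>i. i \<in> I \<Longrightarrow> c i (e i) = 1"
  shows "vectorspace.dim complex_field V = card I"
proof -
  interpret vectorspace complex_field V by fact
  obtain B where B: "finite B" "basis B"
    using finite_basis_exists frame_imp_fin_dim[OF V f] by auto
  have id: "linear_map complex_field V V (\<lambda>v. v)" using V by (intro complex_linear_mapI) auto
  have "(of_nat (card I) :: complex) = (\<Sum>i\<in>I. c i (e i))" using d by simp
  also have "\<dots> = (\<Sum>b\<in>B. basis_coeff V B b b)"
    using frame_trace_eq[OF id f basis_frame[OF V B]] by simp
  also have "\<dots> = of_nat (card B)" using basis_coeff_dual[OF V B] by simp
  finally show ?thesis using dim_basis[OF B] by simp
qed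

lemma endo_trace_id:
  assumes "fin_dim_space V"
  shows "endo_trace V (\<lambda>v. v) = of_nat (vectorspace.dim complex_field V)"
proof -
  obtain B c where f: "frame V B (\<lambda>b. b) c"
    "\<And>b b'. b \<in> B \<Longrightarrow> b' \<in> B \<Longrightarrow> c b b' = (if b' = b then 1 else 0)"
    using dual_frame_exists[OF assms] by metis
  have id: "linear_map complex_field V V (\<lambda>v. v)" using assms by (intro complex_linear_mapI) auto
  show ?thesis using endo_trace_frame[OF id f(1)] dim_eq_frame[OF _ f(1)] f(2) assms by simp
qed

section \<open>Subspaces, quotients and additivity of the trace\<close>

definition closed_subspace :: "(complex, 'v) module \<Rightarrow> 'v set \<Rightarrow> bool" where
  "closed_subspace V U \<longleftrightarrow> U \<subseteq> carrier V \<and> \<zero>\<^bsub>V\<^esub> \<in> U \<and>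
     (\<forall>v\<in>U. \<forall>w\<in>U. v \<oplus>\<^bsub>V\<^esub> w \<in> U) \<and> (\<forall>z. \<forall>v\<in>U. z \<odot>\<^bsub>V\<^esub> v \<in> U)"

lemma subspace_iff_closed:
  assumes V: "vectorspace complex_field V"
  shows "VectorSpace.subspace complex_field U V \<longleftrightarrow> closed_subspace V U"
proof
  assume "VectorSpace.subspace complex_field U V"
  then have "submodule complex_field U V" by (simp add: VectorSpace.subspace_def)
  then interpret submodule complex_field U V .
  show "closed_subspace V U"
    unfolding closed_subspace_def using subset smult_closed by simp
next
  assume U: "closed_subspace V U"
  then show "VectorSpace.subspace complex_field U V"
    unfolding VectorSpace.subspace_def submodule_def closed_subspace_def
    using V vs_module[OF V] by auto
qed

lemma subspace_vectorspace:
  assumes "vectorspace complex_field V" "closed_subspace V U"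
  shows "vectorspace complex_field (V\<lparr>carrier := U\<rparr>)"
  using vectorspace.subspace_is_vs[OF assms(1)] subspace_iff_closed assms by blast

lemma vs_finsum_neutral:
  assumes V: "vectorspace complex_field V" and "finite B" "A \<subseteq> B"
    and "\<And>i. i \<in> B - A \<Longrightarrow> h i = \<zero>\<^bsub>V\<^esub>" "\<And>i. i \<in> B \<Longrightarrow> h i \<in> carrier V"
  shows "(\<Oplus>\<^bsub>V\<^esub>i\<in>B. h i) = (\<Oplus>\<^bsub>V\<^esub>i\<in>A. h i)"
  unfolding finsum_def
  by (rule comm_monoid.finprod_mono_neutral_cong_right
      [OF abelian_monoid.a_comm_monoid[OF vs_abelian_monoid[OF V]]])
    (use assms in auto)

lemma finsum_subspace:
  assumes V: "vectorspace complex_field V" and U: "closed_subspace V U"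
    and "finite I" "\<And>i. i \<in> I \<Longrightarrow> g i \<in> U"
  shows "(\<Oplus>\<^bsub>V\<^esub>i\<in>I. g i) \<in> U" "(\<Oplus>\<^bsub>V\<lparr>carrier := U\<rparr>\<^esub>i\<in>I. g i) = (\<Oplus>\<^bsub>V\<^esub>i\<in>I. g i)"
proof -
  note M = vs_abelian_monoid[OF V] and MU = vs_abelian_monoid[OF subspace_vectorspace[OF V U]]
  have UV: "U \<subseteq> carrier V" using U by (simp add: closed_subspace_def)
  have "(\<Oplus>\<^bsub>V\<^esub>i\<in>I. g i) \<in> U \<and> (\<Oplus>\<^bsub>V\<lparr>carrier := U\<rparr>\<^esub>i\<in>I. g i) = (\<Oplus>\<^bsub>V\<^esub>i\<in>I. g i)"
    using assms(3,4)
  proof (induction I rule: finite_induct)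
    case empty
    then show ?case
      using U by (simp add: abelian_monoid.finsum_empty[OF M] abelian_monoid.finsum_empty[OF MU]
          closed_subspace_def)
  next
    case (insert x F)
    have "finsum V g (insert x F) = g x \<oplus>\<^bsub>V\<^esub> finsum V g F"
      using insert UV by (intro abelian_monoid.finsum_insert[OF M]) auto
    moreover have "finsum (V\<lparr>carrier := U\<rparr>) g (insert x F) =
        g x \<oplus>\<^bsub>V\<lparr>carrier := U\<rparr>\<^esub> finsum (V\<lparr>carrier := U\<rparr>) g F"
      using insert by (intro abelian_monoid.finsum_insert[OF MU]) auto
    ultimately show ?case using insert U by (simp add: closed_subspace_def)
  qed
  then show "(\<Oplus>\<^bsub>V\<^esub>i\<in>I. g i) \<in> U" "(\<Oplus>\<^bsub>V\<lparr>carrier := U\<rparr>\<^esub>i\<in>I. g i) = (\<Oplus>\<^bsub>V\<^esub>i\<in>I. g i)"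
    by auto
qed

text \<open>A maximal independent subset \<open>A\<close> of \<open>U\<close> extends to a basis
  \<open>B\<close>, and \<open>U\<close> is cut out by the coordinates outside \<open>A\<close>. All
  facts on subspaces are read off from such coordinates.\<close>

lemma adapted_basis:
  assumes fd: "fin_dim_space V" and U: "closed_subspace V U"
  obtains B c A where "frame V B (\<lambda>b. b) c"
    "\<And>b b'. b \<in> B \<Longrightarrow> b' \<in> B \<Longrightarrow> c b b' = (if b' = b then 1 else 0)"
    "A \<subseteq> B" "\<And>v. v \<in> carrier V \<Longrightarrow> v \<in> U \<longleftrightarrow> (\<forall>b\<in>B - A. c b v = 0)"
proof -
  have V: "vectorspace complex_field V" using fd by simp
  interpret vectorspace complex_field V by fact
  have UV: "U \<subseteq> carrier V" using U by (simp add: closed_subspace_def)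
  have li0: "lin_indpt {}" unfolding lin_dep_def by auto
  have bd: "finite S \<and> card S \<le> dim" if "S \<subseteq> carrier V" "lin_indpt S" for S
    using li_le_dim[OF _ that] fd by auto
  obtain A where A: "finite A" "maximal A (\<lambda>S. S \<subseteq> U \<and> lin_indpt S)"
    using maximal_exists[of "\<lambda>S. S \<subseteq> U \<and> lin_indpt S" dim "{}"] bd UV li0 by (meson empty_subsetI order_trans)
  have AU: "A \<subseteq> U" "lin_indpt A" using A by (auto simp: maximal_def)
  obtain B where B: "finite B" "maximal B (\<lambda>S. A \<subseteq> S \<and> S \<subseteq> carrier V \<and> lin_indpt S)"
    using maximal_exists[of "\<lambda>S. A \<subseteq> S \<and> S \<subseteq> carrier V \<and> lin_indpt S" dim A] bd AU UV by auto
  have AB: "A \<subseteq> B" using B by (auto simp: maximal_def)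
  have "maximal B (\<lambda>S. S \<subseteq> carrier V \<and> lin_indpt S)"
    using B unfolding maximal_def by (metis order_trans)
  then have bB: "basis B" by (rule max_li_is_basis)
  define c where "c = (\<lambda>b v. basis_coeff V B v b)"
  have f: "frame V B (\<lambda>b. b) c" unfolding c_def by (rule basis_frame[OF V B(1) bB])
  have d: "c b b' = (if b' = b then 1 else 0)" if "b \<in> B" "b' \<in> B" for b b'
    unfolding c_def using basis_coeff_dual[OF V B(1) bB that(2,1)] by simp
  have Usp: "u \<in> span A" if u: "u \<in> U" for u
  proof (cases "u \<in> A")
    case True
    then show ?thesis using in_own_span[of A] AU UV by auto
  next
    case False
    have "lin_dep (insert u A)"
    proof (rule ccontr)
      assume "\<not> lin_dep (insert u A)"
      then have "insert u A = A"
        using A(2) AU u unfolding maximal_def by (metis insert_subset subset_insertI)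
      then show False using False by auto
    qed
    moreover have "A \<subseteq> carrier V" "u \<in> carrier V" using AU UV u by auto
    ultimately show ?thesis
      using lin_dep_iff_in_span[OF _ AU(2) _ False] by (metis Un_commute insert_is_Un)
  qed
  have "v \<in> U \<longleftrightarrow> (\<forall>b\<in>B - A. c b v = 0)" if v: "v \<in> carrier V" for v
  proof
    assume "v \<in> U"
    then have "v \<in> span A" by (rule Usp)
    then obtain a where a: "v = lincomb a A"
      using finite_in_span[OF A(1), of v] AU UV by auto
    show "\<forall>b\<in>B - A. c b v = 0"
    proof
      fix b assume b: "b \<in> B - A"
      have cb: "linear_functional V (c b)" using frame_functional[OF f] b by simp
      have "c b v = (\<Sum>x\<in>A. c b (a x \<odot>\<^bsub>V\<^esub> x))"
        unfolding a lincomb_def using AU UV A(1)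
        by (intro functional_finsum[OF V cb]) (auto intro!: vs_smult[OF V])
      also have "\<dots> = (\<Sum>x\<in>A. a x * c b x)"
        using AU UV cb by (intro sum.cong) (auto simp: linear_functional_def)
      also have "\<dots> = 0"
      proof (intro sum.neutral ballI)
        fix x assume "x \<in> A"
        then have "x \<in> B" "x \<noteq> b" using AB b by auto
        then show "a x * c b x = 0" using d[of b x] b by auto
      qed
      finally show "c b v = 0" .
    qed
  next
    assume *: "\<forall>b\<in>B - A. c b v = 0"
    have "(\<Oplus>\<^bsub>V\<^esub>b\<in>B. c b v \<odot>\<^bsub>V\<^esub> b) \<in> U"
    proof (rule finsum_subspace(1)[OF V U B(1)])
      fix b assume b: "b \<in> B"
      show "c b v \<odot>\<^bsub>V\<^esub> b \<in> U"
      proof (cases "b \<in> A")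
        case True
        then show ?thesis using AU U by (auto simp: closed_subspace_def)
      next
        case False
        then have "c b v = 0" using * b by auto
        then show ?thesis using vs_smult_zero[OF V] frame_carrier[OF f b] U by (simp add: closed_subspace_def)
      qed
    qed
    then show "v \<in> U" using frame_expand[OF f v] by simp
  qed
  then show ?thesis using that f d AB by blast
qed

lemma linear_functional_subspace:
  "linear_functional V c \<Longrightarrow> U \<subseteq> carrier V \<Longrightarrow> linear_functional (V\<lparr>carrier := U\<rparr>) c"
  unfolding linear_functional_def by (simp add: subset_iff)

lemma adapted_frame:
  assumes V: "vectorspace complex_field V" and U: "closed_subspace V U"
    and f: "frame V B (\<lambda>b. b) c"
    and d: "\<And>b b'. b \<in> B \<Longrightarrow> b' \<in> B \<Longrightarrow> c b b' = (if b' = b then 1 else 0)"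
    and A: "A \<subseteq> B" and UA: "\<And>v. v \<in> carrier V \<Longrightarrow> v \<in> U \<longleftrightarrow> (\<forall>b\<in>B - A. c b v = 0)"
  shows "frame (V\<lparr>carrier := U\<rparr>) A (\<lambda>b. b) c"
proof -
  have UV: "U \<subseteq> carrier V" using U by (simp add: closed_subspace_def)
  have fA: "finite A" using A frame_finite[OF f] finite_subset by blast
  have AU: "a \<in> U" if "a \<in> A" for a
    using UA[OF frame_carrier[OF f, of a]] d that A by auto
  have "v = (\<Oplus>\<^bsub>V\<lparr>carrier := U\<rparr>\<^esub>b\<in>A. c b v \<odot>\<^bsub>V\<^esub> b)" if v: "v \<in> U" for v
  proof -
    have vV: "v \<in> carrier V" using v UV by auto
    have "v = (\<Oplus>\<^bsub>V\<^esub>b\<in>B. c b v \<odot>\<^bsub>V\<^esub> b)" using frame_expand[OF f vV] by simp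
    also have "\<dots> = (\<Oplus>\<^bsub>V\<^esub>b\<in>A. c b v \<odot>\<^bsub>V\<^esub> b)"
    proof (rule vs_finsum_neutral[OF V frame_finite[OF f] A])
      show "\<And>i. i \<in> B - A \<Longrightarrow> c i v \<odot>\<^bsub>V\<^esub> i = \<zero>\<^bsub>V\<^esub>"
        using UA[OF vV] v vs_smult_zero[OF V] frame_carrier[OF f] by auto
      show "\<And>i. i \<in> B \<Longrightarrow> c i v \<odot>\<^bsub>V\<^esub> i \<in> carrier V"
        using frame_carrier[OF f] by (auto intro!: vs_smult[OF V])
    qed
    also have "\<dots> = (\<Oplus>\<^bsub>V\<lparr>carrier := U\<rparr>\<^esub>b\<in>A. c b v \<odot>\<^bsub>V\<^esub> b)"
      using AU U by (intro finsum_subspace(2)[OF V U fA, symmetric]) (auto simp: closed_subspace_def)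
    finally show ?thesis .
  qed
  then show ?thesis
    unfolding frame_def using fA AU UV linear_functional_subspace[OF frame_functional[OF f]] A by auto
qed

lemma subspace_fin_dim_space:
  assumes "fin_dim_space V" "closed_subspace V U"
  shows "fin_dim_space (V\<lparr>carrier := U\<rparr>)"
proof -
  obtain B c A where f: "frame V B (\<lambda>b. b) c"
    "\<And>b b'. b \<in> B \<Longrightarrow> b' \<in> B \<Longrightarrow> c b b' = (if b' = b then 1 else 0)"
    "A \<subseteq> B" "\<And>v. v \<in> carrier V \<Longrightarrow> v \<in> U \<longleftrightarrow> (\<forall>b\<in>B - A. c b v = 0)"
    using adapted_basis[OF assms] by metis
  have "frame (V\<lparr>carrier := U\<rparr>) A (\<lambda>b. b) c"
    using adapted_frame[of V U B c A] f assms by auto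
  then show ?thesis
    using frame_imp_fin_dim[OF subspace_vectorspace] subspace_vectorspace assms by blast
qed

lemma functional_separates_subspace:
  assumes "fin_dim_space V" "closed_subspace V U" "a \<in> carrier V" "a \<notin> U"
  obtains d where "linear_functional V d" "\<And>u. u \<in> U \<Longrightarrow> d u = 0" "d a \<noteq> 0"
proof -
  obtain B c A where f: "frame V B (\<lambda>b. b) c"
    "\<And>b b'. b \<in> B \<Longrightarrow> b' \<in> B \<Longrightarrow> c b b' = (if b' = b then 1 else 0)"
    "A \<subseteq> B" "\<And>v. v \<in> carrier V \<Longrightarrow> v \<in> U \<longleftrightarrow> (\<forall>b\<in>B - A. c b v = 0)"
    using adapted_basis[OF assms(1,2)] by metis
  obtain b where b: "b \<in> B - A" "c b a \<noteq> 0" using f(4)[OF assms(3)] assms(4) by auto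
  have "U \<subseteq> carrier V" using assms by (simp add: closed_subspace_def)
  then have "c b u = 0" if "u \<in> U" for u using f(4)[of u] that b by auto
  moreover have "linear_functional V (c b)" using frame_functional[OF f(1)] b by auto
  ultimately show ?thesis using that b(2) by blast
qed

text \<open>In a basis adapted to the kernel \<open>U\<close> the basis vectors in \<open>U\<close>
  give the trace on \<open>U\<close>, and the images under \<open>f\<close> of the others form a
  basis of \<open>W\<close>.\<close>

lemma trace_exact:
  assumes fd: "fin_dim_space V" and f: "linear_map complex_field V W f" and surj: "f ` carrier V = carrier W"
    and T: "linear_map complex_field V V T" and S: "linear_map complex_field W W S"
    and comm: "\<And>v. v \<in> carrier V \<Longrightarrow> f (T v) = S (f v)"
    and U: "U = {v \<in> carrier V. f v = \<zero>\<^bsub>W\<^esub>}"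
  shows "fin_dim_space W" "closed_subspace V U"
    "endo_trace V T = endo_trace (V\<lparr>carrier := U\<rparr>) T + endo_trace W S"
proof -
  have V: "vectorspace complex_field V" using fd by simp
  note W = lm_cod[OF f]
  show cU: "closed_subspace V U"
    unfolding closed_subspace_def U
    using lm_add[OF f] lm_smult[OF f] lm_zero[OF f] vs_zero[OF V] vs_zero[OF W] vs_add[OF V] vs_smult[OF V]
      vs_l_zero[OF W] vs_smult_zero2[OF W] by auto
  obtain B c A where fr: "frame V B (\<lambda>b. b) c"
    and d: "\<And>b b'. b \<in> B \<Longrightarrow> b' \<in> B \<Longrightarrow> c b b' = (if b' = b then 1 else 0)"
    and A: "A \<subseteq> B" and UA: "\<And>v. v \<in> carrier V \<Longrightarrow> v \<in> U \<longleftrightarrow> (\<forall>b\<in>B - A. c b v = 0)"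
    using adapted_basis[OF fd cU] by metis
  have fB: "finite B" using frame_finite[OF fr] .
  define s where "s w = (SOME v. v \<in> carrier V \<and> f v = w)" for w
  have s: "s w \<in> carrier V" "f (s w) = w" if "w \<in> carrier W" for w
  proof -
    have "\<exists>v. v \<in> carrier V \<and> f v = w" using surj that by (metis imageE)
    then show "s w \<in> carrier V" "f (s w) = w"
      unfolding s_def by (metis (mono_tags, lifting) someI_ex)+
  qed
  have lf: "linear_functional V (c b)" if "b \<in> B" for b using frame_functional[OF fr that] .
  have cs: "c b v = c b v'" if "b \<in> B - A" "v \<in> carrier V" "v' \<in> carrier V" "f v = f v'" for b v v'
  proof -
    let ?u = "v \<oplus>\<^bsub>V\<^esub> (-1) \<odot>\<^bsub>V\<^esub> v'"
    have uV: "?u \<in> carrier V" using that V by (auto intro!: vs_add vs_smult)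
    have "f ?u = f v' \<oplus>\<^bsub>W\<^esub> (-1) \<odot>\<^bsub>W\<^esub> f v'"
      using that lm_add[OF f] lm_smult[OF f] vs_smult[OF V] by auto
    also have "\<dots> = \<zero>\<^bsub>W\<^esub>" using vs_neg[OF W] lm_closed[OF f] that by auto
    finally have "c b ?u = 0" using UA[OF uV] uV that(1) by (auto simp: U)
    moreover have "c b ?u = c b v - c b v'"
      using lf[of b] that vs_smult[OF V that(3)] by (auto simp: linear_functional_def)
    ultimately show ?thesis by simp
  qed
  have frW: "frame W (B - A) f (\<lambda>b w. c b (s w))"
    unfolding frame_def
  proof (intro conjI ballI)
    show "finite (B - A)" using fB by simp
    show "f \<in> B - A \<rightarrow> carrier W" using frame_carrier[OF fr] lm_closed[OF f] by auto
    fix b assume b: "b \<in> B - A"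
    have "c b (s (w \<oplus>\<^bsub>W\<^esub> w')) = c b (s w) + c b (s w')" if "w \<in> carrier W" "w' \<in> carrier W" for w w'
    proof -
      have "c b (s (w \<oplus>\<^bsub>W\<^esub> w')) = c b (s w \<oplus>\<^bsub>V\<^esub> s w')"
        using s that lm_add[OF f] by (intro cs[OF b]) (auto intro!: vs_add V W)
      then show ?thesis using lf[of b] b s that by (auto simp: linear_functional_def)
    qed
    moreover have "c b (s (z \<odot>\<^bsub>W\<^esub> w)) = z * c b (s w)" if "w \<in> carrier W" for w z
    proof -
      have "c b (s (z \<odot>\<^bsub>W\<^esub> w)) = c b (z \<odot>\<^bsub>V\<^esub> s w)"
        using s that lm_smult[OF f] by (intro cs[OF b]) (auto intro!: vs_smult V W)
      then show ?thesis using lf[of b] b s that by (auto simp: linear_functional_def)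
    qed
    ultimately show "linear_functional W (\<lambda>w. c b (s w))" by (simp add: linear_functional_def)
  next
    fix w assume w: "w \<in> carrier W"
    have "w = f (s w)" using s w by simp
    also have "\<dots> = (\<Oplus>\<^bsub>W\<^esub>i\<in>B. c i (s w) \<odot>\<^bsub>W\<^esub> f i)" using frame_linear_map[OF f fr s(1)[OF w]] .
    also have "\<dots> = (\<Oplus>\<^bsub>W\<^esub>i\<in>B - A. c i (s w) \<odot>\<^bsub>W\<^esub> f i)"
    proof (rule vs_finsum_neutral[OF W fB])
      have "a \<in> U" if "a \<in> A" for a
        using UA[OF frame_carrier[OF fr, of a]] d that A by auto
      then show "\<And>i. i \<in> B - (B - A) \<Longrightarrow> c i (s w) \<odot>\<^bsub>W\<^esub> f i = \<zero>\<^bsub>W\<^esub>"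
        using vs_smult_zero2[OF W] by (auto simp: U)
      show "\<And>i. i \<in> B \<Longrightarrow> c i (s w) \<odot>\<^bsub>W\<^esub> f i \<in> carrier W"
        using frame_carrier[OF fr] lm_closed[OF f] by (auto intro!: vs_smult[OF W])
    qed auto
    finally show "w = (\<Oplus>\<^bsub>W\<^esub>i\<in>B - A. c i (s w) \<odot>\<^bsub>W\<^esub> f i)" .
  qed
  then show "fin_dim_space W" using frame_imp_fin_dim[OF W frW] W by simp
  have frU: "frame (V\<lparr>carrier := U\<rparr>) A (\<lambda>b. b) c" by (rule adapted_frame[OF V cU fr d A UA])
  have TU: "linear_map complex_field (V\<lparr>carrier := U\<rparr>) (V\<lparr>carrier := U\<rparr>) T"
    using lm_closed[OF T] lm_add[OF T] lm_smult[OF T] comm lm_zero[OF S]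
    by (intro complex_linear_mapI subspace_vectorspace[OF V cU]) (auto simp: U)
  have "endo_trace W S = (\<Sum>b\<in>B - A. c b (s (S (f b))))" by (rule endo_trace_frame[OF S frW])
  also have "\<dots> = (\<Sum>b\<in>B - A. c b (T b))"
  proof (rule sum.cong[OF refl])
    fix b assume b: "b \<in> B - A"
    have bV: "b \<in> carrier V" using frame_carrier[OF fr] b by auto
    have "f b \<in> carrier W" using lm_closed[OF f bV] .
    then have "S (f b) \<in> carrier W" using lm_closed[OF S] by auto
    then show "c b (s (S (f b))) = c b (T b)"
      using s comm[OF bV] lm_closed[OF T bV] by (intro cs[OF b]) auto
  qed
  finally show "endo_trace V T = endo_trace (V\<lparr>carrier := U\<rparr>) T + endo_trace W S"
    using endo_trace_frame[OF T fr] endo_trace_frame[OF TU frU] sum.subset_diff[OF A fB, of "\<lambda>b. c b (T b)"]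
    by simp
qed

text \<open>Structures such as homology arrive without a proof that they are vector spaces. Being
  the image of a vector space under a map compatible with the operations is enough, and this is how
  the axioms are verified for them.\<close>

lemma vectorspace_image:
  assumes V: "vectorspace complex_field V"
    and surj: "f ` carrier V = carrier W" and zero: "f \<zero>\<^bsub>V\<^esub> = \<zero>\<^bsub>W\<^esub>"
    and add: "\<And>v w. v \<in> carrier V \<Longrightarrow> w \<in> carrier V \<Longrightarrow> f (v \<oplus>\<^bsub>V\<^esub> w) = f v \<oplus>\<^bsub>W\<^esub> f w"
    and smult: "\<And>z v. v \<in> carrier V \<Longrightarrow> f (z \<odot>\<^bsub>V\<^esub> v) = z \<odot>\<^bsub>W\<^esub> f v"
  shows "vectorspace complex_field W" "linear_map complex_field V W f"
proof -
  note facts = vs_add[OF V] vs_smult[OF V] vs_zero[OF V]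
  show W: "vectorspace complex_field W"
  proof (rule vs_criteria)
    show "field complex_field" using V by (simp add: vectorspace_def)
    show "\<zero>\<^bsub>W\<^esub> \<in> carrier W" using surj zero facts by (metis imageI)
    show "\<forall>v w. v \<in> carrier W \<and> w \<in> carrier W \<longrightarrow> v \<oplus>\<^bsub>W\<^esub> w \<in> carrier W"
      unfolding surj[symmetric] using add facts by (smt (verit) imageE imageI)
    show "\<forall>v\<in>carrier W. \<exists>neg_v\<in>carrier W. v \<oplus>\<^bsub>W\<^esub> neg_v = \<zero>\<^bsub>W\<^esub>"
      unfolding surj[symmetric]
    proof (clarify)
      fix v assume v: "v \<in> carrier V"
      have "f v \<oplus>\<^bsub>W\<^esub> f ((-1) \<odot>\<^bsub>V\<^esub> v) = \<zero>\<^bsub>W\<^esub>"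
        using add[OF v facts(2)[OF v, of "-1"]] vs_neg[OF V v] zero by simp
      then show "\<exists>neg_v\<in>f ` carrier V. f v \<oplus>\<^bsub>W\<^esub> neg_v = \<zero>\<^bsub>W\<^esub>" using facts(2)[OF v] by blast
    qed
    show "\<forall>c v. c \<in> carrier complex_field \<and> v \<in> carrier W \<longrightarrow> c \<odot>\<^bsub>W\<^esub> v \<in> carrier W"
      unfolding surj[symmetric] using smult facts by (smt (verit) imageE imageI)
    show "\<forall>v w. v \<in> carrier W \<and> w \<in> carrier W \<longrightarrow> v \<oplus>\<^bsub>W\<^esub> w = w \<oplus>\<^bsub>W\<^esub> v"
      unfolding surj[symmetric] using add vs_comm[OF V] by (smt (verit) imageE)
    show "\<forall>v w x. v \<in> carrier W \<and> w \<in> carrier W \<and> x \<in> carrier W \<longrightarrow>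
        v \<oplus>\<^bsub>W\<^esub> w \<oplus>\<^bsub>W\<^esub> x = v \<oplus>\<^bsub>W\<^esub> (w \<oplus>\<^bsub>W\<^esub> x)"
    proof clarify
      fix v w x assume "v \<in> carrier W" "w \<in> carrier W" "x \<in> carrier W"
      then obtain a b c where "v = f a" "w = f b" "x = f c" "a \<in> carrier V" "b \<in> carrier V" "c \<in> carrier V"
        unfolding surj[symmetric] by blast
      then show "v \<oplus>\<^bsub>W\<^esub> w \<oplus>\<^bsub>W\<^esub> x = v \<oplus>\<^bsub>W\<^esub> (w \<oplus>\<^bsub>W\<^esub> x)"
        using add facts(1) vs_assoc[OF V] by metis
    qed
    show "\<forall>v\<in>carrier W. v \<oplus>\<^bsub>W\<^esub> \<zero>\<^bsub>W\<^esub> = v"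
      unfolding surj[symmetric] zero[symmetric] using add vs_r_zero[OF V] facts(3) by (smt (verit) imageE)
    show "\<forall>a b v. a \<in> carrier complex_field \<and> b \<in> carrier complex_field \<and> v \<in> carrier W \<longrightarrow>
        a \<otimes>\<^bsub>complex_field\<^esub> b \<odot>\<^bsub>W\<^esub> v = a \<odot>\<^bsub>W\<^esub> (b \<odot>\<^bsub>W\<^esub> v)"
      unfolding surj[symmetric] using vs_smult_assoc[OF V] smult facts(2) by (auto simp flip: smult)
    show "\<forall>v\<in>carrier W. \<one>\<^bsub>complex_field\<^esub> \<odot>\<^bsub>W\<^esub> v = v"
      unfolding surj[symmetric] using vs_smult_one[OF V] by (auto simp flip: smult)
    show "\<forall>a b v. a \<in> carrier complex_field \<and> b \<in> carrier complex_field \<and> v \<in> carrier W \<longrightarrow>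
        (a \<oplus>\<^bsub>complex_field\<^esub> b) \<odot>\<^bsub>W\<^esub> v = a \<odot>\<^bsub>W\<^esub> v \<oplus>\<^bsub>W\<^esub> b \<odot>\<^bsub>W\<^esub> v"
      unfolding surj[symmetric] using vs_smult_l_distr[OF V] facts by (auto simp flip: smult add)
    show "\<forall>a v w. a \<in> carrier complex_field \<and> v \<in> carrier W \<and> w \<in> carrier W \<longrightarrow>
        a \<odot>\<^bsub>W\<^esub> (v \<oplus>\<^bsub>W\<^esub> w) = a \<odot>\<^bsub>W\<^esub> v \<oplus>\<^bsub>W\<^esub> a \<odot>\<^bsub>W\<^esub> w"
      unfolding surj[symmetric] using vs_smult_r_distr[OF V] facts by (auto simp flip: smult add)
  qed
  show "linear_map complex_field V W f"
    using surj add smult by (intro complex_linear_mapI[OF V W]) auto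
qed

text \<open>The functions on \<open>I\<close>, used for cellular chains; they take the value
  \<open>undefined\<close> outside \<open>I\<close>.\<close>

definition fun_space :: "'i set \<Rightarrow> (complex, 'i \<Rightarrow> complex) module" where
  "fun_space I = \<lparr>carrier = extensional I, monoid.mult = undefined, monoid.one = undefined,
     ring.zero = (\<lambda>i\<in>I. 0), ring.add = (\<lambda>v w. \<lambda>i\<in>I. v i + w i), module.smult = (\<lambda>z v. \<lambda>i\<in>I. z * v i)\<rparr>"

lemma fun_space_simps [simp]:
  "carrier (fun_space I) = extensional I" "\<zero>\<^bsub>fun_space I\<^esub> = (\<lambda>i\<in>I. 0)"
  "v \<oplus>\<^bsub>fun_space I\<^esub> w = (\<lambda>i\<in>I. v i + w i)" "z \<odot>\<^bsub>fun_space I\<^esub> v = (\<lambda>i\<in>I. z * v i)"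
  by (simp_all add: fun_space_def)

lemma complex_field_field: "field complex_field"
  by (rule class_field.field_axioms)

lemma fun_space_vectorspace: "vectorspace complex_field (fun_space I)"
proof (rule vs_criteria[OF complex_field_field])
  show "\<forall>v\<in>carrier (fun_space I). \<exists>w\<in>carrier (fun_space I). v \<oplus>\<^bsub>fun_space I\<^esub> w = \<zero>\<^bsub>fun_space I\<^esub>"
    by (auto intro!: bexI[of _ "\<lambda>i\<in>I. - _ i"])
qed (auto simp: algebra_simps extensional_def restrict_def fun_eq_iff)

lemma fun_space_frame:
  assumes "finite I"
  shows "frame (fun_space I) I (\<lambda>i. \<lambda>j\<in>I. if j = i then 1 else 0) (\<lambda>i v. v i)"
proof -
  note V = fun_space_vectorspace[of I]
  have "(\<Oplus>\<^bsub>fun_space I\<^esub>i\<in>I. v i \<odot>\<^bsub>fun_space I\<^esub> (\<lambda>j\<in>I. if j = i then 1 else 0)) = v"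
    if v: "v \<in> extensional I" for v
  proof (rule extensionalityI[of _ I])
    show "(\<Oplus>\<^bsub>fun_space I\<^esub>i\<in>I. v i \<odot>\<^bsub>fun_space I\<^esub> (\<lambda>j\<in>I. if j = i then 1 else 0)) \<in> extensional I"
      using vs_finsum[OF V, of "\<lambda>i. v i \<odot>\<^bsub>fun_space I\<^esub> (\<lambda>j\<in>I. if j = i then 1 else 0)" I] by simp
    fix k assume k: "k \<in> I"
    have l: "linear_functional (fun_space I) (\<lambda>v. v k)"
      using k by (simp add: linear_functional_def)
    have "(\<Oplus>\<^bsub>fun_space I\<^esub>i\<in>I. v i \<odot>\<^bsub>fun_space I\<^esub> (\<lambda>j\<in>I. if j = i then 1 else 0)) k =
        (\<Sum>i\<in>I. (v i \<odot>\<^bsub>fun_space I\<^esub> (\<lambda>j\<in>I. if j = i then 1 else 0)) k)"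
      by (rule functional_finsum[OF V l assms]) auto
    also have "\<dots> = (\<Sum>i\<in>I. if i = k then v i else 0)"
      using k by (intro sum.cong) auto
    also have "\<dots> = v k" using k assms by simp
    finally show "(\<Oplus>\<^bsub>fun_space I\<^esub>i\<in>I. v i \<odot>\<^bsub>fun_space I\<^esub> (\<lambda>j\<in>I. if j = i then 1 else 0)) k = v k" .
  qed (use v in auto)
  then show ?thesis unfolding frame_def using assms by (auto simp: linear_functional_def)
qed

lemma fun_space_fin_dim_space: "finite I \<Longrightarrow> fin_dim_space (fun_space I)"
  using frame_imp_fin_dim[OF fun_space_vectorspace fun_space_frame] fun_space_vectorspace by blast

text \<open>In the basis of indicator functions the diagonal entry at \<open>i\<close> is 1 exactly
  when \<open>p\<close> fixes \<open>i\<close>.\<close>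

lemma fun_space_trace:
  assumes I: "finite I" and p: "p \<in> I \<rightarrow> I"
  shows "linear_map complex_field (fun_space I) (fun_space I) (\<lambda>v. \<lambda>i\<in>I. v (p i))"
    "endo_trace (fun_space I) (\<lambda>v. \<lambda>i\<in>I. v (p i)) = of_nat (card {i \<in> I. p i = i})"
proof -
  show l: "linear_map complex_field (fun_space I) (fun_space I) (\<lambda>v. \<lambda>i\<in>I. v (p i))"
    using p by (intro complex_linear_mapI fun_space_vectorspace)
      (auto simp: restrict_def fun_eq_iff Pi_iff extensional_def)
  have "endo_trace (fun_space I) (\<lambda>v. \<lambda>i\<in>I. v (p i)) = (\<Sum>i\<in>I. if p i = i then 1 else 0)"
    using p by (subst endo_trace_frame[OF l fun_space_frame[OF I]]) (auto intro!: sum.cong)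
  then show "endo_trace (fun_space I) (\<lambda>v. \<lambda>i\<in>I. v (p i)) = of_nat (card {i \<in> I. p i = i})"
    using I by (simp add: sum.If_cases Int_def)
qed

lemma frame_eqI:
  assumes V: "vectorspace complex_field V" and f: "frame V B e c"
    and "v \<in> carrier V" "w \<in> carrier V" "\<And>b. b \<in> B \<Longrightarrow> c b v = c b w"
  shows "v = w"
proof -
  have "v = (\<Oplus>\<^bsub>V\<^esub>b\<in>B. c b v \<odot>\<^bsub>V\<^esub> e b)" using frame_expand[OF f assms(3)] by simp
  also have "\<dots> = (\<Oplus>\<^bsub>V\<^esub>b\<in>B. c b w \<odot>\<^bsub>V\<^esub> e b)"
    using assms(5) frame_carrier[OF f]
    by (intro abelian_monoid.finsum_cong'[OF vs_abelian_monoid[OF V]]) (auto intro!: vs_smult[OF V])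
  finally show ?thesis using frame_expand[OF f assms(4)] by simp
qed

lemma dual_frame_coordinates:
  assumes V: "vectorspace complex_field V" and f: "frame V B (\<lambda>b. b) c"
    and d: "\<And>b b'. b \<in> B \<Longrightarrow> b' \<in> B \<Longrightarrow> c b b' = (if b' = b then 1 else 0)"
    and A: "A \<subseteq> B"
  shows "(\<Oplus>\<^bsub>V\<^esub>b\<in>A. x b \<odot>\<^bsub>V\<^esub> b) \<in> carrier V"
    "\<And>b. b \<in> B \<Longrightarrow> c b (\<Oplus>\<^bsub>V\<^esub>b\<in>A. x b \<odot>\<^bsub>V\<^esub> b) = (if b \<in> A then x b else 0)"
proof -
  have cl: "\<And>b. b \<in> A \<Longrightarrow> b \<in> carrier V" using frame_carrier[OF f] A by auto
  have fA: "finite A" using frame_finite[OF f] A finite_subset by blast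
  show "(\<Oplus>\<^bsub>V\<^esub>b\<in>A. x b \<odot>\<^bsub>V\<^esub> b) \<in> carrier V"
    using cl by (intro vs_finsum[OF V]) (auto intro!: vs_smult[OF V])
  fix b assume b: "b \<in> B"
  note l = frame_functional[OF f b]
  have "c b (\<Oplus>\<^bsub>V\<^esub>b\<in>A. x b \<odot>\<^bsub>V\<^esub> b) = (\<Sum>a\<in>A. c b (x a \<odot>\<^bsub>V\<^esub> a))"
    using cl by (intro functional_finsum[OF V l fA]) (auto intro!: vs_smult[OF V])
  also have "\<dots> = (\<Sum>a\<in>A. if a = b then x b else 0)"
    using l cl d[OF b] A by (intro sum.cong) (auto simp: linear_functional_def)
  also have "\<dots> = (if b \<in> A then x b else 0)" using fA by simp
  finally show "c b (\<Oplus>\<^bsub>V\<^esub>b\<in>A. x b \<odot>\<^bsub>V\<^esub> b) = (if b \<in> A then x b else 0)" .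
qed

text \<open>A complement \<open>C\<close> of \<open>U\<close> with the projection \<open>Q\<close>
  along \<open>U\<close>. It stands for the quotient by \<open>U\<close>: unlike the set of cosets
  it has vectors of the same type as \<open>V\<close>, as induction on the dimension
  requires.\<close>

lemma invariant_complement:
  assumes fd: "fin_dim_space V" and U: "closed_subspace V U"
  obtains C Q where "closed_subspace V C" "linear_map complex_field V (V\<lparr>carrier := C\<rparr>) Q"
    "\<And>u. u \<in> C \<Longrightarrow> Q u = u" "\<And>v. v \<in> carrier V \<Longrightarrow> Q v = \<zero>\<^bsub>V\<^esub> \<longleftrightarrow> v \<in> U"
proof -
  have V: "vectorspace complex_field V" using fd by simp
  obtain B c A where fr: "frame V B (\<lambda>b. b) c"
    and d: "\<And>b b'. b \<in> B \<Longrightarrow> b' \<in> B \<Longrightarrow> c b b' = (if b' = b then 1 else 0)"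
    and A: "A \<subseteq> B" and UA: "\<And>v. v \<in> carrier V \<Longrightarrow> v \<in> U \<longleftrightarrow> (\<forall>b\<in>B - A. c b v = 0)"
    using adapted_basis[OF fd U] by metis
  define C where "C = {v \<in> carrier V. \<forall>a\<in>A. c a v = 0}"
  define Q where "Q v = (\<Oplus>\<^bsub>V\<^esub>b\<in>B - A. c b v \<odot>\<^bsub>V\<^esub> b)" for v
  have Qc: "Q v \<in> carrier V" for v
    unfolding Q_def by (rule dual_frame_coordinates(1)[OF V fr d]) auto
  have Qb: "c b (Q v) = (if b \<in> A then 0 else c b v)" if "b \<in> B" for b v
    unfolding Q_def using dual_frame_coordinates(2)[OF V fr d, of "B - A" b] that by auto
  have lc: "c b (v \<oplus>\<^bsub>V\<^esub> w) = c b v + c b w" "c b (z \<odot>\<^bsub>V\<^esub> v) = z * c b v" "c b \<zero>\<^bsub>V\<^esub> = 0"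
    if "b \<in> B" "v \<in> carrier V" "w \<in> carrier V" for b v w z
    using frame_functional[OF fr that(1)] that functional_zero[OF V frame_functional[OF fr that(1)]]
    by (auto simp: linear_functional_def)
  have C: "closed_subspace V C"
    unfolding closed_subspace_def C_def using lc A vs_zero[OF V] vs_add[OF V] vs_smult[OF V]
    by (auto simp: subset_iff)
  have eq: "v = w" if "v \<in> carrier V" "w \<in> carrier V" "\<And>b. b \<in> B \<Longrightarrow> c b v = c b w" for v w
    using frame_eqI[OF V fr] that by blast
  have "linear_map complex_field V (V\<lparr>carrier := C\<rparr>) Q"
  proof (rule complex_linear_mapI[OF V subspace_vectorspace[OF V C]])
    show "Q v \<in> carrier (V\<lparr>carrier := C\<rparr>)" for v using Qc Qb A by (auto simp: C_def)
    show "Q (v \<oplus>\<^bsub>V\<^esub> w) = Q v \<oplus>\<^bsub>V\<lparr>carrier := C\<rparr>\<^esub> Q w" if "v \<in> carrier V" "w \<in> carrier V" for v w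
      using that Qc by (intro eq) (auto simp: Qb lc vs_add[OF V])
    show "Q (z \<odot>\<^bsub>V\<^esub> v) = z \<odot>\<^bsub>V\<lparr>carrier := C\<rparr>\<^esub> Q v" if "v \<in> carrier V" for v z
      using that Qc by (intro eq) (auto simp: Qb lc vs_smult[OF V])
  qed
  moreover have "Q u = u" if "u \<in> C" for u
    using that Qc by (intro eq) (auto simp: Qb C_def)
  moreover have "Q v = \<zero>\<^bsub>V\<^esub> \<longleftrightarrow> v \<in> U" if v: "v \<in> carrier V" for v
  proof
    assume "Q v = \<zero>\<^bsub>V\<^esub>"
    then show "v \<in> U" using Qb[of _ v] lc(3) v UA[OF v] by (metis DiffE)
  next
    assume "v \<in> U"
    then show "Q v = \<zero>\<^bsub>V\<^esub>" using UA[OF v] Qc vs_zero[OF V] v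
      by (intro eq) (auto simp: Qb lc(3))
  qed
  ultimately show ?thesis using that C by blast
qed

section \<open>Decomposition of characters into irreducible characters\<close>

lemma representationD:
  assumes "representation K V \<phi>"
  shows rep_group: "group K" and rep_fin_dim_space: "fin_dim_space V" and rep_vs: "vectorspace complex_field V"
    and rep_linear: "\<And>k. k \<in> carrier K \<Longrightarrow> linear_map complex_field V V (\<phi> k)"
    and rep_closed: "\<And>k v. k \<in> carrier K \<Longrightarrow> v \<in> carrier V \<Longrightarrow> \<phi> k v \<in> carrier V"
    and rep_one: "\<And>v. v \<in> carrier V \<Longrightarrow> \<phi> \<one>\<^bsub>K\<^esub> v = v"
    and rep_mult: "\<And>k l v. k \<in> carrier K \<Longrightarrow> l \<in> carrier K \<Longrightarrow> v \<in> carrier V \<Longrightarrow>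
           \<phi> (k \<otimes>\<^bsub>K\<^esub> l) v = \<phi> k (\<phi> l v)"
proof -
  show "group K" "fin_dim_space V" "vectorspace complex_field V"
    using assms by (simp_all add: representation_def)
  show lin: "linear_map complex_field V V (\<phi> k)" if "k \<in> carrier K" for k
    using assms that by (simp add: representation_def)
  show "\<phi> k v \<in> carrier V" if "k \<in> carrier K" "v \<in> carrier V" for k v
    using lm_closed[OF lin] that .
  show "\<phi> \<one>\<^bsub>K\<^esub> v = v" if "v \<in> carrier V" for v
    using assms that by (simp add: representation_def)
  show "\<phi> (k \<otimes>\<^bsub>K\<^esub> l) v = \<phi> k (\<phi> l v)"
    if "k \<in> carrier K" "l \<in> carrier K" "v \<in> carrier V" for k l v
    using assms that by (simp add: representation_def)
qed

lemma rep_inv_cancel: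
  assumes "representation K V \<phi>" "k \<in> carrier K" "v \<in> carrier V"
  shows "\<phi> (inv\<^bsub>K\<^esub> k) (\<phi> k v) = v" "\<phi> k (\<phi> (inv\<^bsub>K\<^esub> k) v) = v"
proof -
  interpret group K using rep_group[OF assms(1)] .
  show "\<phi> (inv\<^bsub>K\<^esub> k) (\<phi> k v) = v" "\<phi> k (\<phi> (inv\<^bsub>K\<^esub> k) v) = v"
    using rep_mult[OF assms(1), of "inv\<^bsub>K\<^esub> k" k v] rep_mult[OF assms(1), of k "inv\<^bsub>K\<^esub> k" v]
      rep_one[OF assms(1)] assms by simp_all
qed

lemma rep_subspace:
  assumes rep: "representation K V \<phi>" and U: "closed_subspace V U"
    and inv: "\<And>k u. k \<in> carrier K \<Longrightarrow> u \<in> U \<Longrightarrow> \<phi> k u \<in> U"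
  shows "representation K (V\<lparr>carrier := U\<rparr>) \<phi>"
  unfolding representation_def
proof (intro conjI ballI)
  have UV: "U \<subseteq> carrier V" using U by (simp add: closed_subspace_def)
  show "group K" by (rule rep_group[OF rep])
  show "vectorspace complex_field (V\<lparr>carrier := U\<rparr>)" "vectorspace.fin_dim complex_field (V\<lparr>carrier := U\<rparr>)"
    using subspace_fin_dim_space[OF rep_fin_dim_space[OF rep] U] by auto
  show "linear_map complex_field (V\<lparr>carrier := U\<rparr>) (V\<lparr>carrier := U\<rparr>) (\<phi> k)" if "k \<in> carrier K" for k
    using lm_add[OF rep_linear[OF rep that]] lm_smult[OF rep_linear[OF rep that]] inv[OF that] UV
    by (intro complex_linear_mapI subspace_vectorspace[OF rep_vs[OF rep] U]) (auto simp: subset_iff)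
  show "\<phi> \<one>\<^bsub>K\<^esub> v = v" if "v \<in> carrier (V\<lparr>carrier := U\<rparr>)" for v
    using rep_one[OF rep] that UV by auto
  show "\<phi> (k \<otimes>\<^bsub>K\<^esub> l) v = \<phi> k (\<phi> l v)"
    if "k \<in> carrier K" "l \<in> carrier K" "v \<in> carrier (V\<lparr>carrier := U\<rparr>)" for k l v
    using rep_mult[OF rep that(1,2)] that UV by auto
qed

lemma trace_zero_space:
  assumes V: "vectorspace complex_field V" and T: "T \<zero>\<^bsub>V\<^esub> = \<zero>\<^bsub>V\<^esub>"
  shows "endo_trace (V\<lparr>carrier := {\<zero>\<^bsub>V\<^esub>}\<rparr>) T = 0"
proof -
  have c: "closed_subspace V {\<zero>\<^bsub>V\<^esub>}"
    unfolding closed_subspace_def using vs_zero[OF V] vs_smult_zero2[OF V] vs_l_zero[OF V] by auto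
  note Z = subspace_vectorspace[OF V c]
  have f: "frame (V\<lparr>carrier := {\<zero>\<^bsub>V\<^esub>}\<rparr>) {} (\<lambda>i::nat. \<zero>\<^bsub>V\<^esub>) (\<lambda>i v. 0)"
    unfolding frame_def by (simp add: abelian_monoid.finsum_empty[OF vs_abelian_monoid[OF Z]])
  have "linear_map complex_field (V\<lparr>carrier := {\<zero>\<^bsub>V\<^esub>}\<rparr>) (V\<lparr>carrier := {\<zero>\<^bsub>V\<^esub>}\<rparr>) T"
    using T vs_l_zero[OF V vs_zero[OF V]] vs_smult_zero2[OF V] by (intro complex_linear_mapI Z) auto
  from endo_trace_frame[OF this f] show ?thesis by simp
qed

text \<open>Additivity of the trace with zero kernel.\<close>

lemma trace_iso:
  assumes fd: "fin_dim_space V" and f: "linear_map complex_field V W f" and surj: "f ` carrier V = carrier W"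
    and inj: "\<And>v. v \<in> carrier V \<Longrightarrow> f v = \<zero>\<^bsub>W\<^esub> \<Longrightarrow> v = \<zero>\<^bsub>V\<^esub>"
    and T: "linear_map complex_field V V T" and S: "linear_map complex_field W W S"
    and comm: "\<And>v. v \<in> carrier V \<Longrightarrow> f (T v) = S (f v)"
  shows "endo_trace V T = endo_trace W S"
proof -
  have V: "vectorspace complex_field V" using fd by simp
  have "{\<zero>\<^bsub>V\<^esub>} = {v \<in> carrier V. f v = \<zero>\<^bsub>W\<^esub>}"
  proof (intro equalityI subsetI)
    fix x assume "x \<in> {v \<in> carrier V. f v = \<zero>\<^bsub>W\<^esub>}"
    then show "x \<in> {\<zero>\<^bsub>V\<^esub>}" using inj[of x] by blast
  qed (use lm_zero[OF f] vs_zero[OF V] in simp)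
  from trace_exact(3)[OF fd f surj T S comm this] show ?thesis
    using trace_zero_space[OF V] lm_zero[OF T] by simp
qed

definition subrep :: "('k, 'l) monoid_scheme \<Rightarrow> (complex, 'v) module \<Rightarrow> ('k \<Rightarrow> 'v \<Rightarrow> 'v) \<Rightarrow> 'v set \<Rightarrow> bool" where
  "subrep K V \<phi> U \<longleftrightarrow> closed_subspace V U \<and> (\<forall>k\<in>carrier K. \<forall>u\<in>U. \<phi> k u \<in> U)"

lemma irreducible_iff:
  "irreducible_rep K V \<phi> \<longleftrightarrow> representation K V \<phi> \<and> carrier V \<noteq> {\<zero>\<^bsub>V\<^esub>} \<and>
     (\<forall>U. subrep K V \<phi> U \<longrightarrow> U = {\<zero>\<^bsub>V\<^esub>} \<or> U = carrier V)"
proof -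
  have "VectorSpace.subspace complex_field W V \<and> (\<forall>k\<in>carrier K. \<phi> k ` W \<subseteq> W) \<longleftrightarrow> subrep K V \<phi> W"
    if "representation K V \<phi>" for W
    using subspace_iff_closed[OF rep_vs[OF that]] by (auto simp: subrep_def)
  then show ?thesis unfolding irreducible_rep_def by blast
qed

text \<open>Irreducible characters are defined with representation spaces of type \<open>nat
  \<Rightarrow> complex\<close>. Coordinates in a basis enumerated by \<open>{..<n}\<close> carry a
  representation on any space to one of that type.\<close>

lemma rep_transport:
  fixes V :: "(complex, 'v) module"
  assumes rep: "representation K V \<phi>"
  obtains W :: "(complex, nat \<Rightarrow> complex) module" and \<psi> where "representation K W \<psi>"
    "rep_character K W \<psi> = rep_character K V \<phi>"
    "irreducible_rep K V \<phi> \<Longrightarrow> irreducible_rep K W \<psi>"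
proof -
  note V = rep_vs[OF rep] and fd = rep_fin_dim_space[OF rep]
  obtain B c where fr: "frame V B (\<lambda>b. b) c"
    and d: "\<And>b b'. b \<in> B \<Longrightarrow> b' \<in> B \<Longrightarrow> c b b' = (if b' = b then 1 else 0)"
    using dual_frame_exists[OF fd] by metis
  obtain h where h: "bij_betw h {..<card B} B"
    using ex_bij_betw_nat_finite[OF frame_finite[OF fr]] by (auto simp: atLeast0LessThan)
  define n where "n = card B"
  define W where "W = fun_space {..<n}"
  have hB: "h i \<in> B" if "i < n" for i using h that by (auto simp: bij_betw_def n_def)
  define f where "f v = (\<lambda>i\<in>{..<n}. c (h i) v)" for v
  define g where "g w = (\<Oplus>\<^bsub>V\<^esub>b\<in>B. w (inv_into {..<n} h b) \<odot>\<^bsub>V\<^esub> b)" for w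
  have Wv: "vectorspace complex_field W" unfolding W_def by (rule fun_space_vectorspace)
  have f: "linear_map complex_field V W f"
    using frame_functional[OF fr hB]
    by (intro complex_linear_mapI V Wv) (auto simp: f_def W_def linear_functional_def)
  have gV: "g w \<in> carrier V" for w unfolding g_def by (rule dual_frame_coordinates(1)[OF V fr d]) auto
  have fg: "f (g w) = w" if "w \<in> carrier W" for w
  proof (rule extensionalityI[of _ "{..<n}"])
    fix i assume i: "i \<in> {..<n}"
    have "c (h i) (g w) = w (inv_into {..<n} h (h i))"
      unfolding g_def using dual_frame_coordinates(2)[OF V fr d, of B] hB i by auto
    also have "\<dots> = w i" using h i by (simp add: bij_betw_def n_def)
    finally show "f (g w) i = w i" using i by (simp add: f_def)
  qed (use that in \<open>auto simp: f_def W_def\<close>)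
  have gf: "g (f v) = v" if v: "v \<in> carrier V" for v
  proof (rule frame_eqI[OF V fr gV v])
    fix b assume b: "b \<in> B"
    then have i: "inv_into {..<n} h b < n" "h (inv_into {..<n} h b) = b"
      using h by (auto simp: bij_betw_def n_def f_inv_into_f dest: inv_into_into[of b h])
        (metis inv_into_into lessThan_iff)
    have "c b (g (f v)) = f v (inv_into {..<n} h b)"
      unfolding g_def using dual_frame_coordinates(2)[OF V fr d, of B] b by auto
    then show "c b (g (f v)) = c b v" using i by (simp add: f_def)
  qed
  have fV: "f v \<in> carrier W" if "v \<in> carrier V" for v using lm_closed[OF f that] .
  have surj: "f ` carrier V = carrier W" using fg gV fV by (metis image_eqI image_subsetI subsetI subset_antisym)
  have inj: "v = \<zero>\<^bsub>V\<^esub>" if "v \<in> carrier V" "f v = \<zero>\<^bsub>W\<^esub>" for v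
    using gf[OF that(1)] gf[OF vs_zero[OF V]] lm_zero[OF f] that(2) by simp
  have g: "linear_map complex_field W V g"
  proof (intro complex_linear_mapI V Wv gV)
    fix v w assume "v \<in> carrier W" "w \<in> carrier W"
    then show "g (v \<oplus>\<^bsub>W\<^esub> w) = g v \<oplus>\<^bsub>V\<^esub> g w"
      using gf[OF vs_add[OF V gV gV, of v w]] lm_add[OF f gV gV, of v w] fg by simp
  next
    fix z v assume "v \<in> carrier W"
    then show "g (z \<odot>\<^bsub>W\<^esub> v) = z \<odot>\<^bsub>V\<^esub> g v"
      using gf[OF vs_smult[OF V gV, of z v]] lm_smult[OF f gV, of z v] fg by simp
  qed
  define \<psi> where "\<psi> k w = f (\<phi> k (g w))" for k w
  have \<psi>l: "linear_map complex_field W W (\<psi> k)" if k: "k \<in> carrier K" for k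
  proof -
    note L = rep_linear[OF rep k]
    show ?thesis
      unfolding \<psi>_def
      using lm_add[OF f] lm_add[OF g] lm_add[OF L] lm_smult[OF f] lm_smult[OF g] lm_smult[OF L] fV gV
        lm_closed[OF L]
      by (intro complex_linear_mapI Wv) auto
  qed
  have repW: "representation K W \<psi>"
    unfolding representation_def
  proof (intro conjI ballI)
    show "group K" by (rule rep_group[OF rep])
    show "vectorspace complex_field W" by fact
    show "vectorspace.fin_dim complex_field W"
      using fun_space_fin_dim_space[of "{..<n}"] by (simp add: W_def)
    show "linear_map complex_field W W (\<psi> k)" if "k \<in> carrier K" for k using \<psi>l[OF that] .
    show "\<psi> \<one>\<^bsub>K\<^esub> w = w" if "w \<in> carrier W" for w
      using rep_one[OF rep gV] fg[OF that] by (simp add: \<psi>_def)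
    show "\<psi> (k \<otimes>\<^bsub>K\<^esub> l) w = \<psi> k (\<psi> l w)" if "k \<in> carrier K" "l \<in> carrier K" "w \<in> carrier W" for k l w
      using rep_mult[OF rep that(1,2) gV] gf[OF rep_closed[OF rep that(2) gV]] by (simp add: \<psi>_def)
  qed
  have comm: "f (\<phi> k v) = \<psi> k (f v)" if "v \<in> carrier V" for k v using gf[OF that] by (simp add: \<psi>_def)
  have "rep_character K W \<psi> = rep_character K V \<phi>"
    unfolding rep_character_def
  proof (intro restrict_ext)
    fix k assume k: "k \<in> carrier K"
    have "endo_trace V (\<phi> k) = endo_trace W (\<psi> k)"
      by (rule trace_iso[OF fd f surj _ rep_linear[OF rep k] \<psi>l[OF k]]) (use inj comm in blast)+
    then show "endo_trace W (\<psi> k) = endo_trace V (\<phi> k)" by simp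
  qed
  moreover have "irreducible_rep K W \<psi>" if irr: "irreducible_rep K V \<phi>"
    unfolding irreducible_iff
  proof (intro conjI allI impI repW)
    show "carrier W \<noteq> {\<zero>\<^bsub>W\<^esub>}"
    proof -
      obtain v where v: "v \<in> carrier V" "v \<noteq> \<zero>\<^bsub>V\<^esub>"
        using irr vs_zero[OF V] unfolding irreducible_iff by blast
      then have "f v \<in> carrier W" "f v \<noteq> \<zero>\<^bsub>W\<^esub>" using fV inj by blast+
      then show ?thesis by blast
    qed
    fix U assume U: "subrep K W \<psi> U"
    define U' where "U' = {v \<in> carrier V. f v \<in> U}"
    have "subrep K V \<phi> U'"
      using U lm_add[OF f] lm_smult[OF f] lm_zero[OF f] comm rep_closed[OF rep] vs_add[OF V] vs_smult[OF V]
        vs_zero[OF V]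
      unfolding subrep_def closed_subspace_def U'_def by auto
    then have "U' = {\<zero>\<^bsub>V\<^esub>} \<or> U' = carrier V" using irr by (simp add: irreducible_iff)
    moreover have "U = f ` U'"
    proof -
      have "U \<subseteq> carrier W" using U by (simp add: subrep_def closed_subspace_def)
      then show ?thesis using surj unfolding U'_def by force
    qed
    ultimately show "U = {\<zero>\<^bsub>W\<^esub>} \<or> U = carrier W" using surj lm_zero[OF f] by auto
  qed
  ultimately show ?thesis using that repW by blast
qed

lemma dim_pos:
  assumes "fin_dim_space V" "carrier V \<noteq> {\<zero>\<^bsub>V\<^esub>}"
  shows "vectorspace.dim complex_field V > 0"
proof -
  have V: "vectorspace complex_field V" using assms by simp
  obtain B c where fr: "frame V B (\<lambda>b. b) c"
    and d: "\<And>b b'. b \<in> B \<Longrightarrow> b' \<in> B \<Longrightarrow> c b b' = (if b' = b then 1 else 0)"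
    using dual_frame_exists[OF assms(1)] by metis
  have "B \<noteq> {}"
  proof
    assume "B = {}"
    then have "v = w" if "v \<in> carrier V" "w \<in> carrier V" for v w using frame_eqI[OF V fr that] by simp
    then show False using assms(2) vs_zero[OF V] by blast
  qed
  then show ?thesis using dim_eq_frame[OF V fr] d frame_finite[OF fr] by (simp add: card_gt_0_iff)
qed

text \<open>Induction on the dimension: an invariant subspace \<open>U\<close> and the action
  induced on a complement, projected along \<open>U\<close>, have smaller dimension, and the
  character is the sum of theirs. The projected operators compose, because what the projection drops
  stays in \<open>U\<close>.\<close>

lemma character_decomposition:
  fixes V :: "(complex, nat \<Rightarrow> complex) module"
  assumes "representation K V \<phi>"
  shows "\<exists>S m. finite S \<and> S \<subseteq> irreducible_characters K \<and>
     (\<forall>k\<in>carrier K. rep_character K V \<phi> k = (\<Sum>\<eta>\<in>S. of_nat (m \<eta>) * \<eta> k))"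
  using assms
proof (induction "vectorspace.dim complex_field V" arbitrary: V \<phi> rule: less_induct)
  case less
  note rep = less.prems
  note V = rep_vs[OF rep] and fd = rep_fin_dim_space[OF rep]
  show ?case
  proof (cases "irreducible_rep K V \<phi> \<or> carrier V = {\<zero>\<^bsub>V\<^esub>}")
    case True
    then show ?thesis
    proof
      assume "irreducible_rep K V \<phi>"
      then have "rep_character K V \<phi> \<in> irreducible_characters K"
        unfolding irreducible_characters_def by auto
      then show ?thesis
        by (intro exI[of _ "{rep_character K V \<phi>}"] exI[of _ "\<lambda>_. 1"]) auto
    next
      assume Z: "carrier V = {\<zero>\<^bsub>V\<^esub>}"
      have "V = V\<lparr>carrier := {\<zero>\<^bsub>V\<^esub>}\<rparr>" using Z by simp
      then have "rep_character K V \<phi> k = 0" if "k \<in> carrier K" for k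
        using trace_zero_space[OF V, of "\<phi> k"] lm_zero[OF rep_linear[OF rep that]] that
        by (simp add: rep_character_def)
      then show ?thesis by (intro exI[of _ "{}"]) auto
    qed
  next
    case False
    then obtain U where U: "subrep K V \<phi> U" "U \<noteq> {\<zero>\<^bsub>V\<^esub>}" "U \<noteq> carrier V"
      using rep by (auto simp: irreducible_iff)
    have cU: "closed_subspace V U" using U by (simp add: subrep_def)
    have UV: "U \<subseteq> carrier V" using cU by (simp add: closed_subspace_def)
    obtain C Q where C: "closed_subspace V C" and Q: "linear_map complex_field V (V\<lparr>carrier := C\<rparr>) Q"
      and QC: "\<And>u. u \<in> C \<Longrightarrow> Q u = u" and QU: "\<And>v. v \<in> carrier V \<Longrightarrow> Q v = \<zero>\<^bsub>V\<^esub> \<longleftrightarrow> v \<in> U"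
      using invariant_complement[OF fd cU] by metis
    have CV: "C \<subseteq> carrier V" using C by (simp add: closed_subspace_def)
    have repU: "representation K (V\<lparr>carrier := U\<rparr>) \<phi>"
      using U by (intro rep_subspace[OF rep cU]) (auto simp: subrep_def)
    define \<psi> where "\<psi> k v = Q (\<phi> k v)" for k v
    have Qin: "Q v \<in> C" if "v \<in> carrier V" for v using lm_closed[OF Q that] by simp
    \<comment> \<open>\<open>v\<close> and \<open>Q v\<close> differ by an element of the invariant
      subspace \<open>U\<close>, which \<open>Q\<close> kills; hence the projected maps
      compose.\<close>
    have QQ: "Q (\<phi> k (Q v)) = Q (\<phi> k v)" if k: "k \<in> carrier K" and v: "v \<in> carrier V" for k v
    proof -
      have Qv: "Q v \<in> carrier V" using Qin[OF v] CV by auto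
      let ?u = "v \<oplus>\<^bsub>V\<^esub> (-1) \<odot>\<^bsub>V\<^esub> Q v"
      have u: "?u \<in> carrier V" using v Qv by (intro vs_add[OF V] vs_smult[OF V])
      have "Q ?u = Q v \<oplus>\<^bsub>V\<^esub> (-1) \<odot>\<^bsub>V\<^esub> Q v"
        using lm_add[OF Q v vs_smult[OF V Qv, of "-1"]] lm_smult[OF Q Qv, of "-1"] QC[OF Qin[OF v]] by simp
      then have "?u \<in> U" using vs_neg[OF V Qv] QU[OF u] by simp
      then have "\<phi> k ?u \<in> U" using U k by (auto simp: subrep_def)
      then have "Q (\<phi> k ?u) = \<zero>\<^bsub>V\<^esub>" using QU UV by auto
      moreover have "v = ?u \<oplus>\<^bsub>V\<^esub> Q v"
      proof -
        have "?u \<oplus>\<^bsub>V\<^esub> Q v = v \<oplus>\<^bsub>V\<^esub> (Q v \<oplus>\<^bsub>V\<^esub> (-1) \<odot>\<^bsub>V\<^esub> Q v)"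
          using v Qv vs_smult[OF V Qv] by (simp add: vs_assoc[OF V] vs_comm[OF V _ Qv])
        then show ?thesis using vs_neg[OF V Qv] vs_r_zero[OF V v] by simp
      qed
      moreover have "Q (\<phi> k (?u \<oplus>\<^bsub>V\<^esub> Q v)) = Q (\<phi> k ?u) \<oplus>\<^bsub>V\<^esub> Q (\<phi> k (Q v))"
        using lm_add[OF rep_linear[OF rep k] u Qv] lm_add[OF Q] rep_closed[OF rep k] u Qv by simp
      moreover have "Q (\<phi> k (Q v)) \<in> carrier V" using Qin rep_closed[OF rep k Qv] CV by auto
      ultimately show ?thesis using vs_l_zero[OF V] by metis
    qed
    have \<psi>l: "linear_map complex_field (V\<lparr>carrier := C\<rparr>) (V\<lparr>carrier := C\<rparr>) (\<psi> k)" if k: "k \<in> carrier K" for k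
      unfolding \<psi>_def
      using lm_add[OF Q] lm_smult[OF Q] lm_add[OF rep_linear[OF rep k]] lm_smult[OF rep_linear[OF rep k]]
        rep_closed[OF rep k] CV Qin
      by (intro complex_linear_mapI subspace_vectorspace[OF V C]) (auto simp: subset_iff)
    have fdC: "fin_dim_space (V\<lparr>carrier := C\<rparr>)" by (rule subspace_fin_dim_space[OF fd C])
    have repC: "representation K (V\<lparr>carrier := C\<rparr>) \<psi>"
      unfolding representation_def
    proof (intro conjI ballI)
      show "\<psi> \<one>\<^bsub>K\<^esub> w = w" if "w \<in> carrier (V\<lparr>carrier := C\<rparr>)" for w
        using rep_one[OF rep, of w] that CV QC by (auto simp: \<psi>_def)
      show "\<psi> (k \<otimes>\<^bsub>K\<^esub> l) w = \<psi> k (\<psi> l w)"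
        if "k \<in> carrier K" "l \<in> carrier K" "w \<in> carrier (V\<lparr>carrier := C\<rparr>)" for k l w
      proof -
        have w: "w \<in> carrier V" using that CV by auto
        show ?thesis
          using rep_mult[OF rep that(1,2) w] QQ[OF that(1) rep_closed[OF rep that(2) w]]
          by (simp add: \<psi>_def)
      qed
    qed (use fdC \<psi>l rep_group[OF rep] in auto)
    have Qs: "Q ` carrier V = carrier (V\<lparr>carrier := C\<rparr>)"
      using Qin QC CV by (auto simp: image_iff) (metis subsetD)
    have ker: "U = {v \<in> carrier V. Q v = \<zero>\<^bsub>V\<lparr>carrier := C\<rparr>\<^esub>}" using QU UV by auto
    have tr: "rep_character K V \<phi> k = rep_character K (V\<lparr>carrier := U\<rparr>) \<phi> k + rep_character K (V\<lparr>carrier := C\<rparr>) \<psi> k"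
      if k: "k \<in> carrier K" for k
    proof -
      have "Q (\<phi> k v) = \<psi> k (Q v)" if "v \<in> carrier V" for v using QQ[OF k that] by (simp add: \<psi>_def)
      then show ?thesis
        using trace_exact(3)[OF fd Q Qs rep_linear[OF rep k] \<psi>l[OF k] _ ker] k
        by (simp add: rep_character_def)
    qed
    have idm: "linear_map complex_field W W (\<lambda>v. v)" if "vectorspace complex_field W" for W :: "(complex, nat \<Rightarrow> complex) module"
      using that by (intro complex_linear_mapI) auto
    have fdU: "fin_dim_space (V\<lparr>carrier := U\<rparr>)" by (rule subspace_fin_dim_space[OF fd cU])
    have "(of_nat (vectorspace.dim complex_field V) :: complex) =
        of_nat (vectorspace.dim complex_field (V\<lparr>carrier := U\<rparr>)) + of_nat (vectorspace.dim complex_field (V\<lparr>carrier := C\<rparr>))"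
      using trace_exact(3)[OF fd Q Qs idm[OF V] idm[OF conjunct1[OF fdC]] _ ker]
      by (simp add: endo_trace_id[OF fd] endo_trace_id[OF fdU] endo_trace_id[OF fdC])
    then have dims: "vectorspace.dim complex_field V =
        vectorspace.dim complex_field (V\<lparr>carrier := U\<rparr>) + vectorspace.dim complex_field (V\<lparr>carrier := C\<rparr>)"
      by (simp only: of_nat_add[symmetric] of_nat_eq_iff)
    have "C \<noteq> {\<zero>\<^bsub>V\<^esub>}"
    proof
      assume "C = {\<zero>\<^bsub>V\<^esub>}"
      then have "v \<in> U" if "v \<in> carrier V" for v using Qin[OF that] QU[OF that] by simp
      then show False using U(3) UV by auto
    qed
    then have "vectorspace.dim complex_field (V\<lparr>carrier := C\<rparr>) > 0" using dim_pos[OF fdC] by simp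
    moreover have "vectorspace.dim complex_field (V\<lparr>carrier := U\<rparr>) > 0" using dim_pos[OF fdU] U by simp
    ultimately have dU: "vectorspace.dim complex_field (V\<lparr>carrier := U\<rparr>) < vectorspace.dim complex_field V"
      and dC: "vectorspace.dim complex_field (V\<lparr>carrier := C\<rparr>) < vectorspace.dim complex_field V"
      using dims by linarith+
    obtain S1 m1 where S1: "finite S1" "S1 \<subseteq> irreducible_characters K"
      "\<forall>k\<in>carrier K. rep_character K (V\<lparr>carrier := U\<rparr>) \<phi> k = (\<Sum>\<eta>\<in>S1. of_nat (m1 \<eta>) * \<eta> k)"
      using less.hyps[OF dU repU] by blast
    obtain S2 m2 where S2: "finite S2" "S2 \<subseteq> irreducible_characters K"
      "\<forall>k\<in>carrier K. rep_character K (V\<lparr>carrier := C\<rparr>) \<psi> k = (\<Sum>\<eta>\<in>S2. of_nat (m2 \<eta>) * \<eta> k)"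
      using less.hyps[OF dC repC] by blast
    note S = S1(1,2) S2(1,2) S1(3) S2(3)
    define m where "m \<eta> = (if \<eta> \<in> S1 then m1 \<eta> else 0) + (if \<eta> \<in> S2 then m2 \<eta> else 0)" for \<eta>
    have "rep_character K V \<phi> k = (\<Sum>\<eta>\<in>S1 \<union> S2. of_nat (m \<eta>) * \<eta> k)" if k: "k \<in> carrier K" for k
    proof -
      have "(\<Sum>\<eta>\<in>S1 \<union> S2. of_nat (m \<eta>) * \<eta> k) =
          (\<Sum>\<eta>\<in>S1 \<union> S2. if \<eta> \<in> S1 then of_nat (m1 \<eta>) * \<eta> k else 0) +
          (\<Sum>\<eta>\<in>S1 \<union> S2. if \<eta> \<in> S2 then of_nat (m2 \<eta>) * \<eta> k else 0)"
        unfolding sum.distrib[symmetric] m_def by (intro sum.cong) (auto simp: algebra_simps)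
      also have "\<dots> = (\<Sum>\<eta>\<in>S1. of_nat (m1 \<eta>) * \<eta> k) + (\<Sum>\<eta>\<in>S2. of_nat (m2 \<eta>) * \<eta> k)"
        using S(1,3) by (intro arg_cong2[of _ _ _ _ "(+)"] sum.mono_neutral_cong_right) auto
      finally show ?thesis using tr[OF k] S k by simp
    qed
    then show ?thesis using S by (intro exI[of _ "S1 \<union> S2"] exI[of _ m]) auto
  qed
qed

section \<open>Orthogonality of characters\<close>

text \<open>The matrix of \<open>T\<close> in a basis has a complex eigenvector.\<close>

lemma complex_eigenvector:
  assumes fd: "fin_dim_space V" and nz: "carrier V \<noteq> {\<zero>\<^bsub>V\<^esub>}" and T: "linear_map complex_field V V T"
  obtains z v where "v \<in> carrier V" "v \<noteq> \<zero>\<^bsub>V\<^esub>" "T v = z \<odot>\<^bsub>V\<^esub> v"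
proof -
  have V: "vectorspace complex_field V" using fd by simp
  obtain B c where fr: "frame V B (\<lambda>b. b) c"
    and d: "\<And>b b'. b \<in> B \<Longrightarrow> b' \<in> B \<Longrightarrow> c b b' = (if b' = b then 1 else 0)"
    using dual_frame_exists[OF fd] by metis
  define n where "n = card B"
  have n: "n > 0" using dim_eq_frame[OF V fr] d dim_pos[OF fd nz] by (simp add: n_def)
  obtain h where h: "bij_betw h {0..<n} B"
    using ex_bij_betw_nat_finite[OF frame_finite[OF fr]] unfolding n_def by blast
  have hB: "h i \<in> B" if "i < n" for i using h that by (auto simp: bij_betw_def)
  define A where "A = mat n n (\<lambda>(i, j). c (h i) (T (h j)))"
  have A: "A \<in> carrier_mat n n" by (simp add: A_def)
  obtain z x where x: "x \<in> carrier_vec n" "x \<noteq> 0\<^sub>v n" "A *\<^sub>v x = z \<cdot>\<^sub>v x"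
    using spectrum_non_empty[OF A n] A unfolding spectrum_def eigenvalue_def eigenvector_def by auto
  define y where "y b = x $ (inv_into {0..<n} h b)" for b
  have yh: "y (h i) = x $ i" if "i < n" for i
    using h that by (simp add: y_def bij_betw_def)
  define v where "v = (\<Oplus>\<^bsub>V\<^esub>b\<in>B. y b \<odot>\<^bsub>V\<^esub> b)"
  have v: "v \<in> carrier V" unfolding v_def by (rule dual_frame_coordinates(1)[OF V fr d]) auto
  have cv: "c b v = y b" if "b \<in> B" for b
    unfolding v_def using dual_frame_coordinates(2)[OF V fr d, of B b] that by auto
  obtain i where i: "i < n" "x $ i \<noteq> 0"
    using x(1,2) by (metis carrier_vecD eq_vecI index_zero_vec)
  have "v \<noteq> \<zero>\<^bsub>V\<^esub>"
    using cv[OF hB[OF i(1)]] yh[OF i(1)] i(2) functional_zero[OF V frame_functional[OF fr hB[OF i(1)]]] by auto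
  moreover have "T v = z \<odot>\<^bsub>V\<^esub> v"
  proof (rule frame_eqI[OF V fr lm_closed[OF T v] vs_smult[OF V v]])
    fix b assume b: "b \<in> B"
    then obtain i where i: "i < n" "b = h i" using h by (auto simp: bij_betw_def)
    note l = functional_compose[OF T frame_functional[OF fr b]]
    have "c b (T v) = (\<Sum>b'\<in>B. c b' v * c b (T b'))"
      by (rule functional_frame[OF V fr l v])
    also have "\<dots> = (\<Sum>j\<in>{0..<n}. c (h j) v * c b (T (h j)))"
      by (rule sum.reindex_bij_betw[OF h, symmetric])
    also have "\<dots> = (\<Sum>j\<in>{0..<n}. A $$ (i, j) * x $ j)"
      using i by (intro sum.cong) (auto simp: cv hB yh A_def)
    also have "\<dots> = (A *\<^sub>v x) $ i"
      using i x(1) A by (simp add: scalar_prod_def A_def)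
    also have "\<dots> = z * c b v" using i x(1) cv[OF b] yh[of i] by (simp add: x(3))
    also have "\<dots> = c b (z \<odot>\<^bsub>V\<^esub> v)"
      using frame_functional[OF fr b] v by (simp add: linear_functional_def)
    finally show "c b (T v) = c b (z \<odot>\<^bsub>V\<^esub> v)" .
  qed
  ultimately show ?thesis using that v by blast
qed

definition intertwiner ::
    "('k, 'l) monoid_scheme \<Rightarrow> (complex, 'v) module \<Rightarrow> ('k \<Rightarrow> 'v \<Rightarrow> 'v) \<Rightarrow>
     (complex, 'w) module \<Rightarrow> ('k \<Rightarrow> 'w \<Rightarrow> 'w) \<Rightarrow> ('v \<Rightarrow> 'w) \<Rightarrow> bool" where
  "intertwiner K V \<phi> W \<psi> R \<longleftrightarrow> linear_map complex_field V W R \<and>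
     (\<forall>k\<in>carrier K. \<forall>v\<in>carrier V. R (\<phi> k v) = \<psi> k (R v))"

text \<open>Kernel and image of \<open>R\<close> are invariant, so a nonzero \<open>R\<close> is an
  isomorphism and the characters agree.\<close>

lemma schur_zero:
  assumes V: "irreducible_rep K V \<phi>" and W: "irreducible_rep K W \<psi>"
    and R: "intertwiner K V \<phi> W \<psi> R"
    and ne: "rep_character K V \<phi> \<noteq> rep_character K W \<psi>" and v: "v \<in> carrier V"
  shows "R v = \<zero>\<^bsub>W\<^esub>"
proof (rule ccontr)
  assume nz: "R v \<noteq> \<zero>\<^bsub>W\<^esub>"
  have rV: "representation K V \<phi>" and rW: "representation K W \<psi>"
    using V W by (auto simp: irreducible_iff)
  note vV = rep_vs[OF rV] and vW = rep_vs[OF rW]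
  have l: "linear_map complex_field V W R" and eq: "\<And>k v. k \<in> carrier K \<Longrightarrow> v \<in> carrier V \<Longrightarrow> R (\<phi> k v) = \<psi> k (R v)"
    using R by (auto simp: intertwiner_def)
  have "subrep K V \<phi> {v \<in> carrier V. R v = \<zero>\<^bsub>W\<^esub>}"
    unfolding subrep_def closed_subspace_def
    using lm_add[OF l] lm_smult[OF l] lm_zero[OF l] vs_zero[OF vV] vs_add[OF vV] vs_smult[OF vV] rep_closed[OF rV]
      eq lm_zero[OF rep_linear[OF rW]] vs_l_zero[OF vW vs_zero[OF vW]] vs_smult_zero2[OF vW]
    by auto
  then have "{v \<in> carrier V. R v = \<zero>\<^bsub>W\<^esub>} = {\<zero>\<^bsub>V\<^esub>} \<or> {v \<in> carrier V. R v = \<zero>\<^bsub>W\<^esub>} = carrier V"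
    using V unfolding irreducible_iff by blast
  then have inj: "\<And>v. v \<in> carrier V \<Longrightarrow> R v = \<zero>\<^bsub>W\<^esub> \<Longrightarrow> v = \<zero>\<^bsub>V\<^esub>" using v nz by blast
  have "subrep K W \<psi> (R ` carrier V)"
    unfolding subrep_def closed_subspace_def
  proof (intro conjI ballI allI)
    show "R ` carrier V \<subseteq> carrier W" using lm_closed[OF l] by auto
    show "\<zero>\<^bsub>W\<^esub> \<in> R ` carrier V" using lm_zero[OF l] vs_zero[OF vV] by (metis imageI)
    show "x \<oplus>\<^bsub>W\<^esub> y \<in> R ` carrier V" if "x \<in> R ` carrier V" "y \<in> R ` carrier V" for x y
      using that lm_add[OF l] vs_add[OF vV] by (smt (verit) imageE imageI)
    show "z \<odot>\<^bsub>W\<^esub> x \<in> R ` carrier V" if "x \<in> R ` carrier V" for x z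
      using that lm_smult[OF l] vs_smult[OF vV] by (smt (verit) imageE imageI)
    show "\<psi> k x \<in> R ` carrier V" if "k \<in> carrier K" "x \<in> R ` carrier V" for x k
      using that eq rep_closed[OF rV] by (smt (verit) imageE imageI)
  qed
  then have "R ` carrier V = {\<zero>\<^bsub>W\<^esub>} \<or> R ` carrier V = carrier W"
    using W unfolding irreducible_iff by blast
  then have surj: "R ` carrier V = carrier W" using v nz by blast
  have "rep_character K V \<phi> = rep_character K W \<psi>"
    unfolding rep_character_def
  proof (intro restrict_ext)
    fix k assume k: "k \<in> carrier K"
    show "endo_trace V (\<phi> k) = endo_trace W (\<psi> k)"
      by (rule trace_iso[OF rep_fin_dim_space[OF rV] l surj _ rep_linear[OF rV k] rep_linear[OF rW k]])
        (use inj eq k in blast)+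
  qed
  then show False using ne by simp
qed

text \<open>The eigenvectors of \<open>R\<close> for one eigenvalue form a nonzero invariant
  subspace.\<close>

lemma schur_scalar:
  assumes V: "irreducible_rep K V \<phi>" and R: "intertwiner K V \<phi> V \<phi> R"
  obtains z where "\<And>v. v \<in> carrier V \<Longrightarrow> R v = z \<odot>\<^bsub>V\<^esub> v"
proof -
  have rV: "representation K V \<phi>" and nz: "carrier V \<noteq> {\<zero>\<^bsub>V\<^esub>}"
    using V by (auto simp: irreducible_iff)
  note vV = rep_vs[OF rV]
  have l: "linear_map complex_field V V R" and eq: "\<And>k v. k \<in> carrier K \<Longrightarrow> v \<in> carrier V \<Longrightarrow> R (\<phi> k v) = \<phi> k (R v)"
    using R by (auto simp: intertwiner_def)
  obtain z w where w: "w \<in> carrier V" "w \<noteq> \<zero>\<^bsub>V\<^esub>" "R w = z \<odot>\<^bsub>V\<^esub> w"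
    using complex_eigenvector[OF rep_fin_dim_space[OF rV] nz l] by blast
  let ?U = "{v \<in> carrier V. R v = z \<odot>\<^bsub>V\<^esub> v}"
  have "subrep K V \<phi> ?U"
    unfolding subrep_def closed_subspace_def
    using lm_add[OF l] lm_smult[OF l] lm_zero[OF l] vs_zero[OF vV] vs_add[OF vV] vs_smult[OF vV] rep_closed[OF rV]
      eq lm_smult[OF rep_linear[OF rV]] vs_smult_zero2[OF vV] vs_smult_r_distr[OF vV]
    by (auto simp: vs_smult_assoc[OF vV] mult.commute)
  then have "?U = {\<zero>\<^bsub>V\<^esub>} \<or> ?U = carrier V" using V unfolding irreducible_iff by blast
  then have "?U = carrier V" using w by blast
  then show ?thesis using that by blast
qed

text \<open>A character of a finite group takes conjugate values at \<open>k\<close> and \<open>inv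
  k\<close>, so on characters this is the usual Hermitian product.\<close>

definition char_inner :: "('k, 'l) monoid_scheme \<Rightarrow> ('k \<Rightarrow> complex) \<Rightarrow> ('k \<Rightarrow> complex) \<Rightarrow> complex" where
  "char_inner K \<xi> \<theta> = (\<Sum>k\<in>carrier K. \<xi> k * \<theta> (inv\<^bsub>K\<^esub> k)) / of_nat (card (carrier K))"

text \<open>The average over \<open>K\<close> of the conjugates of the rank one map \<open>w
  \<mapsto> d w \<odot> b\<close>, up to the factor \<open>card (carrier K)\<close>. Its matrix
  entries are the sums that occur in products of characters.\<close>

lemma averaged_intertwiner:
  assumes rV: "representation K V \<phi>" and rW: "representation K W \<psi>" and K: "finite (carrier K)"
    and d: "linear_functional W d" and b: "b \<in> carrier V"
  defines "R \<equiv> \<lambda>w. \<Oplus>\<^bsub>V\<^esub>k\<in>carrier K. d (\<psi> (inv\<^bsub>K\<^esub> k) w) \<odot>\<^bsub>V\<^esub> \<phi> k b"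
  shows "intertwiner K W \<psi> V \<phi> R"
    "\<And>c w. linear_functional V c \<Longrightarrow> w \<in> carrier W \<Longrightarrow>
       c (R w) = (\<Sum>k\<in>carrier K. d (\<psi> (inv\<^bsub>K\<^esub> k) w) * c (\<phi> k b))"
proof -
  interpret K: group K using rep_group[OF rV] .
  note vV = rep_vs[OF rV] and vW = rep_vs[OF rW]
  have RV: "R w \<in> carrier V" for w
    unfolding R_def using rep_closed[OF rV] b by (intro vs_finsum[OF vV]) (auto intro!: vs_smult[OF vV])
  show ap: "c (R w) = (\<Sum>k\<in>carrier K. d (\<psi> (inv\<^bsub>K\<^esub> k) w) * c (\<phi> k b))"
    if c: "linear_functional V c" for c w
  proof -
    have "c (R w) = (\<Sum>k\<in>carrier K. c (d (\<psi> (inv\<^bsub>K\<^esub> k) w) \<odot>\<^bsub>V\<^esub> \<phi> k b))"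
      unfolding R_def using rep_closed[OF rV] b
      by (intro functional_finsum[OF vV c K]) (auto intro!: vs_smult[OF vV])
    then show ?thesis using c rep_closed[OF rV _ b] by (simp add: linear_functional_def)
  qed
  obtain B c where fr: "frame V B (\<lambda>b. b) c" using dual_frame_exists[OF rep_fin_dim_space[OF rV]] by metis
  have c: "linear_functional V (c b)" if "b \<in> B" for b using frame_functional[OF fr that] .
  have dl: "d (\<psi> k (v \<oplus>\<^bsub>W\<^esub> w)) = d (\<psi> k v) + d (\<psi> k w)" "d (\<psi> k (z \<odot>\<^bsub>W\<^esub> v)) = z * d (\<psi> k v)"
    if "k \<in> carrier K" "v \<in> carrier W" "w \<in> carrier W" for k v w z
    using functional_compose[OF rep_linear[OF rW that(1)] d] that by (auto simp: linear_functional_def)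
  show "intertwiner K W \<psi> V \<phi> R"
    unfolding intertwiner_def
  proof (intro conjI ballI)
    show "linear_map complex_field W V R"
    proof (intro complex_linear_mapI vV vW RV)
      fix v w assume vw: "v \<in> carrier W" "w \<in> carrier W"
      show "R (v \<oplus>\<^bsub>W\<^esub> w) = R v \<oplus>\<^bsub>V\<^esub> R w"
      proof (rule frame_eqI[OF vV fr RV vs_add[OF vV RV RV]])
        fix b' assume b': "b' \<in> B"
        have "c b' (R v \<oplus>\<^bsub>V\<^esub> R w) = c b' (R v) + c b' (R w)"
          using c[OF b'] RV by (simp add: linear_functional_def)
        then show "c b' (R (v \<oplus>\<^bsub>W\<^esub> w)) = c b' (R v \<oplus>\<^bsub>V\<^esub> R w)"
          using vw by (simp add: ap[OF c[OF b']] dl sum.distrib algebra_simps)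
      qed
    next
      fix z v assume v: "v \<in> carrier W"
      show "R (z \<odot>\<^bsub>W\<^esub> v) = z \<odot>\<^bsub>V\<^esub> R v"
      proof (rule frame_eqI[OF vV fr RV vs_smult[OF vV RV]])
        fix b' assume b': "b' \<in> B"
        have "c b' (z \<odot>\<^bsub>V\<^esub> R v) = z * c b' (R v)"
          using c[OF b'] RV by (simp add: linear_functional_def)
        then show "c b' (R (z \<odot>\<^bsub>W\<^esub> v)) = c b' (z \<odot>\<^bsub>V\<^esub> R v)"
          using v by (simp add: ap[OF c[OF b']] dl(2)[OF _ v v] sum_distrib_left algebra_simps)
      qed
    qed
    fix l w assume l: "l \<in> carrier K" and w: "w \<in> carrier W"
    show "R (\<psi> l w) = \<phi> l (R w)"
    proof (rule frame_eqI[OF vV fr RV rep_closed[OF rV l RV]])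
      fix b' assume b': "b' \<in> B"
      have bij: "bij_betw (\<lambda>k. l \<otimes>\<^bsub>K\<^esub> k) (carrier K) (carrier K)"
        using l by (intro bij_betw_byWitness[where f' = "\<lambda>k. inv\<^bsub>K\<^esub> l \<otimes>\<^bsub>K\<^esub> k"])
          (auto simp: K.m_assoc[symmetric])
      have "c b' (R (\<psi> l w)) =
          (\<Sum>k\<in>carrier K. d (\<psi> (inv\<^bsub>K\<^esub> (l \<otimes>\<^bsub>K\<^esub> k)) (\<psi> l w)) * c b' (\<phi> (l \<otimes>\<^bsub>K\<^esub> k) b))"
        using ap[OF c[OF b']] sum.reindex_bij_betw[OF bij,
            of "\<lambda>k. d (\<psi> (inv\<^bsub>K\<^esub> k) (\<psi> l w)) * c b' (\<phi> k b)"] by simp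
      also have "\<dots> = (\<Sum>k\<in>carrier K. d (\<psi> (inv\<^bsub>K\<^esub> k) w) * c b' (\<phi> l (\<phi> k b)))"
      proof (rule sum.cong[OF refl])
        fix k assume k: "k \<in> carrier K"
        have "\<psi> (inv\<^bsub>K\<^esub> (l \<otimes>\<^bsub>K\<^esub> k)) (\<psi> l w) = \<psi> (inv\<^bsub>K\<^esub> (l \<otimes>\<^bsub>K\<^esub> k) \<otimes>\<^bsub>K\<^esub> l) w"
          using rep_mult[OF rW] k l w by simp
        also have "inv\<^bsub>K\<^esub> (l \<otimes>\<^bsub>K\<^esub> k) \<otimes>\<^bsub>K\<^esub> l = inv\<^bsub>K\<^esub> k"
          using k l by (simp add: K.inv_mult_group K.m_assoc)
        finally show "d (\<psi> (inv\<^bsub>K\<^esub> (l \<otimes>\<^bsub>K\<^esub> k)) (\<psi> l w)) * c b' (\<phi> (l \<otimes>\<^bsub>K\<^esub> k) b) =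
            d (\<psi> (inv\<^bsub>K\<^esub> k) w) * c b' (\<phi> l (\<phi> k b))"
          using rep_mult[OF rV l k b] by simp
      qed
      also have "\<dots> = c b' (\<phi> l (R w))"
        by (rule ap[OF functional_compose[OF rep_linear[OF rV l] c[OF b']], symmetric])
      finally show "c b' (R (\<psi> l w)) = c b' (\<phi> l (R w))" .
    qed
  qed
qed

lemma character_product_sum:
  assumes rV: "representation K V \<phi>" and rW: "representation K W \<psi>" and K: "finite (carrier K)"
    and frV: "frame V B (\<lambda>b. b) c" and frW: "frame W D (\<lambda>b. b) d"
  shows "(\<Sum>k\<in>carrier K. rep_character K V \<phi> k * rep_character K W \<psi> (inv\<^bsub>K\<^esub> k)) =
    (\<Sum>b\<in>B. \<Sum>w\<in>D. c b (\<Oplus>\<^bsub>V\<^esub>k\<in>carrier K. d w (\<psi> (inv\<^bsub>K\<^esub> k) w) \<odot>\<^bsub>V\<^esub> \<phi> k b))"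
proof -
  interpret K: group K using rep_group[OF rV] .
  have "(\<Sum>k\<in>carrier K. rep_character K V \<phi> k * rep_character K W \<psi> (inv\<^bsub>K\<^esub> k)) =
    (\<Sum>k\<in>carrier K. \<Sum>b\<in>B. \<Sum>w\<in>D. d w (\<psi> (inv\<^bsub>K\<^esub> k) w) * c b (\<phi> k b))"
    by (intro sum.cong refl)
      (simp add: rep_character_def endo_trace_frame[OF rep_linear[OF rV] frV]
        endo_trace_frame[OF rep_linear[OF rW] frW] sum_product mult.commute)
  also have "\<dots> = (\<Sum>b\<in>B. \<Sum>k\<in>carrier K. \<Sum>w\<in>D. d w (\<psi> (inv\<^bsub>K\<^esub> k) w) * c b (\<phi> k b))"
    by (rule sum.swap)
  also have "\<dots> = (\<Sum>b\<in>B. \<Sum>w\<in>D. \<Sum>k\<in>carrier K. d w (\<psi> (inv\<^bsub>K\<^esub> k) w) * c b (\<phi> k b))"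
    by (intro sum.cong refl sum.swap)
  also have "\<dots> = (\<Sum>b\<in>B. \<Sum>w\<in>D. c b (\<Oplus>\<^bsub>V\<^esub>k\<in>carrier K. d w (\<psi> (inv\<^bsub>K\<^esub> k) w) \<odot>\<^bsub>V\<^esub> \<phi> k b))"
    using averaged_intertwiner(2)[OF rV rW K frame_functional[OF frW] frame_carrier[OF frV]
        frame_functional[OF frV] frame_carrier[OF frW]]
    by (intro sum.cong refl) auto
  finally show ?thesis .
qed

lemma irreducible_orthogonal:
  assumes V: "irreducible_rep K V \<phi>" and W: "irreducible_rep K W \<psi>" and K: "finite (carrier K)"
    and ne: "rep_character K V \<phi> \<noteq> rep_character K W \<psi>"
  shows "char_inner K (rep_character K V \<phi>) (rep_character K W \<psi>) = 0"
proof -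
  have rV: "representation K V \<phi>" and rW: "representation K W \<psi>"
    using V W by (auto simp: irreducible_iff)
  obtain B c where frV: "frame V B (\<lambda>b. b) c" using dual_frame_exists[OF rep_fin_dim_space[OF rV]] by metis
  obtain D d where frW: "frame W D (\<lambda>b. b) d" using dual_frame_exists[OF rep_fin_dim_space[OF rW]] by metis
  have "c b (\<Oplus>\<^bsub>V\<^esub>k\<in>carrier K. d w (\<psi> (inv\<^bsub>K\<^esub> k) w) \<odot>\<^bsub>V\<^esub> \<phi> k b) = 0" if b: "b \<in> B" and w: "w \<in> D" for b w
  proof -
    note it = averaged_intertwiner(1)[OF rV rW K frame_functional[OF frW w] frame_carrier[OF frV b]]
    have "(\<Oplus>\<^bsub>V\<^esub>k\<in>carrier K. d w (\<psi> (inv\<^bsub>K\<^esub> k) w) \<odot>\<^bsub>V\<^esub> \<phi> k b) = \<zero>\<^bsub>V\<^esub>"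
      using schur_zero[OF W V it _ frame_carrier[OF frW w]] ne by simp
    then show ?thesis using functional_zero[OF rep_vs[OF rV] frame_functional[OF frV b]] by simp
  qed
  then show ?thesis by (simp add: char_inner_def character_product_sum[OF rV rW K frV frW])
qed

text \<open>By Schur's lemma the averaged map is a scalar, which its trace determines.\<close>

lemma irreducible_norm:
  assumes V: "irreducible_rep K V \<phi>" and K: "finite (carrier K)"
  shows "char_inner K (rep_character K V \<phi>) (rep_character K V \<phi>) = 1"
proof -
  have rV: "representation K V \<phi>" and nz: "carrier V \<noteq> {\<zero>\<^bsub>V\<^esub>}"
    using V by (auto simp: irreducible_iff)
  interpret K: group K using rep_group[OF rV] .
  note vV = rep_vs[OF rV]
  obtain B c where fr: "frame V B (\<lambda>b. b) c"
    and dual: "\<And>b b'. b \<in> B \<Longrightarrow> b' \<in> B \<Longrightarrow> c b b' = (if b' = b then 1 else 0)"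
    using dual_frame_exists[OF rep_fin_dim_space[OF rV]] by metis
  have n: "card B > 0" using dim_eq_frame[OF vV fr] dual dim_pos[OF rep_fin_dim_space[OF rV] nz] by simp
  have ent: "c b (\<Oplus>\<^bsub>V\<^esub>k\<in>carrier K. c w (\<phi> (inv\<^bsub>K\<^esub> k) w) \<odot>\<^bsub>V\<^esub> \<phi> k b) =
      (if w = b then of_nat (card (carrier K)) / of_nat (card B) else 0)" if b: "b \<in> B" and w: "w \<in> B" for b w
  proof -
    define R where "R = (\<lambda>v. \<Oplus>\<^bsub>V\<^esub>k\<in>carrier K. c w (\<phi> (inv\<^bsub>K\<^esub> k) v) \<odot>\<^bsub>V\<^esub> \<phi> k b)"
    note it = averaged_intertwiner(1)[OF rV rV K frame_functional[OF fr w] frame_carrier[OF fr b], folded R_def]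
    have ap: "f (R v) = (\<Sum>k\<in>carrier K. c w (\<phi> (inv\<^bsub>K\<^esub> k) v) * f (\<phi> k b))"
      if "linear_functional V f" "v \<in> carrier V" for f v
      unfolding R_def
      using averaged_intertwiner(2)[OF rV rV K frame_functional[OF fr w] frame_carrier[OF fr b] that] .
    obtain z where z: "\<And>v. v \<in> carrier V \<Longrightarrow> R v = z \<odot>\<^bsub>V\<^esub> v" using schur_scalar[OF V it] by blast
    have cR: "c e (R v) = z * c e v" if "e \<in> B" "v \<in> carrier V" for e v
      using z[OF that(2)] frame_functional[OF fr that(1)] that(2) by (simp add: linear_functional_def)
    have "of_nat (card B) * z = (\<Sum>e\<in>B. c e (R e))"
      using dual cR frame_carrier[OF fr] by simp
    also have "\<dots> = (\<Sum>e\<in>B. \<Sum>k\<in>carrier K. c w (\<phi> (inv\<^bsub>K\<^esub> k) e) * c e (\<phi> k b))"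
      using ap frame_functional[OF fr] frame_carrier[OF fr] by simp
    also have "\<dots> = (\<Sum>k\<in>carrier K. \<Sum>e\<in>B. c e (\<phi> k b) * c w (\<phi> (inv\<^bsub>K\<^esub> k) e))"
      by (subst sum.swap) (simp add: mult.commute)
    also have "\<dots> = (\<Sum>k\<in>carrier K. c w (\<phi> (inv\<^bsub>K\<^esub> k) (\<phi> k b)))"
    proof (rule sum.cong[OF refl])
      fix k assume k: "k \<in> carrier K"
      show "(\<Sum>e\<in>B. c e (\<phi> k b) * c w (\<phi> (inv\<^bsub>K\<^esub> k) e)) = c w (\<phi> (inv\<^bsub>K\<^esub> k) (\<phi> k b))"
        using functional_frame[OF vV fr functional_compose[OF rep_linear[OF rV K.inv_closed[OF k]]
              frame_functional[OF fr w]] rep_closed[OF rV k frame_carrier[OF fr b]]] by simp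
    qed
    also have "\<dots> = of_nat (card (carrier K)) * c w b"
      using rep_inv_cancel(1)[OF rV _ frame_carrier[OF fr b]] by simp
    finally have "z = of_nat (card (carrier K)) * c w b / of_nat (card B)" using n by (simp add: field_simps)
    then show ?thesis
      using cR[OF b frame_carrier[OF fr w]] dual[OF b w] dual[OF w b] unfolding R_def by auto
  qed
  have "card (carrier K) > 0" using K K.one_closed by (auto simp: card_gt_0_iff)
  moreover have "B \<noteq> {}" using n by auto
  ultimately show ?thesis
    using n frame_finite[OF fr]
    by (simp add: char_inner_def character_product_sum[OF rV rV K fr fr] ent)
qed

lemma char_inner_sum_left:
  "char_inner K (\<lambda>k. \<Sum>i\<in>I. a i * f i k) \<theta> = (\<Sum>i\<in>I. a i * char_inner K (f i) \<theta>)"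
  unfolding char_inner_def
  by (simp add: sum_distrib_right sum_distrib_left sum_divide_distrib sum.swap[of _ "carrier K" I] mult.assoc)

lemma char_inner_cong:
  assumes "\<And>k. k \<in> carrier K \<Longrightarrow> \<xi> k = \<xi>' k"
  shows "char_inner K \<xi> \<theta> = char_inner K \<xi>' \<theta>"
  unfolding char_inner_def using assms by (simp cong: sum.cong)

lemma irreducible_characters_orthonormal:
  assumes "finite (carrier K)" "\<eta> \<in> irreducible_characters K" "\<theta> \<in> irreducible_characters K"
  shows "char_inner K \<eta> \<theta> = (if \<eta> = \<theta> then 1 else 0)"
  using assms irreducible_orthogonal irreducible_norm unfolding irreducible_characters_def
  by (smt (verit) mem_Collect_eq)

text \<open>Hence the coefficients of a decomposition into irreducible characters are
  unique.\<close>

lemma decomposition_coefficient: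
  assumes K: "finite (carrier K)" and S: "finite S" "S \<subseteq> irreducible_characters K"
    and dec: "\<And>k. k \<in> carrier K \<Longrightarrow> \<xi> k = (\<Sum>\<eta>\<in>S. of_nat (m \<eta>) * \<eta> k)"
    and \<theta>: "\<theta> \<in> irreducible_characters K"
  shows "char_inner K \<xi> \<theta> = (if \<theta> \<in> S then of_nat (m \<theta>) else 0)"
proof -
  have "char_inner K \<xi> \<theta> = char_inner K (\<lambda>k. \<Sum>\<eta>\<in>S. of_nat (m \<eta>) * \<eta> k) \<theta>"
    by (rule char_inner_cong) (rule dec)
  also have "\<dots> = (\<Sum>\<eta>\<in>S. of_nat (m \<eta>) * char_inner K \<eta> \<theta>)" by (rule char_inner_sum_left)
  also have "\<dots> = (\<Sum>\<eta>\<in>S. if \<eta> = \<theta> then of_nat (m \<theta>) else 0)"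
    using S irreducible_characters_orthonormal[OF K _ \<theta>] by (intro sum.cong) auto
  finally show ?thesis using S by simp
qed

lemma permutation_representation:
  fixes K (structure) and I :: "'i set"
  assumes K: "group K" and I: "finite I"
    and act: "\<And>k i. k \<in> carrier K \<Longrightarrow> i \<in> I \<Longrightarrow> p k i \<in> I"
    and one: "\<And>i. i \<in> I \<Longrightarrow> p \<one> i = i"
    and mult: "\<And>k l i. k \<in> carrier K \<Longrightarrow> l \<in> carrier K \<Longrightarrow> i \<in> I \<Longrightarrow> p (k \<otimes> l) i = p k (p l i)"
  shows "representation K (fun_space I) (\<lambda>k v. \<lambda>i\<in>I. v (p (inv k) i))"
    "\<And>k. k \<in> carrier K \<Longrightarrow> rep_character K (fun_space I) (\<lambda>k v. \<lambda>i\<in>I. v (p (inv k) i)) k =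
       of_nat (card {i \<in> I. p k i = i})"
proof -
  interpret group K by fact
  show "representation K (fun_space I) (\<lambda>k v. \<lambda>i\<in>I. v (p (inv k) i))"
    unfolding representation_def
  proof (intro conjI ballI K)
    show "vectorspace complex_field (fun_space I)" "vectorspace.fin_dim complex_field (fun_space I)"
      using fun_space_fin_dim_space[OF I] by auto
    show "linear_map complex_field (fun_space I) (fun_space I) (\<lambda>v. \<lambda>i\<in>I. v (p (inv k) i))"
      if "k \<in> carrier K" for k
      using fun_space_trace(1)[OF I, of "p (inv k)"] act that by auto
    show "(\<lambda>i\<in>I. v (p (inv \<one>) i)) = v" if "v \<in> carrier (fun_space I)" for v
      using that one by (auto simp: extensional_def fun_eq_iff)
    show "(\<lambda>i\<in>I. v (p (inv (k \<otimes> l)) i)) = (\<lambda>i\<in>I. (\<lambda>i\<in>I. v (p (inv l) i)) (p (inv k) i))"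
      if "k \<in> carrier K" "l \<in> carrier K" for k l and v :: "'i \<Rightarrow> complex"
      using that mult act by (intro restrict_ext) (simp add: inv_mult_group)
  qed
  fix k assume k: "k \<in> carrier K"
  have "{i \<in> I. p (inv k) i = i} = {i \<in> I. p k i = i}"
    using mult[of k "inv k"] mult[of "inv k" k] one k by auto (metis inv_closed r_inv l_inv)+
  then show "rep_character K (fun_space I) (\<lambda>k v. \<lambda>i\<in>I. v (p (inv k) i)) k = of_nat (card {i \<in> I. p k i = i})"
    using fun_space_trace(2)[OF I, of "p (inv k)"] act k by (simp add: rep_character_def Pi_iff)
qed

lemma irreducible_character_one:
  assumes "\<eta> \<in> irreducible_characters K"
  shows "\<eta> \<one>\<^bsub>K\<^esub> \<noteq> 0"
proof -
  obtain V :: "(complex, nat \<Rightarrow> complex) module" and \<phi> where V: "irreducible_rep K V \<phi>" "\<eta> = rep_character K V \<phi>"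
    using assms unfolding irreducible_characters_def by auto
  have rV: "representation K V \<phi>" and nz: "carrier V \<noteq> {\<zero>\<^bsub>V\<^esub>}"
    using V by (auto simp: irreducible_iff)
  interpret K: group K using rep_group[OF rV] .
  have "\<eta> \<one>\<^bsub>K\<^esub> = of_nat (vectorspace.dim complex_field V)"
    using endo_trace_cong[OF rep_linear[OF rV K.one_closed] rep_fin_dim_space[OF rV], of "\<lambda>v. v"] rep_one[OF rV]
      endo_trace_id[OF rep_fin_dim_space[OF rV]] by (simp add: V(2) rep_character_def)
  then show ?thesis using dim_pos[OF rep_fin_dim_space[OF rV] nz] by simp
qed

text \<open>Every irreducible character has inner product \<open>\<theta> \<one> \<noteq> 0\<close>
  with the character of the regular representation, so it is among the finitely many that occur in a
  decomposition of the latter.\<close>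

lemma finite_irreducible_characters:
  fixes K (structure)
  assumes grp: "group K" and K: "finite (carrier K)"
  shows "finite (irreducible_characters K)"
proof -
  interpret group K by fact
  define reg where "reg = (\<lambda>(k::'a) (v :: 'a \<Rightarrow> complex). \<lambda>i\<in>carrier K. v (inv k \<otimes> i))"
  have rep: "representation K (fun_space (carrier K)) reg"
    and ch: "\<And>k. k \<in> carrier K \<Longrightarrow> rep_character K (fun_space (carrier K)) reg k = of_nat (card {i \<in> carrier K. k \<otimes> i = i})"
    using permutation_representation[OF grp K, of "\<lambda>k i. k \<otimes> i"] by (auto simp: reg_def m_assoc)
  have ch1: "rep_character K (fun_space (carrier K)) reg k = (if k = \<one> then of_nat (card (carrier K)) else 0)"
    if "k \<in> carrier K" for k
  proof -
    have "{i \<in> carrier K. k \<otimes> i = i} = (if k = \<one> then carrier K else {})"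
      using that by (auto simp: l_cancel_one')
    then show ?thesis using ch[OF that] by simp
  qed
  obtain W :: "(complex, nat \<Rightarrow> complex) module" and \<psi> where W: "representation K W \<psi>"
    "rep_character K W \<psi> = rep_character K (fun_space (carrier K)) reg"
    using rep_transport[OF rep] by metis
  obtain S m where S: "finite S" "S \<subseteq> irreducible_characters K"
     "\<forall>k\<in>carrier K. rep_character K W \<psi> k = (\<Sum>\<eta>\<in>S. of_nat (m \<eta>) * \<eta> k)"
    using character_decomposition[OF W(1)] by blast
  \<comment> \<open>The regular character vanishes off the identity, so its inner product with
    \<open>\<theta>\<close> is \<open>\<theta> \<one>\<close>.\<close>
  have "irreducible_characters K \<subseteq> S"
  proof
    fix \<theta> assume \<theta>: "\<theta> \<in> irreducible_characters K"
    have "card (carrier K) > 0" using K one_closed by (auto simp: card_gt_0_iff)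
    moreover have "carrier K \<noteq> {}" using one_closed by blast
    ultimately have "char_inner K (rep_character K W \<psi>) \<theta> = \<theta> \<one>"
      unfolding char_inner_def W(2) using K
      by (simp add: ch1 if_distrib[of "\<lambda>x. x * _"] cong: if_cong)
    then have "char_inner K (rep_character K W \<psi>) \<theta> \<noteq> 0" using irreducible_character_one[OF \<theta>] by simp
    moreover have "char_inner K (rep_character K W \<psi>) \<theta> = (if \<theta> \<in> S then of_nat (m \<theta>) else 0)"
      by (rule decomposition_coefficient[OF K S(1,2) _ \<theta>]) (use S(3) in auto)
    ultimately show "\<theta> \<in> S" by (auto split: if_splits)
  qed
  then show ?thesis using S(1) finite_subset by blast
qed

lemma irreducible_character_mem:
  assumes "irreducible_rep K V \<phi>"
  shows "rep_character K V \<phi> \<in> irreducible_characters K"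
proof -
  have "representation K V \<phi>" using assms by (simp add: irreducible_iff)
  then obtain W :: "(complex, nat \<Rightarrow> complex) module" and \<psi> where "rep_character K W \<psi> = rep_character K V \<phi>"
    "irreducible_rep K V \<phi> \<Longrightarrow> irreducible_rep K W \<psi>"
    using rep_transport by metis
  then show ?thesis using assms unfolding irreducible_characters_def by (metis (mono_tags, lifting) mem_Collect_eq)
qed

text \<open>Uniqueness of the coefficients makes the description in the definition of the
  multiplicity denote.\<close>

lemma character_multiplicity_inner:
  assumes rep: "representation K V \<phi>" and K: "finite (carrier K)" and \<theta>: "\<theta> \<in> irreducible_characters K"
  shows "of_nat (character_multiplicity K (rep_character K V \<phi>) \<theta>) = char_inner K (rep_character K V \<phi>) \<theta>"
proof -
  let ?I = "irreducible_characters K"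
  let ?\<xi> = "rep_character K V \<phi>"
  have fI: "finite ?I" using finite_irreducible_characters[OF rep_group[OF rep] K] .
  obtain W :: "(complex, nat \<Rightarrow> complex) module" and \<psi> where W: "representation K W \<psi>"
    "rep_character K W \<psi> = ?\<xi>" using rep_transport[OF rep] by metis
  obtain S m where S: "finite S" "S \<subseteq> ?I"
     "\<forall>k\<in>carrier K. ?\<xi> k = (\<Sum>\<eta>\<in>S. of_nat (m \<eta>) * \<eta> k)"
    using character_decomposition[OF W(1)] unfolding W(2) by blast
  define m' where "m' \<eta> = (if \<eta> \<in> S then m \<eta> else 0)" for \<eta>
  have m': "\<forall>k\<in>carrier K. ?\<xi> k = (\<Sum>\<eta>\<in>?I. of_nat (m' \<eta>) * \<eta> k)"
  proof
    fix k assume "k \<in> carrier K"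
    then have "?\<xi> k = (\<Sum>\<eta>\<in>S. of_nat (m \<eta>) * \<eta> k)" using S by blast
    also have "\<dots> = (\<Sum>\<eta>\<in>?I. of_nat (m' \<eta>) * \<eta> k)"
      using S fI by (intro sum.mono_neutral_cong_left) (auto simp: m'_def)
    finally show "?\<xi> k = (\<Sum>\<eta>\<in>?I. of_nat (m' \<eta>) * \<eta> k)" .
  qed
  have val: "of_nat (n \<theta>) = char_inner K ?\<xi> \<theta>"
    if "\<forall>k\<in>carrier K. ?\<xi> k = (\<Sum>\<eta>\<in>?I. of_nat (n \<eta>) * \<eta> k)" for n :: "_ \<Rightarrow> nat"
    using decomposition_coefficient[OF K fI order_refl _ \<theta>, of ?\<xi> n] that \<theta> by simp
  have "character_multiplicity K ?\<xi> \<theta> = m' \<theta>"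
    unfolding character_multiplicity_def
  proof (rule the_equality)
    show "\<exists>n. (\<forall>k\<in>carrier K. ?\<xi> k = (\<Sum>\<eta>\<in>?I. of_nat (n \<eta>) * \<eta> k)) \<and> n \<theta> = m' \<theta>"
      using m' by blast
    fix l assume "\<exists>n. (\<forall>k\<in>carrier K. ?\<xi> k = (\<Sum>\<eta>\<in>?I. of_nat (n \<eta>) * \<eta> k)) \<and> n \<theta> = l"
    then have "of_nat l = char_inner K ?\<xi> \<theta>" using val by blast
    then show "l = m' \<theta>" using val[OF m'] by (metis of_nat_eq_iff)
  qed
  then show ?thesis using val[OF m'] by simp
qed

text \<open>The average \<open>P\<close> of the operators \<open>\<phi> k\<close> is a projection
  onto the fixed space, whose dimension is therefore the trace of \<open>P\<close>.\<close>

lemma fixed_space_trace: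
  fixes K (structure)
  assumes rep: "representation K V \<phi>" and S: "subgroup S K" "finite S"
  shows "(\<Sum>k\<in>S. endo_trace V (\<phi> k)) = of_nat (card S) *
     of_nat (vectorspace.dim complex_field (V\<lparr>carrier := {v \<in> carrier V. \<forall>k\<in>S. \<phi> k v = v}\<rparr>))"
proof -
  interpret group K using rep_group[OF rep] .
  note V = rep_vs[OF rep] and fd = rep_fin_dim_space[OF rep]
  have SK: "S \<subseteq> carrier K" and S1: "\<one> \<in> S" using S by (auto simp: subgroup_def)
  define n :: complex where "n = of_nat (card S)"
  have n: "n \<noteq> 0" using S S1 by (auto simp: n_def)
  define U where "U = {v \<in> carrier V. \<forall>k\<in>S. \<phi> k v = v}"
  define P where "P v = (\<Oplus>\<^bsub>V\<^esub>k\<in>S. (1 / n) \<odot>\<^bsub>V\<^esub> \<phi> k v)" for v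
  obtain B c where fr: "frame V B (\<lambda>b. b) c" using dual_frame_exists[OF fd] by metis
  have PV: "P v \<in> carrier V" if "v \<in> carrier V" for v
    unfolding P_def using that SK rep_closed[OF rep] by (intro vs_finsum[OF V]) (auto intro!: vs_smult[OF V])
  have ap: "f (P v) = (\<Sum>k\<in>S. f (\<phi> k v)) / n" if f: "linear_functional V f" and v: "v \<in> carrier V" for f v
  proof -
    have m: "\<phi> k v \<in> carrier V" if "k \<in> S" for k using rep_closed[OF rep] SK that v by auto
    have "f (P v) = (\<Sum>k\<in>S. f ((1 / n) \<odot>\<^bsub>V\<^esub> \<phi> k v))"
      unfolding P_def using m by (intro functional_finsum[OF V f S(2)]) (auto intro!: vs_smult[OF V])
    also have "\<dots> = (\<Sum>k\<in>S. f (\<phi> k v) / n)"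
      using f m by (intro sum.cong) (auto simp: linear_functional_def)
    finally show ?thesis by (simp add: sum_divide_distrib)
  qed
  have cU: "closed_subspace V U"
    unfolding closed_subspace_def U_def
    using vs_zero[OF V] vs_add[OF V] vs_smult[OF V] SK lm_zero[OF rep_linear[OF rep]]
      lm_add[OF rep_linear[OF rep]] lm_smult[OF rep_linear[OF rep]] by (auto simp: subset_iff)
  have PU: "P v \<in> U" if v: "v \<in> carrier V" for v
    unfolding U_def
  proof (intro CollectI conjI ballI PV[OF v])
    fix l assume l: "l \<in> S"
    then have lK: "l \<in> carrier K" using SK by auto
    show "\<phi> l (P v) = P v"
    proof (rule frame_eqI[OF V fr rep_closed[OF rep lK PV[OF v]] PV[OF v]])
      fix b assume b: "b \<in> B"
      have bij: "bij_betw (\<lambda>k. l \<otimes> k) S S"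
        using l S(1) SK by (intro bij_betw_byWitness[where f' = "\<lambda>k. inv l \<otimes> k"])
          (auto simp: m_assoc[symmetric] subgroup_def subset_iff)
      have "c b (\<phi> l (P v)) = (\<Sum>k\<in>S. c b (\<phi> l (\<phi> k v))) / n"
        using ap[OF functional_compose[OF rep_linear[OF rep lK] frame_functional[OF fr b]] v] .
      also have "\<dots> = (\<Sum>k\<in>S. c b (\<phi> (l \<otimes> k) v)) / n"
        using rep_mult[OF rep lK] SK v by (intro arg_cong2[of _ _ _ _ "(/)"] sum.cong) auto
      also have "\<dots> = (\<Sum>k\<in>S. c b (\<phi> k v)) / n"
        using sum.reindex_bij_betw[OF bij, of "\<lambda>k. c b (\<phi> k v)"] by simp
      finally show "c b (\<phi> l (P v)) = c b (P v)" using ap[OF frame_functional[OF fr b] v] by simp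
    qed
  qed
  have UV: "U \<subseteq> carrier V" by (auto simp: U_def)
  have Pid: "P u = u" if u: "u \<in> U" for u
  proof (rule frame_eqI[OF V fr PV])
    show "u \<in> carrier V" "u \<in> carrier V" using u UV by auto
    fix b assume b: "b \<in> B"
    have "c b (P u) = (\<Sum>k\<in>S. c b u) / n" using ap[OF frame_functional[OF fr b]] u by (simp add: U_def)
    then show "c b (P u) = c b u" using n by (simp add: n_def)
  qed
  have Plin: "P (v \<oplus>\<^bsub>V\<^esub> w) = P v \<oplus>\<^bsub>V\<^esub> P w" "P (z \<odot>\<^bsub>V\<^esub> v) = z \<odot>\<^bsub>V\<^esub> P v"
    if v: "v \<in> carrier V" and w: "w \<in> carrier V" for v w z
  proof -
    show "P (v \<oplus>\<^bsub>V\<^esub> w) = P v \<oplus>\<^bsub>V\<^esub> P w"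
    proof (rule frame_eqI[OF V fr PV[OF vs_add[OF V v w]] vs_add[OF V PV[OF v] PV[OF w]]])
      fix b assume b: "b \<in> B"
      note f = frame_functional[OF fr b]
      have *: "c b (\<phi> k (v \<oplus>\<^bsub>V\<^esub> w)) = c b (\<phi> k v) + c b (\<phi> k w)" if "k \<in> S" for k
        using functional_compose[OF rep_linear[OF rep] f, of k] that SK v w by (auto simp: linear_functional_def)
      have "c b (P v \<oplus>\<^bsub>V\<^esub> P w) = c b (P v) + c b (P w)"
        using f PV v w by (simp add: linear_functional_def)
      then show "c b (P (v \<oplus>\<^bsub>V\<^esub> w)) = c b (P v \<oplus>\<^bsub>V\<^esub> P w)"
        using ap[OF f v] ap[OF f w] ap[OF f vs_add[OF V v w]] * by (simp add: sum.distrib add_divide_distrib)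
    qed
    show "P (z \<odot>\<^bsub>V\<^esub> v) = z \<odot>\<^bsub>V\<^esub> P v"
    proof (rule frame_eqI[OF V fr PV[OF vs_smult[OF V v]] vs_smult[OF V PV[OF v]]])
      fix b assume b: "b \<in> B"
      note f = frame_functional[OF fr b]
      have *: "c b (\<phi> k (z \<odot>\<^bsub>V\<^esub> v)) = z * c b (\<phi> k v)" if "k \<in> S" for k
        using functional_compose[OF rep_linear[OF rep] f, of k] that SK v by (auto simp: linear_functional_def)
      have "c b (z \<odot>\<^bsub>V\<^esub> P v) = z * c b (P v)"
        using f PV v by (simp add: linear_functional_def)
      then show "c b (P (z \<odot>\<^bsub>V\<^esub> v)) = c b (z \<odot>\<^bsub>V\<^esub> P v)"
        using ap[OF f v] ap[OF f vs_smult[OF V v]] * by (simp add: sum_distrib_left)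
    qed
  qed
  have P: "linear_map complex_field V V P"
    using PV Plin by (intro complex_linear_mapI V) auto
  have P': "linear_map complex_field V (V\<lparr>carrier := U\<rparr>) P"
    using PU Plin by (intro complex_linear_mapI V subspace_vectorspace[OF V cU]) auto
  have surj: "P ` carrier V = carrier (V\<lparr>carrier := U\<rparr>)"
    using PU Pid UV by (auto simp: image_iff) (metis subsetD)
  have fdU: "fin_dim_space (V\<lparr>carrier := U\<rparr>)" by (rule subspace_fin_dim_space[OF fd cU])
  have idU: "linear_map complex_field (V\<lparr>carrier := U\<rparr>) (V\<lparr>carrier := U\<rparr>) (\<lambda>v. v)"
    using fdU by (intro complex_linear_mapI) auto
  define Z where "Z = {v \<in> carrier V. P v = \<zero>\<^bsub>V\<lparr>carrier := U\<rparr>\<^esub>}"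
  have comm: "P (P v) = P v" if "v \<in> carrier V" for v using Pid[OF PU[OF that]] .
  note ex = trace_exact[OF fd P' surj P idU comm Z_def]
  have "endo_trace (V\<lparr>carrier := Z\<rparr>) P = 0"
  proof -
    have Zv: "vectorspace complex_field (V\<lparr>carrier := Z\<rparr>)" by (rule subspace_vectorspace[OF V ex(2)])
    have fdZ: "fin_dim_space (V\<lparr>carrier := Z\<rparr>)" by (rule subspace_fin_dim_space[OF fd ex(2)])
    obtain D e where fZ: "frame (V\<lparr>carrier := Z\<rparr>) D (\<lambda>b. b) e" using dual_frame_exists[OF fdZ] by metis
    have PZ: "linear_map complex_field (V\<lparr>carrier := Z\<rparr>) (V\<lparr>carrier := Z\<rparr>) P"
      using Plin ex(2) by (intro complex_linear_mapI Zv) (auto simp: Z_def closed_subspace_def lm_zero[OF P] vs_zero[OF V])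
    show ?thesis
      unfolding endo_trace_frame[OF PZ fZ]
      using frame_carrier[OF fZ] functional_zero[OF Zv frame_functional[OF fZ]]
      by (intro sum.neutral) (auto simp: Z_def)
  qed
  then have tP: "endo_trace V P = of_nat (vectorspace.dim complex_field (V\<lparr>carrier := U\<rparr>))"
    using ex(3) endo_trace_id[OF fdU] by simp
  have "endo_trace V P = (\<Sum>b\<in>B. (\<Sum>k\<in>S. c b (\<phi> k b)) / n)"
    unfolding endo_trace_frame[OF P fr] using ap frame_functional[OF fr] frame_carrier[OF fr] by simp
  also have "\<dots> = (\<Sum>k\<in>S. \<Sum>b\<in>B. c b (\<phi> k b)) / n"
    by (simp add: sum_divide_distrib[symmetric] sum.swap[of _ B S])
  also have "\<dots> = (\<Sum>k\<in>S. endo_trace V (\<phi> k)) / n"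
    using endo_trace_frame[OF rep_linear[OF rep] fr] SK by (intro arg_cong2[of _ _ _ _ "(/)"] sum.cong) auto
  finally show ?thesis using tP n unfolding U_def n_def by (simp add: field_simps)
qed

section \<open>Singular chains of low degree\<close>

lemma lookup_chain_scale [simp]: "Poly_Mapping.lookup (chain_scale z c) f = z * Poly_Mapping.lookup c f"
  by (simp add: chain_scale_def map.rep_eq when_def)

lemma chain_scale_simps [simp]:
  "chain_scale z 0 = 0" "chain_scale 0 c = 0" "chain_scale 1 c = c"
  "chain_scale z (chain_scale w c) = chain_scale (z * w) c"
  "chain_scale z (Poly_Mapping.single f w) = Poly_Mapping.single f (z * w)"
  by (rule poly_mapping_eqI, simp add: lookup_single when_def)+

lemma chain_scale_add: "chain_scale z (c + d) = chain_scale z c + chain_scale z d"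
  by (rule poly_mapping_eqI) (simp add: lookup_add algebra_simps)

lemma chain_scale_add_left: "chain_scale (z + w) c = chain_scale z c + chain_scale w c"
  by (rule poly_mapping_eqI) (simp add: lookup_add algebra_simps)

lemma chain_scale_diff: "chain_scale z (c - d) = chain_scale z c - chain_scale z d"
  by (rule poly_mapping_eqI) (simp add: lookup_minus algebra_simps)

lemma chain_scale_uminus: "chain_scale (-1) c = - c"
  by (rule poly_mapping_eqI) simp

lemma chain_scale_sum: "chain_scale z (\<Sum>i\<in>I. c i) = (\<Sum>i\<in>I. chain_scale z (c i))"
  by (induction I rule: infinite_finite_induct) (simp_all add: chain_scale_add)

lemma lookup_sum_pm: "Poly_Mapping.lookup (\<Sum>i\<in>I. c i) f = (\<Sum>i\<in>I. Poly_Mapping.lookup (c i) f)"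
  by (induction I rule: infinite_finite_induct) (simp_all add: lookup_add)

text \<open>The value on a chain of the cochain with values \<open>w\<close> on simplices.\<close>

definition chain_pairing :: "('b \<Rightarrow> complex) \<Rightarrow> ('b \<Rightarrow>\<^sub>0 complex) \<Rightarrow> complex" where
  "chain_pairing w c = (\<Sum>f\<in>Poly_Mapping.keys c. Poly_Mapping.lookup c f * w f)"

lemma chain_pairing_superset:
  assumes "finite A" "Poly_Mapping.keys c \<subseteq> A"
  shows "chain_pairing w c = (\<Sum>f\<in>A. Poly_Mapping.lookup c f * w f)"
  unfolding chain_pairing_def using assms
  by (intro sum.mono_neutral_left) (auto simp: in_keys_iff)

lemma chain_pairing_linear [simp]:
  "chain_pairing w 0 = 0"
  "chain_pairing w (c + d) = chain_pairing w c + chain_pairing w d"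
  "chain_pairing w (c - d) = chain_pairing w c - chain_pairing w d"
  "chain_pairing w (chain_scale z c) = z * chain_pairing w c"
  "chain_pairing w (Poly_Mapping.single f z) = z * w f"
proof -
  let ?A = "Poly_Mapping.keys c \<union> Poly_Mapping.keys d"
  have fin: "finite ?A" by simp
  have k: "Poly_Mapping.keys (c + d) \<subseteq> ?A" "Poly_Mapping.keys (c - d) \<subseteq> ?A" "Poly_Mapping.keys (chain_scale z c) \<subseteq> ?A"
    "Poly_Mapping.keys c \<subseteq> ?A" "Poly_Mapping.keys d \<subseteq> ?A"
    by (auto simp: in_keys_iff lookup_add lookup_minus)
  show "chain_pairing w 0 = 0" by (simp add: chain_pairing_def)
  show "chain_pairing w (c + d) = chain_pairing w c + chain_pairing w d"
    "chain_pairing w (c - d) = chain_pairing w c - chain_pairing w d"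
    "chain_pairing w (chain_scale z c) = z * chain_pairing w c"
    unfolding k[THEN chain_pairing_superset[OF fin]]
    by (simp_all add: lookup_add lookup_minus algebra_simps sum.distrib sum_subtractf sum_distrib_left)
  show "chain_pairing w (Poly_Mapping.single f z) = z * w f"
    by (cases "z = 0") (simp_all add: chain_pairing_def)
qed

lemma lookup_linear_extend:
  "Poly_Mapping.lookup (linear_extend h c) g = chain_pairing (\<lambda>f. Poly_Mapping.lookup (h f) g) c"
  by (simp add: linear_extend_def chain_pairing_def lookup_sum_pm)

lemma linear_extend_simps [simp]:
  "linear_extend h 0 = 0"
  "linear_extend h (c + d) = linear_extend h c + linear_extend h d"
  "linear_extend h (c - d) = linear_extend h c - linear_extend h d"
  "linear_extend h (chain_scale z c) = chain_scale z (linear_extend h c)"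
  "linear_extend h (Poly_Mapping.single f z) = chain_scale z (h f)"
  by (rule poly_mapping_eqI, simp add: lookup_linear_extend lookup_add lookup_minus)+

lemma chain_pairing_sum: "chain_pairing h (\<Sum>i\<in>I. c i) = (\<Sum>i\<in>I. chain_pairing h (c i))"
  by (induction I rule: infinite_finite_induct) simp_all

lemma chain_expand: "(c :: 'b \<Rightarrow>\<^sub>0 complex) = (\<Sum>f\<in>Poly_Mapping.keys c. Poly_Mapping.single f (Poly_Mapping.lookup c f))"
  by (rule poly_mapping_eqI)
    (auto simp: lookup_sum_pm lookup_single when_def if_distrib sum.If_cases in_keys_iff not_in_keys_iff_lookup_eq_zero)

lemma chain_span_induct [consumes 1, case_names zero add single]:
  fixes c :: "'b \<Rightarrow>\<^sub>0 complex"
  assumes "Poly_Mapping.keys c \<subseteq> A"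
    and "P 0" "\<And>c d. P c \<Longrightarrow> P d \<Longrightarrow> P (c + d)" "\<And>f z. f \<in> A \<Longrightarrow> P (Poly_Mapping.single f z)"
  shows "P c"
proof -
  have "P (\<Sum>f\<in>F. Poly_Mapping.single f (Poly_Mapping.lookup c f))" if "finite F" "F \<subseteq> A" for F
    using that by (induction F rule: finite_induct) (auto intro: assms)
  then show ?thesis using chain_expand[of c] assms(1) by (metis finite_keys)
qed

lemma complex_boundary_linear [simp]:
  "complex_boundary p 0 = 0"
  "complex_boundary p (c + d) = complex_boundary p c + complex_boundary p d"
  "complex_boundary p (c - d) = complex_boundary p c - complex_boundary p d"
  "complex_boundary p (chain_scale z c) = chain_scale z (complex_boundary p c)"
  by (simp_all add: complex_boundary_def)

lemma complex_boundary_sum: "complex_boundary p (\<Sum>i\<in>I. c i) = (\<Sum>i\<in>I. complex_boundary p (c i))"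
  by (induction I rule: infinite_finite_induct) simp_all

lemma complex_chain_map_linear [simp]:
  "complex_chain_map p g 0 = 0"
  "complex_chain_map p g (c + d) = complex_chain_map p g c + complex_chain_map p g d"
  "complex_chain_map p g (c - d) = complex_chain_map p g c - complex_chain_map p g d"
  "complex_chain_map p g (chain_scale z c) = chain_scale z (complex_chain_map p g c)"
  "complex_chain_map p g (Poly_Mapping.single f z) = Poly_Mapping.single (simplex_map p g f) z"
  by (simp_all add: complex_chain_map_def)

lemma complex_chain_map_sum: "complex_chain_map p g (\<Sum>i\<in>I. c i) = (\<Sum>i\<in>I. complex_chain_map p g (c i))"
  by (induction I rule: infinite_finite_induct) simp_all

lemma keys_subspace:
  "Poly_Mapping.keys c \<subseteq> A \<Longrightarrow> Poly_Mapping.keys d \<subseteq> A \<Longrightarrow> Poly_Mapping.keys (c + d) \<subseteq> A"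
  "Poly_Mapping.keys c \<subseteq> A \<Longrightarrow> Poly_Mapping.keys d \<subseteq> A \<Longrightarrow> Poly_Mapping.keys (c - d) \<subseteq> A"
  "Poly_Mapping.keys c \<subseteq> A \<Longrightarrow> Poly_Mapping.keys (chain_scale z c) \<subseteq> A"
  for c d :: "'b \<Rightarrow>\<^sub>0 complex"
  using keys_add[of c d] keys_diff[of c d] by (auto simp: subset_iff in_keys_iff)

lemma carrier_chain_space [simp]:
  "c \<in> carrier (chain_space p X) \<longleftrightarrow> Poly_Mapping.keys c \<subseteq> singular_simplex_set p X"
  "c \<oplus>\<^bsub>chain_space p X\<^esub> d = c + d" "z \<odot>\<^bsub>chain_space p X\<^esub> c = chain_scale z c"
  "\<zero>\<^bsub>chain_space p X\<^esub> = 0"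
  by (simp_all add: chain_space_def)

lemma boundaries_closed:
  shows boundaries_zero: "0 \<in> complex_boundaries p X"
    and boundaries_add: "c \<in> complex_boundaries p X \<Longrightarrow> d \<in> complex_boundaries p X \<Longrightarrow> c + d \<in> complex_boundaries p X"
    and boundaries_diff: "c \<in> complex_boundaries p X \<Longrightarrow> d \<in> complex_boundaries p X \<Longrightarrow> c - d \<in> complex_boundaries p X"
    and boundaries_scale: "c \<in> complex_boundaries p X \<Longrightarrow> chain_scale z c \<in> complex_boundaries p X"
proof -
  show "0 \<in> complex_boundaries p X"
    unfolding complex_boundaries_def by (intro image_eqI[of _ _ 0]) simp_all
  have ex: "\<exists>a. Poly_Mapping.keys a \<subseteq> singular_simplex_set (Suc p) X \<and> c = complex_boundary (Suc p) a"
    if "c \<in> complex_boundaries p X" for c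
    using that unfolding complex_boundaries_def image_iff Bex_def carrier_chain_space .
  have mem: "complex_boundary (Suc p) a \<in> complex_boundaries p X"
    if "Poly_Mapping.keys a \<subseteq> singular_simplex_set (Suc p) X" for a
    using that by (auto simp: complex_boundaries_def)
  show "c + d \<in> complex_boundaries p X" if "c \<in> complex_boundaries p X" "d \<in> complex_boundaries p X"
    using ex[OF that(1)] ex[OF that(2)] mem[OF keys_subspace(1)] by fastforce
  show "c - d \<in> complex_boundaries p X" if "c \<in> complex_boundaries p X" "d \<in> complex_boundaries p X"
    using ex[OF that(1)] ex[OF that(2)] mem[OF keys_subspace(2)] by fastforce
  show "chain_scale z c \<in> complex_boundaries p X" if "c \<in> complex_boundaries p X"
    using ex[OF that] mem[OF keys_subspace(3)] by fastforce
qed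

lemma boundaries_uminus: "c \<in> complex_boundaries p X \<Longrightarrow> - c \<in> complex_boundaries p X"
  using boundaries_diff[OF boundaries_zero] by simp

lemma boundary_chain_map_single:
  assumes f: "singular_simplex (Suc p) X f" and g: "continuous_map X Y g"
  shows "complex_boundary (Suc p) (complex_chain_map (Suc p) g (Poly_Mapping.single f z)) =
     complex_chain_map p g (complex_boundary (Suc p) (Poly_Mapping.single f z))"
proof -
  have "singular_face (Suc p) k (simplex_map (Suc p) g f) = simplex_map p g (singular_face (Suc p) k f)"
    if "k \<le> Suc p" for k
    using that singular_face_simplex_map[of "Suc p" k g f]
    by (simp add: simplex_map_def singular_face_def fun_eq_iff)
  then show ?thesis
    by (simp add: complex_boundary_def complex_chain_map_sum chain_scale_sum)
qed

lemma chain_map_boundaries: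
  assumes g: "continuous_map X Y g" and c: "c \<in> complex_boundaries p X"
  shows "complex_chain_map p g c \<in> complex_boundaries p Y"
proof -
  obtain d where d: "Poly_Mapping.keys d \<subseteq> singular_simplex_set (Suc p) X" "c = complex_boundary (Suc p) d"
    using c by (auto simp: complex_boundaries_def)
  have "complex_boundary (Suc p) (complex_chain_map (Suc p) g d) = complex_chain_map p g (complex_boundary (Suc p) d) \<and>
     Poly_Mapping.keys (complex_chain_map (Suc p) g d) \<subseteq> singular_simplex_set (Suc p) Y"
    using d(1)
  proof (induction d rule: chain_span_induct)
    case (single f z)
    then show ?case using boundary_chain_map_single[OF _ g] singular_simplex_simplex_map[OF _ g] by auto
  next
    case (add c d)
    then show ?case using keys_subspace(1) by auto
  qed simp
  then show ?thesis unfolding complex_boundaries_def d(2) by (metis carrier_chain_space(1) image_eqI)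
qed

definition point_chain :: "'a \<Rightarrow> 'a complex_chain" where
  "point_chain x = Poly_Mapping.single (restrict (\<lambda>_. x) (standard_simplex 0)) 1"

text \<open>Paths, and triangles in the plane, as singular simplices in barycentric coordinates;
  every simplex of degree 1 or 2 has this form.\<close>

definition path_simplex :: "(real \<Rightarrow> 'a) \<Rightarrow> (nat \<Rightarrow> real) \<Rightarrow> 'a" where
  "path_simplex g = restrict (\<lambda>x. g (x 1)) (standard_simplex 1)"

definition path_chain :: "(real \<Rightarrow> 'a) \<Rightarrow> 'a complex_chain" where
  "path_chain g = Poly_Mapping.single (path_simplex g) 1"

definition triangle_simplex :: "(real \<times> real \<Rightarrow> 'a) \<Rightarrow> (nat \<Rightarrow> real) \<Rightarrow> 'a" where
  "triangle_simplex F = restrict (\<lambda>x. F (x 1, x 2)) (standard_simplex 2)"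

definition unit_triangle :: "(real \<times> real) set" where
  "unit_triangle = {(s, t). 0 \<le> s \<and> 0 \<le> t \<and> s + t \<le> 1}"

definition bary1 :: "real \<Rightarrow> nat \<Rightarrow> real" where
  "bary1 t i = (if i = 0 then 1 - t else if i = 1 then t else 0)"

definition bary2 :: "real \<times> real \<Rightarrow> nat \<Rightarrow> real" where
  "bary2 p i = (if i = 0 then 1 - fst p - snd p else if i = 1 then fst p else if i = 2 then snd p else 0)"

lemma standard_simplex_1: "x \<in> standard_simplex 1 \<longleftrightarrow> (\<exists>t\<in>{0..1}. x = bary1 t)"
proof
  assume x: "x \<in> standard_simplex 1"
  have "x = bary1 (x 1)"
  proof
    fix i :: nat
    show "x i = bary1 (x 1) i"
      using x by (cases "i = 0"; cases "i = 1") (auto simp: standard_simplex_def bary1_def)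
  qed
  moreover have "x 1 \<in> {0..1}" using x by (auto simp: standard_simplex_def)
  ultimately show "\<exists>t\<in>{0..1}. x = bary1 t" by blast
qed (auto simp: standard_simplex_def bary1_def)

lemma standard_simplex_2: "x \<in> standard_simplex 2 \<longleftrightarrow> (\<exists>p\<in>unit_triangle. x = bary2 p)"
proof
  assume x: "x \<in> standard_simplex 2"
  have s: "x 0 + x 1 + x 2 = 1" using x by (auto simp: standard_simplex_def numeral_2_eq_2)
  have "x = bary2 (x 1, x 2)"
  proof
    fix i :: nat
    have "i = 0 \<or> i = 1 \<or> i = 2 \<or> i > 2" by linarith
    then show "x i = bary2 (x 1, x 2) i"
      using x s by (auto simp: standard_simplex_def bary2_def)
  qed
  moreover have "0 \<le> x 0" "0 \<le> x 1" "0 \<le> x 2" using x by (auto simp: standard_simplex_def)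
  then have "(x 1, x 2) \<in> unit_triangle" using s by (auto simp: standard_simplex_def unit_triangle_def)
  ultimately show "\<exists>p\<in>unit_triangle. x = bary2 p" by blast
qed (auto simp: standard_simplex_def bary2_def unit_triangle_def numeral_2_eq_2)

lemma bary_simps [simp]: "bary1 t 1 = t" "bary1 t (Suc 0) = t" "bary2 (s, t) 1 = s" "bary2 (s, t) (Suc 0) = s" "bary2 (s, t) 2 = t"
  by (simp_all add: bary1_def bary2_def)

lemma continuous_bary1: "continuous_map (top_of_set {0..1}) (subtopology (powertop_real UNIV) (standard_simplex 1)) bary1"
  unfolding continuous_map_in_subtopology
proof
  show "continuous_map (top_of_set {0..1}) (powertop_real UNIV) bary1"
    unfolding continuous_map_componentwise_UNIV
  proof
    show "continuous_map (top_of_set {0..1}) euclideanreal (\<lambda>t. bary1 t k)" for k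
      by (cases "k = 0"; cases "k = 1") (auto simp: bary1_def intro!: continuous_intros)
  qed
qed (use standard_simplex_1 in auto)

lemma continuous_bary2: "continuous_map (top_of_set unit_triangle) (subtopology (powertop_real UNIV) (standard_simplex 2)) bary2"
  unfolding continuous_map_in_subtopology
proof
  show "continuous_map (top_of_set unit_triangle) (powertop_real UNIV) bary2"
    unfolding continuous_map_componentwise_UNIV
  proof
    show "continuous_map (top_of_set unit_triangle) euclideanreal (\<lambda>t. bary2 t k)" for k
      by (cases "k = 0"; cases "k = 1"; cases "k = 2") (auto simp: bary2_def intro!: continuous_intros)
  qed
qed (use standard_simplex_2 in auto)

lemma coordinate1: "continuous_map (subtopology (powertop_real UNIV) (standard_simplex 1)) (top_of_set {0..1}) (\<lambda>x. x 1)"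
  unfolding continuous_map_in_subtopology
  by (auto intro!: continuous_map_from_subtopology continuous_map_product_projection simp: standard_simplex_def)

lemma coordinate2: "continuous_map (subtopology (powertop_real UNIV) (standard_simplex 2)) (top_of_set unit_triangle) (\<lambda>x. (x 1, x 2))"
  unfolding continuous_map_in_subtopology
proof
  have "continuous_on UNIV (\<lambda>x::nat\<Rightarrow>real. (x 1, x 2))"
    by (intro continuous_intros continuous_on_product_coordinates)
  then show "continuous_map (subtopology (powertop_real UNIV) (standard_simplex 2)) euclidean (\<lambda>x. (x 1, x 2))"
    by (intro continuous_map_from_subtopology) (simp add: euclidean_product_topology)
qed (auto simp: standard_simplex_2)

lemma singular_path_simplex:
  assumes "continuous_map (top_of_set {0..1}) Y g"
  shows "singular_simplex 1 Y (path_simplex g)"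
proof -
  have "continuous_map (subtopology (powertop_real UNIV) (standard_simplex 1)) Y (g \<circ> (\<lambda>x. x 1))"
    by (rule continuous_map_compose[OF coordinate1 assms])
  then show ?thesis
    unfolding singular_simplex_def path_simplex_def
    by (auto elim!: continuous_map_eq)
qed

lemma singular_triangle_simplex:
  assumes "continuous_map (top_of_set unit_triangle) Y F"
  shows "singular_simplex 2 Y (triangle_simplex F)"
proof -
  have "continuous_map (subtopology (powertop_real UNIV) (standard_simplex 2)) Y (F \<circ> (\<lambda>x. (x 1, x 2)))"
    by (rule continuous_map_compose[OF coordinate2 assms])
  then show ?thesis
    unfolding singular_simplex_def triangle_simplex_def
    by (auto elim!: continuous_map_eq)
qed

lemma singular_1_simplex_path:
  assumes "singular_simplex 1 Y f"
  obtains g where "continuous_map (top_of_set {0..1}) Y g" "f = path_simplex g"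
proof
  show "continuous_map (top_of_set {0..1}) Y (f \<circ> bary1)"
    using assms by (intro continuous_map_compose[OF continuous_bary1]) (simp add: singular_simplex_def)
  show "f = path_simplex (f \<circ> bary1)"
  proof (rule extensionalityI[of _ "standard_simplex 1"])
    show "f \<in> extensional (standard_simplex 1)" using assms by (simp add: singular_simplex_def)
    fix x assume x: "x \<in> standard_simplex 1"
    then obtain t where "x = bary1 t" using standard_simplex_1 by blast
    then show "f x = path_simplex (f \<circ> bary1) x" using x by (simp add: path_simplex_def)
  qed (simp add: path_simplex_def)
qed

lemma singular_2_simplex_triangle:
  assumes "singular_simplex 2 Y f"
  obtains F where "continuous_map (top_of_set unit_triangle) Y F" "f = triangle_simplex F"
proof
  show "continuous_map (top_of_set unit_triangle) Y (f \<circ> bary2)"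
    using assms by (intro continuous_map_compose[OF continuous_bary2]) (simp add: singular_simplex_def)
  show "f = triangle_simplex (f \<circ> bary2)"
  proof (rule extensionalityI[of _ "standard_simplex 2"])
    show "f \<in> extensional (standard_simplex 2)" using assms by (simp add: singular_simplex_def)
    fix x assume x: "x \<in> standard_simplex 2"
    then obtain p where "x = bary2 p" using standard_simplex_2 by blast
    then show "f x = triangle_simplex (f \<circ> bary2) x" using x by (cases p) (simp add: triangle_simplex_def)
  qed (simp add: triangle_simplex_def)
qed

lemma path_simplex_cong:
  assumes "\<And>t. 0 \<le> t \<Longrightarrow> t \<le> 1 \<Longrightarrow> g t = h t"
  shows "path_simplex g = path_simplex h"
  unfolding path_simplex_def using assms by (intro restrict_ext) (auto simp: standard_simplex_def)

lemma path_chain_cong: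
  assumes "\<And>t. 0 \<le> t \<Longrightarrow> t \<le> 1 \<Longrightarrow> g t = h t"
  shows "path_chain g = path_chain h"
  unfolding path_chain_def using path_simplex_cong[OF assms] by simp

lemma boundary_path_chain: "complex_boundary 1 (path_chain g) = point_chain (g 1) - point_chain (g 0)"
proof -
  have 1: "singular_face 1 0 (path_simplex g) = restrict (\<lambda>_. g 1) (standard_simplex 0)"
    unfolding singular_face_def diff_self_eq_0 One_nat_def
  proof (intro restrict_ext)
    fix x :: "nat \<Rightarrow> real" assume x: "x \<in> standard_simplex 0"
    have "simplical_face 0 x \<in> standard_simplex (Suc 0)"
      using simplical_face_in_standard_simplex[of 1 0 x] x by simp
    then have "(path_simplex g \<circ> simplical_face 0) x = g (simplical_face 0 x (Suc 0))"
      by (simp add: path_simplex_def)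
    also have "simplical_face 0 x (Suc 0) = 1"
      using x by (simp add: simplical_face_def standard_simplex_0)
    finally show "(path_simplex g \<circ> simplical_face 0) x = g 1" .
  qed
  have 2: "singular_face 1 1 (path_simplex g) = restrict (\<lambda>_. g 0) (standard_simplex 0)"
    unfolding singular_face_def diff_self_eq_0 One_nat_def
  proof (intro restrict_ext)
    fix x :: "nat \<Rightarrow> real" assume x: "x \<in> standard_simplex 0"
    have "simplical_face (Suc 0) x \<in> standard_simplex (Suc 0)"
      using simplical_face_in_standard_simplex[of 1 1 x] x by simp
    then have "(path_simplex g \<circ> simplical_face (Suc 0)) x = g (simplical_face (Suc 0) x (Suc 0))"
      by (simp add: path_simplex_def)
    also have "simplical_face (Suc 0) x (Suc 0) = 0" by (simp add: simplical_face_def)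
    finally show "(path_simplex g \<circ> simplical_face (Suc 0)) x = g 0" .
  qed
  show ?thesis
    using 1 2 by (simp add: complex_boundary_def path_chain_def point_chain_def single_uminus)
qed

lemma boundary_triangle:
  "complex_boundary 2 (Poly_Mapping.single (triangle_simplex F) 1) =
     path_chain (\<lambda>t. F (1 - t, t)) - path_chain (\<lambda>t. F (0, t)) + path_chain (\<lambda>t. F (t, 0))"
proof -
  have face: "singular_face 2 k (triangle_simplex F) = path_simplex (\<lambda>t. F (h t))"
    if "k \<le> 2" "\<And>t. (simplical_face k (bary1 t) 1, simplical_face k (bary1 t) 2) = h t" for k h
  proof (rule extensionalityI[of _ "standard_simplex 1"])
    fix x assume x: "x \<in> standard_simplex 1"
    then obtain t where t: "x = bary1 t" using standard_simplex_1 by blast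
    have "simplical_face k x \<in> standard_simplex 2"
      using simplical_face_in_standard_simplex[of 2 k x] x that(1) by simp
    then show "singular_face 2 k (triangle_simplex F) x = path_simplex (\<lambda>t. F (h t)) x"
      using x that(2)[of t] by (simp add: singular_face_def triangle_simplex_def path_simplex_def t)
  qed (simp_all add: singular_face_def path_simplex_def)
  have 0: "singular_face 2 0 (triangle_simplex F) = path_simplex (\<lambda>t. F (1 - t, t))"
    by (rule face) (simp_all add: simplical_face_def bary1_def)
  have 1: "singular_face 2 1 (triangle_simplex F) = path_simplex (\<lambda>t. F (0, t))"
    by (rule face) (simp_all add: simplical_face_def bary1_def)
  have 2: "singular_face 2 2 (triangle_simplex F) = path_simplex (\<lambda>t. F (t, 0))"
    by (rule face) (simp_all add: simplical_face_def bary1_def)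
  have "{..2::nat} = {0, 1, 2}" by auto
  then show ?thesis
    using 0 1 2 by (simp add: complex_boundary_def path_chain_def single_uminus)
qed

definition homologous :: "'a topology \<Rightarrow> 'a complex_chain \<Rightarrow> 'a complex_chain \<Rightarrow> bool" where
  "homologous Y c d \<longleftrightarrow> c - d \<in> complex_boundaries 1 Y"

lemma homologous_refl [simp]: "homologous Y c c"
  by (simp add: homologous_def boundaries_zero)

lemma homologous_sym: "homologous Y c d \<Longrightarrow> homologous Y d c"
  using boundaries_uminus unfolding homologous_def by fastforce

lemma homologous_trans [trans]: "homologous Y c d \<Longrightarrow> homologous Y d e \<Longrightarrow> homologous Y c e"
  using boundaries_add[of "c - d" 1 Y "d - e"] unfolding homologous_def by simp

lemma homologous_add: "homologous Y c d \<Longrightarrow> homologous Y c' d' \<Longrightarrow> homologous Y (c + c') (d + d')"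
  using boundaries_add[of "c - d" 1 Y "c' - d'"] unfolding homologous_def by (simp add: algebra_simps)

lemma homologous_scale: "homologous Y c d \<Longrightarrow> homologous Y (chain_scale z c) (chain_scale z d)"
  using boundaries_scale[of "c - d" 1 Y z] unfolding homologous_def by (simp add: chain_scale_diff)

definition segment :: "'b::real_vector \<Rightarrow> 'b \<Rightarrow> real \<Rightarrow> 'b" where
  "segment A B t = A + t *\<^sub>R (B - A)"

lemma segment_ends [simp]: "segment A B 0 = A" "segment A B 1 = B"
  by (simp_all add: segment_def)

text \<open>The segments bound an affine triangle, which lies in \<open>D\<close> by convexity. All
  homologies in the surface come from this one.\<close>

lemma path_triangle:
  fixes D :: "'b::real_normed_vector set"
  assumes D: "convex D" and \<Psi>: "continuous_map (top_of_set D) Y \<Psi>" and A: "A \<in> D" "B \<in> D" "C \<in> D"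
  shows "homologous Y (path_chain (\<lambda>t. \<Psi> (segment A B t)) + path_chain (\<lambda>t. \<Psi> (segment B C t)))
     (path_chain (\<lambda>t. \<Psi> (segment A C t)))"
proof -
  define \<alpha> where "\<alpha> = (\<lambda>p. A + fst p *\<^sub>R (B - A) + snd p *\<^sub>R (C - A))"
  have "\<alpha> p \<in> D" if "p \<in> unit_triangle" for p
  proof -
    obtain s t where p0: "p = (s, t)" by (cases p)
    then have p: "p = (s, t)" "0 \<le> s" "0 \<le> t" "s + t \<le> 1" using that by (auto simp: unit_triangle_def)
    have "convex hull {A, B, C} \<subseteq> D" using A D by (intro hull_minimal) auto
    moreover have "(1 - s - t) *\<^sub>R A + s *\<^sub>R B + t *\<^sub>R C \<in> convex hull {A, B, C}"
      unfolding convex_hull_3 using p by fastforce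
    ultimately have "(1 - s - t) *\<^sub>R A + s *\<^sub>R B + t *\<^sub>R C \<in> D" by blast
    then show ?thesis by (simp add: \<alpha>_def p algebra_simps)
  qed
  then have c: "continuous_map (top_of_set unit_triangle) (top_of_set D) \<alpha>"
    unfolding continuous_map_in_subtopology \<alpha>_def by (auto intro!: continuous_intros)
  define F where "F = \<Psi> \<circ> \<alpha>"
  have F: "continuous_map (top_of_set unit_triangle) Y F"
    unfolding F_def by (rule continuous_map_compose[OF c \<Psi>])
  have "complex_boundary 2 (Poly_Mapping.single (triangle_simplex F) 1) \<in> complex_boundaries 1 Y"
    unfolding complex_boundaries_def using singular_triangle_simplex[OF F]
    by (intro image_eqI[of _ _ "Poly_Mapping.single (triangle_simplex F) 1"]) (auto simp: numeral_2_eq_2)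
  moreover have "(\<lambda>t. F (1 - t, t)) = (\<lambda>t. \<Psi> (segment B C t))" "(\<lambda>t. F (0, t)) = (\<lambda>t. \<Psi> (segment A C t))"
    "(\<lambda>t. F (t, 0)) = (\<lambda>t. \<Psi> (segment A B t))"
    by (simp_all add: F_def \<alpha>_def segment_def algebra_simps)
  ultimately show ?thesis
    by (simp add: homologous_def boundary_triangle algebra_simps)
qed

text \<open>A degenerate triangle shows that twice the constant path is homologous to
  itself.\<close>

lemma path_constant:
  assumes "x \<in> topspace Y"
  shows "homologous Y (path_chain (\<lambda>t. x)) 0"
proof -
  have "homologous Y (path_chain (\<lambda>t. x) + path_chain (\<lambda>t. x)) (path_chain (\<lambda>t. x))"
    using path_triangle[of "UNIV :: real set" Y "\<lambda>_. x" 0 0 0] assms by simp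
  then show ?thesis by (simp add: homologous_def)
qed

section \<open>Windings of nonvanishing functions along paths\<close>

text \<open>Two logarithms differ by a multiple of \<open>2 * pi * \<i>\<close>, which is constant
  on a connected set.\<close>

lemma exponential_lift_unique:
  fixes \<theta> \<theta>' :: "real \<Rightarrow> complex"
  assumes c: "continuous_on {0..1} \<theta>" "continuous_on {0..1} \<theta>'"
    and e: "\<And>t. t \<in> {0..1} \<Longrightarrow> exp (\<theta> t) = exp (\<theta>' t)"
  shows "\<theta> 1 - \<theta> 0 = \<theta>' 1 - \<theta>' 0"
proof -
  define h where "h t = \<theta> t - \<theta>' t" for t
  have "h constant_on {0..1}"
  proof (rule continuous_discrete_range_constant)
    show "connected {0..1::real}" by simp
    show "continuous_on {0..1} h" unfolding h_def using c by (intro continuous_intros)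
    fix x :: real assume x: "x \<in> {0..1}"
    have "2 * pi \<le> norm (h y - h x)" if y: "y \<in> {0..1}" "h y \<noteq> h x" for y
    proof -
      have "exp (h y) = 1" "exp (h x) = 1"
        using e x y by (simp_all add: h_def exp_diff)
      then have "exp (h y - h x) = 1" by (simp add: exp_diff)
      then obtain n :: int where n: "Re (h y - h x) = 0" "Im (h y - h x) = of_int (2 * n) * pi"
        by (auto simp: exp_eq_1)
      have "n \<noteq> 0" using n y(2) by (auto simp: complex_eq_iff)
      then have "1 \<le> \<bar>real_of_int n\<bar>" by linarith
      then have "2 * pi * 1 \<le> 2 * pi * \<bar>real_of_int n\<bar>" by (intro mult_left_mono) auto
      then have "2 * pi \<le> \<bar>Im (h y - h x)\<bar>" unfolding n(2) by (simp add: abs_mult)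
      then show ?thesis using abs_Im_le_cmod order_trans by blast
    qed
    then show "\<exists>e>0. \<forall>y. y \<in> {0..1} \<and> h y \<noteq> h x \<longrightarrow> e \<le> norm (h y - h x)"
      by (intro exI[of _ "2 * pi"]) auto
  qed
  then have "h 1 = h 0" unfolding constant_on_def by force
  then show ?thesis by (simp add: h_def algebra_simps)
qed

text \<open>The increment of a logarithm of \<open>f\<close> along the path
  \<open>\<sigma>\<close>.\<close>

definition log_change :: "('a \<Rightarrow> complex) \<Rightarrow> ((nat \<Rightarrow> real) \<Rightarrow> 'a) \<Rightarrow> complex" where
  "log_change f \<sigma> = (SOME d. \<exists>\<theta>. continuous_on {0..1} \<theta> \<and>
     (\<forall>t\<in>{0..1}. f (\<sigma> (bary1 t)) = exp (\<theta> t)) \<and> d = \<theta> 1 - \<theta> 0)"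

lemma log_change_path:
  assumes "continuous_on {0..1} \<theta>" "\<And>t. t \<in> {0..1} \<Longrightarrow> f (g t) = exp (\<theta> t)"
  shows "log_change f (path_simplex g) = \<theta> 1 - \<theta> 0"
proof -
  have g: "path_simplex g (bary1 t) = g t" if "t \<in> {0..1}" for t
    using that standard_simplex_1 by (auto simp: path_simplex_def)
  show ?thesis
    unfolding log_change_def
  proof (rule some_equality)
    show "\<exists>\<theta>'. continuous_on {0..1} \<theta>' \<and> (\<forall>t\<in>{0..1}. f (path_simplex g (bary1 t)) = exp (\<theta>' t)) \<and>
        \<theta> 1 - \<theta> 0 = \<theta>' 1 - \<theta>' 0"
      using assms g by (intro exI[of _ \<theta>]) auto
    fix d assume "\<exists>\<theta>'. continuous_on {0..1} \<theta>' \<and> (\<forall>t\<in>{0..1}. f (path_simplex g (bary1 t)) = exp (\<theta>' t)) \<and>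
        d = \<theta>' 1 - \<theta>' 0"
    then obtain \<theta>' where "continuous_on {0..1} \<theta>'" "\<forall>t\<in>{0..1}. f (path_simplex g (bary1 t)) = exp (\<theta>' t)"
      "d = \<theta>' 1 - \<theta>' 0" by blast
    then show "d = \<theta> 1 - \<theta> 0"
      using exponential_lift_unique[of \<theta>' \<theta>] assms g by auto
  qed
qed

lemma convex_unit_triangle: "convex unit_triangle"
proof -
  have "unit_triangle = {p. (1, 0) \<bullet> p \<ge> 0} \<inter> {p. (0, 1) \<bullet> p \<ge> 0} \<inter> {p. (1, 1) \<bullet> p \<le> (1::real)}"
    by (auto simp: unit_triangle_def)
  then show ?thesis
    by (metis convex_Int convex_halfspace_ge convex_halfspace_le)
qed

text \<open>On a triangle \<open>f\<close> has a continuous logarithm, whose increments along the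
  three sides cancel. So \<open>log_change f\<close> is a cocycle, a substitute for the integral of
  the logarithmic derivative.\<close>

lemma log_change_boundary:
  assumes f: "continuous_map Y euclidean f" and nz: "\<And>y. y \<in> topspace Y \<Longrightarrow> f y \<noteq> 0"
    and c: "c \<in> complex_boundaries 1 Y"
  shows "chain_pairing (log_change f) c = 0"
proof -
  obtain d where d: "Poly_Mapping.keys d \<subseteq> singular_simplex_set 2 Y" "c = complex_boundary 2 d"
    using c by (auto simp: complex_boundaries_def numeral_2_eq_2)
  have "chain_pairing (log_change f) (complex_boundary 2 d) = 0"
    using d(1)
  proof (induction d rule: chain_span_induct)
    case (single \<sigma> z)
    then obtain F where F: "continuous_map (top_of_set unit_triangle) Y F" "\<sigma> = triangle_simplex F"
      using singular_2_simplex_triangle by blast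
    have "continuous_map (top_of_set unit_triangle) euclidean (f \<circ> F)"
      by (rule continuous_map_compose[OF F(1) f])
    then have "continuous_on unit_triangle (f \<circ> F)" by simp
    moreover have "(f \<circ> F) p \<noteq> 0" if "p \<in> unit_triangle" for p
      using nz F(1) that by (auto simp: continuous_map_def Pi_iff)
    ultimately obtain \<theta> where \<theta>: "continuous_on unit_triangle \<theta>" "\<And>p. p \<in> unit_triangle \<Longrightarrow> (f \<circ> F) p = exp (\<theta> p)"
      using continuous_logarithm_on_contractible[OF _ convex_imp_contractible[OF convex_unit_triangle]] by blast
    have side: "log_change f (path_simplex (\<lambda>t. F (h t))) = \<theta> (h 1) - \<theta> (h 0)"
      if "continuous_on {0..1} h" "\<And>t. t \<in> {0..1} \<Longrightarrow> h t \<in> unit_triangle" for h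
    proof (rule log_change_path)
      show "continuous_on {0..1} (\<lambda>t. \<theta> (h t))"
        by (rule continuous_on_compose2[OF \<theta>(1) that(1)]) (use that in auto)
      show "f (F (h t)) = exp (\<theta> (h t))" if "t \<in> {0..1}" for t
        using \<theta>(2)[of "h t"] \<open>\<And>t. t \<in> {0..1} \<Longrightarrow> h t \<in> unit_triangle\<close> that by simp
    qed
    have "chain_pairing (log_change f) (complex_boundary 2 (Poly_Mapping.single \<sigma> 1)) = 0"
    proof -
      have "log_change f (path_simplex (\<lambda>t. F (1 - t, t))) = \<theta> (1 - 1, 1) - \<theta> (1 - 0, 0)"
        by (rule side) (auto simp: unit_triangle_def intro!: continuous_intros)
      moreover have "log_change f (path_simplex (\<lambda>t. F (0, t))) = \<theta> (0, 1) - \<theta> (0, 0)"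
        by (rule side) (auto simp: unit_triangle_def intro!: continuous_intros)
      moreover have "log_change f (path_simplex (\<lambda>t. F (t, 0))) = \<theta> (1, 0) - \<theta> (0, 0)"
        by (rule side) (auto simp: unit_triangle_def intro!: continuous_intros)
      ultimately show ?thesis
        unfolding F(2) boundary_triangle path_chain_def by simp
    qed
    moreover have "Poly_Mapping.single \<sigma> z = chain_scale z (Poly_Mapping.single \<sigma> 1)" by simp
    ultimately show ?case by (metis chain_pairing_linear(4) complex_boundary_linear(4) mult_zero_right)
  qed simp_all
  then show ?thesis using d(2) by simp
qed

section \<open>The surface and its cellular chains\<close>

lemma continuous_map_discrete_prod:
  assumes "\<And>s. s \<in> X \<Longrightarrow> continuous_map T Y (\<lambda>p. f (s, p))"
  shows "continuous_map (prod_topology (discrete_topology X) T) Y f"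
  unfolding continuous_map_def
proof (intro conjI allI impI)
  show "f \<in> topspace (prod_topology (discrete_topology X) T) \<rightarrow> topspace Y"
    using assms by (auto simp: continuous_map_def Pi_iff)
  fix U assume U: "openin Y U"
  have "{x \<in> topspace (prod_topology (discrete_topology X) T). f x \<in> U} =
      (\<Union>s\<in>X. {s} \<times> {p \<in> topspace T. f (s, p) \<in> U})" by auto
  moreover have "openin (prod_topology (discrete_topology X) T) ({s} \<times> {p \<in> topspace T. f (s, p) \<in> U})"
    if "s \<in> X" for s
    using assms[OF that] U that by (auto simp: openin_prod_Times_iff continuous_map_def)
  then have "openin (prod_topology (discrete_topology X) T) (\<Union>s\<in>X. {s} \<times> {p \<in> topspace T. f (s, p) \<in> U})"
    by (intro openin_Union) auto
  ultimately show "openin (prod_topology (discrete_topology X) T) {x \<in> topspace (prod_topology (discrete_topology X) T). f x \<in> U}"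
    by (simp only:)
qed

lemma homologous_move: "homologous Y (a + b) c \<Longrightarrow> homologous Y (c - b) a"
  using homologous_sym[of Y "a + b" c] by (simp add: homologous_def algebra_simps)

context origami_data
begin

abbreviation squares where "squares \<equiv> rcosets H"
abbreviation rt where "rt s \<equiv> s #> g_r"
abbreviation up where "up s \<equiv> s #> g_u"
abbreviation unit_square :: "(real \<times> real) set" where "unit_square \<equiv> {0..1} \<times> {0..1}"
abbreviation tiles where "tiles \<equiv> prod_topology (discrete_topology squares) (top_of_set unit_square)"
abbreviation surface where "surface \<equiv> origami G H g_r g_u"
abbreviation pt where "pt \<equiv> origami_point G H g_r g_u"
abbreviation gluing where "gluing \<equiv> square_gluing G H g_r g_u"

lemma squares_translate:
  assumes "s \<in> squares"
  shows "s \<subseteq> carrier G" "\<And>g. g \<in> carrier G \<Longrightarrow> s #> g \<in> squares"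
    "\<And>g h. g \<in> carrier G \<Longrightarrow> h \<in> carrier G \<Longrightarrow> s #> g #> h = s #> (g \<otimes> h)" "s #> \<one> = s"
proof -
  have HG: "H \<subseteq> carrier G" using subgroup.subset[OF subgroup_H] .
  show sG: "s \<subseteq> carrier G" using assms rcosets_part_G[OF subgroup_H] by blast
  show m: "\<And>g h. g \<in> carrier G \<Longrightarrow> h \<in> carrier G \<Longrightarrow> s #> g #> h = s #> (g \<otimes> h)"
    using coset_mult_assoc[OF sG] by simp
  show "s #> \<one> = s" using coset_mult_one[OF sG] .
  obtain a where a: "a \<in> carrier G" "s = H #> a" using assms by (auto simp: RCOSETS_def)
  show "s #> g \<in> squares" if "g \<in> carrier G" for g
    using coset_mult_assoc[OF HG a(1) that] a that by (auto simp: RCOSETS_def)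
qed

lemma square_cancel:
  assumes "s \<in> squares" "g \<in> carrier G"
  shows "s #> g #> inv g = s" "s #> inv g #> g = s"
  using assms squares_translate[OF assms(1)] by simp_all

lemma rt_up_closed: "s \<in> squares \<Longrightarrow> rt s \<in> squares" "s \<in> squares \<Longrightarrow> up s \<in> squares"
  using squares_translate(2) g_r_closed g_u_closed by auto

text \<open>The elements \<open>g_r\<close> and \<open>g_u\<close> generate \<open>G\<close>, so
  right and up moves connect any two squares.\<close>

lemma squares_connected:
  assumes "\<And>s. s \<in> squares \<Longrightarrow> f (rt s) = f s" "\<And>s. s \<in> squares \<Longrightarrow> f (up s) = f s"
    and "s \<in> squares" "s' \<in> squares"
  shows "f s = f s'"
proof -
  have inv: "f (s #> g) = f s" if "g \<in> generate G {g_r, g_u}" "s \<in> squares" for g s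
    using that
  proof (induction g arbitrary: s rule: generate.induct)
    case one
    then show ?case using squares_translate(4) by simp
  next
    case (incl h)
    then show ?case using assms by auto
  next
    case (inv h)
    then have h: "h \<in> carrier G" using g_r_closed g_u_closed by auto
    have "f (s #> inv h #> h) = f (s #> inv h)"
      using inv assms squares_translate(2)[OF inv(2), of "inv h"] h by auto
    then show ?case using square_cancel[OF inv(2) h] by simp
  next
    case (eng h1 h2)
    have h: "h1 \<in> carrier G" "h2 \<in> carrier G"
      using eng generate_in_carrier[of "{g_r, g_u}"] g_r_closed g_u_closed by auto
    have "f (s #> h1 #> h2) = f s"
      using eng squares_translate(2)[OF eng.prems h(1)] by metis
    then show ?case using squares_translate(3)[OF eng.prems h] by simp
  qed
  obtain a a' where a: "a \<in> carrier G" "s = H #> a" "a' \<in> carrier G" "s' = H #> a'"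
    using assms(3,4) by (auto simp: RCOSETS_def)
  have HG: "H \<subseteq> carrier G" using subgroup.subset[OF subgroup_H] .
  have "s' = s #> (inv a \<otimes> a')"
    using a coset_mult_assoc[OF HG a(1), of "inv a \<otimes> a'"] by (simp add: m_assoc[symmetric])
  then show ?thesis using inv[of "inv a \<otimes> a'" s] a assms(3) generated by simp
qed

lemma finite_squares: "finite squares"
  using finite_G rcosets_part_G[OF subgroup_H] by (metis finite_UnionD)

lemma squares_nonempty: "squares \<noteq> {}"
  using one_closed by (auto simp: RCOSETS_def)

abbreviation glue_rel where "glue_rel \<equiv> (gluing \<union> gluing\<inverse>)\<^sup>*"

lemma gluing_right: "s \<in> squares \<Longrightarrow> y \<in> {0..1} \<Longrightarrow> ((s, 1, y), (rt s, 0, y)) \<in> gluing"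
  and gluing_up: "s \<in> squares \<Longrightarrow> x \<in> {0..1} \<Longrightarrow> ((s, x, 1), (up s, x, 0)) \<in> gluing"
  unfolding square_gluing_def by auto

lemma glue_rel_sym: "(p, q) \<in> glue_rel \<Longrightarrow> (q, p) \<in> glue_rel"
  by (rule symD[OF sym_rtrancl]) (auto simp: sym_def)

lemma pt_eq_iff: "pt p = pt q \<longleftrightarrow> (p, q) \<in> glue_rel"
proof
  assume "pt p = pt q"
  moreover have "q \<in> pt q" by (simp add: origami_point_def)
  ultimately show "(p, q) \<in> glue_rel" by (auto simp: origami_point_def)
next
  assume R: "(p, q) \<in> glue_rel"
  have *: "(p, x) \<in> glue_rel \<longleftrightarrow> (q, x) \<in> glue_rel" for x
    by (rule iffI) (rule rtrancl_trans[OF glue_rel_sym[OF R]] rtrancl_trans[OF R], assumption)+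
  show "pt p = pt q"
    unfolding origami_point_def
    by (intro equalityI subsetI) (simp_all only: Image_singleton_iff *)
qed

lemma pt_glue: "(p, q) \<in> gluing \<Longrightarrow> pt p = pt q"
  unfolding pt_eq_iff by auto

lemma pt_right: "s \<in> squares \<Longrightarrow> 0 \<le> y \<Longrightarrow> y \<le> 1 \<Longrightarrow> pt (s, 1, y) = pt (rt s, 0, y)"
  and pt_up: "s \<in> squares \<Longrightarrow> 0 \<le> x \<Longrightarrow> x \<le> 1 \<Longrightarrow> pt (s, x, 1) = pt (up s, x, 0)"
  using pt_glue gluing_right gluing_up by auto

lemma gluing_tiles:
  assumes "(p, q) \<in> gluing" shows "p \<in> squares \<times> unit_square" "q \<in> squares \<times> unit_square"
proof -
  consider s y where "p = (s, 1, y)" "q = (rt s, 0, y)" "s \<in> squares" "y \<in> {0..1}"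
    | s x where "p = (s, x, 1)" "q = (up s, x, 0)" "s \<in> squares" "x \<in> {0..1}"
    using assms unfolding square_gluing_def by blast
  then show "p \<in> squares \<times> unit_square" "q \<in> squares \<times> unit_square"
    using rt_up_closed by (cases; simp)+
qed

text \<open>This is how distinct points of the surface are told apart.\<close>

lemma glue_rel_invariant:
  assumes "\<And>p q. (p, q) \<in> gluing \<Longrightarrow> f p = f q" and "(p, q) \<in> glue_rel"
  shows "f p = f q"
  using assms(2) by (induction rule: rtrancl_induct) (auto dest: assms(1))

lemma glue_rel_tiles:
  assumes "(p, q) \<in> glue_rel" "p \<in> squares \<times> unit_square"
  shows "q \<in> squares \<times> unit_square"
proof -
  have "(p \<in> squares \<times> unit_square) = (q \<in> squares \<times> unit_square)"
    by (rule glue_rel_invariant[OF _ assms(1)]) (use gluing_tiles in blast)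
  then show ?thesis using assms(2) by simp
qed

lemma surface_quotient_map: "quotient_map tiles surface pt"
  unfolding origami_def by (rule quotient_map_quotient_top)

lemma topspace_surface: "topspace surface = pt ` (squares \<times> unit_square)"
  unfolding origami_def by simp

lemma surface_point:
  assumes "m \<in> topspace surface"
  obtains s P where "s \<in> squares" "P \<in> unit_square" "m = pt (s, P)"
  using assms by (auto simp: topspace_surface)

lemma continuous_square:
  assumes "s \<in> squares"
  shows "continuous_map (top_of_set unit_square) surface (\<lambda>P. pt (s, P))"
proof -
  have "continuous_map (top_of_set unit_square) tiles (\<lambda>P. (s, P))"
    using assms by (intro continuous_map_pairedI) auto
  from continuous_map_compose[OF this quotient_imp_continuous_map[OF surface_quotient_map]]
  show ?thesis by (simp add: o_def)
qed

lemma continuous_map_from_surface: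
  assumes "\<And>s. s \<in> squares \<Longrightarrow> continuous_map (top_of_set unit_square) Y (\<lambda>P. f (s, P))"
    and "\<And>p q. (p, q) \<in> gluing \<Longrightarrow> f p = f q"
  obtains h where "continuous_map surface Y h"
    "\<And>s P. s \<in> squares \<Longrightarrow> P \<in> unit_square \<Longrightarrow> h (pt (s, P)) = f (s, P)"
proof -
  have c: "continuous_map tiles Y f" by (rule continuous_map_discrete_prod) (rule assms(1))
  have "f p = f q" if "pt p = pt q" for p q
    using that glue_rel_invariant[of f, OF assms(2)] pt_eq_iff by blast
  then obtain h where "continuous_map surface Y h" "\<And>x. x \<in> topspace tiles \<Longrightarrow> h (pt x) = f x"
    using quotient_map_lift_exists[OF surface_quotient_map c] by metis
  then show ?thesis using that by simp
qed

definition seg_chain where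
  "seg_chain s A B = path_chain (\<lambda>t. pt (s, segment A B t))"

lemma convex_unit_square: "convex unit_square"
  by (intro convex_Times) auto

lemma segment_unit_square:
  assumes "A \<in> unit_square" "B \<in> unit_square" "0 \<le> t" "t \<le> 1"
  shows "segment A B t \<in> unit_square"
proof -
  have "(1 - t) *\<^sub>R A + t *\<^sub>R B \<in> unit_square"
    using convexD_alt[OF convex_unit_square] assms by blast
  then show ?thesis by (simp add: segment_def algebra_simps)
qed

lemma seg_chain_triangle:
  assumes "s \<in> squares" "A \<in> unit_square" "B \<in> unit_square" "C \<in> unit_square"
  shows "homologous surface (seg_chain s A B + seg_chain s B C) (seg_chain s A C)"
  unfolding seg_chain_def
  by (rule path_triangle[OF convex_unit_square continuous_square[OF assms(1)] assms(2-)])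

text \<open>\<open>(s, True)\<close> stands for the bottom side of \<open>s\<close>, from left to
  right, and \<open>(s, False)\<close> for its left side, from bottom to top. The other two sides
  are edges of neighbours.\<close>

definition edges where "edges = squares \<times> (UNIV :: bool set)"

definition edge_chain where
  "edge_chain e = seg_chain (fst e) (0, 0) (if snd e then (1, 0) else (0, 1))"

definition cell_chain where
  "cell_chain a = (\<Sum>e\<in>edges. chain_scale (a e) (edge_chain e))"

lemma finite_edges: "finite edges"
  using finite_squares by (simp add: edges_def)

text \<open>For a cycle this says that its class is carried by the edges; for arbitrary chains it is
  a relation that can be summed over the pieces of a path.\<close>

definition cellular where
  "cellular c \<longleftrightarrow> (\<exists>a. homologous surface c (cell_chain a))"

lemma cell_chain_linear:
  "cell_chain (\<lambda>e. a e + b e) = cell_chain a + cell_chain b"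
  "cell_chain (\<lambda>e. z * a e) = chain_scale z (cell_chain a)"
  "cell_chain (\<lambda>e. 0) = 0"
  by (simp_all add: cell_chain_def chain_scale_add_left sum.distrib chain_scale_sum)

lemma cell_chain_cong: "(\<And>e. e \<in> edges \<Longrightarrow> a e = b e) \<Longrightarrow> cell_chain a = cell_chain b"
  by (simp add: cell_chain_def)

lemma cellular_homologous: "homologous surface c d \<Longrightarrow> cellular d \<Longrightarrow> cellular c"
  unfolding cellular_def using homologous_trans by blast

lemma cellular_zero: "cellular 0"
  unfolding cellular_def using cell_chain_linear(3) homologous_refl by metis

lemma cellular_add: "cellular c \<Longrightarrow> cellular d \<Longrightarrow> cellular (c + d)"
proof -
  assume "cellular c" "cellular d"
  then obtain a b where "homologous surface c (cell_chain a)" "homologous surface d (cell_chain b)"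
    unfolding cellular_def by blast
  from homologous_add[OF this] show ?thesis
    unfolding cellular_def cell_chain_linear(1)[symmetric] by blast
qed

lemma cellular_scale: "cellular c \<Longrightarrow> cellular (chain_scale z c)"
proof -
  assume "cellular c"
  then obtain a where "homologous surface c (cell_chain a)" unfolding cellular_def by blast
  from homologous_scale[OF this] show ?thesis
    unfolding cellular_def cell_chain_linear(2)[symmetric] by blast
qed

lemma cellular_uminus: "cellular c \<Longrightarrow> cellular (- c)"
  using cellular_scale[of c "-1"] by (simp add: chain_scale_uminus)

lemma cellular_diff: "cellular c \<Longrightarrow> cellular d \<Longrightarrow> cellular (c - d)"
  using cellular_add[of c "- d"] cellular_uminus[of d] by simp

lemma cellular_edge:
  assumes "e \<in> edges" shows "cellular (edge_chain e)"
proof -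
  have "cell_chain (\<lambda>e'. if e' = e then 1 else 0) = edge_chain e"
    using assms finite_edges by (simp add: cell_chain_def if_distrib[of "\<lambda>z. chain_scale z _"] cong: if_cong)
  then show ?thesis unfolding cellular_def by (metis homologous_refl)
qed

text \<open>The straight path from the lower left corner of a square to a point \<open>p\<close> of
  it.\<close>

definition ray where "ray p = seg_chain (fst p) (0, 0) (snd p)"

lemma seg_ray:
  assumes "s \<in> squares" "A \<in> unit_square" "B \<in> unit_square"
  shows "homologous surface (seg_chain s A B) (ray (s, B) - ray (s, A))"
  using seg_chain_triangle[OF assms(1) _ assms(2,3), of "(0, 0)"]
  by (simp add: ray_def homologous_def algebra_simps)

text \<open>On the right side of \<open>s\<close>, the ray ending at \<open>(1, y)\<close> is
  homologous to the bottom side of \<open>s\<close> followed by the vertical segment, which is the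
  ray of the neighbour; similarly on top.\<close>

lemma ray_gluing:
  assumes "(p, q) \<in> gluing"
  shows "cellular (ray p - ray q)"
proof -
  consider s y where "p = (s, 1, y)" "q = (rt s, 0, y)" "s \<in> squares" "0 \<le> y" "y \<le> 1"
    | s x where "p = (s, x, 1)" "q = (up s, x, 0)" "s \<in> squares" "0 \<le> x" "x \<le> 1"
    using assms unfolding square_gluing_def by auto
  then show ?thesis
  proof cases
    case 1
    have "seg_chain s (1, 0) (1, y) = ray q"
      unfolding ray_def seg_chain_def 1
    proof (rule path_chain_cong)
      fix t :: real assume "0 \<le> t" "t \<le> 1"
      then show "pt (s, segment (1, 0) (1, y) t) = pt (fst (rt s, 0, y), segment (0, 0) (snd (rt s, 0, y)) t)"
        using pt_right[of s "t * y"] 1 by (simp add: segment_def mult_le_one)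
    qed
    then have "homologous surface (edge_chain (s, True) + ray q) (ray p)"
      using seg_chain_triangle[of s "(0, 0)" "(1, 0)" "(1, y)"] 1 by (simp add: edge_chain_def ray_def)
    then have "homologous surface (ray p - ray q) (edge_chain (s, True))"
      by (rule homologous_move)
    then show ?thesis using cellular_edge[of "(s, True)"] cellular_homologous 1 by (auto simp: edges_def)
  next
    case 2
    have "seg_chain s (0, 1) (x, 1) = ray q"
      unfolding ray_def seg_chain_def 2
    proof (rule path_chain_cong)
      fix t :: real assume "0 \<le> t" "t \<le> 1"
      then show "pt (s, segment (0, 1) (x, 1) t) = pt (fst (up s, x, 0), segment (0, 0) (snd (up s, x, 0)) t)"
        using pt_up[of s "t * x"] 2 by (simp add: segment_def mult_le_one)
    qed
    then have "homologous surface (edge_chain (s, False) + ray q) (ray p)"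
      using seg_chain_triangle[of s "(0, 0)" "(0, 1)" "(x, 1)"] 2 by (simp add: edge_chain_def ray_def)
    then have "homologous surface (ray p - ray q) (edge_chain (s, False))"
      by (rule homologous_move)
    then show ?thesis using cellular_edge[of "(s, False)"] cellular_homologous 2 by (auto simp: edges_def)
  qed
qed

lemma ray_well_defined:
  assumes "pt p = pt q" shows "cellular (ray p - ray q)"
proof -
  have "(p, q) \<in> glue_rel" using assms pt_eq_iff by simp
  then show ?thesis
  proof (induction rule: rtrancl_induct)
    case base
    then show ?case using cellular_zero by simp
  next
    case (step q r)
    have "cellular (ray q - ray r)"
      using step(2) ray_gluing[of q r] cellular_uminus[OF ray_gluing[of r q]] by auto
    from cellular_add[OF step(3) this] show ?case by simp
  qed
qed

text \<open>Modulo edges the ray to a point of the surface does not depend on the square used to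
  reach it, so an arbitrary one is chosen.\<close>

definition base_ray where
  "base_ray m = ray (SOME p. p \<in> squares \<times> unit_square \<and> pt p = m)"

lemma base_ray:
  assumes "p \<in> squares \<times> unit_square" shows "cellular (base_ray (pt p) - ray p)"
proof -
  have "pt (SOME q. q \<in> squares \<times> unit_square \<and> pt q = pt p) = pt p"
  proof -
    have "\<exists>q. q \<in> squares \<times> unit_square \<and> pt q = pt p" using assms by blast
    from someI_ex[OF this] show ?thesis by (rule conjunct2)
  qed
  then show ?thesis unfolding base_ray_def by (rule ray_well_defined)
qed

section \<open>Every cycle is homologous to a combination of edges\<close>

definition half_grid :: "(real \<times> real) set" where "half_grid = {0, 1/2, 1} \<times> {0, 1/2, 1}"

text \<open>\<open>Z\<close> is the point of the grid over \<open>z\<close> in the square of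
  \<open>p\<close> towards which the star of \<open>z\<close> contracts. A grid of step
  \<open>1/2\<close> is used because every point of a square is at distance less than
  \<open>1/2\<close> from it in each coordinate, so the stars cover the surface, while two
  candidates for \<open>Z\<close> differ by integers and are less than 1 apart, so \<open>Z\<close>
  is unique.\<close>

definition near where
  "near z p Z \<longleftrightarrow> Z \<in> half_grid \<and> pt (fst p, Z) = z \<and>
     \<bar>fst (snd p) - fst Z\<bar> < 1/2 \<and> \<bar>snd (snd p) - snd Z\<bar> < 1/2"

definition star_tiles where "star_tiles z = {p \<in> squares \<times> unit_square. \<exists>Z. near z p Z}"

definition star where "star z = pt ` star_tiles z"

lemma half_grid_square: "half_grid \<subseteq> unit_square"
  by (auto simp: half_grid_def)

lemma torus_point_eq:
  "torus_point P = torus_point P' \<longleftrightarrow> (\<exists>m n :: int. P' = P + (of_int m, of_int n))"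
proof
  assume "torus_point P = torus_point P'"
  moreover have "P' \<in> torus_point P'" unfolding torus_point_def 
    by (intro CollectI exI[of _ P'] exI[of _ "0::int"]) (simp add: zero_prod_def[symmetric])
  ultimately have "P' \<in> torus_point P" by simp
  then show "\<exists>m n :: int. P' = P + (of_int m, of_int n)" by (auto simp: torus_point_def)
next
  assume "\<exists>m n :: int. P' = P + (of_int m, of_int n)"
  then obtain m n :: int where P': "P' = P + (of_int m, of_int n)" by blast
  show "torus_point P = torus_point P'"
  proof (intro equalityI subsetI)
    fix x assume "x \<in> torus_point P"
    then obtain i j :: int where "x = P + (of_int i, of_int j)" by (auto simp: torus_point_def)
    then have "x = P' + (of_int (i - m), of_int (j - n))" by (cases P) (simp add: P')
    then show "x \<in> torus_point P'" unfolding torus_point_def by blast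
  next
    fix x assume "x \<in> torus_point P'"
    then obtain i j :: int where "x = P' + (of_int i, of_int j)" by (auto simp: torus_point_def)
    then have "x = P + (of_int (i + m), of_int (j + n))" by (cases P) (simp add: P')
    then show "x \<in> torus_point P" unfolding torus_point_def by blast
  qed
qed

lemma pt_torus:
  assumes "pt p = pt q" shows "torus_point (snd p) = torus_point (snd q)"
proof (rule glue_rel_invariant[of "\<lambda>p. torus_point (snd p)"])
  show "(p, q) \<in> glue_rel" using assms pt_eq_iff by simp
  fix p q assume "(p, q) \<in> gluing"
  then consider y where "snd p = (1, y)" "snd q = (0, y)" | x where "snd p = (x, 1)" "snd q = (x, 0)"
    unfolding square_gluing_def by auto
  then show "torus_point (snd p) = torus_point (snd q)"
  proof cases
    case 1
    then show ?thesis unfolding torus_point_eq by (intro exI[of _ "-1::int"] exI[of _ "0::int"]) simp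
  next
    case 2
    then show ?thesis unfolding torus_point_eq by (intro exI[of _ "0::int"] exI[of _ "-1::int"]) simp
  qed
qed

lemma near_unique:
  assumes "near z (s, P) Z" "near z (s, P) Z'" shows "Z = Z'"
proof -
  have "pt (s, Z) = pt (s, Z')" using assms by (simp add: near_def)
  from pt_torus[OF this] obtain m n :: int where mn: "Z' = Z + (of_int m, of_int n)"
    unfolding torus_point_eq snd_conv by blast
  have "\<bar>fst Z' - fst Z\<bar> < 1" "\<bar>snd Z' - snd Z\<bar> < 1"
    using assms unfolding near_def fst_conv snd_conv by linarith+
  then have "\<bar>real_of_int m\<bar> < 1" "\<bar>real_of_int n\<bar> < 1" by (simp_all add: mn)
  then have "m = 0" "n = 0" by linarith+
  then show ?thesis using mn by (cases Z) simp
qed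

text \<open>Glued points are contracted towards glued grid points, along glued segments: a point of
  the right side within \<open>1/2\<close> of \<open>Z\<close> forces \<open>Z\<close> onto that
  side, as the grid has no other column that close.\<close>

lemma near_gluing:
  assumes "((s, P), (s', P')) \<in> gluing"
  shows "near z (s, P) Z \<Longrightarrow> \<exists>Z'. near z (s', P') Z' \<and>
      (\<forall>t. 0 \<le> t \<longrightarrow> t \<le> 1 \<longrightarrow> pt (s, segment P Z t) = pt (s', segment P' Z' t))"
    and "near z (s', P') Z' \<Longrightarrow> \<exists>Z. near z (s, P) Z \<and>
      (\<forall>t. 0 \<le> t \<longrightarrow> t \<le> 1 \<longrightarrow> pt (s, segment P Z t) = pt (s', segment P' Z' t))"
proof -
  have sg: "0 \<le> y + t * (b - y)" "y + t * (b - y) \<le> 1"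
    if "0 \<le> y" "y \<le> 1" "0 \<le> b" "b \<le> 1" "0 \<le> t" "t \<le> 1" for y b t :: real
  proof -
    have "y + t * (b - y) = (1 - t) * y + t * b" by (simp add: algebra_simps)
    moreover have "(1 - t) * y + t * b \<le> (1 - t) * 1 + t * 1"
      using that by (intro add_mono mult_left_mono) auto
    ultimately show "0 \<le> y + t * (b - y)" "y + t * (b - y) \<le> 1" using that by auto
  qed
  have right: "near z (s, 1, y) (1, b) \<longleftrightarrow> near z (rt s, 0, y) (0, b)"
    "0 \<le> t \<Longrightarrow> t \<le> 1 \<Longrightarrow> pt (s, segment (1, y) (1, b) t) = pt (rt s, segment (0, y) (0, b) t)"
    if "s \<in> squares" "0 \<le> y" "y \<le> 1" "b \<in> {0, 1/2, 1}" for s y b t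
    using that pt_right[OF that(1), of b] pt_right[OF that(1), of "y + t * (b - y)"] sg[of y b t]
    by (auto simp: near_def half_grid_def segment_def)
  have up: "near z (s, x, 1) (b, 1) \<longleftrightarrow> near z (up s, x, 0) (b, 0)"
    "0 \<le> t \<Longrightarrow> t \<le> 1 \<Longrightarrow> pt (s, segment (x, 1) (b, 1) t) = pt (up s, segment (x, 0) (b, 0) t)"
    if "s \<in> squares" "0 \<le> x" "x \<le> 1" "b \<in> {0, 1/2, 1}" for s x b t
    using that pt_up[OF that(1), of b] pt_up[OF that(1), of "x + t * (b - x)"] sg[of x b t]
    by (auto simp: near_def half_grid_def segment_def)
  consider y where "P = (1, y)" "P' = (0, y)" "s' = rt s" "s \<in> squares" "0 \<le> y" "y \<le> 1"
    | x where "P = (x, 1)" "P' = (x, 0)" "s' = up s" "s \<in> squares" "0 \<le> x" "x \<le> 1"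
    using assms unfolding square_gluing_def by auto
  note cs = this
  show "\<exists>Z'. near z (s', P') Z' \<and>
      (\<forall>t. 0 \<le> t \<longrightarrow> t \<le> 1 \<longrightarrow> pt (s, segment P Z t) = pt (s', segment P' Z' t))" if n: "near z (s, P) Z"
    using cs
  proof cases
    case 1
    obtain a b where Z: "Z = (a, b)" by (cases Z)
    have "a = 1" "b \<in> {0, 1/2, 1}" using n 1 by (auto simp: near_def half_grid_def Z)
    then show ?thesis using right[of s y b] n 1 by (intro exI[of _ "(0, b)"]) (auto simp: Z)
  next
    case 2
    obtain a b where Z: "Z = (a, b)" by (cases Z)
    have "b = 1" "a \<in> {0, 1/2, 1}" using n 2 by (auto simp: near_def half_grid_def Z)
    then show ?thesis using up[of s x a] n 2 by (intro exI[of _ "(a, 0)"]) (auto simp: Z)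
  qed
  show "\<exists>Z. near z (s, P) Z \<and>
      (\<forall>t. 0 \<le> t \<longrightarrow> t \<le> 1 \<longrightarrow> pt (s, segment P Z t) = pt (s', segment P' Z' t))" if n: "near z (s', P') Z'"
    using cs
  proof cases
    case 1
    obtain a b where Z: "Z' = (a, b)" by (cases Z')
    have "a = 0" "b \<in> {0, 1/2, 1}" using n 1 by (auto simp: near_def half_grid_def Z)
    then show ?thesis using right[of s y b] n 1 by (intro exI[of _ "(1, b)"]) (auto simp: Z)
  next
    case 2
    obtain a b where Z: "Z' = (a, b)" by (cases Z')
    have "b = 0" "a \<in> {0, 1/2, 1}" using n 2 by (auto simp: near_def half_grid_def Z)
    then show ?thesis using up[of s x a] n 2 by (intro exI[of _ "(a, 1)"]) (auto simp: Z)
  qed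
qed

lemma near_glue_rel:
  assumes "((s, P), (s', P')) \<in> glue_rel" "near z (s, P) Z"
  shows "\<exists>Z'. near z (s', P') Z' \<and>
      (\<forall>t. 0 \<le> t \<longrightarrow> t \<le> 1 \<longrightarrow> pt (s, segment P Z t) = pt (s', segment P' Z' t))"
  using assms(1)
proof (induction "(s', P')" arbitrary: s' P' rule: rtrancl_induct)
  case base
  then show ?case using assms(2) by blast
next
  case (step q)
  obtain s'' P'' where q: "q = (s'', P'')" by (cases q)
  obtain Z'' where Z'': "near z (s'', P'') Z''"
    "\<forall>t. 0 \<le> t \<longrightarrow> t \<le> 1 \<longrightarrow> pt (s, segment P Z t) = pt (s'', segment P'' Z'' t)"
    using step(3)[OF q] by blast
  have "\<exists>Z'. near z (s', P') Z' \<and>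
      (\<forall>t. 0 \<le> t \<longrightarrow> t \<le> 1 \<longrightarrow> pt (s'', segment P'' Z'' t) = pt (s', segment P' Z' t))"
  proof -
    consider "((s'', P''), (s', P')) \<in> gluing" | "((s', P'), (s'', P'')) \<in> gluing"
      using step(2) q by blast
    then show ?thesis
    proof cases
      case 1
      then show ?thesis using near_gluing(1)[OF 1 Z''(1)] by blast
    next
      case 2
      obtain Z' where "near z (s', P') Z'"
        "\<forall>t. 0 \<le> t \<longrightarrow> t \<le> 1 \<longrightarrow> pt (s', segment P' Z' t) = pt (s'', segment P'' Z'' t)"
        using near_gluing(2)[OF 2 Z''(1)] by blast
      then show ?thesis by (intro exI[of _ Z']) simp
    qed
  qed
  then obtain Z' where "near z (s', P') Z'"
    "\<forall>t. 0 \<le> t \<longrightarrow> t \<le> 1 \<longrightarrow> pt (s'', segment P'' Z'' t) = pt (s', segment P' Z' t)" by blast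
  then show ?case using Z''(2) by (intro exI[of _ Z']) simp
qed

lemma star_tiles_saturated:
  "{p \<in> topspace tiles. pt p \<in> star z} = star_tiles z"
proof -
  have "p \<in> star_tiles z" if p: "p \<in> squares \<times> unit_square" and ps: "pt p \<in> star z" for p
  proof -
    obtain q where q: "q \<in> star_tiles z" "pt p = pt q" using ps by (auto simp: star_def)
    obtain s P s' P' where sp: "q = (s, P)" "p = (s', P')" by (cases p; cases q)
    obtain Z where "near z (s, P) Z" using q sp by (auto simp: star_tiles_def)
    moreover have "((s, P), (s', P')) \<in> glue_rel" using q(2) pt_eq_iff sp by metis
    ultimately obtain Z' where "near z (s', P') Z'" using near_glue_rel by blast
    then show ?thesis using p unfolding star_tiles_def sp by blast
  qed
  note * = this
  show ?thesis
  proof (intro equalityI subsetI)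
    fix p assume "p \<in> {p \<in> topspace tiles. pt p \<in> star z}"
    then have "p \<in> squares \<times> unit_square" "pt p \<in> star z" by simp_all
    then show "p \<in> star_tiles z" by (rule *)
  next
    fix p assume p: "p \<in> star_tiles z"
    then have "p \<in> squares \<times> unit_square" unfolding star_tiles_def by blast
    then show "p \<in> {p \<in> topspace tiles. pt p \<in> star z}" using p unfolding star_def by simp
  qed
qed

lemma openin_star_tiles:
  "openin tiles {p \<in> squares \<times> unit_square. near z p Z}"
proof (cases "Z \<in> half_grid")
  case True
  let ?O = "{P \<in> unit_square. \<bar>fst P - fst Z\<bar> < 1/2 \<and> \<bar>snd P - snd Z\<bar> < 1/2}"
  have "openin (top_of_set unit_square) ?O"
  proof -
    have "open {P :: real \<times> real. \<bar>fst P - fst Z\<bar> < 1/2 \<and> \<bar>snd P - snd Z\<bar> < 1/2}"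
      by (intro open_Collect_conj open_Collect_less continuous_intros)
    moreover have "?O = unit_square \<inter> {P. \<bar>fst P - fst Z\<bar> < 1/2 \<and> \<bar>snd P - snd Z\<bar> < 1/2}" by auto
    ultimately show ?thesis using openin_open_Int by (simp only:)
  qed
  moreover have "{p \<in> squares \<times> unit_square. near z p Z} = {s \<in> squares. pt (s, Z) = z} \<times> ?O"
    using True by (auto simp: near_def)
  ultimately show ?thesis by (simp add: openin_prod_Times_iff)
qed (simp add: near_def)

lemma openin_star: "openin surface (star z)"
proof -
  have "star_tiles z = (\<Union>Z\<in>half_grid. {p \<in> squares \<times> unit_square. near z p Z})"
  proof (intro equalityI subsetI)
    fix p assume p: "p \<in> star_tiles z"
    then obtain Z where "near z p Z" unfolding star_tiles_def by blast
    moreover from this have "Z \<in> half_grid" unfolding near_def by (rule conjunct1)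
    ultimately show "p \<in> (\<Union>Z\<in>half_grid. {p \<in> squares \<times> unit_square. near z p Z})"
      using p unfolding star_tiles_def by blast
  qed (unfold star_tiles_def, blast)
  moreover have "openin tiles (\<Union>Z\<in>half_grid. {p \<in> squares \<times> unit_square. near z p Z})"
    by (intro openin_Union) (use openin_star_tiles in blast)
  ultimately have "openin tiles (star_tiles z)" by (simp only:)
  moreover have "star z \<subseteq> topspace surface"
    unfolding star_def star_tiles_def topspace_surface by blast
  then have "openin tiles {p \<in> topspace tiles. pt p \<in> star z} = openin surface (star z)"
    using surface_quotient_map unfolding quotient_map_def by blast
  ultimately show ?thesis unfolding star_tiles_saturated by simp
qed

text \<open>Within a square the contraction is a straight line homotopy. It descends to the star
  because the product of the quotient map with a compact interval is again a quotient map.\<close>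

lemma star_contraction:
  obtains h where
    "continuous_map (prod_topology (subtopology surface (star z)) (top_of_set {0..1::real})) surface h"
    "\<And>s P Z t. s \<in> squares \<Longrightarrow> P \<in> unit_square \<Longrightarrow> near z (s, P) Z \<Longrightarrow> 0 \<le> t \<Longrightarrow> t \<le> 1 \<Longrightarrow>
       h (pt (s, P), t) = pt (s, segment P Z t)"
proof -
  let ?I = "top_of_set {0..1::real}"
  define k where "k = (\<lambda>((s, P), t). pt (s, segment P (THE Z. near z (s, P) Z) t))"
  have THE: "(THE Z. near z (s, P) Z) = Z" if "near z (s, P) Z" for s P Z
    using near_unique that by blast
  let ?A = "prod_topology (subtopology tiles (star_tiles z)) ?I"
  have cont: "continuous_map ?A surface k"
  proof (rule pasting_lemma[where T = "\<lambda>Z. {p \<in> squares \<times> unit_square. near z p Z} \<times> {0..1}" and I = half_grid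
        and f = "\<lambda>Z ((s, P), t). pt (s, segment P Z t)"])
    fix Z assume Z: "Z \<in> half_grid"
    have sub: "{p \<in> squares \<times> unit_square. near z p Z} \<subseteq> star_tiles z" unfolding star_tiles_def by blast
    have "openin (subtopology tiles (star_tiles z)) {p \<in> squares \<times> unit_square. near z p Z}"
      using openin_star_tiles[of z Z] sub by (simp add: openin_subtopology_alt image_iff) blast
    then show "openin ?A ({p \<in> squares \<times> unit_square. near z p Z} \<times> {0..1})"
      by (simp add: openin_prod_Times_iff)
    have f1: "continuous_map (prod_topology tiles ?I) (discrete_topology squares) (\<lambda>x. fst (fst x))"
      using continuous_map_compose[OF continuous_map_fst continuous_map_fst] by (simp add: o_def)
    have f2: "continuous_map (prod_topology tiles ?I) (top_of_set unit_square) (\<lambda>x. snd (fst x))"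
      using continuous_map_compose[OF continuous_map_fst continuous_map_snd] by (simp add: o_def)
    have f3: "continuous_map (prod_topology tiles ?I) (top_of_set (unit_square \<times> {0..1})) (\<lambda>x. (snd (fst x), snd x))"
      using continuous_map_pairedI[OF f2 continuous_map_snd] by simp
    have seg: "continuous_map (top_of_set (unit_square \<times> {0..1})) (top_of_set unit_square) (\<lambda>x. segment (fst x) Z (snd x))"
      unfolding continuous_map_in_subtopology
      using segment_unit_square half_grid_square Z
      by (auto simp: segment_def intro!: continuous_intros)
    have f4: "continuous_map (prod_topology tiles ?I) (top_of_set unit_square) (\<lambda>x. segment (snd (fst x)) Z (snd x))"
      using continuous_map_compose[OF f3 seg] by (simp add: o_def)
    have "continuous_map (prod_topology tiles ?I) surface (\<lambda>x. pt (fst (fst x), segment (snd (fst x)) Z (snd x)))"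
      using continuous_map_compose[OF continuous_map_pairedI[OF f1 f4] quotient_imp_continuous_map[OF surface_quotient_map]]
      by (simp add: o_def)
    then show "continuous_map (subtopology ?A ({p \<in> squares \<times> unit_square. near z p Z} \<times> {0..1})) surface
        (\<lambda>((s, P), t). pt (s, segment P Z t))"
      by (simp add: prod_topology_subtopology(1) subtopology_subtopology continuous_map_from_subtopology case_prod_unfold)
  next
    fix Z Z' x assume "Z \<in> half_grid" "Z' \<in> half_grid"
      "x \<in> topspace ?A \<inter> ({p \<in> squares \<times> unit_square. near z p Z} \<times> {0..1}) \<inter> ({p \<in> squares \<times> unit_square. near z p Z'} \<times> {0..1})"
    moreover obtain s P t where x: "x = ((s, P), t)" by (metis prod.exhaust)
    ultimately have "near z (s, P) Z" "near z (s, P) Z'" by simp_all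
    then have "Z = Z'" by (rule near_unique)
    then show "(\<lambda>((s, P), t). pt (s, segment P Z t)) x = (\<lambda>((s, P), t). pt (s, segment P Z' t)) x"
      by simp
  next
    fix x assume "x \<in> topspace ?A"
    then show "\<exists>Z. Z \<in> half_grid \<and> x \<in> {p \<in> squares \<times> unit_square. near z p Z} \<times> {0..1} \<and> k x = (\<lambda>((s, P), t). pt (s, segment P Z t)) x"
    proof -
      obtain s P t where x: "x = ((s, P), t)" by (metis prod.exhaust)
      have "(s, P) \<in> star_tiles z" "t \<in> {0..1}" using \<open>x \<in> topspace ?A\<close> by (simp_all add: x)
      then obtain Z where Z: "near z (s, P) Z" "(s, P) \<in> squares \<times> unit_square" "t \<in> {0..1}"
        unfolding star_tiles_def by blast
      have "Z \<in> half_grid" using Z(1) by (simp add: near_def)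
      moreover have "x \<in> {p \<in> squares \<times> unit_square. near z p Z} \<times> {0..1}" using Z by (simp add: x)
      moreover have "k x = (\<lambda>((s, P), t). pt (s, segment P Z t)) x" using THE[OF Z(1)] by (simp add: k_def x)
      ultimately show ?thesis by blast
    qed
  qed
  have q: "quotient_map ?A (prod_topology (subtopology surface (star z)) ?I) (\<lambda>(x, y). (pt x, y))"
  proof (rule quotient_map_prod_left)
    have "compact_space ?I" by (intro compact_space_subtopology) simp
    then show "locally_compact_space ?I" by (rule compact_imp_locally_compact_space)
    have "Hausdorff_space ?I" by (intro Hausdorff_space_subtopology Hausdorff_space_euclidean)
    then show "Hausdorff_space ?I \<or> regular_space ?I" ..
    show "quotient_map (subtopology tiles (star_tiles z)) (subtopology surface (star z)) pt"
      by (rule quotient_map_restriction[OF surface_quotient_map star_tiles_saturated disjI1[OF openin_star]])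
  qed
  have eq: "k x = k y" if xy: "x \<in> topspace ?A" "y \<in> topspace ?A" "(\<lambda>(x, y). (pt x, y)) x = (\<lambda>(x, y). (pt x, y)) y" for x y
  proof -
    obtain s P s' P' t where *: "x = ((s, P), t)" "y = ((s', P'), t)" "pt (s, P) = pt (s', P')"
      using xy(3) by (cases x; cases y) auto
    obtain Z where Z: "near z (s, P) Z" using xy(1) by (auto simp: * star_tiles_def)
    obtain Z' where "near z (s', P') Z'" "\<forall>t. 0 \<le> t \<longrightarrow> t \<le> 1 \<longrightarrow> pt (s, segment P Z t) = pt (s', segment P' Z' t)"
      using near_glue_rel[OF _ Z] *(3) pt_eq_iff by blast
    then show ?thesis using THE Z xy(1) by (simp add: k_def *)
  qed
  obtain h where h: "continuous_map (prod_topology (subtopology surface (star z)) ?I) surface h"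
    "\<And>x. x \<in> topspace ?A \<Longrightarrow> h ((\<lambda>(x, y). (pt x, y)) x) = k x"
  proof (rule quotient_map_lift_exists[OF q cont eq])
    fix g
    assume "continuous_map (prod_topology (subtopology surface (star z)) ?I) surface g"
      "\<And>x. x \<in> topspace ?A \<Longrightarrow> g ((\<lambda>(x, y). (pt x, y)) x) = k x"
    then show thesis by (rule that)
  qed
  show ?thesis
  proof (rule that[OF h(1)])
    fix s P Z and t :: real
    assume *: "s \<in> squares" "P \<in> unit_square" "near z (s, P) Z" "0 \<le> t" "t \<le> 1"
    then have "(s, P) \<in> star_tiles z" unfolding star_tiles_def by blast
    then have "((s, P), t) \<in> topspace ?A" using * by (simp add: star_tiles_def)
    from h(2)[OF this] show "h (pt (s, P), t) = pt (s, segment P Z t)"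
      using THE[OF *(3)] by (simp add: k_def)
  qed
qed

lemma cellular_of_homologous: "homologous surface c d \<Longrightarrow> cellular (c - d)"
  using cellular_homologous[OF _ cellular_zero, of "c - d"] by (simp add: homologous_def)

lemma near_exists:
  assumes "P \<in> unit_square"
  obtains Z where "near (pt (s, Z)) (s, P) Z"
proof -
  have "\<exists>z\<in>{0, 1/2, 1}. \<bar>p - z\<bar> < 1/2" if "p \<in> {0..1}" for p :: real
    using that by (cases "p < 1/2"; cases "p = 1/2") auto
  then obtain a b where "a \<in> {0, 1/2, 1}" "b \<in> {0, 1/2, 1}" "\<bar>fst P - a\<bar> < 1/2" "\<bar>snd P - b\<bar> < 1/2"
    using assms by (metis mem_Times_iff)
  then have "near (pt (s, (a, b))) (s, P) (a, b)" 
    by (simp only: near_def half_grid_def mem_Sigma_iff fst_conv snd_conv)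
  then show ?thesis by (rule that)
qed

text \<open>The contraction sweeps out a square with sides \<open>g\<close>, two segments inside
  squares of the surface, and a constant path. Cutting it into two triangles expresses
  \<open>g\<close> through the segments, which are differences of rays.\<close>

lemma path_in_star:
  assumes g: "continuous_map (top_of_set {0..1}) surface g"
    and sub: "\<And>t. 0 \<le> t \<Longrightarrow> t \<le> 1 \<Longrightarrow> g t \<in> star z"
  shows "cellular (path_chain g - (base_ray (g 1) - base_ray (g 0)))"
proof -
  obtain h where h: "continuous_map (prod_topology (subtopology surface (star z)) (top_of_set {0..1::real})) surface h"
    and hv: "\<And>s P Z t. s \<in> squares \<Longrightarrow> P \<in> unit_square \<Longrightarrow> near z (s, P) Z \<Longrightarrow> 0 \<le> t \<Longrightarrow> t \<le> 1 \<Longrightarrow>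
       h (pt (s, P), t) = pt (s, segment P Z t)"
    using star_contraction by metis
  \<comment> \<open>Bottom side \<open>g\<close>, top side constant at \<open>z\<close>, lateral
    sides the contraction of the end points.\<close>
  define \<Psi> where "\<Psi> = (\<lambda>q. h (g (fst q), snd q))"
  let ?D = "{0..1::real} \<times> {0..1::real}"
  have c1: "continuous_map (top_of_set ?D) (top_of_set {0..1::real}) fst"
    and c2: "continuous_map (top_of_set ?D) (top_of_set {0..1::real}) snd"
    unfolding continuous_map_in_subtopology by (auto intro!: continuous_intros)
  have g': "continuous_map (top_of_set {0..1}) (subtopology surface (star z)) g"
    unfolding continuous_map_in_subtopology using g sub by auto
  have \<Psi>: "continuous_map (top_of_set ?D) surface \<Psi>"
    using continuous_map_compose[OF continuous_map_pairedI[OF continuous_map_compose[OF c1 g'] c2] h]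
    by (simp add: \<Psi>_def o_def)
  have D: "convex ?D" by (intro convex_Times) auto
  have starE: "\<exists>s P Z. s \<in> squares \<and> P \<in> unit_square \<and> near z (s, P) Z \<and> m = pt (s, P)" if m: "m \<in> star z" for m
  proof -
    obtain p where p: "p \<in> star_tiles z" "m = pt p" using m unfolding star_def by blast
    obtain s P where sp: "p = (s, P)" by (cases p)
    have "(s, P) \<in> squares \<times> unit_square" "\<exists>Z. near z (s, P) Z"
      using p(1) unfolding star_tiles_def sp by blast+
    then show ?thesis using p(2) sp by (metis mem_Sigma_iff)
  qed
  obtain s0 P0 Z0 where 0: "s0 \<in> squares" "P0 \<in> unit_square" "near z (s0, P0) Z0" "g 0 = pt (s0, P0)"
    using starE[OF sub[of 0]] by auto
  obtain s1 P1 Z1 where 1: "s1 \<in> squares" "P1 \<in> unit_square" "near z (s1, P1) Z1" "g 1 = pt (s1, P1)"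
    using starE[OF sub[of 1]] by auto
  have Z: "Z0 \<in> unit_square" "Z1 \<in> unit_square" "pt (s0, Z0) = z" "pt (s1, Z1) = z"
    using 0(3) 1(3) half_grid_square by (auto simp only: near_def fst_conv)
  have e1: "path_chain (\<lambda>t. \<Psi> (segment (0, 0) (1, 0) t)) = path_chain g"
  proof (rule path_chain_cong)
    fix t :: real assume t: "0 \<le> t" "t \<le> 1"
    obtain s P Z where "s \<in> squares" "P \<in> unit_square" "near z (s, P) Z" "g t = pt (s, P)"
      using starE[OF sub[OF t]] by blast
    then show "\<Psi> (segment (0, 0) (1, 0) t) = g t"
      using hv[of s P Z 0] by (simp add: \<Psi>_def segment_def)
  qed
  have e2: "path_chain (\<lambda>t. \<Psi> (segment (1, 0) (1, 1) t)) = seg_chain s1 P1 Z1"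
    unfolding seg_chain_def
    by (rule path_chain_cong) (use hv[OF 1(1-3)] 1(4) in \<open>simp add: \<Psi>_def segment_def\<close>)
  have e3: "path_chain (\<lambda>t. \<Psi> (segment (0, 0) (0, 1) t)) = seg_chain s0 P0 Z0"
    unfolding seg_chain_def
    by (rule path_chain_cong) (use hv[OF 0(1-3)] 0(4) in \<open>simp add: \<Psi>_def segment_def\<close>)
  have e4: "path_chain (\<lambda>t. \<Psi> (segment (0, 1) (1, 1) t)) = path_chain (\<lambda>t. z)"
  proof (rule path_chain_cong)
    fix t :: real assume t: "0 \<le> t" "t \<le> 1"
    obtain s P Z where *: "s \<in> squares" "P \<in> unit_square" "near z (s, P) Z" "g t = pt (s, P)"
      using starE[OF sub[OF t]] by blast
    then have "pt (s, Z) = z" by (simp add: near_def)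
    then show "\<Psi> (segment (0, 1) (1, 1) t) = z"
      using hv[OF *(1-3), of 1] *(4) by (simp add: \<Psi>_def segment_def)
  qed
  have zt: "z \<in> topspace surface"
    unfolding topspace_surface using Z(1,3) 0(1) by (metis image_eqI mem_Sigma_iff)
  have t1: "homologous surface (path_chain g + seg_chain s1 P1 Z1) (path_chain (\<lambda>t. \<Psi> (segment (0, 0) (1, 1) t)))"
    using path_triangle[OF D \<Psi>, of "(0, 0)" "(1, 0)" "(1, 1)"] by (simp add: e1 e2)
  have "homologous surface (seg_chain s0 P0 Z0 + path_chain (\<lambda>t. z)) (path_chain (\<lambda>t. \<Psi> (segment (0, 0) (1, 1) t)))"
    using path_triangle[OF D \<Psi>, of "(0, 0)" "(0, 1)" "(1, 1)"] by (simp add: e3 e4)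
  from homologous_trans[OF t1 homologous_sym[OF this]]
  have t2: "path_chain g + seg_chain s1 P1 Z1 - (seg_chain s0 P0 Z0 + path_chain (\<lambda>t. z)) \<in> complex_boundaries 1 surface"
    by (simp only: homologous_def)
  have "path_chain (\<lambda>t. z) \<in> complex_boundaries 1 surface"
    using path_constant[OF zt] by (simp add: homologous_def)
  from boundaries_add[OF t2 this]
  have t2: "homologous surface (path_chain g) (seg_chain s0 P0 Z0 - seg_chain s1 P1 Z1)"
    by (simp add: homologous_def algebra_simps)
  note k1 = cellular_of_homologous[OF t2]
  note k2 = cellular_of_homologous[OF seg_ray[OF 0(1,2) Z(1)]]
  note k3 = cellular_of_homologous[OF seg_ray[OF 1(1,2) Z(2)]]
  have k4: "cellular (ray (s0, Z0) - ray (s1, Z1))" by (rule ray_well_defined) (use Z in simp)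
  have k5: "cellular (base_ray (g 1) - ray (s1, P1))" unfolding 1(4) by (rule base_ray) (use 1 in blast)
  have k6: "cellular (base_ray (g 0) - ray (s0, P0))" unfolding 0(4) by (rule base_ray) (use 0 in blast)
  from cellular_add[OF cellular_diff[OF cellular_add[OF cellular_diff[OF cellular_add[OF k1 k2] k3] k4] k5] k6]
  show ?thesis by (simp add: algebra_simps)
qed

text \<open>The statement is additive in subintervals, by a degenerate triangle in
  \<open>{0..1}\<close>, and holds on those mapped into a single star; compactness of
  \<open>{0..1}\<close>, in the form of Bolzano's principle, does the rest.\<close>

lemma path_cellular:
  assumes g: "continuous_map (top_of_set {0..1}) surface g"
  shows "cellular (path_chain g - (base_ray (g 1) - base_ray (g 0)))"
proof -
  define P where "P a b \<longleftrightarrow> (0 \<le> a \<longrightarrow> b \<le> 1 \<longrightarrow>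
    cellular (path_chain (\<lambda>t. g (segment a b t)) - (base_ray (g b) - base_ray (g a))))" for a b :: real
  have seg: "segment a b t \<in> {a..b}" if "a \<le> b" "0 \<le> t" "t \<le> 1" for a b t :: real
  proof -
    have "t * (b - a) \<le> 1 * (b - a)" using that by (intro mult_right_mono) auto
    then show ?thesis using that by (simp add: segment_def)
  qed
  have "(0::real) \<le> 1" by simp
  then have "P 0 1"
  proof (induction rule: Bolzano)
    case trans
    fix a b c assume ab: "P a b" "P b c" "a \<le> b" "b \<le> c"
    show "P a c"
      unfolding P_def
    proof (intro impI)
      assume "0 \<le> a" "c \<le> 1"
      then have c: "cellular (path_chain (\<lambda>t. g (segment a b t)) - (base_ray (g b) - base_ray (g a)))"
        "cellular (path_chain (\<lambda>t. g (segment b c t)) - (base_ray (g c) - base_ray (g b)))"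
        "homologous surface (path_chain (\<lambda>t. g (segment a b t)) + path_chain (\<lambda>t. g (segment b c t)))
           (path_chain (\<lambda>t. g (segment a c t)))"
        using ab path_triangle[OF _ g, of a b c] by (auto simp: P_def)
      from cellular_diff[OF cellular_add[OF c(1,2)] cellular_of_homologous[OF c(3)]]
      show "cellular (path_chain (\<lambda>t. g (segment a c t)) - (base_ray (g c) - base_ray (g a)))"
        by (simp add: algebra_simps)
    qed
  next
    case (local x)
    have "g x \<in> topspace surface" using g local by (auto simp: continuous_map_def)
    then obtain s Q where Q: "s \<in> squares" "Q \<in> unit_square" "g x = pt (s, Q)" by (rule surface_point)
    obtain Z where Z: "near (pt (s, Z)) (s, Q) Z" using near_exists[OF Q(2)] .
    define z where "z = pt (s, Z)"
    have gx: "g x \<in> star z"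
      unfolding star_def star_tiles_def Q(3) using Z Q(1,2) z_def by blast
    have "openin (top_of_set {0..1}) {t \<in> {0..1}. g t \<in> star z}"
      using g openin_star by (auto simp: continuous_map_def)
    then obtain d where d: "d > 0" "\<And>t. t \<in> {0..1} \<Longrightarrow> \<bar>t - x\<bar> < d \<Longrightarrow> g t \<in> star z"
      using gx local unfolding openin_euclidean_subtopology_iff dist_real_def by force
    have "P a b" if ab: "a \<le> x" "x \<le> b" "b - a < d" for a b
      unfolding P_def
    proof (intro impI)
      assume b: "0 \<le> a" "b \<le> 1"
      have "continuous_map (top_of_set {0..1}) (top_of_set {0..1}) (segment a b)"
        unfolding continuous_map_in_subtopology
      proof
        show "continuous_map (top_of_set {0..1}) euclidean (segment a b)"
          unfolding segment_def by (auto intro!: continuous_intros)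
        show "segment a b \<in> topspace (top_of_set {0..1}) \<rightarrow> {0..1}"
          using seg[of a b] ab b by fastforce
      qed
      from continuous_map_compose[OF this g]
      have "cellular (path_chain (g \<circ> segment a b) - (base_ray ((g \<circ> segment a b) 1) - base_ray ((g \<circ> segment a b) 0)))"
      proof (rule path_in_star)
        fix t :: real assume t: "0 \<le> t" "t \<le> 1"
        have "segment a b t \<in> {a..b}" using seg ab t by simp
        then show "(g \<circ> segment a b) t \<in> star z" using d(2)[of "segment a b t"] ab b by auto
      qed
      then show "cellular (path_chain (\<lambda>t. g (segment a b t)) - (base_ray (g b) - base_ray (g a)))"
        by (simp add: o_def)
    qed
    then show ?case using d(1) by blast
  qed
  then show ?thesis by (simp add: P_def segment_def)
qed

text \<open>Replacing each end point by its ray extends the preceding lemma to all chains; for a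
  cycle the rays cancel.\<close>

theorem cycle_cellular:
  assumes c: "Poly_Mapping.keys c \<subseteq> singular_simplex_set 1 surface" and z: "complex_boundary 1 c = 0"
  shows "cellular c"
proof -
  \<comment> \<open>\<open>\<sigma>\<close> is a singular simplex of degree 0, evaluated at the only
    point of the standard simplex.\<close>
  define \<rho> where "\<rho> \<sigma> = base_ray (\<sigma> (\<lambda>j::nat. if j = 0 then 1 else 0 :: real))" for \<sigma>
  have \<rho>: "linear_extend \<rho> (point_chain x) = base_ray x" for x
    by (simp add: point_chain_def \<rho>_def standard_simplex_0)
  have "cellular (c - linear_extend \<rho> (complex_boundary 1 c))"
    using c
  proof (induction c rule: chain_span_induct)
    case zero
    then show ?case using cellular_zero by simp
  next
    case (add c d)
    from cellular_add[OF this] show ?case by (simp add: algebra_simps)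
  next
    case (single f w)
    then obtain g where g: "continuous_map (top_of_set {0..1}) surface g" "f = path_simplex g"
      using singular_1_simplex_path by blast
    have 1: "Poly_Mapping.single f w = chain_scale w (path_chain g)" by (simp add: path_chain_def g(2))
    have "linear_extend \<rho> (complex_boundary 1 (path_chain g)) = base_ray (g 1) - base_ray (g 0)"
      by (simp only: boundary_path_chain linear_extend_simps \<rho>)
    then have "Poly_Mapping.single f w - linear_extend \<rho> (complex_boundary 1 (Poly_Mapping.single f w)) =
        chain_scale w (path_chain g - (base_ray (g 1) - base_ray (g 0)))"
      unfolding 1 by (simp only: complex_boundary_linear linear_extend_simps chain_scale_diff)
    then show ?case using cellular_scale[OF path_cellular[OF g(1)], of w] by simp
  qed
  then show ?thesis by (simp only: z linear_extend_simps diff_zero)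
qed

section \<open>Cocycles vanish on bounding combinations of edges\<close>

text \<open>An integral cocycle \<open>w\<close> is the winding of a map to the circle: put the
  value 1 at all vertices, let the edge \<open>e\<close> turn \<open>w e\<close> times, and fill in
  the squares, which is possible because the total turning around a square is 0. Windings vanish on
  boundaries.\<close>

lemma integral_cocycle_pairing:
  fixes w :: "'a set \<times> bool \<Rightarrow> int"
  assumes w: "\<And>s. s \<in> squares \<Longrightarrow> w (s, True) + w (rt s, False) = w (s, False) + w (up s, True)"
    and a: "cell_chain a \<in> complex_boundaries 1 surface"
  shows "(\<Sum>e\<in>edges. a e * of_int (w e)) = 0"
proof -
  \<comment> \<open>Bilinear interpolation of the angles at the corners, counted from the lower left
    one. The cocycle condition makes the angle at the upper right corner the same along both
    ways.\<close>
  define \<theta> :: "'a set \<times> real \<times> real \<Rightarrow> real" where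
    "\<theta> = (\<lambda>(s, x, y). x * (1 - y) * of_int (w (s, True)) + (1 - x) * y * of_int (w (s, False)) +
       x * y * of_int (w (s, True) + w (rt s, False)))"
  define f where "f p = exp (2 * of_real pi * \<i> * of_real (\<theta> p))" for p
  have cont: "continuous_map (top_of_set unit_square) euclidean (\<lambda>P. f (s, P))" for s
    unfolding f_def \<theta>_def by (auto simp: case_prod_unfold intro!: continuous_intros)
  have per: "f p = f q" if "\<theta> p = \<theta> q + of_int n" for p q n
  proof -
    have "f p = f q * exp (2 * of_real pi * \<i> * of_int n)"
      unfolding f_def exp_add[symmetric] that by (simp add: algebra_simps)
    also have "exp (2 * of_real pi * \<i> * of_int n) = 1"
      using exp_eq_1[of "2 * of_real pi * \<i> * of_int n"] by auto
    finally show ?thesis by simp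
  qed
  have glue: "f p = f q" if pq: "(p, q) \<in> gluing" for p q
  proof -
    consider s y where "p = (s, 1, y)" "q = (rt s, 0, y)" "s \<in> squares"
      | s x where "p = (s, x, 1)" "q = (up s, x, 0)" "s \<in> squares"
      using pq unfolding square_gluing_def by auto
    then show ?thesis
    proof cases
      case 1
      then show ?thesis by (intro per[of _ _ "w (s, True)"]) (simp add: \<theta>_def algebra_simps)
    next
      case 2
      have "real_of_int (w (s, True)) + of_int (w (rt s, False)) = of_int (w (s, False)) + of_int (w (up s, True))"
        using w[OF 2(3)] by (metis of_int_add)
      then have "x * (real_of_int (w (s, True)) + of_int (w (rt s, False))) =
          x * (of_int (w (s, False)) + of_int (w (up s, True)))" by simp
      then have "\<theta> p = \<theta> q + of_int (w (s, False))"
        by (simp add: \<theta>_def 2 algebra_simps)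
      then show ?thesis by (rule per)
    qed
  qed
  obtain h where h: "continuous_map surface euclidean h"
    "\<And>s P. s \<in> squares \<Longrightarrow> P \<in> unit_square \<Longrightarrow> h (pt (s, P)) = f (s, P)"
    using continuous_map_from_surface[of euclidean f, OF cont glue] by metis
  have nz: "h m \<noteq> 0" if "m \<in> topspace surface" for m
    using surface_point[OF that] h(2) by (metis exp_not_eq_zero f_def)
  have edge: "chain_pairing (log_change h) (edge_chain e) = 2 * of_real pi * \<i> * of_int (w e)" if he: "e \<in> edges" for e
  proof -
    obtain s b where e: "e = (s, b)" "s \<in> squares" using he by (auto simp: edges_def)
    have "log_change h (path_simplex (\<lambda>t. pt (s, segment (0, 0) (if b then (1, 0) else (0, 1)) t))) =
        2 * of_real pi * \<i> * of_real (1 * of_int (w e)) - 2 * of_real pi * \<i> * of_real (0 * of_int (w e))"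
    proof (rule log_change_path)
      show "continuous_on {0..1} (\<lambda>t. 2 * complex_of_real pi * \<i> * of_real (t * of_int (w e)))"
        by (intro continuous_intros)
      fix t :: real assume t: "t \<in> {0..1}"
      have "segment (0, 0) (if b then (1, 0) else (0, 1)) t \<in> unit_square"
        using t by (auto simp: segment_def)
      then show "h (pt (s, segment (0, 0) (if b then (1, 0) else (0, 1)) t)) =
          exp (2 * of_real pi * \<i> * of_real (t * of_int (w e)))"
        using h(2)[OF e(2)] by (cases b) (simp_all add: f_def \<theta>_def segment_def e(1))
    qed
    then show ?thesis by (simp add: edge_chain_def seg_chain_def path_chain_def e(1))
  qed
  have "0 = chain_pairing (log_change h) (cell_chain a)"
    using log_change_boundary[OF h(1) nz a] by simp
  also have "\<dots> = (\<Sum>e\<in>edges. a e * (2 * of_real pi * \<i> * of_int (w e)))"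
    by (simp add: cell_chain_def chain_pairing_sum edge)
  also have "\<dots> = 2 * of_real pi * \<i> * (\<Sum>e\<in>edges. a e * of_int (w e))"
    by (simp add: sum_distrib_left algebra_simps)
  finally show ?thesis by simp
qed

text \<open>A common multiple of the denominators makes the values integral.\<close>

lemma rational_cocycle_pairing:
  fixes w :: "'a set \<times> bool \<Rightarrow> rat"
  assumes w: "\<And>s. s \<in> squares \<Longrightarrow> w (s, True) + w (rt s, False) = w (s, False) + w (up s, True)"
    and a: "cell_chain a \<in> complex_boundaries 1 surface"
  shows "(\<Sum>e\<in>edges. a e * of_rat (w e)) = 0"
proof -
  define N where "N = (\<Prod>e\<in>edges. snd (quotient_of (w e)))"
  have pos: "snd (quotient_of (w e)) > 0" for e using quotient_of_denom_pos' by simp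
  have N: "N > 0" unfolding N_def using pos by (intro prod_pos) auto
  have int: "\<exists>k. w e * of_int N = of_int k" if "e \<in> edges" for e
  proof -
    obtain p q where pq: "quotient_of (w e) = (p, q)" by (cases "quotient_of (w e)")
    have "N = q * (\<Prod>e\<in>edges - {e}. snd (quotient_of (w e)))"
      unfolding N_def using that finite_edges pq by (simp add: prod.remove)
    moreover have "w e = of_int p / of_int q" by (rule quotient_of_div[OF pq])
    moreover have "q > 0" using pos[of e] pq by simp
    ultimately have "w e * of_int N = of_int (p * (\<Prod>e\<in>edges - {e}. snd (quotient_of (w e))))" by simp
    then show ?thesis by blast
  qed
  then obtain u where u: "\<And>e. e \<in> edges \<Longrightarrow> w e * of_int N = of_int (u e)" by metis
  have "(\<Sum>e\<in>edges. a e * of_int (u e)) = 0"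
  proof (rule integral_cocycle_pairing[OF _ a])
    fix s assume s: "s \<in> squares"
    then have "(s, b) \<in> edges" "(rt s, b) \<in> edges" "(up s, b) \<in> edges" for b
      using rt_up_closed by (simp_all add: edges_def)
    then have "(of_int (u (s, True) + u (rt s, False)) :: rat) = of_int (u (s, False) + u (up s, True))"
      using w[OF s] by (simp add: u[symmetric] distrib_right[symmetric])
    then show "u (s, True) + u (rt s, False) = u (s, False) + u (up s, True)" by (simp only: of_int_eq_iff)
  qed
  also have "(\<Sum>e\<in>edges. a e * of_int (u e)) = (\<Sum>e\<in>edges. a e * of_rat (w e)) * of_int N"
  proof -
    have "(of_int (u e) :: complex) = of_rat (w e) * of_int N" if "e \<in> edges" for e
      using u[OF that] by (metis of_rat_mult of_rat_of_int_eq)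
    then show ?thesis by (simp add: sum_distrib_right mult.assoc)
  qed
  finally show ?thesis using N by simp
qed

text \<open>The coordinates of \<open>w\<close> in a basis of the complex numbers over the rationals
  are rational cocycles, since the cocycle condition has rational coefficients. Finitely many
  coordinates matter.\<close>

lemma complex_cocycle_pairing:
  fixes w :: "'a set \<times> bool \<Rightarrow> complex"
  assumes w: "\<And>s. s \<in> squares \<Longrightarrow> w (s, True) + w (rt s, False) = w (s, False) + w (up s, True)"
    and a: "cell_chain a \<in> complex_boundaries 1 surface"
  shows "(\<Sum>e\<in>edges. a e * w e) = 0"
proof -
  interpret Q: vector_space "\<lambda>(q::rat) (z::complex). of_rat q * z"
    by unfold_locales (simp_all add: algebra_simps of_rat_add of_rat_mult)
  define B where "B = Q.extend_basis {}"
  have B: "Q.independent B" "Q.span B = UNIV"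
    unfolding B_def using Q.independent_extend_basis[OF Q.independent_empty] Q.span_extend_basis[OF Q.independent_empty] by auto
  define q where "q b z = Q.representation B z b" for b z
  define B0 where "B0 = (\<Union>e\<in>edges. {b. q b (w e) \<noteq> 0})"
  have fB: "finite B0"
    unfolding B0_def q_def using finite_edges Q.finite_representation by blast
  have we: "w e = (\<Sum>b\<in>B0. of_rat (q b (w e)) * b)" if e: "e \<in> edges" for e
  proof -
    have "w e = (\<Sum>b | q b (w e) \<noteq> 0. of_rat (q b (w e)) * b)"
      unfolding q_def using Q.sum_nonzero_representation_eq[OF B(1), of "w e"] B(2) by simp
    also have "\<dots> = (\<Sum>b\<in>B0. of_rat (q b (w e)) * b)"
      using e fB by (intro sum.mono_neutral_left) (auto simp: B0_def)
    finally show ?thesis .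
  qed
  have qadd: "q b (x + y) = q b x + q b y" for b x y
    unfolding q_def using Q.representation_add[OF B(1), of y x] B(2) by simp
  have "(\<Sum>e\<in>edges. a e * of_rat (q b (w e))) = 0" for b
  proof (rule rational_cocycle_pairing[OF _ a])
    fix s assume s: "s \<in> squares"
    show "q b (w (s, True)) + q b (w (rt s, False)) = q b (w (s, False)) + q b (w (up s, True))"
      using w[OF s] by (simp flip: qadd)
  qed
  then have "0 = (\<Sum>b\<in>B0. (\<Sum>e\<in>edges. a e * of_rat (q b (w e))) * b)" by simp
  also have "\<dots> = (\<Sum>e\<in>edges. a e * (\<Sum>b\<in>B0. of_rat (q b (w e)) * b))"
    by (simp add: sum_distrib_left sum_distrib_right mult.assoc) (rule sum.swap)
  also have "\<dots> = (\<Sum>e\<in>edges. a e * w e)" using we by simp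
  finally show ?thesis by simp
qed

end

section \<open>Homology classes and automorphisms\<close>

text \<open>Additivity of the trace. An equivariant surjection also carries the structure of a
  representation over to its target, and this is how homology is recognized as one.\<close>

lemma character_exact:
  assumes rep: "representation K V \<phi>"
    and surj: "f ` carrier V = carrier W" and zero: "f \<zero>\<^bsub>V\<^esub> = \<zero>\<^bsub>W\<^esub>"
    and add: "\<And>v w. v \<in> carrier V \<Longrightarrow> w \<in> carrier V \<Longrightarrow> f (v \<oplus>\<^bsub>V\<^esub> w) = f v \<oplus>\<^bsub>W\<^esub> f w"
    and smult: "\<And>z v. v \<in> carrier V \<Longrightarrow> f (z \<odot>\<^bsub>V\<^esub> v) = z \<odot>\<^bsub>W\<^esub> f v"
    and comm: "\<And>k v. k \<in> carrier K \<Longrightarrow> v \<in> carrier V \<Longrightarrow> f (\<phi> k v) = \<psi> k (f v)"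
    and U: "U = {v \<in> carrier V. f v = \<zero>\<^bsub>W\<^esub>}"
  shows "representation K W \<psi>" "representation K (V\<lparr>carrier := U\<rparr>) \<phi>"
    "\<And>k. k \<in> carrier K \<Longrightarrow>
       rep_character K V \<phi> k = rep_character K (V\<lparr>carrier := U\<rparr>) \<phi> k + rep_character K W \<psi> k"
proof -
  note V = rep_vs[OF rep] and fd = rep_fin_dim_space[OF rep]
  note W = vectorspace_image(1)[OF V surj zero add smult] and f = vectorspace_image(2)[OF V surj zero add smult]
  have lin: "linear_map complex_field W W (\<psi> k)" if k: "k \<in> carrier K" for k
  proof (intro complex_linear_mapI W)
    show "\<psi> k w \<in> carrier W" if w: "w \<in> carrier W" for w
    proof -
      obtain v where "v \<in> carrier V" "w = f v" using w surj by blast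
      then show ?thesis using comm[OF k, of v] lm_closed[OF f rep_closed[OF rep k, of v]] by simp
    qed
    show "\<psi> k (w \<oplus>\<^bsub>W\<^esub> w') = \<psi> k w \<oplus>\<^bsub>W\<^esub> \<psi> k w'" if w: "w \<in> carrier W" "w' \<in> carrier W" for w w'
    proof -
      obtain v v' where v: "v \<in> carrier V" "w = f v" "v' \<in> carrier V" "w' = f v'" using w surj by blast
      have "\<psi> k (w \<oplus>\<^bsub>W\<^esub> w') = f (\<phi> k (v \<oplus>\<^bsub>V\<^esub> v'))" using v add comm[OF k] vs_add[OF V] by simp
      also have "\<dots> = \<psi> k w \<oplus>\<^bsub>W\<^esub> \<psi> k w'"
        using v add comm[OF k] lm_add[OF rep_linear[OF rep k]] rep_closed[OF rep k] by simp
      finally show ?thesis .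
    qed
    show "\<psi> k (z \<odot>\<^bsub>W\<^esub> w) = z \<odot>\<^bsub>W\<^esub> \<psi> k w" if w: "w \<in> carrier W" for w z
    proof -
      obtain v where v: "v \<in> carrier V" "w = f v" using w surj by blast
      have "\<psi> k (z \<odot>\<^bsub>W\<^esub> w) = f (\<phi> k (z \<odot>\<^bsub>V\<^esub> v))" using v smult comm[OF k] vs_smult[OF V] by simp
      also have "\<dots> = z \<odot>\<^bsub>W\<^esub> \<psi> k w"
        using v smult comm[OF k] lm_smult[OF rep_linear[OF rep k]] rep_closed[OF rep k] by simp
      finally show ?thesis .
    qed
  qed
  interpret K: group K using rep_group[OF rep] .
  have ex: "fin_dim_space W" "closed_subspace V U"
    "endo_trace V (\<phi> k) = endo_trace (V\<lparr>carrier := U\<rparr>) (\<phi> k) + endo_trace W (\<psi> k)" if k: "k \<in> carrier K" for k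
    using trace_exact[OF fd f surj rep_linear[OF rep k] lin[OF k] comm[OF k] U] by blast+
  show "representation K W \<psi>"
    unfolding representation_def
  proof (intro conjI ballI)
    show "group K" by (rule K.is_group)
    show "vectorspace complex_field W" "vectorspace.fin_dim complex_field W" using ex(1)[OF K.one_closed] by auto
    show "linear_map complex_field W W (\<psi> k)" if "k \<in> carrier K" for k by (rule lin[OF that])
    show "\<psi> \<one>\<^bsub>K\<^esub> w = w" if w: "w \<in> carrier W" for w
    proof -
      obtain v where v: "v \<in> carrier V" "w = f v" using w surj by blast
      then show ?thesis using comm[OF K.one_closed v(1)] rep_one[OF rep v(1)] by simp
    qed
    show "\<psi> (k \<otimes>\<^bsub>K\<^esub> l) w = \<psi> k (\<psi> l w)" if w: "k \<in> carrier K" "l \<in> carrier K" "w \<in> carrier W" for k l w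
    proof -
      obtain v where v: "v \<in> carrier V" "w = f v" using w surj by blast
      have "\<psi> (k \<otimes>\<^bsub>K\<^esub> l) w = f (\<phi> k (\<phi> l v))"
        using comm[OF K.m_closed[OF w(1,2)] v(1)] rep_mult[OF rep w(1,2) v(1)] v(2) by simp
      also have "\<dots> = \<psi> k (\<psi> l w)"
        using comm[OF w(1) rep_closed[OF rep w(2) v(1)]] comm[OF w(2) v(1)] v(2) by simp
      finally show ?thesis .
    qed
  qed
  show "representation K (V\<lparr>carrier := U\<rparr>) \<phi>"
  proof (rule rep_subspace[OF rep ex(2)[OF K.one_closed]])
    fix k u assume k: "k \<in> carrier K" and u: "u \<in> U"
    then have "f (\<phi> k u) = \<psi> k \<zero>\<^bsub>W\<^esub>" using comm[OF k, of u] by (simp add: U)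
    then show "\<phi> k u \<in> U" using lm_zero[OF lin[OF k]] rep_closed[OF rep k] u by (simp add: U)
  qed
  show "rep_character K V \<phi> k = rep_character K (V\<lparr>carrier := U\<rparr>) \<phi> k + rep_character K W \<psi> k"
    if "k \<in> carrier K" for k
    using ex(3)[OF that] that by (simp add: rep_character_def)
qed

text \<open>The coset of \<open>c\<close>, defined for chains that need not be cycles, so that the
  operations of the homology module become those of chains without side conditions.\<close>

definition homology_class :: "'a topology \<Rightarrow> 'a complex_chain \<Rightarrow> 'a complex_chain set" where
  "homology_class Y c = (\<lambda>b. b + c) ` complex_boundaries 1 Y"

lemma homology_class_eq: "homology_class Y c = homology_class Y d \<longleftrightarrow> homologous Y c d"
proof
  assume "homology_class Y c = homology_class Y d"
  moreover have "c \<in> homology_class Y c"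
    unfolding homology_class_def using boundaries_zero[of 1 Y] by (metis add_0 image_eqI)
  ultimately obtain b where "b \<in> complex_boundaries 1 Y" "c = b + d" unfolding homology_class_def by blast
  then show "homologous Y c d" by (simp add: homologous_def)
next
  assume h: "homologous Y c d"
  have sub: "homology_class Y c \<subseteq> homology_class Y d" if h: "homologous Y c d" for c d
  proof
    fix x assume "x \<in> homology_class Y c"
    then obtain b where b: "b \<in> complex_boundaries 1 Y" "x = b + c" unfolding homology_class_def by blast
    have "b + (c - d) \<in> complex_boundaries 1 Y"
      using boundaries_add[OF b(1)] h by (simp only: homologous_def)
    then show "x \<in> homology_class Y d"
      unfolding homology_class_def by (rule image_eqI[rotated]) (simp add: b)
  qed
  show "homology_class Y c = homology_class Y d"
    using sub[OF h] sub[OF homologous_sym[OF h]] by blast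
qed

lemma homology_class_coset:
  "complex_boundaries 1 Y +>\<^bsub>(chain_space 1 Y)\<^esub> c = homology_class Y c"
  "complex_boundaries 1 Y +>\<^bsub>(chain_space 1 Y)\<lparr>carrier := C\<rparr>\<^esub> c = homology_class Y c"
  by (auto simp: a_r_coset_def r_coset_def homology_class_def chain_space_def)

lemma boundaries_homology_class: "complex_boundaries 1 Y = homology_class Y 0"
  by (simp add: homology_class_def)

lemma homology_map_class:
  assumes "continuous_map X Y g"
  shows "homology_map 1 Y g (homology_class X c) = homology_class Y (complex_chain_map 1 g c)"
proof -
  have "homology_class Y (complex_chain_map 1 g (b + c)) = homology_class Y (complex_chain_map 1 g c)"
    if "b \<in> complex_boundaries 1 X" for b
    using chain_map_boundaries[OF assms that] by (simp add: homology_class_eq homologous_def)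
  moreover have "complex_boundaries 1 X \<noteq> {}" using boundaries_zero by blast
  ultimately show ?thesis
    unfolding homology_map_def homology_class_coset by (simp add: homology_class_def[of X])
qed

lemma complex_homology_operations:
  "carrier (complex_homology 1 Y) = homology_class Y ` complex_cycles 1 Y"
  "\<zero>\<^bsub>complex_homology 1 Y\<^esub> = homology_class Y 0"
  "homology_class Y c \<oplus>\<^bsub>complex_homology 1 Y\<^esub> homology_class Y d = homology_class Y (c + d)"
  "z \<odot>\<^bsub>complex_homology 1 Y\<^esub> homology_class Y c = homology_class Y (chain_scale z c)"
proof -
  show "carrier (complex_homology 1 Y) = homology_class Y ` complex_cycles 1 Y"
  proof -
    have "a_rcosets\<^bsub>V\<^esub> W = (\<lambda>c. W +>\<^bsub>V\<^esub> c) ` carrier V" for V :: "(complex, 'a complex_chain) module" and W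
      by (auto simp: A_RCOSETS_def RCOSETS_def a_r_coset_def)
    then show ?thesis
      unfolding complex_homology_def quotient_space_def
      by (simp add: homology_class_coset[unfolded One_nat_def])
  qed
  show "\<zero>\<^bsub>complex_homology 1 Y\<^esub> = homology_class Y 0"
    unfolding complex_homology_def quotient_space_def boundaries_homology_class by simp
  have ad: "homology_class Y c \<oplus>\<^bsub>complex_homology 1 Y\<^esub> homology_class Y d =
      {x + y | x y. x \<in> homology_class Y c \<and> y \<in> homology_class Y d}"
    unfolding complex_homology_def quotient_space_def
    by (auto simp: set_add_def set_mult_def chain_space_def)
  show "homology_class Y c \<oplus>\<^bsub>complex_homology 1 Y\<^esub> homology_class Y d = homology_class Y (c + d)"
    unfolding ad
  proof (intro equalityI subsetI)
    fix x assume "x \<in> {x + y | x y. x \<in> homology_class Y c \<and> y \<in> homology_class Y d}"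
    then obtain b b' where "b \<in> complex_boundaries 1 Y" "b' \<in> complex_boundaries 1 Y" "x = (b + c) + (b' + d)"
      unfolding homology_class_def by blast
    then show "x \<in> homology_class Y (c + d)"
      unfolding homology_class_def using boundaries_add[of b 1 Y b'] by (intro image_eqI[of _ _ "b + b'"]) simp_all
  next
    fix x assume "x \<in> homology_class Y (c + d)"
    then obtain b where "b \<in> complex_boundaries 1 Y" "x = (b + c) + (0 + d)"
      unfolding homology_class_def by (auto simp: add.assoc)
    then show "x \<in> {x + y | x y. x \<in> homology_class Y c \<and> y \<in> homology_class Y d}"
      unfolding homology_class_def using boundaries_zero by blast
  qed
  have sm: "z \<odot>\<^bsub>complex_homology 1 Y\<^esub> homology_class Y c =
      (\<Union>v\<in>homology_class Y c. homology_class Y (chain_scale z v))"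
    unfolding complex_homology_def quotient_space_def by (simp add: homology_class_coset[unfolded One_nat_def])
  have "homology_class Y (chain_scale z (b + c)) = homology_class Y (chain_scale z c)"
    if "b \<in> complex_boundaries 1 Y" for b
    using boundaries_scale[OF that, of z] by (simp add: homology_class_eq homologous_def chain_scale_add)
  moreover have "complex_boundaries 1 Y \<noteq> {}" using boundaries_zero by blast
  ultimately show "z \<odot>\<^bsub>complex_homology 1 Y\<^esub> homology_class Y c = homology_class Y (chain_scale z c)"
    unfolding sm by (simp add: homology_class_def[of Y c])
qed

lemma trivial_trace_fun_space:
  assumes "finite I"
  shows "endo_trace (fun_space I) (\<lambda>v. v) = of_nat (card I)"
proof -
  have "linear_map complex_field (fun_space I) (fun_space I) (\<lambda>v. v)"
    by (intro complex_linear_mapI fun_space_vectorspace) auto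
  from endo_trace_frame[OF this fun_space_frame[OF assms]] show ?thesis by simp
qed

context origami_data
begin

abbreviation aut_group where "aut_group \<equiv> normalizer_quotient G H"
abbreviation norm_H where "norm_H \<equiv> normalizer G H"

lemma norm_H_subgroup: "subgroup norm_H G"
  using normalizer_imp_subgroup[OF subgroup.subset[OF subgroup_H]] .

lemma aut_group_group: "group aut_group"
  using normal.factorgroup_is_group[OF subgroup_in_normalizer[OF subgroup_H]] .

lemma norm_H_coset_eq: "n \<in> norm_H \<Longrightarrow> H #> n = n <# H"
  using normal.coset_eq[OF subgroup_in_normalizer[OF subgroup_H]]
  by (simp add: r_coset_def l_coset_def)

lemma aut_group_carrier: "carrier aut_group = {H #> n | n. n \<in> norm_H}"
  by (auto simp: FactGroup_def RCOSETS_def r_coset_def)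

lemma aut_group_mult: "k \<otimes>\<^bsub>aut_group\<^esub> l = k <#> l"
  by (auto simp: FactGroup_def set_mult_def)

lemma aut_group_one: "\<one>\<^bsub>aut_group\<^esub> = H"
  by (simp add: FactGroup_def)

text \<open>For \<open>n\<close> in the normalizer, \<open>H n H g = H H n g = H n
  g\<close>.\<close>

lemma coset_product:
  assumes "n \<in> norm_H" "g \<in> carrier G"
  shows "(H #> n) <#> (H #> g) = H #> (n \<otimes> g)"
proof -
  have HG: "H \<subseteq> carrier G" using subgroup.subset[OF subgroup_H] .
  have n: "n \<in> carrier G" using assms norm_H_subgroup by (meson subgroup.mem_carrier)
  have "(H #> n) <#> (H #> g) = ((H #> n) <#> H) #> g"
    using setmult_rcos_assoc[of "H #> n" H g] HG n assms(2) r_coset_subset_G by auto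
  also have "(H #> n) <#> H = H #> n"
    using rcos_assoc_lcos[OF HG HG n] norm_H_coset_eq[OF assms(1)] setmult_rcos_assoc[OF HG HG n]
      subgroup_mult_id[OF subgroup_H] by simp
  finally show ?thesis using coset_mult_assoc[OF HG n assms(2)] by simp
qed

lemma aut_subset:
  assumes "k \<in> carrier aut_group" shows "k \<subseteq> carrier G"
proof -
  obtain n where "n \<in> norm_H" "k = H #> n" using assms unfolding aut_group_carrier by blast
  then show ?thesis
    using r_coset_subset_G[OF subgroup.subset[OF subgroup_H]] subgroup.mem_carrier[OF norm_H_subgroup] by blast
qed

lemma aut_square_closed:
  assumes "k \<in> carrier aut_group" "s \<in> squares" shows "k <#> s \<in> squares"
proof -
  obtain n a where "n \<in> norm_H" "k = H #> n" "a \<in> carrier G" "s = H #> a"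
    using assms by (auto simp: aut_group_carrier RCOSETS_def)
  then show ?thesis
    using coset_product norm_H_subgroup subgroup.mem_carrier by (fastforce simp: RCOSETS_def)
qed

lemma aut_square_translate:
  assumes "k \<in> carrier aut_group" "s \<in> squares" "g \<in> carrier G"
  shows "k <#> (s #> g) = (k <#> s) #> g"
  using setmult_rcos_assoc[OF aut_subset[OF assms(1)] squares_translate(1)[OF assms(2)] assms(3)] .

lemma aut_square_one: "s \<in> squares \<Longrightarrow> \<one>\<^bsub>aut_group\<^esub> <#> s = s"
proof -
  assume "s \<in> squares"
  then obtain a where "a \<in> carrier G" "s = H #> a" by (auto simp: RCOSETS_def)
  then show ?thesis
    using setmult_rcos_assoc[of H H a] subgroup.subset[OF subgroup_H] subgroup_mult_id[OF subgroup_H]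
    by (simp add: aut_group_one)
qed

lemma aut_square_mult:
  assumes "k \<in> carrier aut_group" "l \<in> carrier aut_group" "s \<in> squares"
  shows "(k \<otimes>\<^bsub>aut_group\<^esub> l) <#> s = k <#> (l <#> s)"
  unfolding aut_group_mult using set_mult_assoc aut_subset squares_translate(1) assms by metis

lemma aut_inv_cancel:
  assumes "k \<in> carrier aut_group" "s \<in> squares"
  shows "k <#> (inv\<^bsub>aut_group\<^esub> k <#> s) = s" "inv\<^bsub>aut_group\<^esub> k <#> (k <#> s) = s"
proof -
  interpret K: group aut_group by (rule aut_group_group)
  have i: "inv\<^bsub>aut_group\<^esub> k \<in> carrier aut_group" by (rule K.inv_closed[OF assms(1)])
  show "k <#> (inv\<^bsub>aut_group\<^esub> k <#> s) = s"
    unfolding aut_square_mult[OF assms(1) i assms(2), symmetric] K.r_inv[OF assms(1)]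
    by (rule aut_square_one[OF assms(2)])
  show "inv\<^bsub>aut_group\<^esub> k <#> (k <#> s) = s"
    unfolding aut_square_mult[OF i assms, symmetric] K.l_inv[OF assms(1)]
    by (rule aut_square_one[OF assms(2)])
qed

lemma finite_aut_group: "finite (carrier aut_group)"
proof -
  have "carrier aut_group \<subseteq> Pow (carrier G)" using aut_subset by blast
  then show ?thesis using finite_G finite_subset by blast
qed

lemma aut_gluing:
  assumes "k \<in> carrier aut_group" "(p, q) \<in> gluing"
  shows "((k <#> fst p, snd p), (k <#> fst q, snd q)) \<in> gluing"
proof -
  consider s y where "p = (s, 1, y)" "q = (rt s, 0, y)" "s \<in> squares" "y \<in> {0..1}"
    | s x where "p = (s, x, 1)" "q = (up s, x, 0)" "s \<in> squares" "x \<in> {0..1}"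
    using assms(2) unfolding square_gluing_def by auto
  then show ?thesis
    using aut_square_translate[OF assms(1)] aut_square_closed[OF assms(1)] g_r_closed g_u_closed
      gluing_right gluing_up by cases (simp_all del: atLeastAtMost_iff)
qed

lemma aut_glue_rel:
  assumes k: "k \<in> carrier aut_group" and "(p, q) \<in> glue_rel"
  shows "((k <#> fst p, snd p), (k <#> fst q, snd q)) \<in> glue_rel"
  using assms(2)
proof (induction rule: rtrancl_induct)
  case base
  then show ?case by simp
next
  case (step q r)
  have "((k <#> fst q, snd q), (k <#> fst r, snd r)) \<in> gluing \<union> gluing\<inverse>"
    using step(2) aut_gluing[OF k] by blast
  then show ?case using step(3) by (meson rtrancl.rtrancl_into_rtrancl)
qed

lemma automorphism_pt:
  assumes k: "k \<in> carrier aut_group" and p: "s \<in> squares" "P \<in> unit_square"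
  shows "origami_automorphism G k (pt (s, P)) = pt (k <#> s, P)"
proof -
  interpret K: group aut_group by (rule aut_group_group)
  have mem: "q \<in> pt p \<longleftrightarrow> (p, q) \<in> glue_rel" for p q unfolding origami_point_def by (simp only: Image_singleton_iff)
  have split: "(\<lambda>(s, P). (k <#> s, P)) = (\<lambda>q. (k <#> fst q, snd q))" by auto
  show ?thesis
    unfolding origami_automorphism_def split
  proof (intro equalityI subsetI)
    fix x assume "x \<in> (\<lambda>q. (k <#> fst q, snd q)) ` pt (s, P)"
    then obtain q where q: "q \<in> pt (s, P)" "x = (k <#> fst q, snd q)" by blast
    have "((s, P), q) \<in> glue_rel" using q(1) by (simp only: mem)
    from aut_glue_rel[OF k this] show "x \<in> pt (k <#> s, P)" by (simp only: mem q(2) fst_conv snd_conv)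
  next
    fix x assume x: "x \<in> pt (k <#> s, P)"
    then have r: "((k <#> s, P), x) \<in> glue_rel" by (simp only: mem)
    have "(k <#> s, P) \<in> squares \<times> unit_square" using aut_square_closed[OF k p(1)] p(2) by blast
    from glue_rel_tiles[OF r this] have xt: "fst x \<in> squares" by auto
    have "((s, P), (inv\<^bsub>aut_group\<^esub> k <#> fst x, snd x)) \<in> glue_rel"
      using aut_glue_rel[OF K.inv_closed[OF k] r] aut_inv_cancel(2)[OF k p(1)] by (simp only: fst_conv snd_conv)
    then show "x \<in> (\<lambda>q. (k <#> fst q, snd q)) ` pt (s, P)"
      using aut_inv_cancel(1)[OF k xt]
      by (intro image_eqI[of _ _ "(inv\<^bsub>aut_group\<^esub> k <#> fst x, snd x)"]) (simp_all only: mem fst_conv snd_conv prod.collapse)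
  qed
qed

lemma continuous_automorphism:
  assumes k: "k \<in> carrier aut_group"
  shows "continuous_map surface surface (origami_automorphism G k)"
proof -
  obtain h where h: "continuous_map surface surface h"
    "\<And>s P. s \<in> squares \<Longrightarrow> P \<in> unit_square \<Longrightarrow> h (pt (s, P)) = pt (k <#> s, P)"
  proof (rule continuous_map_from_surface[of surface "\<lambda>p. pt (k <#> fst p, snd p)"])
    show "continuous_map (top_of_set unit_square) surface (\<lambda>P. pt (k <#> fst (s, P), snd (s, P)))"
      if "s \<in> squares" for s
      using continuous_square[OF aut_square_closed[OF k that]] by simp
    show "pt (k <#> fst p, snd p) = pt (k <#> fst q, snd q)" if "(p, q) \<in> gluing" for p q
      by (rule pt_glue[OF aut_gluing[OF k that]])
    fix h assume "continuous_map surface surface h"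
      "\<And>s P. s \<in> squares \<Longrightarrow> P \<in> unit_square \<Longrightarrow> h (pt (s, P)) = pt (k <#> fst (s, P), snd (s, P))"
    then show thesis using that by simp
  qed
  have "h m = origami_automorphism G k m" if m: "m \<in> topspace surface" for m
  proof -
    obtain s P where "s \<in> squares" "P \<in> unit_square" "m = pt (s, P)" using surface_point[OF m] .
    then show ?thesis using h(2) automorphism_pt[OF k] by metis
  qed
  then show ?thesis using continuous_map_eq[OF h(1)] by blast
qed

lemma covering_pt:
  assumes "s \<in> squares" "P \<in> unit_square" shows "covering (pt (s, P)) = torus_point P"
proof -
  have "torus_point (snd q) = torus_point P" if "q \<in> pt (s, P)" for q
  proof -
    have "((s, P), q) \<in> glue_rel" using that unfolding origami_point_def by (simp only: Image_singleton_iff)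
    then have "pt (s, P) = pt q" by (simp only: pt_eq_iff)
    from pt_torus[OF this] show ?thesis by simp
  qed
  moreover have "(s, P) \<in> pt (s, P)" unfolding origami_point_def Image_singleton_iff by (rule rtrancl_refl)
  ultimately show ?thesis unfolding covering_def by blast
qed

lemma continuous_covering: "continuous_map surface torus covering"
proof -
  have t: "continuous_map euclidean torus torus_point"
    unfolding torus_def by (rule quotient_imp_continuous_map[OF quotient_map_quotient_top])
  obtain h where h: "continuous_map surface torus h"
    "\<And>s P. s \<in> squares \<Longrightarrow> P \<in> unit_square \<Longrightarrow> h (pt (s, P)) = torus_point P"
  proof (rule continuous_map_from_surface[of torus "\<lambda>p. torus_point (snd p)"])
    show "continuous_map (top_of_set unit_square) torus (\<lambda>P. torus_point (snd (s, P)))" for s :: "'a set"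
      using continuous_map_from_subtopology[OF t] by simp
    show "torus_point (snd p) = torus_point (snd q)" if "(p, q) \<in> gluing" for p q
      by (rule pt_torus[OF pt_glue[OF that]])
    fix h assume "continuous_map surface torus h"
      "\<And>s P. s \<in> squares \<Longrightarrow> P \<in> unit_square \<Longrightarrow> h (pt (s, P)) = torus_point (snd (s, P))"
    then show thesis using that by simp
  qed
  have "h m = covering m" if m: "m \<in> topspace surface" for m
  proof -
    obtain s P where "s \<in> squares" "P \<in> unit_square" "m = pt (s, P)" using surface_point[OF m] .
    then show ?thesis using h(2) covering_pt by metis
  qed
  then show ?thesis using continuous_map_eq[OF h(1)] by blast
qed

lemma simplex_map_edge:
  assumes "e \<in> edges"
    and "\<And>P. P \<in> unit_square \<Longrightarrow> f (pt (fst e, P)) = h P"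
  shows "complex_chain_map 1 f (edge_chain e) = path_chain (\<lambda>t. h (segment (0, 0) (if snd e then (1, 0) else (0, 1)) t))"
proof -
  let ?d = "if snd e then (1, 0) else (0, 1) :: real \<times> real"
  have "simplex_map 1 f (path_simplex (\<lambda>t. pt (fst e, segment (0, 0) ?d t))) = path_simplex (\<lambda>t. h (segment (0, 0) ?d t))"
    unfolding simplex_map_def path_simplex_def
  proof (intro restrict_ext)
    fix x :: "nat \<Rightarrow> real" assume x: "x \<in> standard_simplex 1"
    have "0 \<le> x 1" "x 1 \<le> 1" using x by (auto simp: standard_simplex_def)
    then have "segment (0, 0) ?d (x 1) \<in> unit_square" by (intro segment_unit_square) auto
    then show "(f \<circ> restrict (\<lambda>x. pt (fst e, segment (0, 0) ?d (x 1))) (standard_simplex 1)) x = h (segment (0, 0) ?d (x 1))"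
      using x assms(2) by simp
  qed
  then show ?thesis by (simp add: edge_chain_def seg_chain_def path_chain_def)
qed

lemma automorphism_edge:
  assumes "k \<in> carrier aut_group" "e \<in> edges"
  shows "complex_chain_map 1 (origami_automorphism G k) (edge_chain e) = edge_chain (k <#> fst e, snd e)"
  using simplex_map_edge[OF assms(2), of "origami_automorphism G k" "\<lambda>P. pt (k <#> fst e, P)"]
    automorphism_pt[OF assms(1)] assms(2)
  by (simp add: edge_chain_def seg_chain_def edges_def mem_Times_iff)

definition torus_loop :: "bool \<Rightarrow> (real \<times> real) set complex_chain" where
  "torus_loop b = path_chain (\<lambda>t. torus_point (segment (0, 0) (if b then (1, 0) else (0, 1)) t))"

lemma covering_edge:
  assumes "e \<in> edges" shows "complex_chain_map 1 covering (edge_chain e) = torus_loop (snd e)"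
  unfolding torus_loop_def
  using simplex_map_edge[OF assms, of covering torus_point] covering_pt assms
  by (simp add: edges_def mem_Times_iff)

text \<open>The winding of \<open>exp (2 * pi * \<i> * x)\<close> separates the horizontal loop from
  the vertical one, and likewise for the second coordinate.\<close>

lemma torus_loops_independent:
  assumes "(\<Sum>b\<in>UNIV. chain_scale (z b) (torus_loop b)) \<in> complex_boundaries 1 torus"
  shows "z b = 0"
proof -
  define f :: "real \<times> real \<Rightarrow> complex" where
    "f P = exp (2 * of_real pi * \<i> * of_real (if b then fst P else snd P))" for P
  have q: "quotient_map euclidean torus torus_point"
    unfolding torus_def by (rule quotient_map_quotient_top)
  have cf: "continuous_map euclidean euclidean f" unfolding f_def by (cases b) (auto intro!: continuous_intros)
  have per: "f P = f P'" if tp: "torus_point P = torus_point P'" for P P'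
  proof -
    obtain m n :: int where P': "P' = P + (of_int m, of_int n)" using tp unfolding torus_point_eq by blast
    have "f P' = f P * exp (2 * of_real pi * \<i> * of_int (if b then m else n))"
      unfolding f_def exp_add[symmetric] by (cases P) (simp add: P' algebra_simps)
    also have "exp (2 * of_real pi * \<i> * of_int (if b then m else n)) = 1"
      using exp_eq_1[of "2 * of_real pi * \<i> * of_int (if b then m else n)"] by auto
    finally show ?thesis by simp
  qed
  obtain h where h: "continuous_map torus euclidean h" "\<And>P. h (torus_point P) = f P"
    using quotient_map_lift_exists[OF q cf per] by (metis UNIV_I topspace_euclidean)
  have nz: "h m \<noteq> 0" if "m \<in> topspace torus" for m
    using that h(2) unfolding torus_def by (auto simp: f_def)
  have loop: "chain_pairing (log_change h) (torus_loop b') = (if b' = b then 2 * of_real pi * \<i> else 0)" for b'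
  proof -
    let ?c = "if b' = b then 1 else 0 :: real"
    have "log_change h (path_simplex (\<lambda>t. torus_point (segment (0, 0) (if b' then (1, 0) else (0, 1)) t))) =
        2 * of_real pi * \<i> * of_real (1 * ?c) - 2 * of_real pi * \<i> * of_real (0 * ?c)"
    proof (rule log_change_path)
      show "continuous_on {0..1} (\<lambda>t. 2 * complex_of_real pi * \<i> * of_real (t * ?c))"
        by (intro continuous_intros)
      show "h (torus_point (segment (0, 0) (if b' then (1, 0) else (0, 1)) t)) = exp (2 * of_real pi * \<i> * of_real (t * ?c))" for t
        unfolding h(2) f_def by (cases b; cases b') (simp_all add: segment_def)
    qed
    then show ?thesis by (simp add: torus_loop_def path_chain_def)
  qed
  have "0 = chain_pairing (log_change h) (\<Sum>b\<in>UNIV. chain_scale (z b) (torus_loop b))"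
    using log_change_boundary[OF h(1) nz assms] by simp
  also have "\<dots> = (\<Sum>b'\<in>UNIV. if b' = b then z b * (2 * of_real pi * \<i>) else 0)"
    unfolding chain_pairing_sum by (intro sum.cong) (auto simp: loop)
  also have "\<dots> = z b * (2 * of_real pi * \<i>)" by simp
  finally show ?thesis by simp
qed

end

section \<open>The cellular description of the homology in the kernel of the covering\<close>

lemma boundaries_sum: "(\<And>i. i \<in> I \<Longrightarrow> c i \<in> complex_boundaries p X) \<Longrightarrow> (\<Sum>i\<in>I. c i) \<in> complex_boundaries p X"
  by (induction I rule: infinite_finite_induct) (auto intro: boundaries_add boundaries_zero)

context origami_data
begin

lemma translate_bij:
  assumes "g \<in> carrier G" shows "bij_betw (\<lambda>s. s #> g) squares squares"
  by (rule bij_betw_byWitness[where f' = "\<lambda>s. s #> inv g"])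
    (use assms square_cancel squares_translate(2) in auto)

lemma sum_edges: "(\<Sum>e\<in>edges. f e) = (\<Sum>s\<in>squares. f (s, True) + f (s, False))"
  unfolding edges_def by (simp add: sum.cartesian_product' UNIV_bool add.commute)

text \<open>The cellular boundary of the 2-chain with coefficients \<open>x\<close>. The boundary of
  the square \<open>s\<close> is its bottom, plus the left side of \<open>s #> g_r\<close>, minus
  the bottom of \<open>s #> g_u\<close>, minus its left side; collecting the coefficient of an edge
  explains the inverses.\<close>

definition square_boundary where
  "square_boundary x = (\<lambda>e\<in>edges. if snd e then x (fst e) - x (fst e #> inv g_u) else x (fst e #> inv g_r) - (x (fst e) :: complex))"

lemma square_boundary_sum:
  "(\<Sum>e\<in>edges. square_boundary x e * f e) = (\<Sum>s\<in>squares. x s * (f (s, True) - f (up s, True) + f (rt s, False) - f (s, False)))"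
proof -
  have 1: "(\<Sum>s\<in>squares. x (s #> inv g) * f (s, b)) = (\<Sum>s\<in>squares. x s * f (s #> g, b))" if g: "g \<in> carrier G" for g b
    using sum.reindex_bij_betw[OF translate_bij[OF g], of "\<lambda>s. x (s #> inv g) * f (s, b)"] square_cancel(1)[OF _ g]
    by simp
  have "(\<Sum>e\<in>edges. square_boundary x e * f e) = (\<Sum>s\<in>squares. (x s - x (s #> inv g_u)) * f (s, True) + (x (s #> inv g_r) - x s) * f (s, False))"
    unfolding sum_edges by (intro sum.cong) (auto simp: square_boundary_def edges_def)
  also have "\<dots> = (\<Sum>s\<in>squares. x s * f (s, True)) - (\<Sum>s\<in>squares. x (s #> inv g_u) * f (s, True)) +
      ((\<Sum>s\<in>squares. x (s #> inv g_r) * f (s, False)) - (\<Sum>s\<in>squares. x s * f (s, False)))"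
    by (simp add: sum.distrib sum_subtractf left_diff_distrib)
  also have "\<dots> = (\<Sum>s\<in>squares. x s * (f (s, True) - f (up s, True) + f (rt s, False) - f (s, False)))"
    unfolding 1[OF g_u_closed] 1[OF g_r_closed]
    by (simp add: sum.distrib sum_subtractf right_diff_distrib distrib_left)
  finally show ?thesis .
qed

lemma square_relation:
  assumes s: "s \<in> squares"
  shows "homologous surface (edge_chain (s, True) + edge_chain (rt s, False)) (edge_chain (s, False) + edge_chain (up s, True))"
proof -
  have 1: "seg_chain s (1, 0) (1, 1) = edge_chain (rt s, False)"
    unfolding edge_chain_def seg_chain_def
  proof (rule path_chain_cong)
    fix t :: real assume "0 \<le> t" "t \<le> 1"
    then show "pt (s, segment (1, 0) (1, 1) t) = pt (fst (rt s, False), segment (0, 0) (if snd (rt s, False) then (1, 0) else (0, 1)) t)"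
      using pt_right[OF s, of t] by (simp add: segment_def)
  qed
  have 2: "seg_chain s (0, 1) (1, 1) = edge_chain (up s, True)"
    unfolding edge_chain_def seg_chain_def
  proof (rule path_chain_cong)
    fix t :: real assume "0 \<le> t" "t \<le> 1"
    then show "pt (s, segment (0, 1) (1, 1) t) = pt (fst (up s, True), segment (0, 0) (if snd (up s, True) then (1, 0) else (0, 1)) t)"
      using pt_up[OF s, of t] by (simp add: segment_def)
  qed
  have "homologous surface (edge_chain (s, True) + edge_chain (rt s, False)) (seg_chain s (0, 0) (1, 1))"
    using seg_chain_triangle[OF s, of "(0, 0)" "(1, 0)" "(1, 1)"] by (simp add: 1 edge_chain_def)
  moreover have "homologous surface (edge_chain (s, False) + edge_chain (up s, True)) (seg_chain s (0, 0) (1, 1))"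
    using seg_chain_triangle[OF s, of "(0, 0)" "(0, 1)" "(1, 1)"] by (simp add: 2 edge_chain_def)
  ultimately show ?thesis using homologous_trans homologous_sym by blast
qed

lemma lookup_cell_chain:
  "Poly_Mapping.lookup (cell_chain a) \<sigma> = (\<Sum>e\<in>edges. a e * Poly_Mapping.lookup (edge_chain e) \<sigma>)"
  by (simp add: cell_chain_def lookup_sum_pm)

lemma cell_chain_square_boundary: "cell_chain (square_boundary x) \<in> complex_boundaries 1 surface"
proof -
  have "cell_chain (square_boundary x) = (\<Sum>s\<in>squares. chain_scale (x s)
      ((edge_chain (s, True) + edge_chain (rt s, False)) - (edge_chain (s, False) + edge_chain (up s, True))))"
    by (rule poly_mapping_eqI)
      (simp add: lookup_cell_chain square_boundary_sum lookup_sum_pm lookup_add lookup_minus algebra_simps)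
  then show ?thesis
    using square_relation by (simp only:) (intro boundaries_sum boundaries_scale, simp only: homologous_def)
qed

text \<open>If \<open>a\<close> were not the boundary of a combination of squares, a linear
  functional would separate it from these boundaries. A functional vanishing on the boundaries of
  squares is a cellular cocycle, and cocycles vanish on \<open>a\<close>.\<close>

lemma cell_chain_boundary_imp_square_boundary:
  assumes a: "a \<in> extensional edges" and b: "cell_chain a \<in> complex_boundaries 1 surface"
  shows "\<exists>x\<in>extensional squares. a = square_boundary x"
proof (rule ccontr)
  assume n: "\<not> (\<exists>x\<in>extensional squares. a = square_boundary x)"
  let ?F = "fun_space edges"
  let ?U = "square_boundary ` extensional squares"
  have fd: "fin_dim_space ?F" by (rule fun_space_fin_dim_space[OF finite_edges])
  have ml: "s #> inv g_u \<in> squares" "s #> inv g_r \<in> squares" if "s \<in> squares" for s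
    using squares_translate(2)[OF that] g_u_closed g_r_closed by auto
  have "closed_subspace ?F ?U"
    unfolding closed_subspace_def
  proof (intro conjI ballI allI)
    show "?U \<subseteq> carrier ?F" by (auto simp: square_boundary_def)
    show "\<zero>\<^bsub>?F\<^esub> \<in> ?U"
      by (rule image_eqI[of _ _ "\<lambda>s\<in>squares. 0"]) (auto simp: square_boundary_def edges_def ml fun_eq_iff)
    show "v \<oplus>\<^bsub>?F\<^esub> w \<in> ?U" if "v \<in> ?U" "w \<in> ?U" for v w
    proof -
      obtain x y where "v = square_boundary x" "w = square_boundary y" using \<open>v \<in> ?U\<close> \<open>w \<in> ?U\<close> by blast
      then have "v \<oplus>\<^bsub>?F\<^esub> w = square_boundary (\<lambda>s\<in>squares. x s + y s)"
        by (auto simp: square_boundary_def edges_def ml fun_eq_iff)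
      then show ?thesis by blast
    qed
    show "z \<odot>\<^bsub>?F\<^esub> v \<in> ?U" if "v \<in> ?U" for v z
    proof -
      obtain x where "v = square_boundary x" using \<open>v \<in> ?U\<close> by blast
      then have "z \<odot>\<^bsub>?F\<^esub> v = square_boundary (\<lambda>s\<in>squares. z * x s)"
        by (auto simp: square_boundary_def edges_def ml fun_eq_iff algebra_simps)
      then show ?thesis by blast
    qed
  qed
  then obtain d where d: "linear_functional ?F d" "\<And>u. u \<in> ?U \<Longrightarrow> d u = 0" "d a \<noteq> 0"
    using functional_separates_subspace[OF fd, of ?U a] a n by auto
  define w where "w e = d (\<lambda>j\<in>edges. if j = e then 1 else 0)" for e
  have dw: "d v = (\<Sum>e\<in>edges. v e * w e)" if "v \<in> extensional edges" for v
    unfolding w_def using functional_frame[OF fun_space_vectorspace fun_space_frame[OF finite_edges] d(1), of v] that by simp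
  have "(\<Sum>e\<in>edges. a e * w e) = 0"
  proof (rule complex_cocycle_pairing[OF _ b])
    fix s assume s: "s \<in> squares"
    \<comment> \<open>Vanishing on the boundary of the single square \<open>s\<close> is the cocycle
      condition at \<open>s\<close>.\<close>
    define x where "x = (\<lambda>t\<in>squares. if t = s then 1 else 0 :: complex)"
    have "0 = d (square_boundary x)" using d(2) by (simp add: x_def)
    also have "\<dots> = (\<Sum>e\<in>edges. square_boundary x e * w e)" by (rule dw) (simp add: square_boundary_def)
    also have "\<dots> = (\<Sum>t\<in>squares. if t = s then w (t, True) - w (up t, True) + w (rt t, False) - w (t, False) else 0)"
      unfolding square_boundary_sum by (intro sum.cong) (auto simp: x_def)
    also have "\<dots> = w (s, True) - w (up s, True) + w (rt s, False) - w (s, False)"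
      using s finite_squares by simp
    finally show "w (s, True) + w (rt s, False) = w (s, False) + w (up s, True)"
      by (simp add: algebra_simps)
  qed
  then show False using dw[OF a] d(3) by simp
qed

text \<open>The points over \<open>0\<close>, listed with repetitions by the lower left corners of
  the squares.\<close>

definition vertices where "vertices = (\<lambda>s. pt (s, 0, 0)) ` squares"
definition edge_source where "edge_source e = pt (fst e, 0, 0)"
definition edge_target where "edge_target e = pt (if snd e then rt (fst e) else up (fst e), 0, 0)"

text \<open>The coefficients of the boundary of a combination of edges, a function on
  vertices.\<close>

definition edge_boundary where
  "edge_boundary a = (\<lambda>v\<in>vertices. \<Sum>e\<in>edges. a e * ((if edge_target e = v then 1 else 0) - (if edge_source e = v then 1 else 0) :: complex))"

lemma edge_ends_vertices: "e \<in> edges \<Longrightarrow> edge_source e \<in> vertices" "e \<in> edges \<Longrightarrow> edge_target e \<in> vertices"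
  using rt_up_closed by (auto simp: edges_def vertices_def edge_source_def edge_target_def)

lemma finite_vertices: "finite vertices"
  using finite_squares by (simp add: vertices_def)

lemma boundary_edge_chain:
  assumes "e \<in> edges"
  shows "complex_boundary 1 (edge_chain e) = point_chain (edge_target e) - point_chain (edge_source e)"
proof -
  obtain s b where e: "e = (s, b)" "s \<in> squares" using assms unfolding edges_def by blast
  have "pt (s, (if b then (1, 0) else (0, 1))) = edge_target e"
    using pt_right[OF e(2), of 0] pt_up[OF e(2), of 0] by (cases b) (simp_all add: edge_target_def e)
  then show ?thesis
    unfolding edge_chain_def seg_chain_def boundary_path_chain segment_ends by (simp add: e edge_source_def)
qed

lemma boundary_cell_chain:
  "complex_boundary 1 (cell_chain a) = (\<Sum>v\<in>vertices. chain_scale (edge_boundary a v) (point_chain v))"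
proof (rule poly_mapping_eqI)
  fix \<sigma> :: "(nat \<Rightarrow> real) \<Rightarrow> ('a set \<times> real \<times> real) set"
  let ?p = "\<lambda>v. Poly_Mapping.lookup (point_chain v) \<sigma>"
  have "Poly_Mapping.lookup (complex_boundary 1 (cell_chain a)) \<sigma> = (\<Sum>e\<in>edges. a e * (?p (edge_target e) - ?p (edge_source e)))"
    unfolding cell_chain_def complex_boundary_sum lookup_sum_pm
    by (intro sum.cong refl) (simp only: complex_boundary_linear lookup_chain_scale boundary_edge_chain lookup_minus)
  also have "\<dots> = (\<Sum>e\<in>edges. \<Sum>v\<in>vertices. a e * ((if edge_target e = v then 1 else 0) - (if edge_source e = v then 1 else 0)) * ?p v)"
  proof (rule sum.cong[OF refl])
    fix e assume e: "e \<in> edges"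
    have "(\<Sum>v\<in>vertices. (if x = v then 1 else 0) * ?p v) = ?p x" if "x \<in> vertices" for x
      using that finite_vertices by (simp add: if_distrib[of "\<lambda>z. z * _"] cong: if_cong)
    then show "a e * (?p (edge_target e) - ?p (edge_source e)) =
        (\<Sum>v\<in>vertices. a e * ((if edge_target e = v then 1 else 0) - (if edge_source e = v then 1 else 0)) * ?p v)"
      using edge_ends_vertices[OF e]
      by (simp add: left_diff_distrib right_diff_distrib sum_subtractf mult.assoc sum_distrib_left[symmetric])
  qed
  also have "\<dots> = (\<Sum>v\<in>vertices. edge_boundary a v * ?p v)"
    by (subst sum.swap) (simp add: edge_boundary_def sum_distrib_right)
  finally show "Poly_Mapping.lookup (complex_boundary 1 (cell_chain a)) \<sigma> =
      Poly_Mapping.lookup (\<Sum>v\<in>vertices. chain_scale (edge_boundary a v) (point_chain v)) \<sigma>"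
    by (simp add: lookup_sum_pm)
qed

lemma cell_chain_cycle_iff:
  "complex_boundary 1 (cell_chain a) = 0 \<longleftrightarrow> (\<forall>v\<in>vertices. edge_boundary a v = 0)"
proof
  assume z: "complex_boundary 1 (cell_chain a) = 0"
  show "\<forall>v\<in>vertices. edge_boundary a v = 0"
  proof
    fix v assume v: "v \<in> vertices"
    let ?\<sigma> = "restrict (\<lambda>_. v) (standard_simplex 0)"
    have "Poly_Mapping.lookup (point_chain x) ?\<sigma> = (if x = v then 1 else 0)" for x
    proof -
      have "restrict (\<lambda>_. x) (standard_simplex 0) = ?\<sigma> \<longleftrightarrow> x = v"
      proof
        assume "restrict (\<lambda>_. x) (standard_simplex 0) = ?\<sigma>"
        from fun_cong[OF this, of "\<lambda>j. if j = 0 then 1 else 0"] show "x = v"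
          by (simp only: restrict_def basis_in_standard_simplex order_refl if_True)
      qed simp
      then show ?thesis by (simp add: point_chain_def lookup_single when_def)
    qed
    then have "Poly_Mapping.lookup (\<Sum>x\<in>vertices. chain_scale (edge_boundary a x) (point_chain x)) ?\<sigma> =
        (\<Sum>x\<in>vertices. if x = v then edge_boundary a v else 0)"
      unfolding lookup_sum_pm by (intro sum.cong) auto
    then show "edge_boundary a v = 0" using z v finite_vertices unfolding boundary_cell_chain by simp
  qed
qed (simp add: boundary_cell_chain[unfolded One_nat_def])

text \<open>The covering maps every edge of a given direction to the same loop of the torus, so
  these two numbers are the coordinates of the image in the homology of the torus.\<close>

definition direction_total :: "('a set \<times> bool \<Rightarrow> complex) \<Rightarrow> bool \<Rightarrow> complex" where "direction_total a b = (\<Sum>s\<in>squares. a (s, b))"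

lemma covering_cell_chain:
  "complex_chain_map 1 covering (cell_chain a) = (\<Sum>b\<in>UNIV. chain_scale (direction_total a b) (torus_loop b))"
proof -
  have "complex_chain_map 1 covering (cell_chain a) = (\<Sum>e\<in>edges. chain_scale (a e) (torus_loop (snd e)))"
    unfolding cell_chain_def complex_chain_map_sum
    by (intro sum.cong refl) (simp only: complex_chain_map_linear covering_edge)
  also have "\<dots> = (\<Sum>b\<in>UNIV. chain_scale (direction_total a b) (torus_loop b))"
    by (rule poly_mapping_eqI) (simp add: lookup_sum_pm lookup_add sum_edges direction_total_def UNIV_bool sum.distrib sum_distrib_right add.commute)
  finally show ?thesis .
qed

text \<open>The cellular cycles whose image in the homology of the torus is zero.\<close>

definition zero_cycles where
  "zero_cycles = {a \<in> extensional edges. (\<forall>v\<in>vertices. edge_boundary a v = 0) \<and> (\<forall>b. direction_total a b = 0)}"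

definition cell_class where "cell_class a = homology_class surface (cell_chain a)"

lemma edge_chain_simplex:
  assumes "e \<in> edges" shows "Poly_Mapping.keys (edge_chain e) \<subseteq> singular_simplex_set 1 surface"
proof -
  obtain s b where e: "e = (s, b)" "s \<in> squares" using assms unfolding edges_def by blast
  let ?d = "if b then (1, 0) else (0, 1) :: real \<times> real"
  have "continuous_map (top_of_set {0..1}) (top_of_set unit_square) (segment (0, 0) ?d)"
    unfolding continuous_map_in_subtopology
  proof
    show "continuous_map (top_of_set {0..1}) euclidean (segment (0, 0) ?d)"
      unfolding segment_def by (auto intro!: continuous_intros)
    have "?d \<in> unit_square" by auto
    then show "segment (0, 0) ?d \<in> topspace (top_of_set {0..1}) \<rightarrow> unit_square"
      using segment_unit_square[of "(0, 0)" ?d] by fastforce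
  qed
  from continuous_map_compose[OF this continuous_square[OF e(2)]]
  have "continuous_map (top_of_set {0..1}) surface (\<lambda>t. pt (s, segment (0, 0) ?d t))" by (simp add: o_def)
  from singular_path_simplex[OF this] show ?thesis
    by (simp add: edge_chain_def seg_chain_def path_chain_def e)
qed

lemma cell_chain_simplex: "Poly_Mapping.keys (cell_chain a) \<subseteq> singular_simplex_set 1 surface"
proof -
  have "Poly_Mapping.keys (\<Sum>e\<in>I. chain_scale (a e) (edge_chain e)) \<subseteq> singular_simplex_set 1 surface" if "finite I" "I \<subseteq> edges" for I
    using that
  proof (induction I rule: finite_induct)
    case (insert e I)
    then have "Poly_Mapping.keys (chain_scale (a e) (edge_chain e)) \<subseteq> singular_simplex_set 1 surface"
      by (intro keys_subspace(3) edge_chain_simplex) auto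
    then show ?case unfolding sum.insert[OF insert(1,2)] using insert by (intro keys_subspace(1)) auto
  qed simp
  then show ?thesis unfolding cell_chain_def using finite_edges by blast
qed

abbreviation H1_null where "H1_null \<equiv> H1_zero G H g_r g_u"

lemma H1_zero_operations:
  "\<zero>\<^bsub>H1_null\<^esub> = homology_class surface 0"
  "homology_class surface c \<oplus>\<^bsub>H1_null\<^esub> homology_class surface d = homology_class surface (c + d)"
  "z \<odot>\<^bsub>H1_null\<^esub> homology_class surface c = homology_class surface (chain_scale z c)"
  using complex_homology_operations(2-4)[of surface] by (simp_all add: H1_zero_def Let_def)

text \<open>A class in the kernel of the covering is represented by a combination of edges. That the
  homology class of the image is zero says that its coordinates in the torus are zero, because the
  two loops are independent.\<close>

lemma H1_zero_carrier: "carrier H1_null = cell_class ` zero_cycles"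
proof (intro equalityI subsetI)
  have hm: "homology_map 1 torus covering (cell_class a) = \<zero>\<^bsub>complex_homology 1 torus\<^esub> \<longleftrightarrow> (\<forall>b. direction_total a b = 0)" for a
  proof -
    have "homology_map 1 torus covering (cell_class a) = \<zero>\<^bsub>complex_homology 1 torus\<^esub> \<longleftrightarrow>
        (\<Sum>b\<in>UNIV. chain_scale (direction_total a b) (torus_loop b)) \<in> complex_boundaries 1 torus"
      unfolding cell_class_def homology_map_class[OF continuous_covering] complex_homology_operations(2)
        homology_class_eq covering_cell_chain homologous_def by (simp only: diff_zero)
    also have "\<dots> \<longleftrightarrow> (\<forall>b. direction_total a b = 0)"
      using torus_loops_independent[of "direction_total a"] boundaries_zero by auto
    finally show ?thesis .
  qed
  have carr: "carrier H1_null = {S \<in> homology_class surface ` complex_cycles 1 surface.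
      homology_map 1 torus covering S = \<zero>\<^bsub>complex_homology 1 torus\<^esub>}"
    unfolding H1_zero_def Let_def complex_homology_operations(1)[symmetric] by simp
  have cyc: "c \<in> complex_cycles 1 surface \<longleftrightarrow>
      Poly_Mapping.keys c \<subseteq> singular_simplex_set 1 surface \<and> complex_boundary 1 c = 0" for c
    unfolding complex_cycles_def by (simp only: mem_Collect_eq carrier_chain_space)
  {
    fix S assume "S \<in> carrier H1_null"
    then obtain c where c: "S = homology_class surface c" "c \<in> complex_cycles 1 surface"
      "homology_map 1 torus covering S = \<zero>\<^bsub>complex_homology 1 torus\<^esub>"
      unfolding carr by blast
    have "cellular c" using c(2) cyc by (intro cycle_cellular) blast+
    then obtain a where a: "homologous surface c (cell_chain a)" unfolding cellular_def by blast
    define a' where "a' = restrict a edges"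
    have a': "homologous surface c (cell_chain a')"
      using a cell_chain_cong[of a a'] by (simp add: a'_def)
    have S: "S = cell_class a'" unfolding c(1) cell_class_def homology_class_eq by (rule a')
    have "complex_boundary 1 (cell_chain a') = 0"
    proof -
      obtain d where d: "Poly_Mapping.keys d \<subseteq> singular_simplex_set 2 surface" "c - cell_chain a' = complex_boundary 2 d"
        using a' unfolding homologous_def complex_boundaries_def by (auto simp: numeral_2_eq_2)
      have "complex_boundary 1 (complex_boundary 2 d) = 0"
        using d(1)
      proof (induction d rule: chain_span_induct)
        case (single \<sigma> z)
        obtain F where F: "\<sigma> = triangle_simplex F" using singular_2_simplex_triangle single by blast
        have "complex_boundary 1 (complex_boundary 2 (Poly_Mapping.single \<sigma> 1)) = 0"
          unfolding F boundary_triangle complex_boundary_linear boundary_path_chain by simp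
        moreover have eq: "Poly_Mapping.single \<sigma> z = chain_scale z (Poly_Mapping.single \<sigma> 1)" by simp
        ultimately show ?case unfolding eq complex_boundary_linear by (simp only: chain_scale_simps)
      qed (simp_all only: complex_boundary_linear add_0)
      moreover have "cell_chain a' = c - complex_boundary 2 d" using d(2) by (simp add: algebra_simps)
      ultimately show ?thesis using c(2) cyc by (simp only: complex_boundary_linear) simp
    qed
    then have "\<forall>v\<in>vertices. edge_boundary a' v = 0" by (simp only: cell_chain_cycle_iff)
    moreover have "\<forall>b. direction_total a' b = 0" using c(3) unfolding S hm .
    ultimately have "a' \<in> zero_cycles" by (simp add: zero_cycles_def a'_def)
    then show "S \<in> cell_class ` zero_cycles" using S by blast
  next
    fix S assume "S \<in> cell_class ` zero_cycles"
    then obtain a where a: "S = cell_class a" "a \<in> zero_cycles" by blast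
    have "complex_boundary 1 (cell_chain a) = 0" unfolding cell_chain_cycle_iff using a(2) by (simp add: zero_cycles_def)
    then have "cell_chain a \<in> complex_cycles 1 surface" unfolding cyc using cell_chain_simplex by blast
    moreover have "homology_map 1 torus covering S = \<zero>\<^bsub>complex_homology 1 torus\<^esub>"
      unfolding a(1) hm using a(2) by (simp add: zero_cycles_def)
    ultimately show "S \<in> carrier H1_null" unfolding carr a(1) cell_class_def by blast
  }
qed

lemma edge_boundary_square_boundary:
  assumes "v \<in> vertices" shows "edge_boundary (square_boundary x) v = 0"
proof -
  have "complex_boundary 1 (cell_chain (square_boundary x)) = 0"
    unfolding boundary_cell_chain
  proof (rule sum.neutral, rule ballI)
    fix v assume v: "v \<in> vertices"
    define f where "f e = ((if edge_target e = v then 1 else 0) - (if edge_source e = v then 1 else 0) :: complex)" for e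
    have "f (s, True) - f (up s, True) + f (rt s, False) - f (s, False) = 0" if s: "s \<in> squares" for s
    proof -
      have "pt (rt (up s), 0, 0) = pt (up (rt s), 0, 0)"
      proof -
        have "pt (rt (up s), 0, 0) = pt (s, 1, 1)"
          using pt_right[OF rt_up_closed(2)[OF s], of 0] pt_up[OF s, of 1] by simp
        also have "\<dots> = pt (up (rt s), 0, 0)"
          using pt_up[OF rt_up_closed(1)[OF s], of 0] pt_right[OF s, of 1] by simp
        finally show ?thesis .
      qed
      then show ?thesis by (simp add: f_def edge_target_def edge_source_def)
    qed
    then have "edge_boundary (square_boundary x) v = 0" using v square_boundary_sum[of x f] by (simp add: edge_boundary_def f_def)
    then show "chain_scale (edge_boundary (square_boundary x) v) (point_chain v) = 0" by simp
  qed
  then show ?thesis using assms by (simp only: cell_chain_cycle_iff)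
qed

lemma direction_total_square_boundary: "direction_total (square_boundary x) b = 0"
proof -
  have "direction_total (square_boundary x) b = (\<Sum>e\<in>edges. square_boundary x e * (if snd e = b then 1 else 0))"
    unfolding sum_edges direction_total_def by (cases b) simp_all
  also have "\<dots> = 0" unfolding square_boundary_sum by simp
  finally show ?thesis .
qed

lemma square_boundary_zero_cycles: "square_boundary ` extensional squares \<subseteq> zero_cycles"
  using edge_boundary_square_boundary direction_total_square_boundary by (auto simp: zero_cycles_def square_boundary_def)

lemma cell_class_zero_iff:
  assumes "a \<in> zero_cycles"
  shows "cell_class a = \<zero>\<^bsub>H1_null\<^esub> \<longleftrightarrow> a \<in> square_boundary ` extensional squares"
proof -
  have "cell_class a = \<zero>\<^bsub>H1_null\<^esub> \<longleftrightarrow> cell_chain a \<in> complex_boundaries 1 surface"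
    unfolding cell_class_def H1_zero_operations homology_class_eq homologous_def by (simp only: diff_zero)
  also have "\<dots> \<longleftrightarrow> a \<in> square_boundary ` extensional squares"
    using cell_chain_boundary_imp_square_boundary[of a] cell_chain_square_boundary assms by (auto simp: zero_cycles_def)
  finally show ?thesis .
qed

abbreviation inv_aut where "inv_aut k \<equiv> inv\<^bsub>aut_group\<^esub> k"

section \<open>The character of the homology in the kernel of the covering\<close>

text \<open>The inverses turn permutations of the cells into left actions on functions on the
  cells.\<close>

definition act_edges where "act_edges k v = (\<lambda>e\<in>edges. v (inv_aut k <#> fst e, snd e) :: complex)"
definition act_squares where "act_squares k v = (\<lambda>s\<in>squares. v (inv_aut k <#> s) :: complex)"
definition act_vertices where "act_vertices k v = (\<lambda>m\<in>vertices. v (origami_automorphism G (inv_aut k) m) :: complex)"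

lemma inv_aut_closed: "k \<in> carrier aut_group \<Longrightarrow> inv_aut k \<in> carrier aut_group"
  using group.inv_closed[OF aut_group_group] .

lemma automorphism_vertex:
  assumes "k \<in> carrier aut_group" "s \<in> squares"
  shows "origami_automorphism G k (pt (s, 0, 0)) = pt (k <#> s, 0, 0)"
  using automorphism_pt[OF assms, of "(0, 0)"] by simp

lemma automorphism_vertices:
  assumes "v \<in> vertices"
  shows "\<And>k. k \<in> carrier aut_group \<Longrightarrow> origami_automorphism G k v \<in> vertices"
    "origami_automorphism G \<one>\<^bsub>aut_group\<^esub> v = v"
    "\<And>k l. k \<in> carrier aut_group \<Longrightarrow> l \<in> carrier aut_group \<Longrightarrow>
       origami_automorphism G (k \<otimes>\<^bsub>aut_group\<^esub> l) v = origami_automorphism G k (origami_automorphism G l v)"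
proof -
  interpret K: group aut_group by (rule aut_group_group)
  obtain s where s: "s \<in> squares" "v = pt (s, 0, 0)" using assms unfolding vertices_def by blast
  show "origami_automorphism G k v \<in> vertices" if "k \<in> carrier aut_group" for k
    unfolding s(2) automorphism_vertex[OF that s(1)] vertices_def using aut_square_closed[OF that s(1)] by blast
  show "origami_automorphism G \<one>\<^bsub>aut_group\<^esub> v = v"
    unfolding s(2) automorphism_vertex[OF K.one_closed s(1)] aut_square_one[OF s(1)] ..
  show "origami_automorphism G (k \<otimes>\<^bsub>aut_group\<^esub> l) v = origami_automorphism G k (origami_automorphism G l v)"
    if "k \<in> carrier aut_group" "l \<in> carrier aut_group" for k l
    unfolding s(2) automorphism_vertex[OF K.m_closed[OF that] s(1)] automorphism_vertex[OF that(2) s(1)]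
      automorphism_vertex[OF that(1) aut_square_closed[OF that(2) s(1)]] aut_square_mult[OF that s(1)] ..
qed

lemma rep_squares:
  "representation aut_group (fun_space squares) act_squares"
  "k \<in> carrier aut_group \<Longrightarrow> rep_character aut_group (fun_space squares) act_squares k = of_nat (card {s \<in> squares. k <#> s = s})"
  unfolding act_squares_def
  by (rule permutation_representation[OF aut_group_group finite_squares, of "\<lambda>k s. k <#> s"];
      (rule aut_square_closed aut_square_one aut_square_mult; assumption)?; assumption?)+

lemma rep_vertices:
  "representation aut_group (fun_space vertices) act_vertices"
  "k \<in> carrier aut_group \<Longrightarrow> rep_character aut_group (fun_space vertices) act_vertices k =
     of_nat (card {v \<in> vertices. origami_automorphism G k v = v})"
  unfolding act_vertices_def
  by (rule permutation_representation[OF aut_group_group finite_vertices, of "origami_automorphism G"];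
      (rule automorphism_vertices; assumption)?; assumption?)+

lemma rep_edges:
  "representation aut_group (fun_space edges) act_edges"
  "k \<in> carrier aut_group \<Longrightarrow> rep_character aut_group (fun_space edges) act_edges k = 2 * of_nat (card {s \<in> squares. k <#> s = s})"
proof -
  have cl: "(k <#> fst e, snd e) \<in> edges" if "k \<in> carrier aut_group" "e \<in> edges" for k e
    using aut_square_closed[OF that(1)] that(2) by (simp add: edges_def mem_Times_iff)
  have sq: "fst e \<in> squares" if "e \<in> edges" for e using that by (simp add: edges_def mem_Times_iff)
  have one: "(\<one>\<^bsub>aut_group\<^esub> <#> fst e, snd e) = e" if "e \<in> edges" for e
    unfolding aut_square_one[OF sq[OF that]] by simp
  have mult: "((k \<otimes>\<^bsub>aut_group\<^esub> l) <#> fst e, snd e) = (k <#> fst (l <#> fst e, snd e), snd (l <#> fst e, snd e))"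
    if "k \<in> carrier aut_group" "l \<in> carrier aut_group" "e \<in> edges" for k l e
    unfolding aut_square_mult[OF that(1,2) sq[OF that(3)]] by simp
  show "representation aut_group (fun_space edges) act_edges"
    unfolding act_edges_def
    by (rule permutation_representation(1)[OF aut_group_group finite_edges, of "\<lambda>k e. (k <#> fst e, snd e)"];
        (rule cl one mult; assumption))
  assume k: "k \<in> carrier aut_group"
  have P: "rep_character aut_group (fun_space edges) act_edges k = of_nat (card {e \<in> edges. (k <#> fst e, snd e) = e})"
    unfolding act_edges_def
    by (rule permutation_representation(2)[OF aut_group_group finite_edges, of "\<lambda>k e. (k <#> fst e, snd e)", OF _ _ _ k];
        (rule cl one mult; assumption))
  have "{e \<in> edges. (k <#> fst e, snd e) = e} = {s \<in> squares. k <#> s = s} \<times> (UNIV :: bool set)"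
    unfolding edges_def by (auto simp: prod_eq_iff)
  then have "card {e \<in> edges. (k <#> fst e, snd e) = e} = card {s \<in> squares. k <#> s = s} * 2"
    by (simp add: card_cartesian_product)
  then show "rep_character aut_group (fun_space edges) act_edges k = 2 * of_nat (card {s \<in> squares. k <#> s = s})"
    unfolding P by simp
qed

lemma aut_edges_bij:
  assumes k: "k \<in> carrier aut_group"
  shows "bij_betw (\<lambda>e. (k <#> fst e, snd e)) edges edges"
  by (rule bij_betw_byWitness[where f' = "\<lambda>e. (inv_aut k <#> fst e, snd e)"])
    (use k aut_inv_cancel[OF k] aut_square_closed inv_aut_closed[OF k] in \<open>auto simp: edges_def\<close>)

lemma aut_squares_bij:
  assumes k: "k \<in> carrier aut_group"
  shows "bij_betw (\<lambda>s. k <#> s) squares squares"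
  by (rule bij_betw_byWitness[where f' = "\<lambda>s. inv_aut k <#> s"])
    (use k aut_inv_cancel[OF k] aut_square_closed inv_aut_closed[OF k] in auto)

lemma act_edges_apply:
  assumes k: "k \<in> carrier aut_group" and e: "e \<in> edges"
  shows "act_edges k a (k <#> fst e, snd e) = a e"
proof -
  have s: "fst e \<in> squares" using e by (simp add: edges_def mem_Times_iff)
  have "(k <#> fst e, snd e) \<in> edges" using aut_square_closed[OF k s] by (simp add: edges_def)
  then show ?thesis using aut_inv_cancel(2)[OF k s] by (simp add: act_edges_def)
qed

lemma edge_ends_automorphism:
  assumes k: "k \<in> carrier aut_group" and e: "e \<in> edges"
  shows "edge_source (k <#> fst e, snd e) = origami_automorphism G k (edge_source e)"
    "edge_target (k <#> fst e, snd e) = origami_automorphism G k (edge_target e)"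
proof -
  have s: "fst e \<in> squares" using e by (simp add: edges_def mem_Times_iff)
  show "edge_source (k <#> fst e, snd e) = origami_automorphism G k (edge_source e)"
    unfolding edge_source_def automorphism_vertex[OF k s] by simp
  show "edge_target (k <#> fst e, snd e) = origami_automorphism G k (edge_target e)"
    using automorphism_vertex[OF k] rt_up_closed[OF s] aut_square_translate[OF k s] g_r_closed g_u_closed
    by (simp add: edge_target_def)
qed

lemma automorphism_eq_iff:
  assumes k: "k \<in> carrier aut_group" and m: "m \<in> vertices" "v \<in> vertices"
  shows "origami_automorphism G k m = v \<longleftrightarrow> m = origami_automorphism G (inv_aut k) v"
proof -
  interpret K: group aut_group by (rule aut_group_group)
  note i = inv_aut_closed[OF k]
  show ?thesis
    using automorphism_vertices(2,3)[OF m(1)] automorphism_vertices(2,3)[OF m(2)] k i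
    by (metis K.l_inv K.r_inv)
qed

lemma edge_boundary_act:
  assumes k: "k \<in> carrier aut_group"
  shows "edge_boundary (act_edges k a) = act_vertices k (edge_boundary a)"
  unfolding act_vertices_def
proof (rule extensionalityI[of _ vertices])
  fix v assume v: "v \<in> vertices"
  have iv: "origami_automorphism G (inv_aut k) v \<in> vertices" by (rule automorphism_vertices(1)[OF v inv_aut_closed[OF k]])
  define f where "f v e = ((if edge_target e = v then 1 else 0) - (if edge_source e = v then 1 else 0) :: complex)" for v e
  have "edge_boundary (act_edges k a) v = (\<Sum>e\<in>edges. act_edges k a e * f v e)" using v by (simp add: edge_boundary_def f_def)
  also have "\<dots> = (\<Sum>e\<in>edges. act_edges k a (k <#> fst e, snd e) * f v (k <#> fst e, snd e))"
    by (rule sum.reindex_bij_betw[OF aut_edges_bij[OF k], symmetric])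
  also have "\<dots> = (\<Sum>e\<in>edges. a e * f (origami_automorphism G (inv_aut k) v) e)"
  proof (rule sum.cong[OF refl])
    fix e assume e: "e \<in> edges"
    show "act_edges k a (k <#> fst e, snd e) * f v (k <#> fst e, snd e) = a e * f (origami_automorphism G (inv_aut k) v) e"
      unfolding act_edges_apply[OF k e] f_def edge_ends_automorphism[OF k e]
        automorphism_eq_iff[OF k edge_ends_vertices(1)[OF e] v] automorphism_eq_iff[OF k edge_ends_vertices(2)[OF e] v] ..
  qed
  also have "\<dots> = edge_boundary a (origami_automorphism G (inv_aut k) v)" using iv by (simp add: edge_boundary_def f_def)
  finally show "edge_boundary (act_edges k a) v = (\<lambda>m\<in>vertices. edge_boundary a (origami_automorphism G (inv_aut k) m)) v" using v by simp
qed (simp_all add: edge_boundary_def)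

lemma direction_total_act:
  assumes k: "k \<in> carrier aut_group" shows "direction_total (act_edges k a) = direction_total a"
proof
  fix b
  have "direction_total (act_edges k a) b = (\<Sum>s\<in>squares. act_edges k a (k <#> s, b))"
    unfolding direction_total_def by (rule sum.reindex_bij_betw[OF aut_squares_bij[OF k], symmetric])
  also have "\<dots> = direction_total a b"
    unfolding direction_total_def using act_edges_apply[OF k, of "(_, b)"] by (intro sum.cong) (simp_all add: edges_def)
  finally show "direction_total (act_edges k a) b = direction_total a b" .
qed

lemma square_boundary_act:
  assumes k: "k \<in> carrier aut_group" shows "square_boundary (act_squares k x) = act_edges k (square_boundary x)"
proof (rule extensionalityI[of _ edges])
  fix e assume "e \<in> edges"
  then obtain s b where e: "e = (s, b)" "s \<in> squares" unfolding edges_def by blast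
  note i = inv_aut_closed[OF k]
  have c: "s #> inv g_u \<in> squares" "s #> inv g_r \<in> squares" "inv_aut k <#> s \<in> squares"
    using e(2) squares_translate(2) g_u_closed g_r_closed aut_square_closed[OF i] by auto
  have t: "inv_aut k <#> (s #> inv g_u) = (inv_aut k <#> s) #> inv g_u" "inv_aut k <#> (s #> inv g_r) = (inv_aut k <#> s) #> inv g_r"
    using aut_square_translate[OF i e(2)] g_u_closed g_r_closed by auto
  show "square_boundary (act_squares k x) e = act_edges k (square_boundary x) e"
    unfolding square_boundary_def act_squares_def act_edges_def using c e t by (simp add: edges_def)
qed (simp_all add: square_boundary_def act_edges_def)

lemma cell_class_act:
  assumes k: "k \<in> carrier aut_group"
  shows "cell_class (act_edges k a) = H1_action G H g_r g_u k (cell_class a)"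
proof -
  have "complex_chain_map 1 (origami_automorphism G k) (cell_chain a) =
      (\<Sum>e\<in>edges. chain_scale (a e) (edge_chain (k <#> fst e, snd e)))"
    unfolding cell_chain_def complex_chain_map_sum
    by (intro sum.cong refl) (simp only: complex_chain_map_linear automorphism_edge[OF k])
  also have "\<dots> = (\<Sum>e\<in>edges. chain_scale (act_edges k a (k <#> fst e, snd e)) (edge_chain (k <#> fst e, snd e)))"
    by (intro sum.cong refl) (simp only: act_edges_apply[OF k])
  also have "\<dots> = cell_chain (act_edges k a)"
    unfolding cell_chain_def by (rule sum.reindex_bij_betw[OF aut_edges_bij[OF k]])
  finally show ?thesis
    unfolding H1_action_def cell_class_def homology_map_class[OF continuous_automorphism[OF k]] by simp
qed

lemma edge_boundary_linear:
  "edge_boundary (\<lambda>i\<in>edges. a i + b i) = (\<lambda>i\<in>vertices. edge_boundary a i + edge_boundary b i)"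
  "edge_boundary (\<lambda>i\<in>edges. z * a i) = (\<lambda>i\<in>vertices. z * edge_boundary a i)"
  "edge_boundary (\<lambda>i\<in>edges. 0) = (\<lambda>i\<in>vertices. 0)"
  unfolding edge_boundary_def by (intro restrict_ext; simp add: distrib_right sum.distrib sum_distrib_left mult.assoc)+

lemma direction_total_linear:
  "direction_total (\<lambda>i\<in>edges. a i + b i) = (\<lambda>i. direction_total a i + direction_total b i)"
  "direction_total (\<lambda>i\<in>edges. z * a i) = (\<lambda>i. z * direction_total a i)"
  "direction_total (\<lambda>i\<in>edges. 0) = (\<lambda>i. 0)"
  unfolding direction_total_def by (simp_all add: fun_eq_iff edges_def sum.distrib sum_distrib_left)

lemma square_boundary_linear:
  "square_boundary (\<lambda>i\<in>squares. a i + b i) = (\<lambda>i\<in>edges. square_boundary a i + square_boundary b i)"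
  "square_boundary (\<lambda>i\<in>squares. z * a i) = (\<lambda>i\<in>edges. z * square_boundary a i)"
  "square_boundary (\<lambda>i\<in>squares. 0) = (\<lambda>i\<in>edges. 0)"
proof -
  have c: "fst e \<in> squares" "fst e #> inv g_u \<in> squares" "fst e #> inv g_r \<in> squares" if "e \<in> edges" for e
    using that squares_translate(2) g_u_closed g_r_closed by (auto simp: edges_def)
  show "square_boundary (\<lambda>i\<in>squares. a i + b i) = (\<lambda>i\<in>edges. square_boundary a i + square_boundary b i)"
    "square_boundary (\<lambda>i\<in>squares. z * a i) = (\<lambda>i\<in>edges. z * square_boundary a i)" "square_boundary (\<lambda>i\<in>squares. 0) = (\<lambda>i\<in>edges. 0)"
    by (rule extensionalityI[of _ edges]; simp add: square_boundary_def c algebra_simps)+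
qed

text \<open>A functional that vanishes on all boundaries of edges takes equal values at the end
  points of each edge, hence is constant since the squares are connected; so it vanishes on
  functions of sum 0.\<close>

lemma edge_boundary_image:
  "edge_boundary ` extensional edges = {v \<in> extensional vertices. (\<Sum>m\<in>vertices. v m) = 0}"
proof (intro equalityI subsetI)
  fix v assume "v \<in> edge_boundary ` extensional edges"
  then obtain a where a: "v = edge_boundary a" by blast
  have "(\<Sum>m\<in>vertices. edge_boundary a m) = (\<Sum>e\<in>edges. \<Sum>m\<in>vertices. a e * ((if edge_target e = m then 1 else 0) - (if edge_source e = m then 1 else 0)))"
    unfolding edge_boundary_def by (simp add: sum.swap[of _ vertices edges])
  also have "\<dots> = 0"
    using edge_ends_vertices finite_vertices
    by (intro sum.neutral) (simp add: sum_distrib_left[symmetric] sum_subtractf)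
  finally show "v \<in> {v \<in> extensional vertices. (\<Sum>m\<in>vertices. v m) = 0}" by (simp add: a edge_boundary_def)
next
  fix v :: "_ \<Rightarrow> complex" assume v: "v \<in> {v \<in> extensional vertices. (\<Sum>m\<in>vertices. v m) = 0}"
  let ?F = "fun_space vertices"
  let ?U = "edge_boundary ` extensional edges"
  show "v \<in> ?U"
  proof (rule ccontr)
    assume n: "v \<notin> ?U"
    have "closed_subspace ?F ?U"
      unfolding closed_subspace_def
    proof (intro conjI ballI allI)
      show "?U \<subseteq> carrier ?F" by (auto simp: edge_boundary_def)
      show "\<zero>\<^bsub>?F\<^esub> \<in> ?U" using edge_boundary_linear(3) by (intro image_eqI[of _ _ "\<lambda>i\<in>edges. 0"]) simp_all
      fix u assume "u \<in> ?U"
      then obtain a where a: "u = edge_boundary a" by blast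
      show "z \<odot>\<^bsub>?F\<^esub> u \<in> ?U" for z
        unfolding a using edge_boundary_linear(2) by (intro image_eqI[of _ _ "\<lambda>i\<in>edges. z * a i"]) simp_all
      fix w assume "w \<in> ?U"
      then obtain b where b: "w = edge_boundary b" by blast
      show "u \<oplus>\<^bsub>?F\<^esub> w \<in> ?U"
        unfolding a b using edge_boundary_linear(1) by (intro image_eqI[of _ _ "\<lambda>i\<in>edges. a i + b i"]) simp_all
    qed
    then obtain d where d: "linear_functional ?F d" "\<And>u. u \<in> ?U \<Longrightarrow> d u = 0" "d v \<noteq> 0"
      using functional_separates_subspace[OF fun_space_fin_dim_space[OF finite_vertices], of ?U v] v n by auto
    define w where "w m = d (\<lambda>j\<in>vertices. if j = m then 1 else 0)" for m
    have dw: "d u = (\<Sum>m\<in>vertices. u m * w m)" if "u \<in> extensional vertices" for u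
      unfolding w_def using functional_frame[OF fun_space_vectorspace fun_space_frame[OF finite_vertices] d(1), of u] that by simp
    have ends: "w (edge_target e) = w (edge_source e)" if e: "e \<in> edges" for e
    proof -
      have "0 = d (edge_boundary (\<lambda>i\<in>edges. if i = e then 1 else 0))" using d(2) by simp
      also have "\<dots> = (\<Sum>m\<in>vertices. edge_boundary (\<lambda>i\<in>edges. if i = e then 1 else 0) m * w m)"
        by (rule dw) (simp add: edge_boundary_def)
      also have "\<dots> = (\<Sum>m\<in>vertices. ((if edge_target e = m then 1 else 0) - (if edge_source e = m then 1 else 0)) * w m)"
        using e finite_edges by (intro sum.cong) (simp_all add: edge_boundary_def if_distrib[of "\<lambda>z. z * _"] cong: if_cong)
      also have "\<dots> = w (edge_target e) - w (edge_source e)"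
        using edge_ends_vertices[OF e] finite_vertices
        by (simp add: left_diff_distrib sum_subtractf if_distrib[of "\<lambda>z. z * _"] cong: if_cong)
      finally show ?thesis by simp
    qed
    define l where "l s = w (pt (s, 0, 0))" for s
    have "l (rt s) = l s" "l (up s) = l s" if "s \<in> squares" for s
      using ends[of "(s, True)"] ends[of "(s, False)"] that by (simp_all add: l_def edges_def edge_target_def edge_source_def)
    then have const: "l s = l s'" if "s \<in> squares" "s' \<in> squares" for s s'
      using squares_connected[of l s s'] that by blast
    obtain s0 where s0: "s0 \<in> squares" using squares_nonempty by blast
    have "w m = l s0" if m: "m \<in> vertices" for m
    proof -
      obtain s where "s \<in> squares" "m = pt (s, 0, 0)" using m unfolding vertices_def by blast
      then show ?thesis using const[OF _ s0] by (simp add: l_def)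
    qed
    then have "d v = (\<Sum>m\<in>vertices. v m) * l s0" using dw[of v] v by (simp add: sum_distrib_right[symmetric])
    then show False using v d(3) by simp
  qed
qed

text \<open>The coefficient of an edge is the difference of the values of \<open>x\<close> on the
  two squares adjacent to it.\<close>

lemma square_boundary_kernel:
  assumes "x \<in> extensional squares" "s0 \<in> squares"
  shows "square_boundary x = (\<lambda>i\<in>edges. 0) \<longleftrightarrow> (\<forall>s\<in>squares. x s = x s0)"
proof
  assume z: "square_boundary x = (\<lambda>i\<in>edges. 0)"
  have "x (rt s) = x s" "x (up s) = x s" if s: "s \<in> squares" for s
    using fun_cong[OF z, of "(rt s, False)"] fun_cong[OF z, of "(up s, True)"] rt_up_closed[OF s]
      square_cancel(1)[OF s g_r_closed] square_cancel(1)[OF s g_u_closed]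
    by (simp_all add: square_boundary_def edges_def)
  then show "\<forall>s\<in>squares. x s = x s0" using squares_connected[of x _ s0] assms(2) by blast
next
  assume c: "\<forall>s\<in>squares. x s = x s0"
  have c': "fst e \<in> squares" "fst e #> inv g_u \<in> squares" "fst e #> inv g_r \<in> squares" if "e \<in> edges" for e
    using that squares_translate(2) g_u_closed g_r_closed by (auto simp: edges_def)
  have eq: "x (fst e) = x s0" "x (fst e #> inv g_u) = x s0" "x (fst e #> inv g_r) = x s0" if "e \<in> edges" for e
    using c c'[OF that] by blast+
  show "square_boundary x = (\<lambda>i\<in>edges. 0)"
    unfolding square_boundary_def by (rule restrict_ext) (simp add: eq)
qed

text \<open>Five exact sequences of representations: edges onto the image of the boundary map,
  vertices onto the sums of coefficients, cycles onto the homology of the torus, squares onto their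
  boundaries, and cycles over zero onto \<open>H1_zero\<close>. The characters are permutation
  characters or trivial. The last sequence also shows that \<open>H1_zero\<close> is a
  representation.\<close>

theorem H1_zero_character:
  "representation aut_group H1_null (H1_action G H g_r g_u)"
  "k \<in> carrier aut_group \<Longrightarrow> rep_character aut_group H1_null (H1_action G H g_r g_u) k =
     of_nat (card {s \<in> squares. k <#> s = s}) - of_nat (card {v \<in> vertices. origami_automorphism G k v = v})"
proof -
  let ?K = aut_group
  let ?F = "fun_space edges" and ?V = "fun_space vertices" and ?S = "fun_space squares"
  define Z where "Z = {a \<in> carrier ?F. edge_boundary a = \<zero>\<^bsub>?V\<^esub>}"
  define B where "B = edge_boundary ` extensional edges"
  define D where "D = square_boundary ` extensional squares"
  have ch1: "rep_character ?K (fun_space I) (\<lambda>k v. v) k = of_nat (card I)"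
    if "finite I" "k \<in> carrier ?K" for I :: "'i set" and k
    using trivial_trace_fun_space[OF that(1)] that(2) by (simp add: rep_character_def)
  obtain s0 where s0: "s0 \<in> squares" using squares_nonempty by blast
  have mem: "a \<in> Z \<longleftrightarrow> a \<in> extensional edges \<and> (\<forall>v\<in>vertices. edge_boundary a v = 0)" for a
    by (auto simp: Z_def edge_boundary_def fun_eq_iff restrict_def)
  note X1 = character_exact[OF rep_edges(1), of edge_boundary "?V\<lparr>carrier := B\<rparr>" act_vertices Z]
  have X1: "representation ?K (?F\<lparr>carrier := Z\<rparr>) act_edges"
    "\<And>k. k \<in> carrier ?K \<Longrightarrow> rep_character ?K ?F act_edges k =
       rep_character ?K (?F\<lparr>carrier := Z\<rparr>) act_edges k + rep_character ?K (?V\<lparr>carrier := B\<rparr>) act_vertices k"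
    by (rule X1; use edge_boundary_linear edge_boundary_act in \<open>simp add: B_def Z_def\<close>)+
  have sumV: "(\<Sum>m\<in>vertices. act_vertices k v m) = (\<Sum>m\<in>vertices. v m)" if k: "k \<in> carrier ?K" for k v
  proof -
    have bij: "bij_betw (origami_automorphism G (inv_aut k)) vertices vertices"
      by (rule bij_betw_byWitness[where f' = "origami_automorphism G k"])
        (use automorphism_eq_iff[OF k] automorphism_vertices(1) k inv_aut_closed[OF k] in \<open>auto simp: image_subset_iff\<close>)
    show ?thesis
      using sum.reindex_bij_betw[OF bij, of v] by (simp add: act_vertices_def)
  qed
  have B: "B = {v \<in> carrier ?V. (\<lambda>i\<in>{()}. \<Sum>m\<in>vertices. v m) = \<zero>\<^bsub>fun_space {()}\<^esub>}"
    unfolding B_def edge_boundary_image by (auto simp: fun_eq_iff)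
  have surj2: "(\<lambda>v. \<lambda>i\<in>{()}. \<Sum>m\<in>vertices. v m) ` carrier ?V = carrier (fun_space {()})"
  proof (intro equalityI subsetI)
    fix y :: "unit \<Rightarrow> complex" assume y: "y \<in> carrier (fun_space {()})"
    have o: "pt (s0, 0, 0) \<in> vertices" using s0 unfolding vertices_def by blast
    have "y = (\<lambda>i\<in>{()}. \<Sum>m\<in>vertices. (\<lambda>m\<in>vertices. if m = pt (s0, 0, 0) then y () else 0) m)"
      using finite_vertices o by (simp add: fun_eq_iff)
    then show "y \<in> (\<lambda>v. \<lambda>i\<in>{()}. \<Sum>m\<in>vertices. v m) ` carrier ?V"
      by (rule image_eqI[where x = "\<lambda>m\<in>vertices. if m = pt (s0, 0, 0) then y () else 0"]) simp
  qed auto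
  note X2 = character_exact[OF rep_vertices(1), of "\<lambda>v. \<lambda>i\<in>{()}. \<Sum>m\<in>vertices. v m" "fun_space {()}" "\<lambda>k v. v" B,
      OF surj2 _ _ _ _ B]
  have X2: "rep_character ?K ?V act_vertices k =
      rep_character ?K (?V\<lparr>carrier := B\<rparr>) act_vertices k + rep_character ?K (fun_space {()}) (\<lambda>k v. v) k"
    if "k \<in> carrier ?K" for k
    by (rule X2(3)) (use that sumV in \<open>simp_all add: fun_eq_iff sum.distrib sum_distrib_left\<close>)
  have Z0: "zero_cycles = {a \<in> carrier (?F\<lparr>carrier := Z\<rparr>). direction_total a = \<zero>\<^bsub>fun_space (UNIV :: bool set)\<^esub>}"
    by (auto simp: zero_cycles_def mem fun_eq_iff)
  \<comment> \<open>The constant function on the edges of one direction is a cycle, because moving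
    right or up permutes the squares.\<close>
  have surj3: "direction_total ` carrier (?F\<lparr>carrier := Z\<rparr>) = carrier (fun_space (UNIV :: bool set))"
  proof (intro equalityI subsetI)
    fix y :: "bool \<Rightarrow> complex" assume "y \<in> carrier (fun_space UNIV)"
    define a where "a = (\<lambda>e\<in>edges. y (snd e) / of_nat (card squares))"
    have N: "card squares > 0" using squares_nonempty finite_squares by (simp add: card_gt_0_iff)
    have "direction_total a b = y b" for b using N by (simp add: direction_total_def a_def edges_def)
    then have t: "y = direction_total a" by (simp add: fun_eq_iff)
    have "edge_boundary a v = 0" if v: "v \<in> vertices" for v
    proof -
      let ?i = "\<lambda>s. if pt (s, 0, 0) = v then 1 else 0 :: complex"
      have r: "(\<Sum>s\<in>squares. ?i (s #> g)) = (\<Sum>s\<in>squares. ?i s)" if "g \<in> carrier G" for g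
        by (rule sum.reindex_bij_betw[OF translate_bij[OF that]])
      have "edge_boundary a v = (\<Sum>s\<in>squares. y True / of_nat (card squares) * (?i (rt s) - ?i s) + y False / of_nat (card squares) * (?i (up s) - ?i s))"
        using v unfolding edge_boundary_def sum_edges by (simp add: a_def edges_def edge_target_def edge_source_def)
      also have "\<dots> = y True / of_nat (card squares) * ((\<Sum>s\<in>squares. ?i (rt s)) - (\<Sum>s\<in>squares. ?i s)) +
          y False / of_nat (card squares) * ((\<Sum>s\<in>squares. ?i (up s)) - (\<Sum>s\<in>squares. ?i s))"
        by (simp only: sum.distrib sum_subtractf sum_distrib_left[symmetric])
      also have "\<dots> = 0" unfolding r[OF g_r_closed] r[OF g_u_closed] by simp
      finally show ?thesis .
    qed
    then have "a \<in> Z" unfolding mem by (simp add: a_def)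
    then show "y \<in> direction_total ` carrier (?F\<lparr>carrier := Z\<rparr>)" using t by auto
  qed auto
  have X3: "representation ?K (?F\<lparr>carrier := zero_cycles\<rparr>) act_edges"
    "\<And>k. k \<in> carrier ?K \<Longrightarrow> rep_character ?K (?F\<lparr>carrier := Z\<rparr>) act_edges k =
      rep_character ?K (?F\<lparr>carrier := zero_cycles\<rparr>) act_edges k + rep_character ?K (fun_space (UNIV :: bool set)) (\<lambda>k v. v) k"
  proof -
    have z: "direction_total \<zero>\<^bsub>?F\<lparr>carrier := Z\<rparr>\<^esub> = \<zero>\<^bsub>fun_space (UNIV :: bool set)\<^esub>"
      by (simp add: direction_total_linear fun_eq_iff)
    have a: "direction_total (v \<oplus>\<^bsub>?F\<lparr>carrier := Z\<rparr>\<^esub> w) = direction_total v \<oplus>\<^bsub>fun_space (UNIV :: bool set)\<^esub> direction_total w"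
      and m: "direction_total (c \<odot>\<^bsub>?F\<lparr>carrier := Z\<rparr>\<^esub> v) = c \<odot>\<^bsub>fun_space (UNIV :: bool set)\<^esub> direction_total v" for v w c
      by (simp_all add: direction_total_linear fun_eq_iff)
    note X = character_exact[OF X1(1) surj3 z a m _ Z0, of "\<lambda>k v. v"]
    show "representation ?K (?F\<lparr>carrier := zero_cycles\<rparr>) act_edges"
      using X(2) direction_total_act by simp
    show "rep_character ?K (?F\<lparr>carrier := Z\<rparr>) act_edges k =
      rep_character ?K (?F\<lparr>carrier := zero_cycles\<rparr>) act_edges k + rep_character ?K (fun_space (UNIV :: bool set)) (\<lambda>k v. v) k"
      if "k \<in> carrier ?K" for k
      using X(3)[OF _ that] direction_total_act by simp
  qed
  define C where "C = {x \<in> carrier ?S. square_boundary x = \<zero>\<^bsub>?F\<^esub>}"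
  note X4 = character_exact[OF rep_squares(1), of square_boundary "?F\<lparr>carrier := D\<rparr>" act_edges C]
  have X4: "representation ?K (?S\<lparr>carrier := C\<rparr>) act_squares"
    "\<And>k. k \<in> carrier ?K \<Longrightarrow> rep_character ?K ?S act_squares k =
       rep_character ?K (?S\<lparr>carrier := C\<rparr>) act_squares k + rep_character ?K (?F\<lparr>carrier := D\<rparr>) act_edges k"
    by (rule X4; use square_boundary_linear square_boundary_act in \<open>simp add: D_def C_def\<close>)+
  have C: "x \<in> C \<longleftrightarrow> x \<in> extensional squares \<and> (\<forall>s\<in>squares. x s = x s0)" for x
    using square_boundary_kernel[OF _ s0] by (auto simp: C_def)
  \<comment> \<open>The kernel of the boundary map on squares consists of the constant functions, on
    which automorphisms act trivially.\<close>
  have chC: "rep_character ?K (?S\<lparr>carrier := C\<rparr>) act_squares k = 1" if k: "k \<in> carrier ?K" for k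
  proof -
    have "endo_trace (?S\<lparr>carrier := C\<rparr>) (act_squares k) = endo_trace (fun_space {()}) (\<lambda>v. v)"
    proof (rule trace_iso[where f = "\<lambda>x. \<lambda>i\<in>{()}. x s0"])
      show "fin_dim_space (?S\<lparr>carrier := C\<rparr>)" by (rule rep_fin_dim_space[OF X4(1)])
      show "linear_map complex_field (?S\<lparr>carrier := C\<rparr>) (fun_space {()}) (\<lambda>x. \<lambda>i\<in>{()}. x s0)"
        using s0 by (intro complex_linear_mapI fun_space_vectorspace rep_vs[OF X4(1)]) (auto simp: fun_eq_iff)
      show "(\<lambda>x. \<lambda>i\<in>{()}. x s0) ` carrier (?S\<lparr>carrier := C\<rparr>) = carrier (fun_space {()})"
      proof (intro equalityI subsetI)
        fix y :: "unit \<Rightarrow> complex"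
        have "y = (\<lambda>i\<in>{()}. (\<lambda>s\<in>squares. y ()) s0)" using s0 by (simp add: fun_eq_iff)
        moreover have "(\<lambda>s\<in>squares. y ()) \<in> carrier (?S\<lparr>carrier := C\<rparr>)" using s0 by (simp add: C)
        ultimately show "y \<in> (\<lambda>x. \<lambda>i\<in>{()}. x s0) ` carrier (?S\<lparr>carrier := C\<rparr>)" by (rule image_eqI[where x = "\<lambda>s\<in>squares. y ()"])
      qed auto
      show "v = \<zero>\<^bsub>?S\<lparr>carrier := C\<rparr>\<^esub>" if "v \<in> carrier (?S\<lparr>carrier := C\<rparr>)" "(\<lambda>i\<in>{()}. v s0) = \<zero>\<^bsub>fun_space {()}\<^esub>" for v
      proof -
        have "v s0 = 0" using fun_cong[OF that(2), of "()"] by simp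
        then show ?thesis using that(1) by (auto simp: C fun_eq_iff restrict_def extensional_def)
      qed
      show "linear_map complex_field (?S\<lparr>carrier := C\<rparr>) (?S\<lparr>carrier := C\<rparr>) (act_squares k)"
        by (rule rep_linear[OF X4(1) k])
      show "linear_map complex_field (fun_space {()}) (fun_space {()}) (\<lambda>v. v)"
        by (intro complex_linear_mapI fun_space_vectorspace) auto
      show "(\<lambda>i\<in>{()}. act_squares k v s0) = (\<lambda>i\<in>{()}. v s0)" if "v \<in> carrier (?S\<lparr>carrier := C\<rparr>)" for v
      proof -
        have "v \<in> C" using that by simp
        then have "v (inv_aut k <#> s0) = v s0"
          unfolding C using aut_square_closed[OF inv_aut_closed[OF k] s0] by blast
        then show ?thesis using s0 by (simp add: act_squares_def)
      qed
    qed
    then show ?thesis using trivial_trace_fun_space[of "{()}"] k by (simp add: rep_character_def)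
  qed
  have D: "D = {a \<in> carrier (?F\<lparr>carrier := zero_cycles\<rparr>). cell_class a = \<zero>\<^bsub>H1_null\<^esub>}"
    using cell_class_zero_iff square_boundary_zero_cycles unfolding D_def by auto
  have cc: "cell_chain (\<lambda>i\<in>edges. a i + b i) = cell_chain a + cell_chain b"
    "cell_chain (\<lambda>i\<in>edges. z * a i) = chain_scale z (cell_chain a)" "cell_chain (\<lambda>i\<in>edges. 0) = 0" for a b z
    using cell_chain_linear by (simp_all add: cell_chain_def)
  have X5: "representation ?K H1_null (H1_action G H g_r g_u)"
    "\<And>k. k \<in> carrier ?K \<Longrightarrow> rep_character ?K (?F\<lparr>carrier := zero_cycles\<rparr>) act_edges k =
       rep_character ?K (?F\<lparr>carrier := D\<rparr>) act_edges k + rep_character ?K H1_null (H1_action G H g_r g_u) k"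
  proof -
    have s: "cell_class ` carrier (?F\<lparr>carrier := zero_cycles\<rparr>) = carrier H1_null"
      by (simp add: H1_zero_carrier)
    have z: "cell_class \<zero>\<^bsub>?F\<lparr>carrier := zero_cycles\<rparr>\<^esub> = \<zero>\<^bsub>H1_null\<^esub>"
      by (simp add: cell_class_def cc H1_zero_operations)
    have a: "cell_class (v \<oplus>\<^bsub>?F\<lparr>carrier := zero_cycles\<rparr>\<^esub> w) = cell_class v \<oplus>\<^bsub>H1_null\<^esub> cell_class w"
      and m: "cell_class (c \<odot>\<^bsub>?F\<lparr>carrier := zero_cycles\<rparr>\<^esub> v) = c \<odot>\<^bsub>H1_null\<^esub> cell_class v" for v w c
      by (simp_all add: cell_class_def cc H1_zero_operations)
    note X = character_exact[OF X3(1) s z a m _ D, of "H1_action G H g_r g_u"]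
    show "representation ?K H1_null (H1_action G H g_r g_u)"
      by (rule X(1)) (rule cell_class_act)
    show "rep_character ?K (?F\<lparr>carrier := zero_cycles\<rparr>) act_edges k =
       rep_character ?K (?F\<lparr>carrier := D\<rparr>) act_edges k + rep_character ?K H1_null (H1_action G H g_r g_u) k"
      if "k \<in> carrier ?K" for k
      using X(3)[OF _ that] cell_class_act by simp
  qed
  show "representation ?K H1_null (H1_action G H g_r g_u)" by (rule X5(1))
  assume k: "k \<in> carrier ?K"
  show "rep_character ?K H1_null (H1_action G H g_r g_u) k =
     of_nat (card {s \<in> squares. k <#> s = s}) - of_nat (card {v \<in> vertices. origami_automorphism G k v = v})"
    using X1(2)[OF k] X2[OF k] X3(2)[OF k] X4(2)[OF k] X5(2)[OF k] chC[OF k]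
      ch1[OF _ k, of "{()}"] ch1[OF _ k, of "UNIV :: bool set"] rep_edges(2)[OF k] rep_squares(2)[OF k] rep_vertices(2)[OF k]
    by (simp add: algebra_simps)
qed

end

section \<open>Vertices as orbits of the commutator\<close>

lemma funpow_orbit_period:
  assumes "i \<in> Orbits.orbit f i"
  shows "(f ^^ m) i = i \<longleftrightarrow> card (Orbits.orbit f i) dvd m" "card (Orbits.orbit f i) > 0"
proof -
  define d where "d = funpow_dist1 f i i"
  have d: "(f ^^ d) i = i" "d > 0" unfolding d_def using funpow_dist1_prop[OF assms] by simp_all
  have "Orbits.orbit f i = (\<lambda>m. (f ^^ m) i) ` {..<d}"
    using orbit_altdef_bounded[OF d] by auto
  moreover have "inj_on (\<lambda>m. (f ^^ m) i) {..<d}"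
    using funpow_neq_less_funpow_dist1[OF assms] unfolding inj_on_def d_def by blast
  ultimately have card: "card (Orbits.orbit f i) = d" by (simp add: card_image)
  have mult: "(f ^^ (d * q)) i = i" for q
    by (induction q) (simp_all add: funpow_add d(1))
  have "(f ^^ m) i = (f ^^ (m mod d)) i"
  proof -
    have "(f ^^ m) i = (f ^^ (m mod d + d * (m div d))) i" by simp
    then show ?thesis unfolding funpow_add o_apply mult .
  qed
  moreover have "(f ^^ (m mod d)) i \<noteq> i" if "m mod d \<noteq> 0"
    using funpow_dist1_least[of "m mod d" f i i] that d(2) unfolding d_def[symmetric] by simp
  ultimately have "(f ^^ m) i = i \<longleftrightarrow> m mod d = 0" by (cases "m mod d = 0") auto
  then show "(f ^^ m) i = i \<longleftrightarrow> card (Orbits.orbit f i) dvd m" "card (Orbits.orbit f i) > 0"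
    using card d(2) by (simp_all add: dvd_eq_mod_eq_0)
qed

lemma (in group) right_coset_eq_iff:
  assumes N: "subgroup N G" and "a \<in> carrier G" "b \<in> carrier G"
  shows "N #> a = N #> b \<longleftrightarrow> a \<otimes> inv b \<in> N"
proof
  have NG: "N \<subseteq> carrier G" using subgroup.subset[OF N] .
  {
    assume "N #> a = N #> b"
    then have "a \<in> N #> b" using rcos_self[OF assms(2) N] by simp
    then obtain n where "n \<in> N" "a = n \<otimes> b" by (auto simp: r_coset_def)
    then show "a \<otimes> inv b \<in> N" using NG assms(3) by (auto simp: m_assoc)
  next
    assume n: "a \<otimes> inv b \<in> N"
    have "N #> a = N #> (a \<otimes> inv b) #> b"
      using coset_mult_assoc[OF NG, of "a \<otimes> inv b" b] assms by (simp add: m_assoc)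
    then show "N #> a = N #> b" using coset_join2[OF _ N n] assms by simp
  }
qed

lemma (in group) right_coset_cancel:
  assumes N: "subgroup N G" and "a \<in> carrier G" "b \<in> carrier G" "x \<in> carrier G"
  shows "N #> (a \<otimes> x) = N #> (b \<otimes> x) \<longleftrightarrow> N #> a = N #> b"
  using assms by (simp add: right_coset_eq_iff[OF N] inv_mult_group m_assoc) (simp add: m_assoc[symmetric])

context origami_data
begin

abbreviation commut where "commut \<equiv> g_r \<otimes> g_u \<otimes> inv g_r \<otimes> inv g_u"

lemma commut_closed: "commut \<in> carrier G"
  using g_r_closed g_u_closed by simp

text \<open>Vertices are now located at upper right corners, because turning around this corner of
  \<open>s\<close> leads through \<open>s #> g_r\<close>, \<open>s #> g_r #> g_u\<close> and so on
  to \<open>s #> commut\<close> without a shift.\<close>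

definition corner where "corner s = pt (s, 1, 1)"

definition turns where "turns s = {s #> (commut [^] m) | m :: nat. True}"

lemma turns_step:
  assumes s: "s \<in> squares" shows "turns (s #> commut) = turns s"
proof -
  have p: "commut [^] m \<in> carrier G" for m :: nat using nat_pow_closed[OF commut_closed] .
  have tr: "s #> commut #> (commut [^] m) = s #> (commut [^] Suc m)" for m :: nat
    using squares_translate(3)[OF s commut_closed p] nat_pow_Suc2[OF commut_closed] by simp
  have "s #> (commut [^] m) \<in> turns (s #> commut)" for m :: nat
  proof -
    \<comment> \<open>Going around \<open>ord commut - 1\<close> more times undoes one turn, so
      \<open>s\<close> itself is reached from \<open>s #> commut\<close>.\<close>
    have o: "ord commut \<ge> 1" by (rule ord_ge_1[OF finite_G commut_closed])
    have "commut [^] (Suc (m + ord commut - 1)) = commut [^] m \<otimes> commut [^] ord commut"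
      using o nat_pow_mult[OF commut_closed, of m "ord commut"] by simp
    also have "\<dots> = commut [^] m" using pow_ord_eq_1[OF commut_closed] p by simp
    finally have "s #> (commut [^] m) = s #> commut #> (commut [^] (m + ord commut - 1))" unfolding tr by simp
    then show ?thesis unfolding turns_def by blast
  qed
  moreover have "s #> commut #> (commut [^] m) \<in> turns s" for m :: nat
    unfolding tr turns_def by blast
  ultimately show ?thesis unfolding turns_def by blast
qed

lemma corner_turn:
  assumes s: "s \<in> squares" shows "corner (s #> commut) = corner s"
proof -
  define a where "a = rt s"
  define b where "b = up a"
  define d where "d = b #> inv g_r"
  have a: "a \<in> squares" and b: "b \<in> squares" using rt_up_closed s by (simp_all add: a_def b_def)
  have d: "d \<in> squares" using squares_translate(2)[OF b] g_r_closed by (simp add: d_def)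
  have e: "s #> commut = d #> inv g_u"
    using s squares_translate[OF s] g_r_closed g_u_closed by (simp add: a_def b_def d_def m_assoc)
  have eS: "s #> commut \<in> squares" by (rule squares_translate(2)[OF s commut_closed])
  have "corner s = pt (a, 0, 1)" unfolding corner_def a_def using pt_right[OF s, of 1] by simp
  also have "\<dots> = pt (b, 0, 0)" unfolding b_def using pt_up[OF a, of 0] by simp
  also have "\<dots> = pt (d, 1, 0)"
    using pt_right[OF d, of 0] square_cancel(2)[OF b g_r_closed] by (simp add: d_def)
  also have "\<dots> = corner (s #> commut)"
    unfolding corner_def using pt_up[OF eS, of 1] square_cancel(2)[OF d g_u_closed] e by simp
  finally show ?thesis by simp
qed

text \<open>To tell corners apart, attach to the four corners of each square the set of squares
  reached by turning around the upper right corner of the square which has that vertex there. This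
  is compatible with the gluing.\<close>

lemma corner_eq_iff:
  assumes s: "s \<in> squares" and t: "t \<in> squares"
  shows "corner s = corner t \<longleftrightarrow> (\<exists>m::nat. t = s #> (commut [^] m))"
proof
  \<comment> \<open>Points that are not corners are of no interest and get the empty set.\<close>
  define \<kappa> where "\<kappa> = (\<lambda>(s, x :: real, y :: real).
    if x = 1 \<and> y = 1 then turns s else if x = 0 \<and> y = 1 then turns (s #> inv g_r)
    else if x = 1 \<and> y = 0 then turns (s #> inv g_u)
    else if x = 0 \<and> y = 0 then turns (s #> inv g_r #> inv g_u) else {})"
  have glue: "\<kappa> p = \<kappa> q" if pq: "(p, q) \<in> gluing" for p q
  proof -
    consider s y where "p = (s, 1, y)" "q = (rt s, 0, y)" "s \<in> squares"
      | s x where "p = (s, x, 1)" "q = (up s, x, 0)" "s \<in> squares"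
      using pq unfolding square_gluing_def by auto
    then show ?thesis
    proof cases
      case 1
      then show ?thesis using square_cancel(1)[OF 1(3) g_r_closed] by (simp add: \<kappa>_def)
    next
      case 2
      have i: "s #> inv g_r \<in> squares" using squares_translate(2)[OF 2(3)] g_r_closed by simp
      have "up s #> inv g_r #> inv g_u = s #> inv g_r #> commut"
      proof -
        have "inv g_r \<otimes> commut = g_u \<otimes> inv g_r \<otimes> inv g_u"
          using g_r_closed g_u_closed by (simp add: m_assoc[symmetric])
        then show ?thesis
          using squares_translate(3)[OF 2(3)] g_r_closed g_u_closed by (simp add: commut_closed)
      qed
      then show ?thesis
        using 2 square_cancel(1)[OF 2(3) g_u_closed] turns_step[OF i] by (simp add: \<kappa>_def)
    qed
  qed
  assume "corner s = corner t"
  then have "((s, 1, 1), (t, 1, 1)) \<in> glue_rel" unfolding corner_def pt_eq_iff .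
  from glue_rel_invariant[of \<kappa>, OF glue this] have "turns s = turns t" by (simp add: \<kappa>_def)
  moreover have "t #> (commut [^] (0::nat)) \<in> turns t" unfolding turns_def by blast
  ultimately have "t \<in> turns s" using squares_translate(4)[OF t] by simp
  then show "\<exists>m::nat. t = s #> (commut [^] m)" unfolding turns_def by blast
next
  assume "\<exists>m::nat. t = s #> (commut [^] m)"
  then obtain m :: nat where m: "t = s #> (commut [^] m)" by blast
  have "corner (s #> (commut [^] m)) = corner s" for m :: nat
  proof (induction m)
    case 0
    then show ?case using squares_translate(4)[OF s] by simp
  next
    case (Suc m)
    have sm: "s #> (commut [^] m) \<in> squares" by (rule squares_translate(2)[OF s nat_pow_closed[OF commut_closed]])
    have "s #> (commut [^] Suc m) = s #> (commut [^] m) #> commut"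
      using squares_translate(3)[OF s nat_pow_closed[OF commut_closed] commut_closed, of m] by simp
    then show ?case using corner_turn[OF sm] Suc by simp
  qed
  then show "corner s = corner t" using m by simp
qed

lemma vertices_corner: "vertices = corner ` squares"
proof -
  have 1: "corner s = pt (up (rt s), 0, 0)" if "s \<in> squares" for s
    unfolding corner_def using pt_right[OF that, of 1] pt_up[OF rt_up_closed(1)[OF that], of 0] by simp
  have 2: "pt (s, 0, 0) = corner (s #> inv g_u #> inv g_r)" if s: "s \<in> squares" for s
  proof -
    have "s #> inv g_u \<in> squares" using squares_translate(2)[OF s] g_u_closed by simp
    moreover from this have "s #> inv g_u #> inv g_r \<in> squares" using squares_translate(2) g_r_closed by simp
    ultimately show ?thesis using 1 square_cancel(2)[OF _ g_r_closed] square_cancel(2)[OF s g_u_closed] by simp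
  qed
  show ?thesis
  proof (intro equalityI subsetI)
    fix v assume "v \<in> vertices"
    then obtain s where s: "s \<in> squares" "v = pt (s, 0, 0)" unfolding vertices_def by blast
    have "s #> inv g_u #> inv g_r \<in> squares"
      using squares_translate(2)[OF squares_translate(2)[OF s(1)]] g_r_closed g_u_closed by simp
    then show "v \<in> corner ` squares" using 2[OF s(1)] s(2) by blast
  next
    fix v assume "v \<in> corner ` squares"
    then obtain s where s: "s \<in> squares" "v = corner s" by blast
    then show "v \<in> vertices" unfolding vertices_def using 1[OF s(1)] rt_up_closed by blast
  qed
qed

lemma automorphism_corner:
  assumes "k \<in> carrier aut_group" "s \<in> squares"
  shows "origami_automorphism G k (corner s) = corner (k <#> s)"
  unfolding corner_def using automorphism_pt[OF assms, of "(1, 1)"] by simp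

lemma H_subset_norm: "H \<subseteq> norm_H"
  using normal_imp_subgroup[OF subgroup_in_normalizer[OF subgroup_H]] subgroup.subset by fastforce

lemma norm_carrier: "n \<in> norm_H \<Longrightarrow> n \<in> carrier G"
  using subgroup.mem_carrier[OF norm_H_subgroup] .

lemma aut_group_coset_pow:
  assumes "n \<in> norm_H" shows "(H #> n) [^]\<^bsub>aut_group\<^esub> (q::nat) = H #> (n [^] q)"
proof (induction q)
  case 0
  interpret K: group aut_group by (rule aut_group_group)
  have "H #> \<one> = H" by (rule coset_mult_one[OF subgroup.subset[OF subgroup_H]])
  then show ?case unfolding K.nat_pow_0 nat_pow_0 aut_group_one by simp
next
  case (Suc q)
  interpret K: group aut_group by (rule aut_group_group)
  have "n [^] q \<in> norm_H" using norm_H_subgroup assms by (induction q) (auto simp: subgroup.one_closed subgroup.m_closed)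
  then have "(H #> n [^] q) <#> (H #> n) = H #> (n [^] q \<otimes> n)"
    by (rule coset_product[OF _ norm_carrier[OF assms]])
  then show ?case unfolding K.nat_pow_Suc nat_pow_Suc Suc aut_group_mult .
qed

text \<open>An automorphism fixing \<open>H a\<close> is the class of an \<open>n\<close> with
  \<open>H n a = H a\<close>, and \<open>a\<close> cancels.\<close>

lemma squares_free:
  assumes "k \<in> carrier aut_group" "s \<in> squares" "k <#> s = s"
  shows "k = \<one>\<^bsub>aut_group\<^esub>"
proof -
  obtain n a where na: "n \<in> norm_H" "k = H #> n" "a \<in> carrier G" "s = H #> a"
    using assms by (auto simp: aut_group_carrier RCOSETS_def)
  have nG: "n \<in> carrier G" by (rule norm_carrier[OF na(1)])
  have "H #> (n \<otimes> a) = H #> (\<one> \<otimes> a)" using coset_product[OF na(1,3)] assms(3) na by simp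
  then have "H #> n = H #> \<one>" using right_coset_cancel[OF subgroup_H nG one_closed na(3)] by simp
  then show ?thesis using na(2) coset_mult_one[OF subgroup.subset[OF subgroup_H]] by (simp add: aut_group_one)
qed

lemma card_squares:
  "card squares = card (rcosets norm_H) * card (carrier aut_group)"
proof -
  let ?N = "G\<lparr>carrier := norm_H\<rparr>"
  interpret N: normal H ?N by (rule subgroup_in_normalizer[OF subgroup_H])
  have "card (rcosets\<^bsub>?N\<^esub> H) * card H = Coset.order ?N" by (rule N.lagrange[OF N.subgroup_axioms])
  then have 1: "card (carrier aut_group) * card H = card norm_H"
    by (simp add: FactGroup_def Coset.order_def)
  have 2: "card squares * card H = card (carrier G)" using lagrange[OF subgroup_H] by (simp add: Coset.order_def)
  have 3: "card (rcosets norm_H) * card norm_H = card (carrier G)" using lagrange[OF norm_H_subgroup] by (simp add: Coset.order_def)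
  have "card H > 0" using subgroup.one_closed[OF subgroup_H] finite_subset[OF subgroup.subset[OF subgroup_H] finite_G]
    by (auto simp: card_gt_0_iff)
  moreover have "card squares * card H = card (rcosets norm_H) * card (carrier aut_group) * card H"
    using 1 2 3 by (simp add: mult.assoc)
  ultimately show ?thesis by simp
qed

end

lemma rep_character_conj:
  fixes K (structure)
  assumes rep: "representation K V \<phi>" and k: "k \<in> carrier K" and l: "l \<in> carrier K"
  shows "rep_character K V \<phi> (l \<otimes> k \<otimes> inv l) = rep_character K V \<phi> k"
proof -
  interpret group K by (rule rep_group[OF rep])
  have m: "l \<otimes> k \<otimes> inv l \<in> carrier K" using k l by simp
  have "endo_trace V (\<phi> k) = endo_trace V (\<phi> (l \<otimes> k \<otimes> inv l))"
  proof (rule trace_iso[OF rep_fin_dim_space[OF rep] rep_linear[OF rep l] _ _ rep_linear[OF rep k] rep_linear[OF rep m]])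
    show "\<phi> l ` carrier V = carrier V"
    proof (intro equalityI subsetI)
      fix v assume v: "v \<in> carrier V"
      show "v \<in> \<phi> l ` carrier V"
        using rep_inv_cancel(2)[OF rep l v] rep_closed[OF rep inv_closed[OF l] v] by (metis imageI)
    qed (use rep_closed[OF rep l] in auto)
    show "v = \<zero>\<^bsub>V\<^esub>" if "v \<in> carrier V" "\<phi> l v = \<zero>\<^bsub>V\<^esub>" for v
      using rep_inv_cancel(1)[OF rep l that(1)] lm_zero[OF rep_linear[OF rep inv_closed[OF l]]] that(2) by simp
    show "\<phi> l (\<phi> k v) = \<phi> (l \<otimes> k \<otimes> inv l) (\<phi> l v)" if v: "v \<in> carrier V" for v
    proof -
      have "\<phi> (l \<otimes> k \<otimes> inv l) (\<phi> l v) = \<phi> (l \<otimes> k \<otimes> inv l \<otimes> l) v"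
        by (rule rep_mult[OF rep m l v, symmetric])
      also have "l \<otimes> k \<otimes> inv l \<otimes> l = l \<otimes> k" using k l by (simp add: m_assoc)
      finally show ?thesis using rep_mult[OF rep l k v] by simp
    qed
  qed
  then show ?thesis using k m by (simp add: rep_character_def)
qed

lemma fixed_points_pairing:
  assumes K: "finite K" and V: "finite V"
  shows "(\<Sum>k\<in>K. of_nat (card {v \<in> V. act k v = v}) * f k) =
    (\<Sum>v\<in>V. \<Sum>k\<in>{k \<in> K. act k v = v}. f k :: complex)"
proof -
  have "(\<Sum>k\<in>K. of_nat (card {v \<in> V. act k v = v}) * f k) =
      (\<Sum>k\<in>K. \<Sum>v\<in>V. if act k v = v then f k else 0)"
    using V by (intro sum.cong refl) (simp add: sum.If_cases Int_def)
  also have "\<dots> = (\<Sum>v\<in>V. \<Sum>k\<in>K. if act k v = v then f k else 0)" by (rule sum.swap)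
  also have "\<dots> = (\<Sum>v\<in>V. \<Sum>k\<in>{k \<in> K. act k v = v}. f k)"
    by (rule sum.cong[OF refl]) (rule sum.inter_filter[OF K, symmetric])
  finally show ?thesis .
qed

text \<open>The stabilizers of the points of an orbit are conjugate, so all inner sums agree. Each
  is the order of the stabilizer times the dimension of its fixed space, and the orbit has
  \<open>card (carrier K)\<close> divided by that order points.\<close>

lemma orbit_fixed_sum:
  fixes K (structure)
  assumes rep: "representation K E \<phi>" and fin: "finite (carrier K)"
    and act: "\<And>k v. k \<in> carrier K \<Longrightarrow> v \<in> V \<Longrightarrow> act k v \<in> V"
    and one: "\<And>v. v \<in> V \<Longrightarrow> act \<one> v = v"
    and mult: "\<And>k l v. k \<in> carrier K \<Longrightarrow> l \<in> carrier K \<Longrightarrow> v \<in> V \<Longrightarrow> act (k \<otimes> l) v = act k (act l v)"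
    and v: "v \<in> V"
  defines "st \<equiv> \<lambda>v. {k \<in> carrier K. act k v = v}"
  shows "(\<Sum>w\<in>(\<lambda>l. act l v) ` carrier K. \<Sum>k\<in>st w. rep_character K E \<phi> (inv k)) =
    of_nat (card (carrier K)) * of_nat (vectorspace.dim complex_field (E\<lparr>carrier := {e \<in> carrier E. \<forall>k\<in>st v. \<phi> k e = e}\<rparr>))"
proof -
  interpret group K by (rule rep_group[OF rep])
  let ?O = "(\<lambda>l. act l v) ` carrier K"
  let ?\<chi> = "rep_character K E \<phi>"
  let ?T = "\<lambda>w. \<Sum>k\<in>st w. ?\<chi> (inv k)"
  have cancel: "act (inv k) (act k w) = w" "act k (act (inv k) w) = w" if "k \<in> carrier K" "w \<in> V" for k w
    using mult[of "inv k" k w] mult[of k "inv k" w] one that by simp_all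
  have sub: "subgroup (st v) K"
  proof (rule subgroupI)
    show "st v \<subseteq> carrier K" by (auto simp: st_def)
    show "st v \<noteq> {}" using one[OF v] by (auto simp: st_def)
    show "inv a \<in> st v" if "a \<in> st v" for a using that cancel(1)[of a v] v by (auto simp: st_def)
    show "a \<otimes> b \<in> st v" if "a \<in> st v" "b \<in> st v" for a b using that mult[of a b v] v by (auto simp: st_def)
  qed
  have fs: "finite (st w)" for w using fin by (simp add: st_def)
  have Tl: "?T (act l v) = ?T v" if l: "l \<in> carrier K" for l
  proof -
    have bij: "bij_betw (\<lambda>k. l \<otimes> k \<otimes> inv l) (st v) (st (act l v))"
    proof (rule bij_betw_byWitness[where f' = "\<lambda>k. inv l \<otimes> k \<otimes> l"])
      have lk: "inv l \<otimes> (l \<otimes> k \<otimes> inv l) \<otimes> l = k" "l \<otimes> (inv l \<otimes> k \<otimes> l) \<otimes> inv l = k" if "k \<in> carrier K" for k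
        using that l by (simp_all add: m_assoc) (simp_all add: m_assoc[symmetric])
      show "\<forall>a\<in>st v. inv l \<otimes> (l \<otimes> a \<otimes> inv l) \<otimes> l = a" "\<forall>a'\<in>st (act l v). l \<otimes> (inv l \<otimes> a' \<otimes> l) \<otimes> inv l = a'"
        using lk by (auto simp: st_def)
      show "(\<lambda>k. l \<otimes> k \<otimes> inv l) ` st v \<subseteq> st (act l v)"
        using l v by (auto simp: st_def mult act cancel)
      show "(\<lambda>k. inv l \<otimes> k \<otimes> l) ` st (act l v) \<subseteq> st v"
        using l v by (auto simp: st_def mult act cancel)
    qed
    have "?T (act l v) = (\<Sum>k\<in>st v. ?\<chi> (inv (l \<otimes> k \<otimes> inv l)))"
      by (rule sum.reindex_bij_betw[OF bij, symmetric])
    also have "\<dots> = ?T v"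
    proof (rule sum.cong[OF refl])
      fix k assume "k \<in> st v"
      then have k: "k \<in> carrier K" by (simp add: st_def)
      have "inv (l \<otimes> k \<otimes> inv l) = l \<otimes> inv k \<otimes> inv l"
        using k l by (simp add: inv_mult_group m_assoc)
      then show "?\<chi> (inv (l \<otimes> k \<otimes> inv l)) = ?\<chi> (inv k)"
        using rep_character_conj[OF rep inv_closed[OF k] l] by simp
    qed
    finally show ?thesis .
  qed
  have orb: "card (carrier K) = card ?O * card (st v)"
  proof -
    have "card (carrier K) = (\<Sum>w\<in>?O. card {l \<in> carrier K. act l v = w})"
      using sum.image_gen[OF fin, of "\<lambda>_. 1::nat" "\<lambda>l. act l v"] by simp
    also have "\<dots> = (\<Sum>w\<in>?O. card (st v))"
    proof (rule sum.cong[OF refl])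
      fix w assume "w \<in> ?O"
      then obtain l0 where l0: "l0 \<in> carrier K" "w = act l0 v" by blast
      have "bij_betw (\<lambda>k. l0 \<otimes> k) (st v) {l \<in> carrier K. act l v = w}"
      proof (rule bij_betw_byWitness[where f' = "\<lambda>k. inv l0 \<otimes> k"])
        show "(\<lambda>k. l0 \<otimes> k) ` st v \<subseteq> {l \<in> carrier K. act l v = w}"
          using l0 v by (auto simp: st_def mult)
        show "(\<lambda>k. inv l0 \<otimes> k) ` {l \<in> carrier K. act l v = w} \<subseteq> st v"
          using l0 v by (auto simp: st_def mult cancel)
      qed (use l0 in \<open>auto simp: st_def m_assoc[symmetric]\<close>)
      then show "card {l \<in> carrier K. act l v = w} = card (st v)" by (simp add: bij_betw_same_card)
    qed
    finally show ?thesis by simp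
  qed
  have binv: "bij_betw (\<lambda>k. inv k) (st v) (st v)"
    by (rule bij_betw_byWitness[where f' = "\<lambda>k. inv k"])
      (use subgroup.m_inv_closed[OF sub] subgroup.mem_carrier[OF sub] in auto)
  have "?T v = (\<Sum>k\<in>st v. ?\<chi> k)" by (rule sum.reindex_bij_betw[OF binv])
  also have "\<dots> = (\<Sum>k\<in>st v. endo_trace E (\<phi> k))"
    using subgroup.mem_carrier[OF sub] by (intro sum.cong) (simp_all add: rep_character_def)
  also have "\<dots> = of_nat (card (st v)) * of_nat (vectorspace.dim complex_field (E\<lparr>carrier := {e \<in> carrier E. \<forall>k\<in>st v. \<phi> k e = e}\<rparr>))"
    by (rule fixed_space_trace[OF rep sub fs])
  finally have Tv: "?T v = of_nat (card (st v)) * of_nat (vectorspace.dim complex_field (E\<lparr>carrier := {e \<in> carrier E. \<forall>k\<in>st v. \<phi> k e = e}\<rparr>))" .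
  have "(\<Sum>w\<in>?O. ?T w) = (\<Sum>w\<in>?O. ?T v)" by (rule sum.cong[OF refl]) (use Tl in blast)
  then show ?thesis unfolding sum_constant Tv orb by simp
qed

section \<open>The induced space\<close>

lemma induced_space_simps [simp]:
  "carrier (induced_space E r) = {1..r} \<rightarrow>\<^sub>E carrier E"
  "\<zero>\<^bsub>induced_space E r\<^esub> = (\<lambda>i\<in>{1..r}. \<zero>\<^bsub>E\<^esub>)"
  "v \<oplus>\<^bsub>induced_space E r\<^esub> w = (\<lambda>i\<in>{1..r}. v i \<oplus>\<^bsub>E\<^esub> w i)"
  "z \<odot>\<^bsub>induced_space E r\<^esub> v = (\<lambda>i\<in>{1..r}. z \<odot>\<^bsub>E\<^esub> v i)"
  by (simp_all only: induced_space_def partial_object.simps ring.simps module.simps)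

lemma induced_space_vectorspace:
  assumes E: "vectorspace complex_field E"
  shows "vectorspace complex_field (induced_space E r)"
proof (rule vs_criteria[OF complex_field_field])
  note facts = vs_add[OF E] vs_smult[OF E] vs_zero[OF E]
  show "\<forall>v\<in>carrier (induced_space E r). \<exists>w\<in>carrier (induced_space E r).
      v \<oplus>\<^bsub>induced_space E r\<^esub> w = \<zero>\<^bsub>induced_space E r\<^esub>"
  proof
    fix v assume v: "v \<in> carrier (induced_space E r)"
    have "v \<oplus>\<^bsub>induced_space E r\<^esub> (\<lambda>i\<in>{1..r}. (-1) \<odot>\<^bsub>E\<^esub> v i) = \<zero>\<^bsub>induced_space E r\<^esub>"
      unfolding induced_space_simps using v vs_neg[OF E] by (intro restrict_ext) (auto simp: PiE_iff)
    moreover have "(\<lambda>i\<in>{1..r}. (-1) \<odot>\<^bsub>E\<^esub> v i) \<in> carrier (induced_space E r)"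
      using v facts by (auto simp: PiE_iff)
    ultimately show "\<exists>w\<in>carrier (induced_space E r).
      v \<oplus>\<^bsub>induced_space E r\<^esub> w = \<zero>\<^bsub>induced_space E r\<^esub>" by blast
  qed
  show "\<zero>\<^bsub>induced_space E r\<^esub> \<in> carrier (induced_space E r)" using facts by auto
  show "\<forall>v\<in>carrier (induced_space E r). v \<oplus>\<^bsub>induced_space E r\<^esub> \<zero>\<^bsub>induced_space E r\<^esub> = v"
    using vs_r_zero[OF E] by (auto simp: PiE_iff fun_eq_iff extensional_def)
  show "\<forall>v\<in>carrier (induced_space E r). \<one>\<^bsub>complex_field\<^esub> \<odot>\<^bsub>induced_space E r\<^esub> v = v"
    using vs_smult_one[OF E] by (auto simp: PiE_iff fun_eq_iff extensional_def)
qed (use vs_add[OF E] vs_smult[OF E] vs_comm[OF E] vs_assoc[OF E] vs_smult_assoc[OF E] vs_smult_l_distr[OF E]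
    vs_smult_r_distr[OF E] in \<open>auto simp: PiE_iff fun_eq_iff restrict_def extensional_def\<close>)

lemma induced_space_dim:
  fixes E :: "(complex, 'e) module"
  assumes E: "fin_dim_space E"
  shows "vectorspace.dim complex_field (induced_space E r) = r * vectorspace.dim complex_field E"
proof -
  let ?I = "induced_space E r"
  have VE: "vectorspace complex_field E" using E by simp
  note V = induced_space_vectorspace[OF VE, of r]
  note facts = vs_add[OF VE] vs_smult[OF VE] vs_zero[OF VE]
  obtain B c where f: "frame E B (\<lambda>b. b) c"
    and d: "\<And>b b'. b \<in> B \<Longrightarrow> b' \<in> B \<Longrightarrow> c b b' = (if b' = b then 1 else 0)"
    using dual_frame_exists[OF E] by metis
  define e where "e = (\<lambda>(i, b). \<lambda>j\<in>{1..r}. if j = i then b else \<zero>\<^bsub>E\<^esub>)"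
  define coeff where "coeff = (\<lambda>(i, b) (v :: nat \<Rightarrow> 'e). c b (v i))"
  have eC: "e p \<in> carrier ?I" if "p \<in> {1..r} \<times> B" for p
    using that frame_carrier[OF f] facts by (auto simp: e_def)
  have proj: "linear_map complex_field ?I E (\<lambda>v. v j)" if "j \<in> {1..r}" for j
    using that by (intro complex_linear_mapI V VE) (auto simp: PiE_iff)
  have fin: "finite ({1..r} \<times> B)" using frame_finite[OF f] by simp
  have expand: "(\<Oplus>\<^bsub>?I\<^esub>p\<in>{1..r} \<times> B. coeff p v \<odot>\<^bsub>?I\<^esub> e p) = v" if v: "v \<in> carrier ?I" for v
  proof (rule PiE_ext)
    have cl: "(\<lambda>p. coeff p v \<odot>\<^bsub>?I\<^esub> e p) \<in> {1..r} \<times> B \<rightarrow> carrier ?I" using vs_smult[OF V] eC by blast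
    show "(\<Oplus>\<^bsub>?I\<^esub>p\<in>{1..r} \<times> B. coeff p v \<odot>\<^bsub>?I\<^esub> e p) \<in> {1..r} \<rightarrow>\<^sub>E carrier E"
      using vs_finsum[OF V cl] by simp
    show "v \<in> {1..r} \<rightarrow>\<^sub>E carrier E" using v by simp
    fix j assume j: "j \<in> {1..r}"
    have vj: "v j \<in> carrier E" using v j by auto
    have "(\<Oplus>\<^bsub>?I\<^esub>p\<in>{1..r} \<times> B. coeff p v \<odot>\<^bsub>?I\<^esub> e p) j = (\<Oplus>\<^bsub>E\<^esub>p\<in>{1..r} \<times> B. (coeff p v \<odot>\<^bsub>?I\<^esub> e p) j)"
      by (rule lm_finsum[OF proj[OF j] fin cl])
    also have "\<dots> = (\<Oplus>\<^bsub>E\<^esub>p\<in>{j} \<times> B. (coeff p v \<odot>\<^bsub>?I\<^esub> e p) j)"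
    proof (rule vs_finsum_neutral[OF VE fin])
      show "(coeff p v \<odot>\<^bsub>?I\<^esub> e p) j = \<zero>\<^bsub>E\<^esub>" if "p \<in> {1..r} \<times> B - {j} \<times> B" for p
        using that j vs_smult_zero2[OF VE] by (auto simp: e_def split: if_splits)
      show "(coeff p v \<odot>\<^bsub>?I\<^esub> e p) j \<in> carrier E" if "p \<in> {1..r} \<times> B" for p
        using funcset_mem[OF cl that] j by auto
    qed (use j in auto)
    also have "\<dots> = (\<Oplus>\<^bsub>E\<^esub>p\<in>Pair j ` B. (coeff p v \<odot>\<^bsub>?I\<^esub> e p) j)"
    proof -
      have "{j} \<times> B = Pair j ` B" by auto
      then show ?thesis by simp
    qed
    also have "\<dots> = (\<Oplus>\<^bsub>E\<^esub>b\<in>B. (coeff (j, b) v \<odot>\<^bsub>?I\<^esub> e (j, b)) j)"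
      using cl j by (intro abelian_monoid.finsum_reindex[OF vs_abelian_monoid[OF VE]]) (auto simp: inj_on_def Pi_iff PiE_iff)
    also have "\<dots> = (\<Oplus>\<^bsub>E\<^esub>b\<in>B. c b (v j) \<odot>\<^bsub>E\<^esub> b)"
      using j by (simp add: coeff_def e_def)
    also have "\<dots> = v j" by (rule frame_expand[OF f vj])
    finally show "(\<Oplus>\<^bsub>?I\<^esub>p\<in>{1..r} \<times> B. coeff p v \<odot>\<^bsub>?I\<^esub> e p) j = v j" .
  qed
  have fun': "linear_functional ?I (coeff p)" if p: "p \<in> {1..r} \<times> B" for p
  proof -
    obtain i b where ib: "p = (i, b)" "i \<in> {1..r}" "b \<in> B" using p by blast
    show ?thesis
      using frame_functional[OF f ib(3)] ib(2) unfolding linear_functional_def coeff_def ib(1)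
      by (auto simp: PiE_iff)
  qed
  have fr: "frame ?I ({1..r} \<times> B) e coeff"
    unfolding frame_def using fin eC fun' expand by auto
  have "vectorspace.dim complex_field ?I = card ({1..r} \<times> B)"
    by (rule dim_eq_frame[OF V fr]) (use d in \<open>auto simp: coeff_def e_def\<close>)
  moreover have "vectorspace.dim complex_field E = card B"
    by (rule dim_eq_frame[OF VE f]) (use d in auto)
  ultimately show ?thesis by (simp add: card_cartesian_product)
qed

lemma isomorphic_dim:
  fixes W :: "(complex, 'w) module"
  assumes V: "fin_dim_space V" and f: "linear_map complex_field V W f" and surj: "f ` carrier V = carrier W"
    and inj: "\<And>v. v \<in> carrier V \<Longrightarrow> f v = \<zero>\<^bsub>W\<^esub> \<Longrightarrow> v = \<zero>\<^bsub>V\<^esub>"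
  shows "vectorspace.dim complex_field V = vectorspace.dim complex_field W"
proof -
  have id: "linear_map complex_field V V (\<lambda>v. v)" "linear_map complex_field W W (\<lambda>v. v)"
    using lm_dom[OF f] lm_cod[OF f] by (auto intro!: complex_linear_mapI)
  have "fin_dim_space W" by (rule trace_exact(1)[OF V f surj id refl refl])
  moreover have "endo_trace V (\<lambda>v. v) = endo_trace W (\<lambda>v. v)"
    by (rule trace_iso[OF V f surj inj id refl])
  ultimately show ?thesis unfolding endo_trace_id[OF V] using endo_trace_id[of W] by simp
qed

lemma character_at_one:
  assumes "representation K V \<phi>"
  shows "rep_character K V \<phi> \<one>\<^bsub>K\<^esub> = of_nat (vectorspace.dim complex_field V)"
proof -
  interpret group K using rep_group[OF assms] .
  show ?thesis
    using endo_trace_cong[OF rep_linear[OF assms one_closed] rep_fin_dim_space[OF assms], of "\<lambda>v. v"] rep_one[OF assms]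
      endo_trace_id[OF rep_fin_dim_space[OF assms]] by (simp add: rep_character_def)
qed

lemma fixed_subspace:
  assumes rep: "representation K V \<phi>" and k: "k \<in> carrier K"
  shows "closed_subspace V {v \<in> carrier V. \<phi> k v = v}"
  using lm_add[OF rep_linear[OF rep k]] lm_smult[OF rep_linear[OF rep k]] lm_zero[OF rep_linear[OF rep k]]
    vs_add[OF rep_vs[OF rep]] vs_smult[OF rep_vs[OF rep]] vs_zero[OF rep_vs[OF rep]]
  unfolding closed_subspace_def by auto

lemma fixed_powers:
  assumes rep: "representation K V \<phi>" and k: "k \<in> carrier K" and v: "v \<in> carrier V" "\<phi> k v = v"
  shows "\<phi> (k [^]\<^bsub>K\<^esub> (q::nat)) v = v"
proof -
  interpret group K using rep_group[OF rep] .
  show ?thesis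
  proof (induction q)
    case 0
    then show ?case using rep_one[OF rep v(1)] by simp
  next
    case (Suc q)
    then show ?case using rep_mult[OF rep nat_pow_closed[OF k] k v(1)] v(2) by simp
  qed
qed

section \<open>Cycles of the commutator on cosets of the normalizer\<close>

locale origami_cosets = origami_data +
  fixes r :: nat and g :: "nat \<Rightarrow> 'a"
  assumes reps: "coset_representatives G (normalizer G H) r g"
begin

abbreviation \<rho> where "\<rho> \<equiv> coset_perm G norm_H r g commut"

lemma g_closed: "i \<in> {1..r} \<Longrightarrow> g i \<in> carrier G"
  using reps unfolding coset_representatives_def by blast

lemma representative_exists:
  assumes "a \<in> carrier G" shows "\<exists>i\<in>{1..r}. norm_H #> a = norm_H #> g i"
proof -
  have "norm_H #> a \<in> rcosets norm_H" using assms by (auto simp: RCOSETS_def)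
  then show ?thesis using reps unfolding coset_representatives_def bij_betw_def by (metis (no_types, lifting) imageE)
qed

lemma representative_unique:
  assumes "i \<in> {1..r}" "j \<in> {1..r}" "norm_H #> g i = norm_H #> g j" shows "i = j"
  using reps assms unfolding coset_representatives_def bij_betw_def inj_on_def by blast

lemma card_cosets: "card (rcosets norm_H) = r"
  using reps bij_betw_same_card unfolding coset_representatives_def by fastforce

lemma inverse_coset_mem:
  assumes "x \<in> carrier G" "i \<in> {1..r}" "j \<in> {1..r}"
  shows "x \<otimes> inv (g i) \<in> inv (g j) <# norm_H \<longleftrightarrow> norm_H #> (g j \<otimes> x) = norm_H #> g i"
proof -
  have gi: "g i \<in> carrier G" and gj: "g j \<in> carrier G" using g_closed assms by simp_all
  have "x \<otimes> inv (g i) \<in> inv (g j) <# norm_H \<longleftrightarrow> g j \<otimes> x \<otimes> inv (g i) \<in> norm_H"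
  proof
    assume "x \<otimes> inv (g i) \<in> inv (g j) <# norm_H"
    then obtain n where n: "n \<in> norm_H" "x \<otimes> inv (g i) = inv (g j) \<otimes> n" by (auto simp: l_coset_def)
    have "g j \<otimes> x \<otimes> inv (g i) = g j \<otimes> (x \<otimes> inv (g i))" using gi gj assms(1) by (simp add: m_assoc)
    also have "\<dots> = n" unfolding n(2) using gj norm_carrier[OF n(1)] by (simp add: m_assoc[symmetric])
    finally show "g j \<otimes> x \<otimes> inv (g i) \<in> norm_H" using n(1) by simp
  next
    assume n: "g j \<otimes> x \<otimes> inv (g i) \<in> norm_H"
    have "x \<otimes> inv (g i) = inv (g j) \<otimes> (g j \<otimes> (x \<otimes> inv (g i)))"
      using gi gj assms(1) by (simp add: m_assoc[symmetric])
    then have "x \<otimes> inv (g i) = inv (g j) \<otimes> (g j \<otimes> x \<otimes> inv (g i))"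
      using gi gj assms(1) by (simp add: m_assoc)
    then show "x \<otimes> inv (g i) \<in> inv (g j) <# norm_H" using n by (auto simp: l_coset_def)
  qed
  also have "\<dots> \<longleftrightarrow> norm_H #> (g j \<otimes> x) = norm_H #> g i"
    using right_coset_eq_iff[OF norm_H_subgroup _ gi, of "g j \<otimes> x"] gj assms(1) by simp
  finally show ?thesis .
qed

text \<open>In terms of right cosets, \<open>\<rho>\<close> is right multiplication by the inverse
  of \<open>commut\<close>.\<close>

lemma coset_perm_iff:
  assumes "i \<in> {1..r}"
  shows "\<rho> i = j \<longleftrightarrow> j \<in> {1..r} \<and> norm_H #> (g j \<otimes> commut) = norm_H #> g i"
proof -
  have gi: "g i \<in> carrier G" using g_closed assms by simp
  let ?P = "\<lambda>j. j \<in> {1..r} \<and> commut \<otimes> inv (g i) \<in> inv (g j) <# norm_H"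
  have P: "?P j \<longleftrightarrow> j \<in> {1..r} \<and> norm_H #> (g j \<otimes> commut) = norm_H #> g i" for j
    using inverse_coset_mem[OF commut_closed assms, of j] by blast
  have c2: "norm_H #> (g j \<otimes> commut) = norm_H #> g i \<longleftrightarrow> norm_H #> g j = norm_H #> (g i \<otimes> inv commut)"
    if "j \<in> {1..r}" for j
  proof -
    have "g j \<in> carrier G" using g_closed that by simp
    moreover have "g i \<otimes> inv commut \<otimes> commut = g i" using gi commut_closed by (simp only: m_assoc inv_closed l_inv r_one)
    ultimately show ?thesis
      using right_coset_cancel[OF norm_H_subgroup _ _ commut_closed, of "g j" "g i \<otimes> inv commut"] gi commut_closed by simp
  qed
  obtain k where k: "k \<in> {1..r}" "norm_H #> (g i \<otimes> inv commut) = norm_H #> g k"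
    using representative_exists[of "g i \<otimes> inv commut"] gi commut_closed by auto
  have "?P j \<longleftrightarrow> j = k" for j
    unfolding P using c2 k representative_unique[of j k] by (metis (no_types, lifting))
  moreover from this have "\<rho> i = k" unfolding coset_perm_def using assms by simp
  ultimately show ?thesis unfolding P[symmetric] by auto
qed

lemma coset_perm_closed: "i \<in> {1..r} \<Longrightarrow> (\<rho> ^^ m) i \<in> {1..r}"
proof (induction m)
  case (Suc m)
  then show ?case using coset_perm_iff[of "(\<rho> ^^ m) i" "\<rho> ((\<rho> ^^ m) i)"] by simp
qed simp

lemma coset_perm_permutes: "\<rho> permutes {1..r}"
proof (rule bij_imp_permutes)
  have "inj_on \<rho> {1..r}"
  proof (rule inj_onI)
    fix i j assume ij: "i \<in> {1..r}" "j \<in> {1..r}" "\<rho> i = \<rho> j"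
    have "norm_H #> g i = norm_H #> g j"
      using coset_perm_iff[OF ij(1), of "\<rho> i"] coset_perm_iff[OF ij(2), of "\<rho> i"] ij(3) by simp
    then show "i = j" using representative_unique ij by blast
  qed
  moreover have "\<rho> ` {1..r} \<subseteq> {1..r}" using coset_perm_closed[where m = 1] by auto
  ultimately show "bij_betw \<rho> {1..r} {1..r}"
    by (simp add: bij_betw_def endo_inj_surj)
qed (unfold coset_perm_def, rule if_not_P)

lemma coset_perm_pow_iff:
  assumes "i \<in> {1..r}" "j \<in> {1..r}"
  shows "(\<rho> ^^ m) i = j \<longleftrightarrow> norm_H #> (g j \<otimes> commut [^] m) = norm_H #> g i"
  using assms(2)
proof (induction m arbitrary: j)
  case 0
  then show ?case using representative_unique[OF 0 assms(1)] g_closed[OF 0] by auto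
next
  case (Suc m)
  define k where "k = (\<rho> ^^ m) i"
  have k: "k \<in> {1..r}" unfolding k_def by (rule coset_perm_closed[OF assms(1)])
  have gj: "g j \<in> carrier G" and gk: "g k \<in> carrier G" using g_closed Suc.prems k by simp_all
  have p: "commut [^] m \<in> carrier G" using nat_pow_closed[OF commut_closed] .
  have "norm_H #> (g k \<otimes> commut [^] m) = norm_H #> g i" using Suc.IH[OF k] k_def by simp
  moreover have "g j \<otimes> commut [^] Suc m = g j \<otimes> commut \<otimes> commut [^] m"
    using nat_pow_Suc2[OF commut_closed, of m] gj p commut_closed by (simp only: m_assoc)
  ultimately have "norm_H #> (g j \<otimes> commut [^] Suc m) = norm_H #> g i \<longleftrightarrow> norm_H #> (g j \<otimes> commut) = norm_H #> g k"
    using right_coset_cancel[OF norm_H_subgroup m_closed[OF gj commut_closed] gk p] by metis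
  also have "\<dots> \<longleftrightarrow> \<rho> k = j" using coset_perm_iff[OF k] Suc.prems by blast
  finally show ?case by (simp add: k_def)
qed

lemma permutation_coset_perm: "permutation \<rho>"
  using coset_perm_permutes by (auto simp: permutation_permutes)

lemma mem_own_cycle: "i \<in> Orbits.orbit \<rho> i"
  by (rule permutation_self_in_orbit[OF permutation_coset_perm])

lemma orbit_eq: "j \<in> Orbits.orbit \<rho> i \<Longrightarrow> Orbits.orbit \<rho> j = Orbits.orbit \<rho> i"
  using orbit_cyclic_eq3[OF cyclic_on_orbit'[OF permutation_coset_perm]] by blast

lemma cycle_subset: "i \<in> {1..r} \<Longrightarrow> Orbits.orbit \<rho> i \<subseteq> {1..r}"
  unfolding orbit_altdef using coset_perm_closed by auto

lemma mem_cycle_iff: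
  assumes "i \<in> {1..r}" "j \<in> {1..r}"
  shows "i \<in> Orbits.orbit \<rho> j \<longleftrightarrow> (\<exists>m::nat. norm_H #> g j = norm_H #> (g i \<otimes> commut [^] m))"
  unfolding orbit_altdef_permutation[OF permutation_coset_perm]
  using coset_perm_pow_iff[OF assms(2,1)] by (auto simp: eq_commute)

text \<open>The action of \<open>commut [^] n\<close> on the summand with index \<open>i\<close>,
  where \<open>n\<close> is the length of the cycle of \<open>i\<close>.\<close>

definition monodromy where
  "monodromy i = g i \<otimes> commut [^] card (Orbits.orbit \<rho> i) \<otimes> inv (g i)"

lemma conj_pow:
  assumes "a \<in> carrier G" "x \<in> carrier G"
  shows "(a \<otimes> x \<otimes> inv a) [^] (q::nat) = a \<otimes> x [^] q \<otimes> inv a"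
proof (induction q)
  case 0
  then show ?case using assms by simp
next
  case (Suc q)
  have "a \<otimes> x [^] q \<otimes> inv a \<otimes> (a \<otimes> x \<otimes> inv a) = a \<otimes> x [^] q \<otimes> (inv a \<otimes> a) \<otimes> x \<otimes> inv a"
    using assms by (simp only: m_assoc m_closed inv_closed nat_pow_closed)
  then show ?case using Suc assms by (simp add: m_assoc)
qed

lemma monodromy_norm:
  assumes i: "i \<in> {1..r}" shows "monodromy i \<in> norm_H"
proof -
  let ?n = "card (Orbits.orbit \<rho> i)"
  have gi: "g i \<in> carrier G" using g_closed i .
  have "(\<rho> ^^ ?n) i = i" by (simp only: funpow_orbit_period(1)[OF mem_own_cycle] dvd_refl)
  then have "norm_H #> (g i \<otimes> commut [^] ?n) = norm_H #> g i" using coset_perm_pow_iff[OF i i] by blast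
  then show ?thesis
    unfolding monodromy_def
    using right_coset_eq_iff[OF norm_H_subgroup m_closed[OF gi nat_pow_closed[OF commut_closed]] gi] by blast
qed

lemma square_rep: "i \<in> {1..r} \<Longrightarrow> H #> g i \<in> squares"
  using g_closed by (auto simp: RCOSETS_def)

text \<open>The class of \<open>n\<close> fixes the corner of \<open>H #> g i\<close> when \<open>H
  n (g i) = H (g i) commut [^] m\<close> for some \<open>m\<close>. Passing to cosets of the
  normalizer shows that \<open>m\<close> is a multiple of the length of the cycle, so that
  \<open>n\<close> is a power of the monodromy modulo \<open>H\<close>.\<close>

lemma corner_stabilizer:
  assumes i: "i \<in> {1..r}"
  shows "{k \<in> carrier aut_group. origami_automorphism G k (corner (H #> g i)) = corner (H #> g i)} =
    {(H #> monodromy i) [^]\<^bsub>aut_group\<^esub> q | q :: nat. True}" (is "?S = ?R")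
proof -
  let ?n = "card (Orbits.orbit \<rho> i)"
  have gi: "g i \<in> carrier G" using g_closed i .
  have p: "commut [^] (m::nat) \<in> carrier G" for m by (rule nat_pow_closed[OF commut_closed])
  have fix_iff: "origami_automorphism G (H #> n) (corner (H #> g i)) = corner (H #> g i) \<longleftrightarrow>
      (\<exists>m::nat. H #> (n \<otimes> g i) = H #> (g i \<otimes> commut [^] m))" if n: "n \<in> norm_H" for n
  proof -
    have k: "H #> n \<in> carrier aut_group" using n aut_group_carrier by blast
    have nG: "n \<in> carrier G" by (rule norm_carrier[OF n])
    have sq: "H #> (n \<otimes> g i) \<in> squares" using nG gi by (auto simp: RCOSETS_def)
    have tr: "H #> g i #> (commut [^] m) = H #> (g i \<otimes> commut [^] m)" for m :: nat
      by (rule coset_mult_assoc[OF subgroup.subset[OF subgroup_H] gi p])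
    show ?thesis
      unfolding automorphism_corner[OF k square_rep[OF i]] coset_product[OF n gi]
      using corner_eq_iff[OF square_rep[OF i] sq] unfolding tr by auto
  qed
  have mpow: "monodromy i [^] q = g i \<otimes> commut [^] (?n * q) \<otimes> inv (g i)" for q :: nat
    unfolding monodromy_def conj_pow[OF gi p] nat_pow_pow[OF commut_closed] ..
  have mN: "monodromy i [^] q \<in> norm_H" for q :: nat
    using norm_H_subgroup monodromy_norm[OF i] by (induction q) (auto simp: subgroup.one_closed subgroup.m_closed)
  have canc: "g i \<otimes> x \<otimes> inv (g i) \<otimes> g i = g i \<otimes> x" if "x \<in> carrier G" for x
    using gi that by (simp add: m_assoc)
  show ?thesis
  proof (intro equalityI subsetI)
    fix k assume "k \<in> ?S"
    then obtain n where n: "n \<in> norm_H" "k = H #> n"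
      and fx: "origami_automorphism G k (corner (H #> g i)) = corner (H #> g i)"
      by (auto simp: aut_group_carrier)
    have nG: "n \<in> carrier G" by (rule norm_carrier[OF n(1)])
    obtain m :: nat where m: "H #> (n \<otimes> g i) = H #> (g i \<otimes> commut [^] m)"
      using fx fix_iff[OF n(1)] n(2) by blast
    have "n \<otimes> g i \<otimes> inv (g i \<otimes> commut [^] m) \<in> H"
      using right_coset_eq_iff[OF subgroup_H, of "n \<otimes> g i" "g i \<otimes> commut [^] m"] m nG gi p by simp
    then have "norm_H #> (n \<otimes> g i) = norm_H #> (g i \<otimes> commut [^] m)"
      using right_coset_eq_iff[OF norm_H_subgroup, of "n \<otimes> g i" "g i \<otimes> commut [^] m"] nG gi p H_subset_norm by auto
    moreover have "norm_H #> (n \<otimes> g i) = norm_H #> g i"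
      using right_coset_eq_iff[OF norm_H_subgroup, of "n \<otimes> g i" "g i"] nG gi n(1) by (simp add: m_assoc)
    ultimately have "(\<rho> ^^ m) i = i" using coset_perm_pow_iff[OF i i] by simp
    then obtain q where q: "m = ?n * q" using funpow_orbit_period(1)[OF mem_own_cycle] by (auto elim: dvdE)
    have "H #> (n \<otimes> g i) = H #> (monodromy i [^] q \<otimes> g i)" unfolding m mpow canc[OF p] q ..
    then have "H #> n = H #> (monodromy i [^] q)"
      using right_coset_cancel[OF subgroup_H nG norm_carrier[OF mN] gi] by blast
    then show "k \<in> ?R" using aut_group_coset_pow[OF monodromy_norm[OF i], of q] n(2) by auto
  next
    fix k assume "k \<in> ?R"
    then obtain q :: nat where q: "k = H #> (monodromy i [^] q)"
      using aut_group_coset_pow[OF monodromy_norm[OF i]] by auto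
    have "H #> (monodromy i [^] q \<otimes> g i) = H #> (g i \<otimes> commut [^] (?n * q))" unfolding mpow canc[OF p] ..
    then show "k \<in> ?S" unfolding q using fix_iff[OF mN] mN aut_group_carrier by auto
  qed
qed

text \<open>A corner at \<open>H b\<close> is in the orbit of the corner at \<open>H (g i)\<close>
  when \<open>H b = H n (g i) commut [^] m\<close> with \<open>n\<close> in the normalizer. Elements
  of the normalizer disappear in cosets of it, and what remains is a condition on the cycle.\<close>

lemma corner_orbit_mem:
  assumes i: "i \<in> {1..r}" and j: "j \<in> {1..r}" and b: "b \<in> carrier G" "norm_H #> b = norm_H #> g j"
  shows "corner (H #> b) \<in> (\<lambda>k. origami_automorphism G k (corner (H #> g i))) ` carrier aut_group \<longleftrightarrow>
    i \<in> Orbits.orbit \<rho> j"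
proof -
  have gi: "g i \<in> carrier G" using g_closed i .
  have p: "commut [^] (m::nat) \<in> carrier G" for m by (rule nat_pow_closed[OF commut_closed])
  have act: "origami_automorphism G (H #> n) (corner (H #> g i)) = corner (H #> (n \<otimes> g i))" if "n \<in> norm_H" for n
    using automorphism_corner[OF _ square_rep[OF i], of "H #> n"] coset_product[OF that gi] that aut_group_carrier by auto
  have eq: "corner (H #> (n \<otimes> g i)) = corner (H #> b) \<longleftrightarrow> (\<exists>m::nat. H #> b = H #> (n \<otimes> g i \<otimes> commut [^] m))"
    if n: "n \<in> norm_H" for n
  proof -
    have a: "n \<otimes> g i \<in> carrier G" using norm_carrier[OF n] gi by simp
    then have s: "H #> (n \<otimes> g i) \<in> squares" "H #> b \<in> squares" using b by (auto simp: RCOSETS_def)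
    have tr: "H #> (n \<otimes> g i) #> (commut [^] m) = H #> (n \<otimes> g i \<otimes> commut [^] m)" for m :: nat
      by (rule coset_mult_assoc[OF subgroup.subset[OF subgroup_H] a p])
    show ?thesis using corner_eq_iff[OF s] unfolding tr .
  qed
  have key: "(\<exists>n\<in>norm_H. H #> b = H #> (n \<otimes> g i \<otimes> commut [^] m)) \<longleftrightarrow> norm_H #> b = norm_H #> (g i \<otimes> commut [^] m)" for m :: nat
  proof
    assume "\<exists>n\<in>norm_H. H #> b = H #> (n \<otimes> g i \<otimes> commut [^] m)"
    then obtain n where n: "n \<in> norm_H" "H #> b = H #> (n \<otimes> g i \<otimes> commut [^] m)" by blast
    have nG: "n \<in> carrier G" by (rule norm_carrier[OF n(1)])
    have "b \<in> H #> (n \<otimes> g i \<otimes> commut [^] m)" using rcos_self[OF b(1) subgroup_H] n(2) by simp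
    then obtain h where h: "h \<in> H" "b = h \<otimes> (n \<otimes> g i \<otimes> commut [^] m)" by (auto simp: r_coset_def)
    have hn: "h \<otimes> n \<in> norm_H" using subgroup.m_closed[OF norm_H_subgroup] h(1) n(1) H_subset_norm by blast
    have "b = h \<otimes> n \<otimes> (g i \<otimes> commut [^] m)"
      unfolding h(2) using m_assoc[OF nG gi p] m_assoc[OF norm_carrier nG m_closed[OF gi p], of h] h(1) H_subset_norm
      by auto
    then have "b \<otimes> inv (g i \<otimes> commut [^] m) \<in> norm_H"
      using norm_carrier[OF hn] hn gi p by (simp add: m_assoc)
    then show "norm_H #> b = norm_H #> (g i \<otimes> commut [^] m)"
      using right_coset_eq_iff[OF norm_H_subgroup b(1), of "g i \<otimes> commut [^] m"] gi p by simp
  next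
    assume "norm_H #> b = norm_H #> (g i \<otimes> commut [^] m)"
    then have n: "b \<otimes> inv (g i \<otimes> commut [^] m) \<in> norm_H" (is "?n \<in> _")
      using right_coset_eq_iff[OF norm_H_subgroup b(1), of "g i \<otimes> commut [^] m"] gi p by simp
    have "?n \<otimes> g i \<otimes> commut [^] m = ?n \<otimes> (g i \<otimes> commut [^] m)"
      using norm_carrier[OF n] gi p by (rule m_assoc)
    also have "\<dots> = b"
      using b(1) gi p inv_solve_right[of b ?n "g i \<otimes> commut [^] m"] norm_carrier[OF n] by (simp add: m_assoc)
    finally show "\<exists>n\<in>norm_H. H #> b = H #> (n \<otimes> g i \<otimes> commut [^] m)" using n by (metis (no_types))
  qed
  have "corner (H #> b) \<in> (\<lambda>k. origami_automorphism G k (corner (H #> g i))) ` carrier aut_group \<longleftrightarrow>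
      (\<exists>n\<in>norm_H. corner (H #> (n \<otimes> g i)) = corner (H #> b))"
  proof -
    have "carrier aut_group = (\<lambda>n. H #> n) ` norm_H" using aut_group_carrier by auto
    then have "(\<lambda>k. origami_automorphism G k (corner (H #> g i))) ` carrier aut_group =
        (\<lambda>n. corner (H #> (n \<otimes> g i))) ` norm_H"
      using act by (simp add: image_image)
    then show ?thesis by (auto simp only: image_iff)
  qed
  also have "\<dots> \<longleftrightarrow> (\<exists>m::nat. \<exists>n\<in>norm_H. H #> b = H #> (n \<otimes> g i \<otimes> commut [^] m))" using eq by blast
  also have "\<dots> \<longleftrightarrow> i \<in> Orbits.orbit \<rho> j" unfolding key mem_cycle_iff[OF i j] b(2) ..
  finally show ?thesis .
qed

lemma vertex_representative:
  assumes "v \<in> vertices"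
  obtains b j where "b \<in> carrier G" "j \<in> {1..r}" "v = corner (H #> b)" "norm_H #> b = norm_H #> g j"
proof -
  obtain s where s: "s \<in> squares" "v = corner s" using assms vertices_corner by blast
  then obtain b where b: "b \<in> carrier G" "s = H #> b" by (auto simp: RCOSETS_def)
  then show ?thesis using that representative_exists[OF b(1)] s(2) by blast
qed

lemma corner_vertex: "i \<in> {1..r} \<Longrightarrow> corner (H #> g i) \<in> vertices"
  using square_rep vertices_corner by blast

text \<open>Cycles index the orbits of automorphisms on vertices, the orbit of the cycle
  \<open>C\<close> being that of the corner at \<open>g (sel C)\<close>.\<close>

lemma vertices_decomposition:
  assumes sel: "\<And>C. C \<in> cycles_on r \<rho> \<Longrightarrow> sel C \<in> C"
  defines "O' \<equiv> \<lambda>C. (\<lambda>k. origami_automorphism G k (corner (H #> g (sel C)))) ` carrier aut_group"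
  shows "vertices = (\<Union>C\<in>cycles_on r \<rho>. O' C)"
    and "\<lbrakk>C \<in> cycles_on r \<rho>; D \<in> cycles_on r \<rho>; C \<noteq> D\<rbrakk> \<Longrightarrow> O' C \<inter> O' D = {}"
proof -
  have cyc: "sel C \<in> {1..r}" "C = Orbits.orbit \<rho> (sel C)" if C: "C \<in> cycles_on r \<rho>" for C
  proof -
    obtain i where i: "i \<in> {1..r}" "C = Orbits.orbit \<rho> i" using C by (auto simp: cycles_on_def)
    show "sel C \<in> {1..r}" using sel[OF C] cycle_subset[OF i(1)] unfolding i(2) by blast
    show "C = Orbits.orbit \<rho> (sel C)" using orbit_eq[of "sel C" i] sel[OF C] i(2) by simp
  qed
  have mem: "v \<in> O' C \<longleftrightarrow> C = Orbits.orbit \<rho> j"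
    if C: "C \<in> cycles_on r \<rho>" and v: "b \<in> carrier G" "j \<in> {1..r}" "v = corner (H #> b)" "norm_H #> b = norm_H #> g j"
    for v C b j
  proof -
    have "v \<in> O' C \<longleftrightarrow> sel C \<in> Orbits.orbit \<rho> j"
      unfolding O'_def v(3) by (rule corner_orbit_mem[OF cyc(1)[OF C] v(2,1,4)])
    also have "\<dots> \<longleftrightarrow> C = Orbits.orbit \<rho> j"
      using orbit_eq[of "sel C" j] cyc(2)[OF C] sel[OF C] by auto
    finally show ?thesis .
  qed
  have sub: "v \<in> vertices" if "C \<in> cycles_on r \<rho>" "v \<in> O' C" for C v
    using that automorphism_vertices(1)[OF corner_vertex[OF cyc(1)]] by (auto simp: O'_def)
  show "vertices = (\<Union>C\<in>cycles_on r \<rho>. O' C)"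
  proof (intro equalityI subsetI)
    fix v assume "v \<in> vertices"
    then obtain b j where bj: "b \<in> carrier G" "j \<in> {1..r}" "v = corner (H #> b)" "norm_H #> b = norm_H #> g j"
      by (rule vertex_representative)
    have C: "Orbits.orbit \<rho> j \<in> cycles_on r \<rho>" using bj(2) by (simp add: cycles_on_def)
    show "v \<in> (\<Union>C\<in>cycles_on r \<rho>. O' C)" using mem[OF C bj] C by blast
  qed (use sub in blast)
  assume CD: "C \<in> cycles_on r \<rho>" "D \<in> cycles_on r \<rho>" "C \<noteq> D"
  show "O' C \<inter> O' D = {}"
  proof (rule ccontr)
    assume "O' C \<inter> O' D \<noteq> {}"
    then obtain v where v: "v \<in> O' C" "v \<in> O' D" by blast
    obtain b j where bj: "b \<in> carrier G" "j \<in> {1..r}" "v = corner (H #> b)" "norm_H #> b = norm_H #> g j"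
      using vertex_representative[OF sub[OF CD(1) v(1)]] by metis
    show False using mem[OF CD(1) bj] mem[OF CD(2) bj] v CD(3) by simp
  qed
qed

text \<open>On the summand with index \<open>i\<close>, the only nonzero component of a vector is
  multiplied by the monodromy, so the fixed vectors correspond to those fixed by the monodromy in
  \<open>E\<close>.\<close>

lemma fixed_dim_eq:
  assumes rep: "representation aut_group E \<phi>" and i: "i \<in> {1..r}"
  shows "fixed_dim G norm_H r g E (\<lambda>n. \<phi> (H #> n)) commut (card (Orbits.orbit \<rho> i)) i =
    vectorspace.dim complex_field (E\<lparr>carrier := {e \<in> carrier E. \<phi> (H #> monodromy i) e = e}\<rparr>)"
proof -
  let ?n = "card (Orbits.orbit \<rho> i)"
  let ?act = "induced_action G norm_H r g E (\<lambda>n. \<phi> (H #> n)) (commut [^] ?n)"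
  let ?U = "{e \<in> carrier E. \<phi> (H #> monodromy i) e = e}"
  let ?W = "(induced_space E r)\<lparr>carrier := {v \<in> induced_summand E r i. ?act v = v}\<rparr>"
  \<comment> \<open>The isomorphism of \<open>E\<close> with the summand.\<close>
  define \<iota> where "\<iota> = (\<lambda>e. \<lambda>j\<in>{1..r}. if j = i then e else \<zero>\<^bsub>E\<^esub>)"
  note VE = rep_vs[OF rep]
  note facts = vs_add[OF VE] vs_smult[OF VE] vs_zero[OF VE]
  have p: "commut [^] ?n \<in> carrier G" by (rule nat_pow_closed[OF commut_closed])
  have k: "H #> monodromy i \<in> carrier aut_group" using monodromy_norm[OF i] aut_group_carrier by blast
  have U: "closed_subspace E ?U" by (rule fixed_subspace[OF rep k])
  have fU: "fin_dim_space (E\<lparr>carrier := ?U\<rparr>)" by (rule subspace_fin_dim_space[OF rep_fin_dim_space[OF rep] U])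
  have idx: "commut [^] ?n \<otimes> inv (g l) \<in> inv (g j) <# norm_H \<longleftrightarrow> (\<rho> ^^ ?n) l = j"
    if "l \<in> {1..r}" "j \<in> {1..r}" for l j
    using inverse_coset_mem[OF p that] coset_perm_pow_iff[OF that, of ?n] by simp
  have fixi: "(\<rho> ^^ ?n) i = i" by (simp only: funpow_orbit_period(1)[OF mem_own_cycle] dvd_refl)
  have phi: "\<phi> (H #> (g j \<otimes> commut [^] ?n \<otimes> inv (g l))) \<zero>\<^bsub>E\<^esub> = \<zero>\<^bsub>E\<^esub>"
    "\<And>e. e \<in> carrier E \<Longrightarrow> \<phi> (H #> (g j \<otimes> commut [^] ?n \<otimes> inv (g l))) e \<in> carrier E"
    if "l \<in> {1..r}" "j \<in> {1..r}" "(\<rho> ^^ ?n) l = j" for l j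
  proof -
    have gl: "g l \<in> carrier G" and gj: "g j \<in> carrier G" using g_closed that by simp_all
    have "norm_H #> (g j \<otimes> commut [^] ?n) = norm_H #> g l" using coset_perm_pow_iff[OF that(1,2)] that(3) by blast
    then have "g j \<otimes> commut [^] ?n \<otimes> inv (g l) \<in> norm_H"
      using right_coset_eq_iff[OF norm_H_subgroup m_closed[OF gj p] gl] by blast
    then have kk: "H #> (g j \<otimes> commut [^] ?n \<otimes> inv (g l)) \<in> carrier aut_group" using aut_group_carrier by blast
    show "\<phi> (H #> (g j \<otimes> commut [^] ?n \<otimes> inv (g l))) \<zero>\<^bsub>E\<^esub> = \<zero>\<^bsub>E\<^esub>" by (rule lm_zero[OF rep_linear[OF rep kk]])
    show "\<phi> (H #> (g j \<otimes> commut [^] ?n \<otimes> inv (g l))) e \<in> carrier E" if "e \<in> carrier E" for e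
      by (rule rep_closed[OF rep kk that])
  qed
  have act: "?act (\<iota> e) = \<iota> (\<phi> (H #> monodromy i) e)" if e: "e \<in> carrier E" for e
  proof (rule ext)
    fix j
    show "?act (\<iota> e) j = \<iota> (\<phi> (H #> monodromy i) e) j"
    proof (cases "j \<in> {1..r}")
      case False
      then show ?thesis unfolding induced_action_def \<iota>_def by (simp only: restrict_apply if_False)
    next
      case j: True
      let ?L = "{l \<in> {1..r}. commut [^] ?n \<otimes> inv (g l) \<in> inv (g j) <# norm_H}"
      let ?f = "\<lambda>l. \<phi> (H #> (g j \<otimes> commut [^] ?n \<otimes> inv (g l))) (\<iota> e l)"
      have L: "?L = {l \<in> {1..r}. (\<rho> ^^ ?n) l = j}" using idx[OF _ j] by blast
      have cl: "?f l \<in> carrier E" if "l \<in> ?L" for l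
      proof -
        have "\<iota> e l \<in> carrier E" using that e facts(3) by (auto simp: \<iota>_def)
        then show ?thesis using that phi(2)[OF _ j] unfolding L by blast
      qed
      have z: "?f l = \<zero>\<^bsub>E\<^esub>" if l: "l \<in> ?L" "l \<noteq> i" for l
      proof -
        have "\<iota> e l = \<zero>\<^bsub>E\<^esub>" using l by (simp add: \<iota>_def)
        then show ?thesis using l phi(1)[OF _ j] unfolding L by auto
      qed
      have "?act (\<iota> e) j = (\<Oplus>\<^bsub>E\<^esub>l\<in>?L. ?f l)"
        unfolding induced_action_def restrict_apply using j by (simp only: if_True)
      also have "\<dots> = (\<Oplus>\<^bsub>E\<^esub>l\<in>?L \<inter> {i}. ?f l)"
        by (rule vs_finsum_neutral[OF VE]) (use z cl in auto)
      also have "\<dots> = \<iota> (\<phi> (H #> monodromy i) e) j"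
      proof (cases "j = i")
        case True
        have s: "?L \<inter> {i} = {i}" unfolding L using i fixi True by auto
        have fi: "?f i \<in> carrier E" using cl[of i] s by blast
        have "(\<Oplus>\<^bsub>E\<^esub>l\<in>{i}. ?f l) = ?f i \<oplus>\<^bsub>E\<^esub> (\<Oplus>\<^bsub>E\<^esub>l\<in>{}. ?f l)"
          by (rule abelian_monoid.finsum_insert[OF vs_abelian_monoid[OF VE]]) (use fi in auto)
        then have "(\<Oplus>\<^bsub>E\<^esub>l\<in>{i}. ?f l) = ?f i"
          unfolding abelian_monoid.finsum_empty[OF vs_abelian_monoid[OF VE]] vs_r_zero[OF VE fi] .
        moreover have "?f i = \<phi> (H #> monodromy i) e"
          unfolding True monodromy_def \<iota>_def restrict_apply using i by (simp only: if_True refl)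
        ultimately show ?thesis unfolding s using True i by (simp add: \<iota>_def)
      next
        case False
        have s: "?L \<inter> {i} = {}" unfolding L using fixi False by auto
        show ?thesis unfolding s abelian_monoid.finsum_empty[OF vs_abelian_monoid[OF VE]]
          using False j by (simp add: \<iota>_def)
      qed
      finally show ?thesis .
    qed
  qed
  have inj: "\<iota> e = \<iota> e' \<Longrightarrow> e = e'" for e e'
    using i by (auto simp: \<iota>_def fun_eq_iff dest: spec[of _ i])
  have sm: "induced_summand E r i = \<iota> ` carrier E"
  proof (intro equalityI subsetI)
    fix v assume v: "v \<in> induced_summand E r i"
    have "v = \<iota> (v i)"
      using v by (auto simp: induced_summand_def \<iota>_def fun_eq_iff PiE_iff extensional_def)
    moreover have "v i \<in> carrier E" using v i by (auto simp: induced_summand_def)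
    ultimately show "v \<in> \<iota> ` carrier E" by blast
  next
    fix v assume "v \<in> \<iota> ` carrier E"
    then show "v \<in> induced_summand E r i" using facts(3) by (auto simp: induced_summand_def \<iota>_def)
  qed
  have surj: "\<iota> ` carrier (E\<lparr>carrier := ?U\<rparr>) = carrier ?W"
  proof (intro equalityI subsetI)
    fix v assume "v \<in> \<iota> ` carrier (E\<lparr>carrier := ?U\<rparr>)"
    then obtain e where "e \<in> carrier E" "\<phi> (H #> monodromy i) e = e" "v = \<iota> e" by auto
    then show "v \<in> carrier ?W" using act[of e] sm by auto
  next
    fix v assume "v \<in> carrier ?W"
    then obtain e where e: "e \<in> carrier E" "v = \<iota> e" "?act v = v" using sm by auto
    have "\<phi> (H #> monodromy i) e = e" using act[OF e(1)] e by (intro inj) simp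
    then show "v \<in> \<iota> ` carrier (E\<lparr>carrier := ?U\<rparr>)" using e by auto
  qed
  have V: "vectorspace complex_field (E\<lparr>carrier := ?U\<rparr>)" using fU by simp
  have zero: "\<iota> \<zero>\<^bsub>E\<lparr>carrier := ?U\<rparr>\<^esub> = \<zero>\<^bsub>?W\<^esub>" by (auto simp: \<iota>_def)
  have add: "\<iota> (e \<oplus>\<^bsub>E\<lparr>carrier := ?U\<rparr>\<^esub> e') = \<iota> e \<oplus>\<^bsub>?W\<^esub> \<iota> e'" for e e'
    using vs_l_zero[OF VE vs_zero[OF VE]] by (auto simp: \<iota>_def restrict_def fun_eq_iff)
  have smult: "\<iota> (z \<odot>\<^bsub>E\<lparr>carrier := ?U\<rparr>\<^esub> e) = z \<odot>\<^bsub>?W\<^esub> \<iota> e" for z e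
    using vs_smult_zero2[OF VE] by (auto simp: \<iota>_def restrict_def fun_eq_iff)
  note lin = vectorspace_image[OF V surj zero add smult]
  have ker: "e = \<zero>\<^bsub>E\<lparr>carrier := ?U\<rparr>\<^esub>" if "\<iota> e = \<zero>\<^bsub>?W\<^esub>" for e
    by (rule inj) (simp only: that zero)
  show ?thesis
    unfolding fixed_dim_def by (rule isomorphic_dim[OF fU lin(2) surj ker, symmetric])
qed

lemma fixed_vertices_pairing:
  assumes rep: "representation aut_group E \<phi>"
    and sel: "\<And>C. C \<in> cycles_on r \<rho> \<Longrightarrow> sel C \<in> C"
  shows "(\<Sum>k\<in>carrier aut_group. of_nat (card {v \<in> vertices. origami_automorphism G k v = v}) *
      rep_character aut_group E \<phi> (inv\<^bsub>aut_group\<^esub> k)) =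
    of_nat (card (carrier aut_group)) *
      (\<Sum>C\<in>cycles_on r \<rho>. of_nat (fixed_dim G norm_H r g E (\<lambda>n. \<phi> (H #> n)) commut (card C) (sel C)))"
proof -
  let ?act = "origami_automorphism G"
  let ?T = "\<lambda>v. \<Sum>k\<in>{k \<in> carrier aut_group. ?act k v = v}. rep_character aut_group E \<phi> (inv\<^bsub>aut_group\<^esub> k)"
  let ?O = "\<lambda>C. (\<lambda>k. ?act k (corner (H #> g (sel C)))) ` carrier aut_group"
  have orb: "(\<Sum>v\<in>?O C. ?T v) = of_nat (card (carrier aut_group)) *
      of_nat (fixed_dim G norm_H r g E (\<lambda>n. \<phi> (H #> n)) commut (card C) (sel C))"
    if C: "C \<in> cycles_on r \<rho>" for C
  proof -
    obtain i where i: "i \<in> {1..r}" "C = Orbits.orbit \<rho> i" using C by (auto simp: cycles_on_def)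
    have sC: "sel C \<in> {1..r}" using sel[OF C] cycle_subset[OF i(1)] unfolding i(2) by blast
    have eC: "C = Orbits.orbit \<rho> (sel C)" using orbit_eq[of "sel C" i] sel[OF C] i(2) by simp
    let ?v = "corner (H #> g (sel C))" and ?k = "H #> monodromy (sel C)"
    have k: "?k \<in> carrier aut_group" using monodromy_norm[OF sC] aut_group_carrier by blast
    have st: "(\<forall>k\<in>{k \<in> carrier aut_group. ?act k ?v = ?v}. \<phi> k e = e) \<longleftrightarrow> \<phi> ?k e = e"
      if e: "e \<in> carrier E" for e
    proof
      assume all: "\<forall>k\<in>{k \<in> carrier aut_group. ?act k ?v = ?v}. \<phi> k e = e"
      interpret K: group aut_group by (rule aut_group_group)
      have "?k = ?k [^]\<^bsub>aut_group\<^esub> (1::nat)" by (rule K.nat_pow_eone[OF k, symmetric])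
      then show "\<phi> ?k e = e" using all unfolding corner_stabilizer[OF sC] by blast
    next
      assume "\<phi> ?k e = e"
      then show "\<forall>k\<in>{k \<in> carrier aut_group. ?act k ?v = ?v}. \<phi> k e = e"
        unfolding corner_stabilizer[OF sC] using fixed_powers[OF rep k e] by blast
    qed
    have "(\<Sum>v\<in>?O C. ?T v) = of_nat (card (carrier aut_group)) * of_nat (vectorspace.dim complex_field
        (E\<lparr>carrier := {e \<in> carrier E. \<forall>k\<in>{k \<in> carrier aut_group. ?act k ?v = ?v}. \<phi> k e = e}\<rparr>))"
      by (rule orbit_fixed_sum[OF rep finite_aut_group, where V = vertices])
        (fact automorphism_vertices(2) automorphism_vertices(1) automorphism_vertices(3) corner_vertex[OF sC]
          | rule automorphism_vertices; assumption)+
    also have "{e \<in> carrier E. \<forall>k\<in>{k \<in> carrier aut_group. ?act k ?v = ?v}. \<phi> k e = e} =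
        {e \<in> carrier E. \<phi> ?k e = e}"
      using st by blast
    also have "vectorspace.dim complex_field (E\<lparr>carrier := {e \<in> carrier E. \<phi> ?k e = e}\<rparr>) =
        fixed_dim G norm_H r g E (\<lambda>n. \<phi> (H #> n)) commut (card C) (sel C)"
      using fixed_dim_eq[OF rep sC] eC by simp
    finally show ?thesis .
  qed
  have fin: "finite (cycles_on r \<rho>)" by (simp add: cycles_on_def)
  note dec = vertices_decomposition[of sel, OF sel]
  have "(\<Sum>k\<in>carrier aut_group. of_nat (card {v \<in> vertices. ?act k v = v}) *
      rep_character aut_group E \<phi> (inv\<^bsub>aut_group\<^esub> k)) = (\<Sum>v\<in>vertices. ?T v)"
    by (rule fixed_points_pairing[OF finite_aut_group finite_vertices])
  also have "\<dots> = (\<Sum>v\<in>(\<Union>C\<in>cycles_on r \<rho>. ?O C). ?T v)"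
    by (rule sum.cong[OF _ refl]) (rule dec(1))
  also have "\<dots> = (\<Sum>C\<in>cycles_on r \<rho>. \<Sum>v\<in>?O C. ?T v)"
    by (rule sum.UNION_disjoint[OF fin]) (use dec(2) finite_aut_group in \<open>blast+\<close>)
  also have "\<dots> = (\<Sum>C\<in>cycles_on r \<rho>. of_nat (card (carrier aut_group)) *
      of_nat (fixed_dim G norm_H r g E (\<lambda>n. \<phi> (H #> n)) commut (card C) (sel C)))"
    by (rule sum.cong[OF refl]) (rule orb)
  finally show ?thesis by (simp only: sum_distrib_left)
qed

text \<open>The action on squares is free, so for each square only the identity contributes.\<close>

lemma fixed_squares_pairing:
  assumes rep: "representation aut_group E \<phi>"
  shows "(\<Sum>k\<in>carrier aut_group. of_nat (card {s \<in> squares. k <#> s = s}) *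
      rep_character aut_group E \<phi> (inv\<^bsub>aut_group\<^esub> k)) =
    of_nat (card (carrier aut_group)) * of_nat (r * vectorspace.dim complex_field E)"
proof -
  interpret K: group aut_group by (rule aut_group_group)
  have "(\<Sum>k\<in>carrier aut_group. of_nat (card {s \<in> squares. k <#> s = s}) *
      rep_character aut_group E \<phi> (inv\<^bsub>aut_group\<^esub> k)) =
    (\<Sum>s\<in>squares. \<Sum>k\<in>{k \<in> carrier aut_group. k <#> s = s}. rep_character aut_group E \<phi> (inv\<^bsub>aut_group\<^esub> k))"
    by (rule fixed_points_pairing[OF finite_aut_group finite_squares])
  also have "\<dots> = (\<Sum>s\<in>squares. of_nat (vectorspace.dim complex_field E))"
  proof (rule sum.cong[OF refl])
    fix s assume s: "s \<in> squares"
    have "{k \<in> carrier aut_group. k <#> s = s} = {\<one>\<^bsub>aut_group\<^esub>}"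
      using squares_free[OF _ s] aut_square_one[OF s] K.one_closed by blast
    then show "(\<Sum>k\<in>{k \<in> carrier aut_group. k <#> s = s}. rep_character aut_group E \<phi> (inv\<^bsub>aut_group\<^esub> k)) =
        of_nat (vectorspace.dim complex_field E)"
      using character_at_one[OF rep] by (simp only: sum.insert finite.emptyI empty_iff sum.empty K.inv_one not_False_eq_True add_0_right)
  qed
  finally show ?thesis by (simp add: card_squares card_cosets mult_ac)
qed

end

section \<open>The multiplicity formula\<close>

theorem theorem3p3:
  fixes G :: "('a, 'b) monoid_scheme" (structure)
    and H N :: "'a set" and g_r g_u c :: 'a
    and E :: "(complex, 'e) module" and \<phi> :: "'a set \<Rightarrow> 'e \<Rightarrow> 'e"
    and \<xi> :: "'a set \<Rightarrow> complex"
    and r :: nat and g :: "nat \<Rightarrow> 'a" and \<rho> :: "nat \<Rightarrow> nat"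
    and sel :: "nat set \<Rightarrow> nat"
  assumes "origami_data G H g_r g_u"
    and "N = normalizer G H"
    and "c = g_r \<otimes> g_u \<otimes> inv g_r \<otimes> inv g_u"
    and "irreducible_rep (normalizer_quotient G H) E \<phi>"
    and "\<xi> = rep_character (normalizer_quotient G H) E \<phi>"
    and "coset_representatives G N r g"
    and "\<rho> = coset_perm G N r g c"
    and "\<And>C. C \<in> cycles_on r \<rho> \<Longrightarrow> sel C \<in> C"
  shows "int (character_multiplicity (normalizer_quotient G H)
                (rep_character (normalizer_quotient G H)
                   (H1_zero G H g_r g_u) (H1_action G H g_r g_u)) \<xi>)
       = int (vectorspace.dim complex_field (induced_space E r))
         - (\<Sum>C\<in>cycles_on r \<rho>.
              int (fixed_dim G N r g E (\<lambda>n. \<phi> (H #> n)) c (card C) (sel C)))"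
proof -
  interpret M: origami_cosets G H g_r g_u r g
    using assms(1,2,6) by (simp add: origami_cosets_def origami_cosets_axioms_def)
  let ?K = "normalizer_quotient G H"
  let ?\<theta> = "rep_character ?K (H1_zero G H g_r g_u) (H1_action G H g_r g_u)"
  let ?F = "\<lambda>C. fixed_dim G N r g E (\<lambda>n. \<phi> (H #> n)) c (card C) (sel C)"
  have rep: "representation ?K E \<phi>" using assms(4) by (simp add: irreducible_iff)
  interpret K: group ?K by (rule M.aut_group_group)
  have pos: "card (carrier ?K) > 0"
    using M.finite_aut_group K.one_closed by (auto simp: card_gt_0_iff)
  let ?n = "of_nat (card (carrier ?K)) :: complex"
  have "of_nat (character_multiplicity ?K ?\<theta> \<xi>) = char_inner ?K ?\<theta> \<xi>"
    by (rule character_multiplicity_inner[OF M.H1_zero_character(1) M.finite_aut_group])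
      (use irreducible_character_mem[OF assms(4)] assms(5) in simp)
  also have "\<dots> = (\<Sum>k\<in>carrier ?K. ?\<theta> k * \<xi> (inv\<^bsub>?K\<^esub> k)) / ?n"
    by (simp add: char_inner_def)
  also have "(\<Sum>k\<in>carrier ?K. ?\<theta> k * \<xi> (inv\<^bsub>?K\<^esub> k)) =
      (\<Sum>k\<in>carrier ?K. of_nat (card {s \<in> rcosets H. k <#> s = s}) * \<xi> (inv\<^bsub>?K\<^esub> k)) -
      (\<Sum>k\<in>carrier ?K. of_nat (card {v \<in> M.vertices. origami_automorphism G k v = v}) * \<xi> (inv\<^bsub>?K\<^esub> k))"
    unfolding sum_subtractf[symmetric]
    by (rule sum.cong[OF refl]) (simp only: M.H1_zero_character(2) left_diff_distrib)
  also have "\<dots> = ?n * of_nat (r * vectorspace.dim complex_field E) - ?n * (\<Sum>C\<in>cycles_on r \<rho>. of_nat (?F C))"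
    unfolding assms(5) M.fixed_squares_pairing[OF rep]
    using M.fixed_vertices_pairing[OF rep, of sel] assms(2,3,7,8) by simp
  also have "\<dots> / ?n = of_nat (r * vectorspace.dim complex_field E) - (\<Sum>C\<in>cycles_on r \<rho>. of_nat (?F C))"
    using pos by (simp add: field_simps)
  also have "r * vectorspace.dim complex_field E = vectorspace.dim complex_field (induced_space E r)"
    using induced_space_dim[OF rep_fin_dim_space[OF rep]] by simp
  finally have "(of_int (int (character_multiplicity ?K ?\<theta> \<xi>)) :: complex) =
      of_int (int (vectorspace.dim complex_field (induced_space E r)) - (\<Sum>C\<in>cycles_on r \<rho>. int (?F C)))"
    by (simp only: of_int_of_nat_eq of_int_diff of_int_sum)
  then show ?thesis by (simp only: of_int_eq_iff)
qed

end
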